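(* Let $(X,A)$, $(Y,B)$ and $(Z,C)$ be $C^*$-correspondences. Fix morphisms of $C^*$-correspondences $(\psi_X,\psi_A):(X,A)\to(Z,C)$ and $(\omega_Y,\omega_B):(Y,B)\to(Z,C)$ satisfying (1) $(\psi_X,\psi_A)$ and $(\omega_Y,\omega_B)$ are surjective morphisms (that is, $\psi_X,\psi_A,\omega_Y,\omega_B$ are all surjective) with $\psi_A(\ker(\phi_X))=\omega_B(\ker(\phi_Y))$; (2) $\phi_X(A)\subset\mathcal{K}(X)$ and $\phi_Y(B)\subset\mathcal{K}(Y)$; and (3) the ideals $\ker(\phi_X)$ and $\ker(\phi_Y)$ are complemented, i.e. there exist ideals $J_A\unlhd A$ and $J_B\unlhd B$ such that $A=J_A\oplus\ker(\phi_X)$ and $B=J_B\oplus\ker(\phi_Y)$. Then $$\mathcal{O}_{X\oplus_Z Y}\cong\mathcal{O}_X\oplus_{\mathcal{O}_Z}\mathcal{O}_Y,$$ where $X\oplus_Z Y$ is the restricted direct sum $C^*$-correspondence over $A\oplus_C B$, and $\mathcal{O}_X\oplus_{\mathcal{O}_Z}\mathcal{O}_Y=\{(x,y)\in\mathcal{O}_X\oplus\mathcal{O}_Y:\Psi(x)=\Omega(y)\}$ is the pullback $C^*$-algebra along the $*$-homomorphisms $\Psi:\mathcal{O}_X\to\mathcal{O}_Z$ and $\Omega:\mathcal{O}_Y\to\mathcal{O}_Z$ induced by $(\psi_X,\psi_A)$ and $(\omega_Y,\omega_B)$.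
   Context: For a right Hilbert $A$-module $X$ over a $C^*$-algebra $A$, $\mathcal{L}(X)$ is the $C^*$-algebra of adjointable operators on $X$; for $\xi,\eta\in X$, $\theta_{\xi,\eta}\in\mathcal{L}(X)$ is $\theta_{\xi,\eta}(\zeta)=\xi\langle\eta,\zeta\rangle$; and $\mathcal{K}(X)=\overline{\operatorname{span}}\{\theta_{\xi,\eta}:\xi,\eta\in X\}$. A $C^*$-correspondence $(X,A)$ is a right Hilbert $A$-module $X$ together with a $*$-homomorphism $\phi_X:A\to\mathcal{L}(X)$ (the left action). Define the ideal $J_X=\{a\in A:\phi_X(a)\in\mathcal{K}(X)\text{ and }ab=0\text{ for all }b\in\ker(\phi_X)\}$ of $A$. A morphism $(\psi_X,\psi_A):(X,A)\to(Y,B)$ of $C^*$-correspondences is a pair consisting of a linear map $\psi_X:X\to Y$ and a $*$-homomorphism $\psi_A:A\to B$ such that: (C1) $\langle\psi_X(\xi),\psi_X(\eta)\rangle=\psi_A(\langle\xi,\eta\rangle)$ for all $\xi,\eta\in X$; (C2) $\psi_X(\phi_X(a)\xi)=\phi_Y(\psi_A(a))\psi_X(\xi)$ for all $\xi\in X$, $a\in A$; (C3) $\psi_A(J_X)\subset J_Y$; (C4) $\phi_Y(\psi_A(a))=\psi_X^+(\phi_X(a))$ for all $a\in J_X$. Here $\psi_X^+:\mathcal{K}(X)\to\mathcal{K}(Y)$ is the $*$-homomorphism determined by $\psi_X^+(\theta_{\xi,\eta})=\theta_{\psi_X(\xi),\psi_X(\eta)}$ (it exists for pairs satisfying (C1)).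 Any $C^*$-algebra $D$ gives a $C^*$-correspondence $(D,D)$ with left and right actions by multiplication and $\langle a,b\rangle=a^*b$; there is a canonical isomorphism $\mathcal{K}(D)\cong D$, $\theta_{a,b}\mapsto ab^*$. A covariant representation of $(X,A)$ on $D$ is a morphism $(\rho_X,\rho_A):(X,A)\to(D,D)$. $\mathcal{O}_X$ is the universal $C^*$-algebra for covariant representations: it is generated by the image of a covariant representation $(\pi_X,\pi_A)$ of $(X,A)$ on $\mathcal{O}_X$ (the universal covariant representation) such that every covariant representation $(\rho_X,\rho_A)$ of $(X,A)$ on a $C^*$-algebra $D$ factors as $\rho_X=P\circ\pi_X$, $\rho_A=P\circ\pi_A$ for a unique $*$-homomorphism $P:\mathcal{O}_X\to D$. A morphism $(\psi_X,\psi_A):(X,A)\to(Z,C)$ induces the unique $*$-homomorphism $\Psi:\mathcal{O}_X\to\mathcal{O}_Z$ with $\Psi\circ\pi_X=\pi_Z\circ\psi_X$ and $\Psi\circ\pi_A=\pi_C\circ\psi_A$. Given morphisms $(\psi_X,\psi_A):(X,A)\to(Z,C)$ and $(\omega_Y,\omega_B):(Y,B)\to(Z,C)$, let $A\oplus_C B=\{(a,b)\in A\oplus B:\psi_A(a)=\omega_B(b)\}$ and let the restricted direct sum be $X\oplus_Z Y=\{(\xi,\eta)\in X\oplus Y:\psi_X(\xi)=\omega_Y(\eta)\}$. It is a $C^*$-correspondence over $A\oplus_C B$ with coordinatewise right action, inner product $\langle(\xi,\eta),(\xi',\eta')\rangle=(\langle\xi,\xi'\rangle,\langle\eta,\eta'\rangle)$,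 and left action $\phi_{X\oplus_Z Y}(a,b)(\xi,\eta)=(\phi_X(a)\xi,\phi_Y(b)\eta)$. *)

theory Defs
  imports
    "HOL-Algebra.Module"
    "HOL-Algebra.AbelCoset"
    "HOL-Analysis.Abstract_Metric_Spaces"
begin

section \<open>C*-algebras\<close>

definition complex_ring :: "complex ring"
  where "complex_ring =
    \<lparr>carrier = UNIV, monoid.mult = (*), one = 1, zero = 0, add = (+)\<rparr>"

text \<open>Algebras and Hilbert modules are carrier-based structures extending the record
  of HOL-Algebra modules, with \<^const>\<open>Module.module.smult\<close> the action of the complex numbers. Algebras
  need not be unital: the inherited field \<^const>\<open>one\<close> (and, for Hilbert modules, the
  inherited field \<^const>\<open>monoid.mult\<close>) carries no meaning and occurs in no axiom.\<close>

record 'a cstar_algebra = "(complex, 'a) module" +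
  star :: "'a \<Rightarrow> 'a"
  cnorm :: "'a \<Rightarrow> real"

text \<open>The value 0 off the carrier makes this a metric in the sense of the locale
  \<^locale>\<open>Metric_space\<close>, which asks for symmetry and nonnegativity on the whole type.\<close>

definition norm_dist :: "('a, 'm) ring_scheme \<Rightarrow> ('a \<Rightarrow> real) \<Rightarrow> 'a \<Rightarrow> 'a \<Rightarrow> real"
  where "norm_dist M N x y =
    (if x \<in> carrier M \<and> y \<in> carrier M then N (x \<ominus>\<^bsub>M\<^esub> y) else 0)"

locale cstar_algebra = Module.module complex_ring A
  for A :: "'a cstar_algebra" (structure) +
  assumes mult_closed: "\<lbrakk>x \<in> carrier A; y \<in> carrier A\<rbrakk> \<Longrightarrow> x \<otimes> y \<in> carrier A"
    and mult_assoc: "\<lbrakk>x \<in> carrier A; y \<in> carrier A; z \<in> carrier A\<rbrakk>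
      \<Longrightarrow> (x \<otimes> y) \<otimes> z = x \<otimes> (y \<otimes> z)"
    and mult_add_left: "\<lbrakk>x \<in> carrier A; y \<in> carrier A; z \<in> carrier A\<rbrakk>
      \<Longrightarrow> (x \<oplus> y) \<otimes> z = x \<otimes> z \<oplus> y \<otimes> z"
    and mult_add_right: "\<lbrakk>x \<in> carrier A; y \<in> carrier A; z \<in> carrier A\<rbrakk>
      \<Longrightarrow> z \<otimes> (x \<oplus> y) = z \<otimes> x \<oplus> z \<otimes> y"
    and mult_smult_left: "\<lbrakk>x \<in> carrier A; y \<in> carrier A\<rbrakk>
      \<Longrightarrow> (c \<odot> x) \<otimes> y = c \<odot> (x \<otimes> y)"
    and mult_smult_right: "\<lbrakk>x \<in> carrier A; y \<in> carrier A\<rbrakk>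
      \<Longrightarrow> x \<otimes> (c \<odot> y) = c \<odot> (x \<otimes> y)"
    and star_closed: "x \<in> carrier A \<Longrightarrow> star A x \<in> carrier A"
    and star_star: "x \<in> carrier A \<Longrightarrow> star A (star A x) = x"
    and star_add: "\<lbrakk>x \<in> carrier A; y \<in> carrier A\<rbrakk> \<Longrightarrow> star A (x \<oplus> y) = star A x \<oplus> star A y"
    and star_smult: "x \<in> carrier A \<Longrightarrow> star A (c \<odot> x) = cnj c \<odot> star A x"
    and star_mult: "\<lbrakk>x \<in> carrier A; y \<in> carrier A\<rbrakk> \<Longrightarrow> star A (x \<otimes> y) = star A y \<otimes> star A x"
    and norm_nonneg: "x \<in> carrier A \<Longrightarrow> 0 \<le> cnorm A x"
    and norm_eq_zero: "x \<in> carrier A \<Longrightarrow> cnorm A x = 0 \<longleftrightarrow> x = \<zero>"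
    and norm_smult: "x \<in> carrier A \<Longrightarrow> cnorm A (c \<odot> x) = cmod c * cnorm A x"
    and norm_add: "\<lbrakk>x \<in> carrier A; y \<in> carrier A\<rbrakk> \<Longrightarrow> cnorm A (x \<oplus> y) \<le> cnorm A x + cnorm A y"
    and norm_mult: "\<lbrakk>x \<in> carrier A; y \<in> carrier A\<rbrakk> \<Longrightarrow> cnorm A (x \<otimes> y) \<le> cnorm A x * cnorm A y"
    and cstar_identity: "x \<in> carrier A \<Longrightarrow> cnorm A (star A x \<otimes> x) = (cnorm A x)\<^sup>2"
    and complete: "Metric_space.mcomplete (carrier A) (norm_dist A (cnorm A))"

abbreviation norm_topology :: "'a cstar_algebra \<Rightarrow> 'a topology"
  where "norm_topology A \<equiv> Metric_space.mtopology (carrier A) (norm_dist A (cnorm A))"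

definition positive :: "'a cstar_algebra \<Rightarrow> 'a \<Rightarrow> bool"
  where "positive A a \<longleftrightarrow> (\<exists>b\<in>carrier A. a = star A b \<otimes>\<^bsub>A\<^esub> b)"

definition linear_map ::
  "(complex, 'a, 'm) module_scheme \<Rightarrow> (complex, 'b, 'n) module_scheme \<Rightarrow> ('a \<Rightarrow> 'b) \<Rightarrow> bool"
  where "linear_map M N f \<longleftrightarrow>
    f \<in> carrier M \<rightarrow> carrier N \<and>
    (\<forall>x\<in>carrier M. \<forall>y\<in>carrier M. f (x \<oplus>\<^bsub>M\<^esub> y) = f x \<oplus>\<^bsub>N\<^esub> f y) \<and>
    (\<forall>c. \<forall>x\<in>carrier M. f (c \<odot>\<^bsub>M\<^esub> x) = c \<odot>\<^bsub>N\<^esub> f x)"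

definition star_hom :: "'a cstar_algebra \<Rightarrow> 'b cstar_algebra \<Rightarrow> ('a \<Rightarrow> 'b) \<Rightarrow> bool"
  where "star_hom A B f \<longleftrightarrow>
    linear_map A B f \<and>
    (\<forall>x\<in>carrier A. \<forall>y\<in>carrier A. f (x \<otimes>\<^bsub>A\<^esub> y) = f x \<otimes>\<^bsub>B\<^esub> f y) \<and>
    (\<forall>x\<in>carrier A. f (star A x) = star B (f x))"

definition star_isomorphic :: "'a cstar_algebra \<Rightarrow> 'b cstar_algebra \<Rightarrow> bool"
  where "star_isomorphic A B \<longleftrightarrow>
    cstar_algebra A \<and> cstar_algebra B \<and>
    (\<exists>f. star_hom A B f \<and> bij_betw f (carrier A) (carrier B))"

definition closed_ideal :: "'a cstar_algebra \<Rightarrow> 'a set \<Rightarrow> bool"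
  where "closed_ideal A J \<longleftrightarrow>
    submodule J complex_ring A \<and>
    (\<forall>a\<in>carrier A. \<forall>x\<in>J. a \<otimes>\<^bsub>A\<^esub> x \<in> J \<and> x \<otimes>\<^bsub>A\<^esub> a \<in> J) \<and>
    closedin (norm_topology A) J"

definition complemented :: "'a cstar_algebra \<Rightarrow> 'a set \<Rightarrow> bool"
  where "complemented A K \<longleftrightarrow>
    (\<exists>J. closed_ideal A J \<and> J <+>\<^bsub>A\<^esub> K = carrier A \<and> J \<inter> K = {\<zero>\<^bsub>A\<^esub>})"

definition cstar_subalgebra :: "'a cstar_algebra \<Rightarrow> 'a set \<Rightarrow> bool"
  where "cstar_subalgebra A S \<longleftrightarrow>
    submodule S complex_ring A \<and>
    (\<forall>x\<in>S. \<forall>y\<in>S. x \<otimes>\<^bsub>A\<^esub> y \<in> S) \<and>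
    (\<forall>x\<in>S. star A x \<in> S) \<and>
    closedin (norm_topology A) S"

definition pullback ::
  "'a cstar_algebra \<Rightarrow> 'b cstar_algebra \<Rightarrow> ('a \<Rightarrow> 'c) \<Rightarrow> ('b \<Rightarrow> 'c) \<Rightarrow> ('a \<times> 'b) cstar_algebra"
  where "pullback A B f g =
    \<lparr>carrier = {(a, b). a \<in> carrier A \<and> b \<in> carrier B \<and> f a = g b},
     monoid.mult = (\<lambda>(a, b) (a', b'). (a \<otimes>\<^bsub>A\<^esub> a', b \<otimes>\<^bsub>B\<^esub> b')),
     one = (\<one>\<^bsub>A\<^esub>, \<one>\<^bsub>B\<^esub>),
     zero = (\<zero>\<^bsub>A\<^esub>, \<zero>\<^bsub>B\<^esub>),
     add = (\<lambda>(a, b) (a', b'). (a \<oplus>\<^bsub>A\<^esub> a', b \<oplus>\<^bsub>B\<^esub> b')),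
     Module.module.smult = (\<lambda>c (a, b). (c \<odot>\<^bsub>A\<^esub> a, c \<odot>\<^bsub>B\<^esub> b)),
     star = (\<lambda>(a, b). (star A a, star B b)),
     cnorm = (\<lambda>(a, b). max (cnorm A a) (cnorm B b))\<rparr>"


section \<open>Hilbert modules\<close>

record ('a, 'x) hilbert_module = "(complex, 'x) module" +
  ract :: "'x \<Rightarrow> 'a \<Rightarrow> 'x"
  ip :: "'x \<Rightarrow> 'x \<Rightarrow> 'a"

definition hnorm :: "'a cstar_algebra \<Rightarrow> ('a, 'x, 'm) hilbert_module_scheme \<Rightarrow> 'x \<Rightarrow> real"
  where "hnorm A X \<xi> = sqrt (cnorm A (ip X \<xi> \<xi>))"

locale hilbert_module = A: cstar_algebra A + X: Module.module complex_ring X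
  for A :: "'a cstar_algebra" and X :: "('a, 'x, 'm) hilbert_module_scheme" +
  assumes ract_closed: "\<lbrakk>\<xi> \<in> carrier X; a \<in> carrier A\<rbrakk> \<Longrightarrow> ract X \<xi> a \<in> carrier X"
    and ract_add_left: "\<lbrakk>\<xi> \<in> carrier X; \<eta> \<in> carrier X; a \<in> carrier A\<rbrakk>
      \<Longrightarrow> ract X (\<xi> \<oplus>\<^bsub>X\<^esub> \<eta>) a = ract X \<xi> a \<oplus>\<^bsub>X\<^esub> ract X \<eta> a"
    and ract_add_right: "\<lbrakk>\<xi> \<in> carrier X; a \<in> carrier A; b \<in> carrier A\<rbrakk>
      \<Longrightarrow> ract X \<xi> (a \<oplus>\<^bsub>A\<^esub> b) = ract X \<xi> a \<oplus>\<^bsub>X\<^esub> ract X \<xi> b"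
    and ract_smult_left: "\<lbrakk>\<xi> \<in> carrier X; a \<in> carrier A\<rbrakk>
      \<Longrightarrow> ract X (c \<odot>\<^bsub>X\<^esub> \<xi>) a = c \<odot>\<^bsub>X\<^esub> ract X \<xi> a"
    and ract_smult_right: "\<lbrakk>\<xi> \<in> carrier X; a \<in> carrier A\<rbrakk>
      \<Longrightarrow> ract X \<xi> (c \<odot>\<^bsub>A\<^esub> a) = c \<odot>\<^bsub>X\<^esub> ract X \<xi> a"
    and ract_mult: "\<lbrakk>\<xi> \<in> carrier X; a \<in> carrier A; b \<in> carrier A\<rbrakk>
      \<Longrightarrow> ract X \<xi> (a \<otimes>\<^bsub>A\<^esub> b) = ract X (ract X \<xi> a) b"
    and ip_closed: "\<lbrakk>\<xi> \<in> carrier X; \<eta> \<in> carrier X\<rbrakk> \<Longrightarrow> ip X \<xi> \<eta> \<in> carrier A"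
    and ip_add: "\<lbrakk>\<xi> \<in> carrier X; \<eta> \<in> carrier X; \<zeta> \<in> carrier X\<rbrakk>
      \<Longrightarrow> ip X \<xi> (\<eta> \<oplus>\<^bsub>X\<^esub> \<zeta>) = ip X \<xi> \<eta> \<oplus>\<^bsub>A\<^esub> ip X \<xi> \<zeta>"
    and ip_smult: "\<lbrakk>\<xi> \<in> carrier X; \<eta> \<in> carrier X\<rbrakk>
      \<Longrightarrow> ip X \<xi> (c \<odot>\<^bsub>X\<^esub> \<eta>) = c \<odot>\<^bsub>A\<^esub> ip X \<xi> \<eta>"
    and ip_ract: "\<lbrakk>\<xi> \<in> carrier X; \<eta> \<in> carrier X; a \<in> carrier A\<rbrakk>
      \<Longrightarrow> ip X \<xi> (ract X \<eta> a) = ip X \<xi> \<eta> \<otimes>\<^bsub>A\<^esub> a"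
    and ip_star: "\<lbrakk>\<xi> \<in> carrier X; \<eta> \<in> carrier X\<rbrakk> \<Longrightarrow> star A (ip X \<xi> \<eta>) = ip X \<eta> \<xi>"
    and ip_positive: "\<xi> \<in> carrier X \<Longrightarrow> positive A (ip X \<xi> \<xi>)"
    and ip_definite: "\<xi> \<in> carrier X \<Longrightarrow> ip X \<xi> \<xi> = \<zero>\<^bsub>A\<^esub> \<longleftrightarrow> \<xi> = \<zero>\<^bsub>X\<^esub>"
    and complete: "Metric_space.mcomplete (carrier X) (norm_dist X (hnorm A X))"

definition adjoint_pair ::
  "('a, 'x, 'm) hilbert_module_scheme \<Rightarrow> ('x \<Rightarrow> 'x) \<Rightarrow> ('x \<Rightarrow> 'x) \<Rightarrow> bool"
  where "adjoint_pair X T S \<longleftrightarrow>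
    (\<forall>\<xi>\<in>carrier X. \<forall>\<eta>\<in>carrier X. ip X (T \<xi>) \<eta> = ip X \<xi> (S \<eta>))"

text \<open>The C*-algebra of adjointable operators. Operators are extensional functions, so that
  equality of operators is equality in HOL. Adjointability already implies linearity,
  \<open>A\<close>-linearity and boundedness.\<close>

definition adjointables ::
  "'a cstar_algebra \<Rightarrow> ('a, 'x, 'm) hilbert_module_scheme \<Rightarrow> ('x \<Rightarrow> 'x) cstar_algebra"
  where "adjointables A X =
    \<lparr>carrier = {T \<in> carrier X \<rightarrow>\<^sub>E carrier X. \<exists>S \<in> carrier X \<rightarrow>\<^sub>E carrier X. adjoint_pair X T S},
     monoid.mult = (\<lambda>S T. compose (carrier X) S T),
     one = (\<lambda>\<xi>\<in>carrier X. \<xi>),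
     zero = (\<lambda>\<xi>\<in>carrier X. \<zero>\<^bsub>X\<^esub>),
     add = (\<lambda>S T. \<lambda>\<xi>\<in>carrier X. S \<xi> \<oplus>\<^bsub>X\<^esub> T \<xi>),
     Module.module.smult = (\<lambda>c T. \<lambda>\<xi>\<in>carrier X. c \<odot>\<^bsub>X\<^esub> T \<xi>),
     star = (\<lambda>T. THE S. S \<in> carrier X \<rightarrow>\<^sub>E carrier X \<and> adjoint_pair X T S),
     cnorm = (\<lambda>T. SUP \<xi>\<in>{\<xi> \<in> carrier X. hnorm A X \<xi> \<le> 1}. hnorm A X (T \<xi>))\<rparr>"

definition rank_one ::
  "('a, 'x, 'm) hilbert_module_scheme \<Rightarrow> 'x \<Rightarrow> 'x \<Rightarrow> 'x \<Rightarrow> 'x"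
  where "rank_one X \<xi> \<eta> = (\<lambda>\<zeta>\<in>carrier X. ract X \<xi> (ip X \<eta> \<zeta>))"

definition lin_span :: "'a cstar_algebra \<Rightarrow> 'a set \<Rightarrow> 'a set"
  where "lin_span A S = (\<lambda>H. submodule H complex_ring A) hull S"

definition compacts :: "'a cstar_algebra \<Rightarrow> ('a, 'x, 'm) hilbert_module_scheme \<Rightarrow> ('x \<Rightarrow> 'x) set"
  where "compacts A X =
    norm_topology (adjointables A X) closure_of
      lin_span (adjointables A X) {rank_one X \<xi> \<eta> | \<xi> \<eta>. \<xi> \<in> carrier X \<and> \<eta> \<in> carrier X}"

definition compact_algebra ::
  "'a cstar_algebra \<Rightarrow> ('a, 'x, 'm) hilbert_module_scheme \<Rightarrow> ('x \<Rightarrow> 'x) cstar_algebra"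
  where "compact_algebra A X = (adjointables A X)\<lparr>carrier := compacts A X\<rparr>"

text \<open>The *-homomorphism written \<open>\<psi>\<^sup>+\<close>. It is uniquely determined since *-homomorphisms
  of C*-algebras are continuous.\<close>

definition compact_map ::
  "'a cstar_algebra \<Rightarrow> ('a, 'x, 'm) hilbert_module_scheme \<Rightarrow>
   'b cstar_algebra \<Rightarrow> ('b, 'y, 'n) hilbert_module_scheme \<Rightarrow> ('x \<Rightarrow> 'y) \<Rightarrow> ('x \<Rightarrow> 'x) \<Rightarrow> ('y \<Rightarrow> 'y)"
  where "compact_map A X B Y f =
    (THE F. F \<in> extensional (compacts A X) \<and>
       star_hom (compact_algebra A X) (compact_algebra B Y) F \<and>
       (\<forall>\<xi>\<in>carrier X. \<forall>\<eta>\<in>carrier X. F (rank_one X \<xi> \<eta>) = rank_one Y (f \<xi>) (f \<eta>)))"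


section \<open>C*-correspondences\<close>

record ('a, 'x) correspondence = "('a, 'x) hilbert_module" +
  lact :: "'a \<Rightarrow> 'x \<Rightarrow> 'x"

locale correspondence = hilbert_module A X
  for A :: "'a cstar_algebra" and X :: "('a, 'x) correspondence" +
  assumes lact_hom: "star_hom A (adjointables A X) (lact X)"

definition lker :: "'a cstar_algebra \<Rightarrow> ('a, 'x) correspondence \<Rightarrow> 'a set"
  where "lker A X = a_kernel A (adjointables A X) (lact X)"

definition katsura_ideal :: "'a cstar_algebra \<Rightarrow> ('a, 'x) correspondence \<Rightarrow> 'a set"
  where "katsura_ideal A X =
    {a \<in> carrier A. lact X a \<in> compacts A X \<and> (\<forall>b\<in>lker A X. a \<otimes>\<^bsub>A\<^esub> b = \<zero>\<^bsub>A\<^esub>)}"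

definition corr_morphism ::
  "'a cstar_algebra \<Rightarrow> ('a, 'x) correspondence \<Rightarrow> 'b cstar_algebra \<Rightarrow> ('b, 'y) correspondence \<Rightarrow>
   ('x \<Rightarrow> 'y) \<Rightarrow> ('a \<Rightarrow> 'b) \<Rightarrow> bool"
  where "corr_morphism A X B Y \<psi>X \<psi>A \<longleftrightarrow>
    linear_map X Y \<psi>X \<and> star_hom A B \<psi>A \<and>
    (\<forall>\<xi>\<in>carrier X. \<forall>\<eta>\<in>carrier X. ip Y (\<psi>X \<xi>) (\<psi>X \<eta>) = \<psi>A (ip X \<xi> \<eta>)) \<and>
    (\<forall>\<xi>\<in>carrier X. \<forall>a\<in>carrier A. \<psi>X (lact X a \<xi>) = lact Y (\<psi>A a) (\<psi>X \<xi>)) \<and>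
    \<psi>A ` katsura_ideal A X \<subseteq> katsura_ideal B Y \<and>
    (\<forall>a\<in>katsura_ideal A X. lact Y (\<psi>A a) = compact_map A X B Y \<psi>X (lact X a))"

definition self_corr :: "'d cstar_algebra \<Rightarrow> ('d, 'd) correspondence"
  where "self_corr D =
    \<lparr>carrier = carrier D, monoid.mult = (\<otimes>\<^bsub>D\<^esub>), one = \<one>\<^bsub>D\<^esub>, zero = \<zero>\<^bsub>D\<^esub>, add = (\<oplus>\<^bsub>D\<^esub>),
     Module.module.smult = (\<odot>\<^bsub>D\<^esub>),
     ract = (\<otimes>\<^bsub>D\<^esub>),
     ip = (\<lambda>a b. star D a \<otimes>\<^bsub>D\<^esub> b),
     lact = (\<lambda>a. \<lambda>b\<in>carrier D. a \<otimes>\<^bsub>D\<^esub> b)\<rparr>"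

definition covariant_rep ::
  "'a cstar_algebra \<Rightarrow> ('a, 'x) correspondence \<Rightarrow> 'd cstar_algebra \<Rightarrow> ('x \<Rightarrow> 'd) \<Rightarrow> ('a \<Rightarrow> 'd) \<Rightarrow> bool"
  where "covariant_rep A X D \<rho>X \<rho>A \<longleftrightarrow> corr_morphism A X D (self_corr D) \<rho>X \<rho>A"

definition restricted_sum ::
  "('a, 'x) correspondence \<Rightarrow> ('b, 'y) correspondence \<Rightarrow>
   ('x \<Rightarrow> 'z) \<Rightarrow> ('y \<Rightarrow> 'z) \<Rightarrow> ('a \<times> 'b, 'x \<times> 'y) correspondence"
  where "restricted_sum X Y f g =
    (let S = {(\<xi>, \<eta>). \<xi> \<in> carrier X \<and> \<eta> \<in> carrier Y \<and> f \<xi> = g \<eta>} in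
    \<lparr>carrier = S,
     monoid.mult = (\<lambda>(\<xi>, \<eta>) (\<xi>', \<eta>'). (\<xi> \<otimes>\<^bsub>X\<^esub> \<xi>', \<eta> \<otimes>\<^bsub>Y\<^esub> \<eta>')),
     one = (\<one>\<^bsub>X\<^esub>, \<one>\<^bsub>Y\<^esub>),
     zero = (\<zero>\<^bsub>X\<^esub>, \<zero>\<^bsub>Y\<^esub>),
     add = (\<lambda>(\<xi>, \<eta>) (\<xi>', \<eta>'). (\<xi> \<oplus>\<^bsub>X\<^esub> \<xi>', \<eta> \<oplus>\<^bsub>Y\<^esub> \<eta>')),
     Module.module.smult = (\<lambda>c (\<xi>, \<eta>). (c \<odot>\<^bsub>X\<^esub> \<xi>, c \<odot>\<^bsub>Y\<^esub> \<eta>)),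
     ract = (\<lambda>(\<xi>, \<eta>) (a, b). (ract X \<xi> a, ract Y \<eta> b)),
     ip = (\<lambda>(\<xi>, \<eta>) (\<xi>', \<eta>'). (ip X \<xi> \<xi>', ip Y \<eta> \<eta>')),
     lact = (\<lambda>(a, b). \<lambda>(\<xi>, \<eta>)\<in>S. (lact X a \<xi>, lact Y b \<eta>))\<rparr>)"


section \<open>The universal C*-algebra of a correspondence\<close>

text \<open>A HOL formula cannot quantify over all types, so the universal property is stated for
  all C*-algebras whose carrier lies in one type that is large enough. A covariant
  representation on any C*-algebra is also one on the C*-subalgebra generated by its image.
  Each element of that subalgebra is the limit of a sequence of finite sums of finite products
  of elements of the images of \<open>X\<close> and \<open>A\<close> and adjoints of elements of the image of
  \<open>X\<close> (scalars and adjoints of the image of \<open>A\<close> are absorbed). Such a sequence is coded by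
  an element of the type below, the three summands standing for the three kinds of factors.
  Hence the subalgebra is isomorphic to one with carrier in this type, and the property
  stated below yields the one for C*-algebras over arbitrary types.\<close>

type_synonym ('a, 'x) rep_code = "nat \<Rightarrow> ('x + 'x + 'a) list list"

definition generated_by :: "'d cstar_algebra \<Rightarrow> 'd set \<Rightarrow> bool"
  where "generated_by D G \<longleftrightarrow> (\<forall>S. cstar_subalgebra D S \<and> G \<subseteq> S \<longrightarrow> S = carrier D)"

definition universal_covariant_rep ::
  "'a cstar_algebra \<Rightarrow> ('a, 'x) correspondence \<Rightarrow> 'o cstar_algebra \<Rightarrow>
   ('x \<Rightarrow> 'o) \<Rightarrow> ('a \<Rightarrow> 'o) \<Rightarrow> bool"
  where "universal_covariant_rep A X OX \<pi>X \<pi>A \<longleftrightarrow>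
    cstar_algebra OX \<and>
    covariant_rep A X OX \<pi>X \<pi>A \<and>
    generated_by OX (\<pi>X ` carrier X \<union> \<pi>A ` carrier A) \<and>
    (\<forall>(D :: ('a, 'x) rep_code cstar_algebra) \<rho>X \<rho>A.
       cstar_algebra D \<and> covariant_rep A X D \<rho>X \<rho>A \<longrightarrow>
       (\<exists>!P. P \<in> extensional (carrier OX) \<and> star_hom OX D P \<and>
          (\<forall>\<xi>\<in>carrier X. \<rho>X \<xi> = P (\<pi>X \<xi>)) \<and>
          (\<forall>a\<in>carrier A. \<rho>A a = P (\<pi>A a))))"

definition induced_hom ::
  "'a cstar_algebra \<Rightarrow> ('a, 'x) correspondence \<Rightarrow>
   'o cstar_algebra \<Rightarrow> ('x \<Rightarrow> 'o) \<Rightarrow> ('a \<Rightarrow> 'o) \<Rightarrow>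
   'p cstar_algebra \<Rightarrow> ('z \<Rightarrow> 'p) \<Rightarrow> ('c \<Rightarrow> 'p) \<Rightarrow>
   ('x \<Rightarrow> 'z) \<Rightarrow> ('a \<Rightarrow> 'c) \<Rightarrow> ('o \<Rightarrow> 'p) \<Rightarrow> bool"
  where "induced_hom A X OX \<pi>X \<pi>A OZ \<pi>Z \<pi>C \<psi>X \<psi>A \<Psi> \<longleftrightarrow>
    star_hom OX OZ \<Psi> \<and>
    (\<forall>\<xi>\<in>carrier X. \<Psi> (\<pi>X \<xi>) = \<pi>Z (\<psi>X \<xi>)) \<and>
    (\<forall>a\<in>carrier A. \<Psi> (\<pi>A a) = \<pi>C (\<psi>A a))"

end

theory Submission
  imports Defs
begin

text \<open>The coordinate projections of \<open>X \<oplus>\<^sub>Z Y\<close> are surjective and, under the hypotheses on kernels and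
  compactness, map the Katsura ideal of \<open>X \<oplus>\<^sub>Z Y\<close> onto those of \<open>X\<close> and \<open>Y\<close>. They induce
  \<open>\<Phi>\<^sub>1\<close> and \<open>\<Phi>\<^sub>2\<close> on the universal algebra and hence \<open>\<Phi> = (\<Phi>\<^sub>1, \<Phi>\<^sub>2)\<close> into the pullback.

  If \<open>p\<close> is a surjective morphism under which each element of the Katsura ideal of the target lifts
  to the Katsura ideal of the source, then covariance passes to the quotient of the universal algebra of
  the source by any closed ideal that contains the image of the kernel of \<open>p\<close> on coefficients. The kernel of
  the induced homomorphism is therefore the ideal generated by that image.

  Injectivity: the kernels of \<open>\<Phi>\<^sub>1\<close> and \<open>\<Phi>\<^sub>2\<close> are generated by the images of \<open>0 \<oplus> ker \<omega>\<^sub>B\<close> and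
  \<open>ker \<psi>\<^sub>A \<oplus> 0\<close>. These two ideals of the coefficient algebra are orthogonal and invariant under
  \<open>a \<mapsto> \<langle>a \<xi>, a \<xi>\<rangle>\<close>, which forces the ideals that they generate to be orthogonal as well.

  Surjectivity: \<open>\<Phi>\<^sub>1\<close> and \<open>\<Phi>\<^sub>2\<close> are surjective, and the kernel of \<open>\<Omega>\<close>, generated by the image of
  \<open>ker \<omega>\<^sub>B\<close>, lies in \<open>\<Phi>\<^sub>2 (ker \<Phi>\<^sub>1)\<close>.\<close>

section \<open>Carrier-based complex normed spaces\<close>

text \<open>The obstacle is the Katsura ideal, which is not functorial: a preimage in A of an
  element of \<open>J_Z\<close> need not annihilate the kernel of the left action. A complement of
  that kernel cures this. It lies in the Katsura ideal because A acts by compact operators, and the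
  component of a preimage in the kernel is mapped into both \<open>J_Z\<close> and the kernel for Z,
  hence to zero. Equality of the images of the kernels makes each kernel element a coordinate of a
  pair in the kernel for the restricted sum, so annihilation can be tested in each coordinate.
  Compactness of the left action on the restricted sum is a separate matter: it requires lifting
  compact operators on Y that die on Z to operators with zero first coordinate.

  The C*-theory underneath uses the C*-identity and iterations in place of spectra. Two devices
  recur: p + iq bounds the norm of p when p and q are self-adjoint and commute, and powers of order
  2^k of a self-adjoint element have multiplicative norms, so that a constant or linear factor in an
  estimate disappears in the limit.\<close>

lemma complex_ring_simps [simp]:
  "carrier complex_ring = UNIV" "x \<otimes>\<^bsub>complex_ring\<^esub> y = x * y" "\<one>\<^bsub>complex_ring\<^esub> = 1"
  "\<zero>\<^bsub>complex_ring\<^esub> = 0" "x \<oplus>\<^bsub>complex_ring\<^esub> y = x + y"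
  by (simp_all add: complex_ring_def)

lemma cring_complex_ring: "cring complex_ring"
proof (rule cringI)
  show "abelian_group complex_ring"
    by (rule abelian_groupI) (auto simp: intro: exI[of _ "- x" for x])
qed (auto simp: Group.comm_monoid_def comm_monoid_axioms_def intro!: monoid.intro simp: algebra_simps)

lemma complex_ring_minus [simp]: "\<ominus>\<^bsub>complex_ring\<^esub> x = - x"
proof -
  interpret cring complex_ring by (rule cring_complex_ring)
  show ?thesis using minus_equality[of "-x" x] by simp
qed

locale cvec = Module.module complex_ring M for M :: "(complex, 'a, 'm) module_scheme" (structure)
begin

lemma smult_cl [simp, intro]: "x \<in> carrier M \<Longrightarrow> c \<odot> x \<in> carrier M"
  using smult_closed[of c x] by simp

lemma smult_ladd: "x \<in> carrier M \<Longrightarrow> (a + b) \<odot> x = a \<odot> x \<oplus> b \<odot> x"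
  using smult_l_distr[of a b x] by simp

lemma smult_radd: "\<lbrakk>x \<in> carrier M; y \<in> carrier M\<rbrakk> \<Longrightarrow> c \<odot> (x \<oplus> y) = c \<odot> x \<oplus> c \<odot> y"
  using smult_r_distr[of c x y] by simp

lemma smult_smult [simp]: "x \<in> carrier M \<Longrightarrow> a \<odot> (b \<odot> x) = (a * b) \<odot> x"
  using smult_assoc1[of a b x] by simp

lemma smult_1 [simp]: "x \<in> carrier M \<Longrightarrow> 1 \<odot> x = x"
  using smult_one[of x] by simp

lemma smult_0 [simp]: "x \<in> carrier M \<Longrightarrow> 0 \<odot> x = \<zero>"
  using smult_l_null[of x] by simp

lemma smult_zero [simp]: "c \<odot> \<zero> = \<zero>"
  using smult_r_null[of c] by simp

lemma neg_smult: "x \<in> carrier M \<Longrightarrow> \<ominus> x = (-1) \<odot> x"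
  using smult_l_minus[of 1 x] by simp

lemma minus_smult: "\<lbrakk>x \<in> carrier M; y \<in> carrier M\<rbrakk> \<Longrightarrow> x \<ominus> y = x \<oplus> (-1) \<odot> y"
  by (simp add: M.minus_eq neg_smult)

lemma smult_neg: "x \<in> carrier M \<Longrightarrow> c \<odot> (\<ominus> x) = \<ominus> (c \<odot> x)"
  using smult_r_minus[of c x] by simp

lemma smult_diff: "\<lbrakk>x \<in> carrier M; y \<in> carrier M\<rbrakk> \<Longrightarrow> c \<odot> (x \<ominus> y) = c \<odot> x \<ominus> c \<odot> y"
  by (simp add: M.minus_eq smult_radd smult_neg)

lemmas vs_simprules [algebra vs "zero M" "add M" "a_inv M" "a_minus M" "smult M"] =
  M.a_closed M.zero_closed M.a_inv_closed M.minus_closed smult_cl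
  M.a_assoc M.l_zero M.l_neg M.a_comm M.minus_eq M.r_zero M.r_neg M.r_neg2 M.r_neg1 M.minus_add
  M.minus_minus M.add.inv_one M.a_lcomm smult_radd smult_neg

lemma vs_swap_sum: "\<lbrakk>x \<in> carrier M; y \<in> carrier M\<rbrakk> \<Longrightarrow> x \<ominus> y \<oplus> y = x"
  by algebra

lemma add_diff: "\<lbrakk>x \<in> carrier M; y \<in> carrier M\<rbrakk> \<Longrightarrow> x \<oplus> (y \<ominus> x) = y"
  by algebra

lemma add_diff_cancel: "\<lbrakk>x \<in> carrier M; y \<in> carrier M\<rbrakk> \<Longrightarrow> (x \<oplus> y) \<ominus> x = y"
  by algebra

lemma diff_zero_iff: "\<lbrakk>x \<in> carrier M; y \<in> carrier M\<rbrakk> \<Longrightarrow> x \<ominus> y = \<zero> \<longleftrightarrow> x = y"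
  by (metis M.minus_eq M.r_neg M.l_zero vs_swap_sum)

lemma submodule_iff: "submodule H complex_ring M \<longleftrightarrow>
    H \<subseteq> carrier M \<and> \<zero> \<in> H \<and> (\<forall>x\<in>H. \<forall>y\<in>H. x \<oplus> y \<in> H) \<and> (\<forall>c. \<forall>x\<in>H. c \<odot> x \<in> H)"
proof
  assume H: "submodule H complex_ring M"
  note E = submoduleE[OF H]
  then obtain x where x: "x \<in> H" by blast
  then have "0 \<odot> x \<in> H" using E(4)[of 0 x] by simp
  then have "\<zero> \<in> H" using x E(1) smult_0 by (metis subsetD)
  then show "H \<subseteq> carrier M \<and> \<zero> \<in> H \<and> (\<forall>x\<in>H. \<forall>y\<in>H. x \<oplus> y \<in> H) \<and> (\<forall>c. \<forall>x\<in>H. c \<odot> x \<in> H)"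
    using E by auto
next
  assume H: "H \<subseteq> carrier M \<and> \<zero> \<in> H \<and> (\<forall>x\<in>H. \<forall>y\<in>H. x \<oplus> y \<in> H) \<and> (\<forall>c. \<forall>x\<in>H. c \<odot> x \<in> H)"
  show "submodule H complex_ring M"
    by (rule submoduleI) (use H neg_smult in \<open>auto simp: subset_iff\<close>)
qed

end

lemma submodule_minus:
  assumes "cvec M" and "submodule H complex_ring M" and "x \<in> H" and "y \<in> H"
  shows "x \<ominus>\<^bsub>M\<^esub> y \<in> H"
proof -
  interpret cvec M by fact
  have "x \<in> carrier M" "y \<in> carrier M" using assms submodule_iff by auto
  then show ?thesis using assms(2-4) by (simp add: minus_smult submodule_iff)
qed

text \<open>Negatives come from the scalars: \<open>(-1) \<odot> x\<close> is one by distributivity,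
  so the additive group structure follows from these laws.\<close>

lemma cvecI:
  fixes M (structure)
  assumes "\<And>x y. \<lbrakk>x \<in> carrier M; y \<in> carrier M\<rbrakk> \<Longrightarrow> x \<oplus> y \<in> carrier M"
    and "\<zero> \<in> carrier M"
    and "\<And>c x. x \<in> carrier M \<Longrightarrow> c \<odot> x \<in> carrier M"
    and "\<And>x y z. \<lbrakk>x \<in> carrier M; y \<in> carrier M; z \<in> carrier M\<rbrakk> \<Longrightarrow> (x \<oplus> y) \<oplus> z = x \<oplus> (y \<oplus> z)"
    and "\<And>x y. \<lbrakk>x \<in> carrier M; y \<in> carrier M\<rbrakk> \<Longrightarrow> x \<oplus> y = y \<oplus> x"
    and "\<And>x. x \<in> carrier M \<Longrightarrow> \<zero> \<oplus> x = x"
    and "\<And>x. x \<in> carrier M \<Longrightarrow> 0 \<odot> x = \<zero>"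
    and "\<And>a b x. x \<in> carrier M \<Longrightarrow> (a + b) \<odot> x = a \<odot> x \<oplus> b \<odot> x"
    and "\<And>c x y. \<lbrakk>x \<in> carrier M; y \<in> carrier M\<rbrakk> \<Longrightarrow> c \<odot> (x \<oplus> y) = c \<odot> x \<oplus> c \<odot> y"
    and "\<And>a b x. x \<in> carrier M \<Longrightarrow> (a * b) \<odot> x = a \<odot> (b \<odot> x)"
    and "\<And>x. x \<in> carrier M \<Longrightarrow> 1 \<odot> x = x"
  shows "cvec M"
  unfolding cvec_def
proof (rule moduleI)
  have "(-1) \<odot> x \<oplus> x = \<zero>" if "x \<in> carrier M" for x
    using assms(7)[OF that] assms(8)[OF that, of "-1" 1] assms(11)[OF that] by simp
  then have ex: "\<exists>y\<in>carrier M. y \<oplus> x = \<zero>" if "x \<in> carrier M" for x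
    using that assms(3) by blast
  show "abelian_group M"
    by (rule abelian_groupI) (assumption | rule assms(1-6) ex)+
qed (use assms cring_complex_ring in auto)

lemma cvec_carrier_update:
  assumes "cvec M" and "submodule H complex_ring M"
  shows "cvec (M\<lparr>carrier := H\<rparr>)"
  using submodule.submodule_is_module[OF assms(2)] assms(1) by (simp add: cvec_def)

lemma minus_carrier_update:
  assumes "cvec M" and "submodule H complex_ring M" and "x \<in> H" and "y \<in> H"
  shows "x \<ominus>\<^bsub>M\<lparr>carrier := H\<rparr>\<^esub> y = x \<ominus>\<^bsub>M\<^esub> y"
proof -
  interpret M: cvec M by fact
  interpret H: cvec "M\<lparr>carrier := H\<rparr>" using assms cvec_carrier_update by blast
  have "x \<in> carrier M" "y \<in> carrier M" using assms M.submodule_iff by auto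
  then show ?thesis using assms H.minus_smult[of x y] M.minus_smult[of x y] by simp
qed

locale cnspace = cvec M for M :: "(complex, 'a, 'm) module_scheme" (structure) +
  fixes nm :: "'a \<Rightarrow> real"
  assumes nm_nonneg: "x \<in> carrier M \<Longrightarrow> 0 \<le> nm x"
    and nm_eq_zero: "x \<in> carrier M \<Longrightarrow> nm x = 0 \<longleftrightarrow> x = \<zero>"
    and nm_smult: "x \<in> carrier M \<Longrightarrow> nm (c \<odot> x) = cmod c * nm x"
    and nm_add: "\<lbrakk>x \<in> carrier M; y \<in> carrier M\<rbrakk> \<Longrightarrow> nm (x \<oplus> y) \<le> nm x + nm y"

text \<open>Closure, convergence and completeness are phrased by norms of differences;
  \<open>closure_of_eq\<close>, \<open>closedin_iff\<close> and \<open>mcomplete_iff\<close>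
  identify them with the notions of the metric space given by \<open>norm_dist\<close>.\<close>

definition ncl :: "('a, 'm) ring_scheme \<Rightarrow> ('a \<Rightarrow> real) \<Rightarrow> 'a set \<Rightarrow> 'a set"
  where "ncl M nm S = {x \<in> carrier M. \<forall>e>0. \<exists>y\<in>S. y \<in> carrier M \<and> nm (x \<ominus>\<^bsub>M\<^esub> y) < e}"

definition nconv :: "('a, 'm) ring_scheme \<Rightarrow> ('a \<Rightarrow> real) \<Rightarrow> (nat \<Rightarrow> 'a) \<Rightarrow> 'a \<Rightarrow> bool"
  where "nconv M nm s l \<longleftrightarrow>
    range s \<subseteq> carrier M \<and> l \<in> carrier M \<and> (\<lambda>n. nm (s n \<ominus>\<^bsub>M\<^esub> l)) \<longlonglongrightarrow> 0"

definition ncauchy :: "('a, 'm) ring_scheme \<Rightarrow> ('a \<Rightarrow> real) \<Rightarrow> (nat \<Rightarrow> 'a) \<Rightarrow> bool"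
  where "ncauchy M nm s \<longleftrightarrow>
    range s \<subseteq> carrier M \<and> (\<forall>e>0. \<exists>k. \<forall>m\<ge>k. \<forall>n\<ge>k. nm (s m \<ominus>\<^bsub>M\<^esub> s n) < e)"

definition ncomplete :: "('a, 'm) ring_scheme \<Rightarrow> ('a \<Rightarrow> real) \<Rightarrow> bool"
  where "ncomplete M nm \<longleftrightarrow> (\<forall>s. ncauchy M nm s \<longrightarrow> (\<exists>l. nconv M nm s l))"

context cnspace
begin

lemma nm_zero [simp]: "nm \<zero> = 0"
  by (simp add: nm_eq_zero)

lemma nm_neg [simp]: "x \<in> carrier M \<Longrightarrow> nm (\<ominus> x) = nm x"
  by (simp add: neg_smult nm_smult)

lemma nm_commute: "\<lbrakk>x \<in> carrier M; y \<in> carrier M\<rbrakk> \<Longrightarrow> nm (x \<ominus> y) = nm (y \<ominus> x)"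
proof -
  assume xy: "x \<in> carrier M" "y \<in> carrier M"
  then have "y \<ominus> x = \<ominus> (x \<ominus> y)" by algebra
  then show ?thesis using xy by simp
qed

lemma nm_tri: "\<lbrakk>x \<in> carrier M; y \<in> carrier M; z \<in> carrier M\<rbrakk>
  \<Longrightarrow> nm (x \<ominus> z) \<le> nm (x \<ominus> y) + nm (y \<ominus> z)"
proof -
  assume xy: "x \<in> carrier M" "y \<in> carrier M" "z \<in> carrier M"
  then have "x \<ominus> z = (x \<ominus> y) \<oplus> (y \<ominus> z)" by algebra
  then show ?thesis using xy nm_add by simp
qed

lemma nm_diff_le: "\<lbrakk>x \<in> carrier M; y \<in> carrier M\<rbrakk> \<Longrightarrow> nm (x \<ominus> y) \<le> nm x + nm y"
  using nm_add[of x "\<ominus> y"] by (simp add: M.minus_eq)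

lemma nm_le: "\<lbrakk>x \<in> carrier M; y \<in> carrier M\<rbrakk> \<Longrightarrow> nm x \<le> nm y + nm (x \<ominus> y)"
  using nm_add[of y "x \<ominus> y"] vs_swap_sum[of x y] by (simp add: M.a_comm)

lemma nm_abs_diff: "\<lbrakk>x \<in> carrier M; y \<in> carrier M\<rbrakk> \<Longrightarrow> \<bar>nm x - nm y\<bar> \<le> nm (x \<ominus> y)"
  using nm_le[of x y] nm_le[of y x] nm_commute[of x y] by simp

lemma nm_add_diff: "\<lbrakk>x \<in> carrier M; y \<in> carrier M; x' \<in> carrier M; y' \<in> carrier M\<rbrakk>
  \<Longrightarrow> nm ((x \<oplus> y) \<ominus> (x' \<oplus> y')) \<le> nm (x \<ominus> x') + nm (y \<ominus> y')"
proof -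
  assume xy: "x \<in> carrier M" "y \<in> carrier M" "x' \<in> carrier M" "y' \<in> carrier M"
  then have "(x \<oplus> y) \<ominus> (x' \<oplus> y') = (x \<ominus> x') \<oplus> (y \<ominus> y')" by algebra
  then show ?thesis using xy nm_add by simp
qed

lemma nm_smult_diff: "\<lbrakk>x \<in> carrier M; y \<in> carrier M\<rbrakk>
  \<Longrightarrow> nm (c \<odot> x \<ominus> c \<odot> y) = cmod c * nm (x \<ominus> y)"
  by (simp flip: smult_diff add: nm_smult)

lemma nm_diff_zero: "\<lbrakk>x \<in> carrier M; y \<in> carrier M\<rbrakk> \<Longrightarrow> nm (x \<ominus> y) = 0 \<longleftrightarrow> x = y"
  by (simp add: nm_eq_zero diff_zero_iff)

lemma nm_diff_zero' [simp]: "x \<in> carrier M \<Longrightarrow> nm (x \<ominus> x) = 0"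
  by (simp add: nm_diff_zero)

lemma nm_diff_lt_eqI: "\<lbrakk>x \<in> carrier M; y \<in> carrier M; \<And>e. e > 0 \<Longrightarrow> nm (x \<ominus> y) \<le> e\<rbrakk> \<Longrightarrow> x = y"
  by (metis M.minus_closed nm_diff_zero nm_nonneg antisym field_le_epsilon add_0)

lemma metric: "Metric_space (carrier M) (norm_dist M nm)"
proof
  fix x y z
  show "0 \<le> norm_dist M nm x y" by (simp add: norm_dist_def nm_nonneg)
  show "norm_dist M nm x y = norm_dist M nm y x" by (simp add: norm_dist_def nm_commute)
  assume xy: "x \<in> carrier M" "y \<in> carrier M"
  then show "norm_dist M nm x y = 0 \<longleftrightarrow> x = y" by (simp add: norm_dist_def nm_diff_zero)
  assume "z \<in> carrier M"
  with xy show "norm_dist M nm x z \<le> norm_dist M nm x y + norm_dist M nm y z"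
    by (simp add: norm_dist_def nm_tri)
qed

lemma ncl_carrier: "ncl M nm S \<subseteq> carrier M"
  by (auto simp: ncl_def)

lemma ncl_superset: "S \<subseteq> carrier M \<Longrightarrow> S \<subseteq> ncl M nm S"
  by (force simp: ncl_def)

lemma nclI: "\<lbrakk>x \<in> carrier M; \<And>e. e > 0 \<Longrightarrow> \<exists>y\<in>S. y \<in> carrier M \<and> nm (x \<ominus> y) < e\<rbrakk> \<Longrightarrow> x \<in> ncl M nm S"
  by (simp add: ncl_def)

lemma nclE:
  assumes "x \<in> ncl M nm S" and "e > 0"
  obtains y where "y \<in> S" and "y \<in> carrier M" and "nm (x \<ominus> y) < e"
  using assms by (auto simp: ncl_def)

lemma ncl_mono: "S \<subseteq> T \<Longrightarrow> ncl M nm S \<subseteq> ncl M nm T"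
  unfolding ncl_def by blast

lemma ncl_idem: "ncl M nm (ncl M nm S) = ncl M nm S"
proof
  show "ncl M nm (ncl M nm S) \<subseteq> ncl M nm S"
  proof
    fix x assume x: "x \<in> ncl M nm (ncl M nm S)"
    then have xc: "x \<in> carrier M" by (auto simp: ncl_def)
    have "\<exists>y\<in>S. y \<in> carrier M \<and> nm (x \<ominus> y) < e" if e: "e > 0" for e
    proof -
      obtain z where z: "z \<in> ncl M nm S" "z \<in> carrier M" "nm (x \<ominus> z) < e/2"
        using nclE[OF x half_gt_zero[OF e]] by blast
      obtain y where y: "y \<in> S" "y \<in> carrier M" "nm (z \<ominus> y) < e/2"
        using nclE[OF z(1) half_gt_zero[OF e]] by blast
      show ?thesis using nm_tri[OF xc z(2) y(2)] z y by force
    qed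
    then show "x \<in> ncl M nm S" using xc by (auto simp: ncl_def)
  qed
qed (rule ncl_superset[OF ncl_carrier])

lemma ncl_minimal: "\<lbrakk>S \<subseteq> T; ncl M nm T \<subseteq> T\<rbrakk> \<Longrightarrow> ncl M nm S \<subseteq> T"
  using ncl_mono by blast

lemma closure_of_eq: "Metric_space.mtopology (carrier M) (norm_dist M nm) closure_of S = ncl M nm S"
proof -
  interpret Metric_space "carrier M" "norm_dist M nm" by (rule metric)
  show ?thesis unfolding metric_closure_of ncl_def mball_def
    by (auto simp: norm_dist_def)
qed

lemma closedin_iff: "closedin (Metric_space.mtopology (carrier M) (norm_dist M nm)) S
  \<longleftrightarrow> S \<subseteq> carrier M \<and> ncl M nm S \<subseteq> S"
proof -
  interpret Metric_space "carrier M" "norm_dist M nm" by (rule metric)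
  show ?thesis using closure_of_eq[of S] closure_of_subset_eq[of S mtopology] by simp
qed

lemma ncl_submodule:
  assumes S: "submodule S complex_ring M"
  shows "submodule (ncl M nm S) complex_ring M"
proof -
  note S' = S[unfolded submodule_iff]
  have add: "x \<oplus> y \<in> ncl M nm S" if x: "x \<in> ncl M nm S" and y: "y \<in> ncl M nm S" for x y
  proof -
    have c: "x \<in> carrier M" "y \<in> carrier M" using x y by (auto simp: ncl_def)
    have "\<exists>z\<in>S. z \<in> carrier M \<and> nm (x \<oplus> y \<ominus> z) < e" if e: "e > 0" for e
    proof -
      obtain x' where x': "x' \<in> S" "x' \<in> carrier M" "nm (x \<ominus> x') < e/2"
        using nclE[OF x half_gt_zero[OF e]] by blast
      obtain y' where y': "y' \<in> S" "y' \<in> carrier M" "nm (y \<ominus> y') < e/2"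
        using nclE[OF y half_gt_zero[OF e]] by blast
      show ?thesis using nm_add_diff[OF c x'(2) y'(2)] x' y' S' by (intro bexI[of _ "x' \<oplus> y'"]) auto
    qed
    then show ?thesis using c by (auto simp: ncl_def)
  qed
  have smult: "c \<odot> x \<in> ncl M nm S" if x: "x \<in> ncl M nm S" for x c
  proof -
    have xc: "x \<in> carrier M" using x by (auto simp: ncl_def)
    have "\<exists>z\<in>S. z \<in> carrier M \<and> nm (c \<odot> x \<ominus> z) < e" if e: "e > 0" for e
    proof -
      \<comment> \<open>The summand 1 keeps the divisor positive when c = 0.\<close>
      obtain x' where x': "x' \<in> S" "x' \<in> carrier M" "nm (x \<ominus> x') < e/(cmod c + 1)"
        using nclE[OF x divide_pos_pos[OF e add_nonneg_pos[OF norm_ge_zero zero_less_one]]] by blast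
      have "cmod c * nm (x \<ominus> x') \<le> (cmod c + 1) * nm (x \<ominus> x')"
        using x'(2) xc by (intro mult_right_mono nm_nonneg) auto
      also have "\<dots> < e" using x'(3)
        using pos_less_divide_eq[OF add_nonneg_pos[OF norm_ge_zero zero_less_one], of "nm (x \<ominus> x')" e c]
        by (simp add: mult.commute)
      finally show ?thesis using x' xc S' nm_smult_diff[of x x' c] by (intro bexI[of _ "c \<odot> x'"]) auto
    qed
    then show ?thesis using xc by (auto simp: ncl_def)
  qed
  show ?thesis unfolding submodule_iff
    using add smult ncl_carrier[of S] ncl_superset[of S] S' by blast
qed

lemma nconv_iff_limitin: "range s \<subseteq> carrier M \<Longrightarrow>
  nconv M nm s l \<longleftrightarrow> limitin (Metric_space.mtopology (carrier M) (norm_dist M nm)) s l sequentially"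
proof -
  assume s: "range s \<subseteq> carrier M"
  interpret Metric_space "carrier M" "norm_dist M nm" by (rule metric)
  have sc: "s n \<in> carrier M" for n using s by auto
  have "l \<in> carrier M \<Longrightarrow> (\<lambda>n. norm_dist M nm (s n) l) = (\<lambda>n. nm (s n \<ominus> l))"
    using sc by (simp add: norm_dist_def)
  moreover have "eventually (\<lambda>n. s n \<in> carrier M) sequentially" using sc by simp
  ultimately show ?thesis unfolding limitin_metric_dist_null nconv_def using s by metis
qed

lemma mcomplete_iff: "Metric_space.mcomplete (carrier M) (norm_dist M nm) \<longleftrightarrow> ncomplete M nm"
proof -
  interpret Metric_space "carrier M" "norm_dist M nm" by (rule metric)
  have "MCauchy s \<longleftrightarrow> ncauchy M nm s" for s
  proof (cases "range s \<subseteq> carrier M")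
    case True
    then have "norm_dist M nm (s m) (s n) = nm (s m \<ominus> s n)" for m n
      by (auto simp: norm_dist_def)
    then show ?thesis unfolding MCauchy_def ncauchy_def by metis
  qed (auto simp: MCauchy_def ncauchy_def)
  moreover have "ncauchy M nm s \<Longrightarrow> nconv M nm s l \<longleftrightarrow> limitin mtopology s l sequentially" for s l
    by (intro nconv_iff_limitin) (simp add: ncauchy_def)
  ultimately show ?thesis unfolding mcomplete_def ncomplete_def by metis
qed

lemma telescope_le:
  assumes "range s \<subseteq> carrier M"
  shows "m \<le> n \<Longrightarrow> nm (s n \<ominus> s m) \<le> (\<Sum>i=m..<n. nm (s (Suc i) \<ominus> s i))"
proof (induction n rule: dec_induct)
  case base
  then show ?case using assms by (simp add: subset_iff)
next
  case (step n)
  have "nm (s (Suc n) \<ominus> s m) \<le> nm (s (Suc n) \<ominus> s n) + nm (s n \<ominus> s m)"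
    using assms by (intro nm_tri) auto
  then show ?case using step by (simp add: sum.atLeastLessThan_Suc)
qed

lemma ncauchy_summable:
  assumes s: "range s \<subseteq> carrier M" and b: "summable b"
    and sb: "\<And>n. nm (s (Suc n) \<ominus> s n) \<le> b n"
  shows "ncauchy M nm s"
proof -
  have "\<exists>k. \<forall>m\<ge>k. \<forall>n\<ge>k. nm (s m \<ominus> s n) < e" if e: "e > 0" for e
  proof -
    obtain k where k: "\<And>m n. m \<ge> k \<Longrightarrow> norm (sum b {m..<n}) < e"
      using b e unfolding summable_Cauchy by blast
    have le: "nm (s n \<ominus> s m) < e" if "m \<ge> k" "n \<ge> m" for m n
    proof -
      have "nm (s n \<ominus> s m) \<le> sum b {m..<n}"
        using telescope_le[OF s that(2)] sum_mono[of "{m..<n}" "\<lambda>i. nm (s (Suc i) \<ominus> s i)" b] sb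
        by fastforce
      then show ?thesis using k[OF that(1), of n] by simp
    qed
    have "nm (s m \<ominus> s n) < e" if "m \<ge> k" "n \<ge> k" for m n
    proof (cases "m \<le> n")
      case True
      moreover have "s m \<in> carrier M" "s n \<in> carrier M" using s by auto
      ultimately show ?thesis using le[of m n] that nm_commute[of "s m" "s n"] by auto
    qed (use le[of n m] that in auto)
    then show ?thesis by blast
  qed
  then show ?thesis using s by (simp add: ncauchy_def)
qed

text \<open>A Cauchy sequence has a subsequence with steps at most 2^-n and converges as soon as
  that subsequence does. The form suits quotients, where only consecutive differences can be lifted
  with control of the norm.\<close>

lemma ncomplete_geometricI:
  assumes "\<And>s. \<lbrakk>range s \<subseteq> carrier M; \<And>n. nm (s (Suc n) \<ominus> s n) \<le> (1/2)^n\<rbrakk> \<Longrightarrow> \<exists>l. nconv M nm s l"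
  shows "ncomplete M nm"
  unfolding ncomplete_def
proof (intro allI impI)
  fix s assume s: "ncauchy M nm s"
  then have sc: "\<And>n. s n \<in> carrier M" by (auto simp: ncauchy_def)
  have "\<forall>n. \<exists>k. \<forall>i\<ge>k. \<forall>j\<ge>k. nm (s i \<ominus> s j) < (1/2)^n"
    using s by (simp add: ncauchy_def)
  then obtain K where K: "\<And>n i j. \<lbrakk>i \<ge> K n; j \<ge> K n\<rbrakk> \<Longrightarrow> nm (s i \<ominus> s j) < (1/2)^n" by metis
  \<comment> \<open>The sum makes \<open>r\<close> monotone and at least \<open>K n\<close>; the
    added n makes it tend to infinity.\<close>
  define r where "r n = (\<Sum>i\<le>n. K i) + n" for n
  have r1: "r n \<ge> K n" for n unfolding r_def by (simp add: member_le_sum trans_le_add1)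
  have r2: "r n \<le> r (Suc n)" for n by (simp add: r_def)
  have r3: "r n \<ge> n" for n by (simp add: r_def)
  have "nm (s (r (Suc n)) \<ominus> s (r n)) \<le> (1/2)^n" for n
    using K[of n "r (Suc n)" "r n"] r1[of n] r2[of n] by simp
  then obtain l where l: "nconv M nm (s \<circ> r) l"
    using assms[of "s \<circ> r"] sc by (auto simp: image_subset_iff)
  then have lc: "l \<in> carrier M" by (simp add: nconv_def)
  have "(\<lambda>n. nm (s n \<ominus> l)) \<longlonglongrightarrow> 0"
  proof (rule LIMSEQ_I)
    fix e :: real assume e: "e > 0"
    obtain k where k: "\<And>i j. \<lbrakk>i \<ge> k; j \<ge> k\<rbrakk> \<Longrightarrow> nm (s i \<ominus> s j) < e/2"
      using s e unfolding ncauchy_def by (meson half_gt_zero)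
    have "(\<lambda>n. nm (s (r n) \<ominus> l)) \<longlonglongrightarrow> 0" using l by (simp add: nconv_def)
    from LIMSEQ_D[OF this half_gt_zero[OF e]]
    obtain k' where k': "\<And>n. n \<ge> k' \<Longrightarrow> nm (s (r n) \<ominus> l) < e/2"
      unfolding diff_zero real_norm_def abs_less_iff by blast
    have "norm (nm (s n \<ominus> l) - 0) < e" if "n \<ge> k" for n
    proof -
      have "r (max k k') \<ge> k" using r3[of "max k k'"] by simp
      then show ?thesis using nm_tri[of "s n" "s (r (max k k'))" l] sc lc k[of n "r (max k k')"]
        k'[of "max k k'"] that nm_nonneg[of "s n \<ominus> l"] by simp
    qed
    then show "\<exists>no. \<forall>n\<ge>no. norm (nm (s n \<ominus> l) - 0) < e" by blast
  qed
  then show "\<exists>l. nconv M nm s l" using sc lc unfolding nconv_def by blast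
qed

lemma nconv_unique:
  assumes "nconv M nm s l" and "nconv M nm s l'" shows "l = l'"
proof (rule nm_diff_lt_eqI)
  show c: "l \<in> carrier M" "l' \<in> carrier M" using assms by (auto simp: nconv_def)
  fix e :: real assume e: "e > 0"
  have s: "s n \<in> carrier M" for n using assms by (auto simp: nconv_def)
  have "nm (l \<ominus> l') \<le> nm (s n \<ominus> l) + nm (s n \<ominus> l')" for n
    using nm_tri[of l "s n" l'] c s[of n] nm_commute[of l "s n"] by simp
  moreover have "(\<lambda>n. nm (s n \<ominus> l) + nm (s n \<ominus> l')) \<longlonglongrightarrow> 0 + 0"
    using assms by (intro tendsto_add) (auto simp: nconv_def)
  ultimately have "nm (l \<ominus> l') \<le> 0 + 0" by (intro LIMSEQ_le_const) auto
  then show "nm (l \<ominus> l') \<le> e" using e by simp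
qed

lemma nconvI_bound:
  assumes "range s \<subseteq> carrier M" and "l \<in> carrier M" and "\<And>n. nm (s n \<ominus> l) \<le> b n" and "b \<longlonglongrightarrow> 0"
  shows "nconv M nm s l"
proof -
  have "s n \<in> carrier M" for n using assms by auto
  then have "norm (nm (s n \<ominus> l)) \<le> b n" for n using assms nm_nonneg[of "s n \<ominus> l"] by simp
  then have "(\<lambda>n. nm (s n \<ominus> l)) \<longlonglongrightarrow> 0"
    using assms(4) Lim_null_comparison[of "\<lambda>n. nm (s n \<ominus> l)" b sequentially] by simp
  then show ?thesis using assms unfolding nconv_def by blast
qed

lemma nconv_add:
  assumes s: "nconv M nm s l" and t: "nconv M nm t k"
  shows "nconv M nm (\<lambda>n. s n \<oplus> t n) (l \<oplus> k)"
proof (rule nconvI_bound)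
  have c: "s n \<in> carrier M" "t n \<in> carrier M" "l \<in> carrier M" "k \<in> carrier M" for n
    using assms by (auto simp: nconv_def)
  then show "range (\<lambda>n. s n \<oplus> t n) \<subseteq> carrier M" "l \<oplus> k \<in> carrier M" by auto
  show "nm (s n \<oplus> t n \<ominus> (l \<oplus> k)) \<le> nm (s n \<ominus> l) + nm (t n \<ominus> k)" for n
    using c by (intro nm_add_diff) auto
  show "(\<lambda>n. nm (s n \<ominus> l) + nm (t n \<ominus> k)) \<longlonglongrightarrow> 0"
    using tendsto_add[of "\<lambda>n. nm (s n \<ominus> l)" 0 sequentially "\<lambda>n. nm (t n \<ominus> k)" 0] assms
    by (auto simp: nconv_def)
qed

lemma nconv_smult:
  assumes s: "nconv M nm s l"
  shows "nconv M nm (\<lambda>n. c \<odot> s n) (c \<odot> l)"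
proof (rule nconvI_bound)
  have c: "s n \<in> carrier M" "l \<in> carrier M" for n
    using assms by (auto simp: nconv_def)
  then show "range (\<lambda>n. c \<odot> s n) \<subseteq> carrier M" "c \<odot> l \<in> carrier M" by auto
  show "nm (c \<odot> s n \<ominus> c \<odot> l) \<le> cmod c * nm (s n \<ominus> l)" for n
    using c by (simp add: nm_smult_diff)
  show "(\<lambda>n. cmod c * nm (s n \<ominus> l)) \<longlonglongrightarrow> 0"
    using tendsto_mult_left[of "\<lambda>n. nm (s n \<ominus> l)" 0 sequentially "cmod c"] assms
    by (auto simp: nconv_def)
qed

lemma nconv_norm:
  assumes "nconv M nm s l" shows "(\<lambda>n. nm (s n)) \<longlonglongrightarrow> nm l"
proof -
  have "\<bar>nm (s n) - nm l\<bar> \<le> nm (s n \<ominus> l)" for n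
    using assms by (intro nm_abs_diff) (auto simp: nconv_def)
  then have "(\<lambda>n. nm (s n) - nm l) \<longlonglongrightarrow> 0"
    using assms Lim_null_comparison[of "\<lambda>n. nm (s n) - nm l" "\<lambda>n. nm (s n \<ominus> l)" sequentially]
    by (simp add: nconv_def)
  then show ?thesis by (simp add: LIM_zero_iff)
qed

lemma nconv_mem_ncl:
  assumes s: "nconv M nm s l" and S: "\<And>n. s n \<in> S"
  shows "l \<in> ncl M nm S"
proof -
  have c: "s n \<in> carrier M" "l \<in> carrier M" for n using s by (auto simp: nconv_def)
  have "\<exists>y\<in>S. y \<in> carrier M \<and> nm (l \<ominus> y) < e" if "e > 0" for e
  proof -
    have "(\<lambda>n. nm (s n \<ominus> l)) \<longlonglongrightarrow> 0" using s by (simp add: nconv_def)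
    from LIMSEQ_D[OF this that] obtain n where "\<bar>nm (s n \<ominus> l)\<bar> < e" by auto
    then show ?thesis using c S nm_commute[of l "s n"] by (intro bexI[of _ "s n"]) auto
  qed
  then show ?thesis using c by (auto simp: ncl_def)
qed

lemma ncl_sequence:
  assumes "x \<in> ncl M nm S"
  obtains s where "\<And>n. s n \<in> S" and "nconv M nm s x"
proof -
  have x: "x \<in> carrier M" using assms by (simp add: ncl_def)
  have "\<forall>n. \<exists>y. y \<in> S \<and> y \<in> carrier M \<and> nm (x \<ominus> y) < (1/2)^n"
    by (metis nclE[OF assms] zero_less_power half_gt_zero zero_less_one)
  then obtain s where s: "\<And>n. s n \<in> S" "\<And>n. s n \<in> carrier M" "\<And>n. nm (x \<ominus> s n) < (1/2)^n" by metis
  have "nconv M nm s x"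
  proof (rule nconvI_bound)
    show "nm (s n \<ominus> x) \<le> (1/2)^n" for n using s(3)[of n] s(2)[of n] x nm_commute[of x "s n"] by simp
    show "(\<lambda>n. (1/2::real)^n) \<longlonglongrightarrow> 0" by (rule LIMSEQ_realpow_zero) auto
  qed (use s x in auto)
  then show thesis using that s by blast
qed

lemma ncauchy_nconv:
  assumes "nconv M nm s l" shows "ncauchy M nm s"
proof -
  have c: "s n \<in> carrier M" "l \<in> carrier M" for n using assms by (auto simp: nconv_def)
  have "\<exists>k. \<forall>m\<ge>k. \<forall>n\<ge>k. nm (s m \<ominus> s n) < e" if e: "e > 0" for e
  proof -
    have "(\<lambda>n. nm (s n \<ominus> l)) \<longlonglongrightarrow> 0" using assms by (simp add: nconv_def)
    from LIMSEQ_D[OF this half_gt_zero[OF e]]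
    obtain k where k: "\<And>n. n \<ge> k \<Longrightarrow> nm (s n \<ominus> l) < e/2"
      unfolding diff_zero real_norm_def abs_less_iff by blast
    have "nm (s m \<ominus> s n) < e" if "m \<ge> k" "n \<ge> k" for m n
      using nm_tri[of "s m" l "s n"] c nm_commute[of l "s n"] k[of m] k[of n] that by simp
    then show ?thesis by blast
  qed
  then show ?thesis using c by (auto simp: ncauchy_def)
qed

lemma cnspace_carrier_update:
  assumes "submodule H complex_ring M"
  shows "cnspace (M\<lparr>carrier := H\<rparr>) nm"
proof -
  have H: "H \<subseteq> carrier M" using assms by (simp add: submodule_iff)
  show ?thesis
    using H by (intro cnspace.intro cvec_carrier_update[OF cvec_axioms assms] cnspace_axioms.intro)
      (simp_all add: subset_iff nm_nonneg nm_add nm_eq_zero nm_smult)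
qed

lemma ncomplete_carrier_update:
  assumes "submodule H complex_ring M" and "ncomplete M nm" and "ncl M nm H \<subseteq> H"
  shows "ncomplete (M\<lparr>carrier := H\<rparr>) nm"
  unfolding ncomplete_def
proof (intro allI impI)
  fix s assume s: "ncauchy (M\<lparr>carrier := H\<rparr>) nm s"
  have H: "H \<subseteq> carrier M" using assms by (simp add: submodule_iff)
  have sH: "s n \<in> H" for n using s by (auto simp: ncauchy_def)
  note mi = minus_carrier_update[OF cvec_axioms assms(1)]
  have "ncauchy M nm s" using s sH H by (auto simp: ncauchy_def mi)
  then obtain l where l: "nconv M nm s l" using assms(2) by (auto simp: ncomplete_def)
  then have "l \<in> H" using nconv_mem_ncl[OF l sH] assms(3) by blast
  then have "nconv (M\<lparr>carrier := H\<rparr>) nm s l" using l sH by (auto simp: nconv_def mi)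
  then show "\<exists>l. nconv (M\<lparr>carrier := H\<rparr>) nm s l" ..
qed

end

section \<open>Elementary C*-algebra theory\<close>

sublocale cstar_algebra \<subseteq> cvec A
  by (rule cvec.intro) unfold_locales

sublocale cstar_algebra \<subseteq> cnspace A "cnorm A"
  by unfold_locales (simp_all add: norm_nonneg norm_eq_zero norm_smult norm_add)

lemma cstar_algebraI:
  fixes A :: "'a cstar_algebra" (structure)
  assumes "cnspace A (cnorm A)" and "ncomplete A (cnorm A)"
    and "\<And>x y. \<lbrakk>x \<in> carrier A; y \<in> carrier A\<rbrakk> \<Longrightarrow> x \<otimes> y \<in> carrier A"
    and "\<And>x y z. \<lbrakk>x \<in> carrier A; y \<in> carrier A; z \<in> carrier A\<rbrakk> \<Longrightarrow> (x \<otimes> y) \<otimes> z = x \<otimes> (y \<otimes> z)"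
    and "\<And>x y z. \<lbrakk>x \<in> carrier A; y \<in> carrier A; z \<in> carrier A\<rbrakk> \<Longrightarrow> (x \<oplus> y) \<otimes> z = x \<otimes> z \<oplus> y \<otimes> z"
    and "\<And>x y z. \<lbrakk>x \<in> carrier A; y \<in> carrier A; z \<in> carrier A\<rbrakk> \<Longrightarrow> z \<otimes> (x \<oplus> y) = z \<otimes> x \<oplus> z \<otimes> y"
    and "\<And>c x y. \<lbrakk>x \<in> carrier A; y \<in> carrier A\<rbrakk> \<Longrightarrow> (c \<odot> x) \<otimes> y = c \<odot> (x \<otimes> y)"
    and "\<And>c x y. \<lbrakk>x \<in> carrier A; y \<in> carrier A\<rbrakk> \<Longrightarrow> x \<otimes> (c \<odot> y) = c \<odot> (x \<otimes> y)"
    and "\<And>x. x \<in> carrier A \<Longrightarrow> star A x \<in> carrier A"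
    and "\<And>x. x \<in> carrier A \<Longrightarrow> star A (star A x) = x"
    and "\<And>x y. \<lbrakk>x \<in> carrier A; y \<in> carrier A\<rbrakk> \<Longrightarrow> star A (x \<oplus> y) = star A x \<oplus> star A y"
    and "\<And>c x. x \<in> carrier A \<Longrightarrow> star A (c \<odot> x) = cnj c \<odot> star A x"
    and "\<And>x y. \<lbrakk>x \<in> carrier A; y \<in> carrier A\<rbrakk> \<Longrightarrow> star A (x \<otimes> y) = star A y \<otimes> star A x"
    and "\<And>x y. \<lbrakk>x \<in> carrier A; y \<in> carrier A\<rbrakk> \<Longrightarrow> cnorm A (x \<otimes> y) \<le> cnorm A x * cnorm A y"
    and "\<And>x. x \<in> carrier A \<Longrightarrow> cnorm A (star A x \<otimes> x) = (cnorm A x)\<^sup>2"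
  shows "cstar_algebra A"
proof -
  interpret cnspace A "cnorm A" by fact
  show ?thesis
    by unfold_locales
      (fact assms(3-) nm_nonneg nm_eq_zero nm_smult nm_add assms(2)[folded mcomplete_iff])+
qed

definition selfadj :: "'a cstar_algebra \<Rightarrow> 'a \<Rightarrow> bool"
  where "selfadj A x \<longleftrightarrow> x \<in> carrier A \<and> star A x = x"

context cstar_algebra
begin

lemma ncomplete: "ncomplete A (cnorm A)"
  using complete by (simp add: mcomplete_iff)

declare mult_closed [simp, intro] star_closed [simp, intro] star_star [simp]
declare mult_smult_left [simp] mult_smult_right [simp]

lemma mult_zero_left [simp]: "x \<in> carrier A \<Longrightarrow> \<zero> \<otimes> x = \<zero>"
  using mult_smult_left[of x x 0] by simp

lemma mult_zero_right [simp]: "x \<in> carrier A \<Longrightarrow> x \<otimes> \<zero> = \<zero>"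
  using mult_smult_right[of x x 0] by simp

lemma mult_neg_left: "\<lbrakk>x \<in> carrier A; y \<in> carrier A\<rbrakk> \<Longrightarrow> (\<ominus> x) \<otimes> y = \<ominus> (x \<otimes> y)"
  by (simp add: neg_smult)

lemma mult_neg_right: "\<lbrakk>x \<in> carrier A; y \<in> carrier A\<rbrakk> \<Longrightarrow> x \<otimes> (\<ominus> y) = \<ominus> (x \<otimes> y)"
  by (simp add: neg_smult)

lemma star_neg: "x \<in> carrier A \<Longrightarrow> star A (\<ominus> x) = \<ominus> star A x"
  by (simp add: neg_smult star_smult)

lemma star_zero [simp]: "star A \<zero> = \<zero>"
  using star_smult[of \<zero> 0] by simp

lemma star_diff: "\<lbrakk>x \<in> carrier A; y \<in> carrier A\<rbrakk> \<Longrightarrow> star A (x \<ominus> y) = star A x \<ominus> star A y"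
  by (simp add: M.minus_eq star_add star_neg)

lemmas cs_simprules [algebra cs "zero A" "add A" "a_inv A" "a_minus A" "smult A" "mult A" "star A"] =
  M.a_closed M.zero_closed M.a_inv_closed M.minus_closed smult_cl mult_closed star_closed
  M.a_assoc M.l_zero M.l_neg M.a_comm M.minus_eq M.r_zero M.r_neg M.r_neg2 M.r_neg1 M.minus_add
  M.minus_minus M.add.inv_one M.a_lcomm smult_radd smult_neg mult_assoc mult_add_left
  mult_add_right mult_smult_left mult_smult_right mult_neg_left mult_neg_right
  mult_zero_left mult_zero_right star_star star_add star_mult star_neg star_zero

lemma norm_star [simp]: assumes "x \<in> carrier A" shows "cnorm A (star A x) = cnorm A x"
proof -
  have le: "cnorm A y \<le> cnorm A (star A y)" if y: "y \<in> carrier A" for y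
  proof (cases "cnorm A y = 0")
    case False
    have "(cnorm A y)\<^sup>2 \<le> cnorm A (star A y) * cnorm A y"
      using cstar_identity[OF y] norm_mult[of "star A y" y] y by simp
    then show ?thesis using False norm_nonneg[OF y] by (simp add: power2_eq_square)
  qed (simp add: y norm_nonneg)
  show ?thesis using le[OF assms] le[of "star A x"] assms by simp
qed

lemma cstar_identity': "x \<in> carrier A \<Longrightarrow> cnorm A (x \<otimes> star A x) = (cnorm A x)\<^sup>2"
  using cstar_identity[of "star A x"] by simp

lemma star_mult_eq_zero: "\<lbrakk>x \<in> carrier A; star A x \<otimes> x = \<zero>\<rbrakk> \<Longrightarrow> x = \<zero>"
  using cstar_identity[of x] by (simp add: norm_eq_zero)

lemma mult_star_eq_zero: "\<lbrakk>x \<in> carrier A; x \<otimes> star A x = \<zero>\<rbrakk> \<Longrightarrow> x = \<zero>"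
  using cstar_identity'[of x] by (simp add: norm_eq_zero)

lemma norm_mult_diff:
  assumes "x \<in> carrier A" "y \<in> carrier A" "x' \<in> carrier A" "y' \<in> carrier A"
  shows "cnorm A (x \<otimes> y \<ominus> x' \<otimes> y') \<le> cnorm A x * cnorm A (y \<ominus> y') + cnorm A (x \<ominus> x') * cnorm A y'"
proof -
  have "x \<otimes> y \<ominus> x' \<otimes> y' = x \<otimes> (y \<ominus> y') \<oplus> (x \<ominus> x') \<otimes> y'" using assms by algebra
  also have "cnorm A \<dots> \<le> cnorm A (x \<otimes> (y \<ominus> y')) + cnorm A ((x \<ominus> x') \<otimes> y')"
    using assms by (intro norm_add) auto
  also have "\<dots> \<le> cnorm A x * cnorm A (y \<ominus> y') + cnorm A (x \<ominus> x') * cnorm A y'"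
    using assms by (intro add_mono norm_mult) auto
  finally show ?thesis .
qed

lemma norm_star_diff: "\<lbrakk>x \<in> carrier A; y \<in> carrier A\<rbrakk> \<Longrightarrow> cnorm A (star A x \<ominus> star A y) = cnorm A (x \<ominus> y)"
  by (simp flip: star_diff)

lemma nconv_star:
  assumes "nconv A (cnorm A) s l" shows "nconv A (cnorm A) (\<lambda>n. star A (s n)) (star A l)"
proof -
  have c: "s n \<in> carrier A" "l \<in> carrier A" for n using assms by (auto simp: nconv_def)
  then show ?thesis using assms by (auto simp: nconv_def norm_star_diff)
qed

lemma nconv_mult:
  assumes "nconv A (cnorm A) s l" and "nconv A (cnorm A) t k"
  shows "nconv A (cnorm A) (\<lambda>n. s n \<otimes> t n) (l \<otimes> k)"
proof (rule nconvI_bound)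
  have c: "s n \<in> carrier A" "l \<in> carrier A" "t n \<in> carrier A" "k \<in> carrier A" for n
    using assms by (auto simp: nconv_def)
  then show "range (\<lambda>n. s n \<otimes> t n) \<subseteq> carrier A" "l \<otimes> k \<in> carrier A" by auto
  show "cnorm A (s n \<otimes> t n \<ominus> l \<otimes> k)
      \<le> cnorm A (s n) * cnorm A (t n \<ominus> k) + cnorm A (s n \<ominus> l) * cnorm A k" for n
    using c by (intro norm_mult_diff) auto
  have "(\<lambda>n. cnorm A (s n) * cnorm A (t n \<ominus> k) + cnorm A (s n \<ominus> l) * cnorm A k)
    \<longlonglongrightarrow> cnorm A l * 0 + 0 * cnorm A k"
    using assms nconv_norm[OF assms(1)]
    by (intro tendsto_add tendsto_mult tendsto_const) (auto simp: nconv_def)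
  then show "(\<lambda>n. cnorm A (s n) * cnorm A (t n \<ominus> k) + cnorm A (s n \<ominus> l) * cnorm A k) \<longlonglongrightarrow> 0"
    by simp
qed

lemma nconv_const: "x \<in> carrier A \<Longrightarrow> nconv A (cnorm A) (\<lambda>_. x) x"
  by (simp add: nconv_def)

lemma ncl_mult:
  assumes "\<And>x y. \<lbrakk>x \<in> S; y \<in> T\<rbrakk> \<Longrightarrow> x \<otimes> y \<in> U"
    and "x \<in> ncl A (cnorm A) S" and "y \<in> ncl A (cnorm A) T"
  shows "x \<otimes> y \<in> ncl A (cnorm A) U"
proof -
  obtain s where s: "\<And>n. s n \<in> S" "nconv A (cnorm A) s x" using ncl_sequence[OF assms(2)] by blast
  obtain t where t: "\<And>n. t n \<in> T" "nconv A (cnorm A) t y" using ncl_sequence[OF assms(3)] by blast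
  show ?thesis using nconv_mem_ncl[OF nconv_mult[OF s(2) t(2)]] assms(1) s(1) t(1) by blast
qed

lemma ncl_star:
  assumes "\<And>x. x \<in> S \<Longrightarrow> star A x \<in> T" and "x \<in> ncl A (cnorm A) S"
  shows "star A x \<in> ncl A (cnorm A) T"
proof -
  obtain s where s: "\<And>n. s n \<in> S" "nconv A (cnorm A) s x" using ncl_sequence[OF assms(2)] by blast
  show ?thesis using nconv_mem_ncl[OF nconv_star[OF s(2)]] assms(1) s(1) by blast
qed

lemma ncl_zero: "ncl A (cnorm A) {\<zero>} \<subseteq> {\<zero>}"
proof
  fix x assume "x \<in> ncl A (cnorm A) {\<zero>}"
  then obtain s where s: "\<And>n. s n \<in> {\<zero>}" "nconv A (cnorm A) s x" using ncl_sequence by metis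
  then have "s = (\<lambda>_. \<zero>)" by auto
  then show "x \<in> {\<zero>}" using s(2) nconv_const[of \<zero>] nconv_unique[of s x \<zero>] by simp
qed

lemma cstar_subalgebra_iff: "cstar_subalgebra A S \<longleftrightarrow>
    submodule S complex_ring A \<and> (\<forall>x\<in>S. \<forall>y\<in>S. x \<otimes> y \<in> S) \<and> (\<forall>x\<in>S. star A x \<in> S) \<and>
    ncl A (cnorm A) S \<subseteq> S"
  unfolding cstar_subalgebra_def closedin_iff by (auto simp: submodule_iff)

lemma closed_ideal_iff: "closed_ideal A S \<longleftrightarrow>
    submodule S complex_ring A \<and> (\<forall>a\<in>carrier A. \<forall>x\<in>S. a \<otimes> x \<in> S \<and> x \<otimes> a \<in> S) \<and>
    ncl A (cnorm A) S \<subseteq> S"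
  unfolding closed_ideal_def closedin_iff by (auto simp: submodule_iff)

lemma cstar_subalgebra_ncl:
  assumes "submodule S complex_ring A" and "\<And>x y. \<lbrakk>x \<in> S; y \<in> S\<rbrakk> \<Longrightarrow> x \<otimes> y \<in> S"
    and "\<And>x. x \<in> S \<Longrightarrow> star A x \<in> S"
  shows "cstar_subalgebra A (ncl A (cnorm A) S)"
  unfolding cstar_subalgebra_iff
  using assms ncl_mult[of S S S] ncl_star[of S S] by (auto simp: ncl_submodule ncl_idem)

lemma cstar_algebra_carrier_update:
  assumes "cstar_subalgebra A S"
  shows "cstar_algebra (A\<lparr>carrier := S\<rparr>)"
proof -
  note S = assms[unfolded cstar_subalgebra_iff]
  have sub: "S \<subseteq> carrier A" using S by (simp add: submodule_iff)
  show ?thesis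
    by (rule cstar_algebraI)
      (use S sub cnspace_carrier_update[of S] ncomplete_carrier_update[OF _ ncomplete, of S]
        in \<open>simp_all add: subset_iff mult_assoc mult_add_left mult_add_right
          star_add star_smult star_mult norm_mult cstar_identity\<close>)
qed

text \<open>For u = p + iq the cross terms in u*u cancel by commutation, so u*u is the sum of the
  squares, while p is the real part of u and hence no larger in norm. This is the substitute for the
  order on commuting squares.\<close>

lemma norm_le_U1:
  assumes p: "selfadj A p" and q: "selfadj A q" and pq: "p \<otimes> q = q \<otimes> p"
  shows "(cnorm A p)\<^sup>2 \<le> cnorm A (p \<otimes> p \<oplus> q \<otimes> q)"
proof -
  have c: "p \<in> carrier A" "q \<in> carrier A" "star A p = p" "star A q = q"
    using p q by (auto simp: selfadj_def)
  define u where "u = p \<oplus> \<i> \<odot> q"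
  have uc: "u \<in> carrier A" using c by (simp add: u_def)
  have su: "star A u = p \<oplus> (-\<i>) \<odot> q" using c by (simp add: u_def star_add star_smult)
  have "star A u \<otimes> u = p \<otimes> p \<oplus> (\<i> \<odot> (p \<otimes> q) \<oplus> (-\<i>) \<odot> (p \<otimes> q)) \<oplus> q \<otimes> q"
    using c pq unfolding su by (simp add: u_def mult_add_left mult_add_right smult_radd M.a_ac)
  also have "\<dots> = p \<otimes> p \<oplus> q \<otimes> q" using c smult_ladd[of "p \<otimes> q" \<i> "-\<i>"] by simp
  finally have 1: "cnorm A (p \<otimes> p \<oplus> q \<otimes> q) = (cnorm A u)\<^sup>2" using cstar_identity[OF uc] by simp
  have "u \<oplus> star A u = (p \<oplus> p) \<oplus> (\<i> \<odot> q \<oplus> (-\<i>) \<odot> q)"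
    using c unfolding su by (simp add: u_def M.a_ac)
  also have "\<dots> = 2 \<odot> p" using c smult_ladd[of p 1 1] smult_ladd[of q \<i> "-\<i>"] by simp
  finally have "2 * cnorm A p = cnorm A (u \<oplus> star A u)" using c by (simp add: norm_smult)
  also have "\<dots> \<le> 2 * cnorm A u" using norm_add[of u "star A u"] uc by simp
  finally have "cnorm A p \<le> cnorm A u" by simp
  then show ?thesis unfolding 1 using c(1) norm_nonneg by (simp add: power_mono)
qed

text \<open>The solution \<open>s\<close> of \<open>s = (k + s\<^sup>2)/2\<close> plays the role of \<open>1 - sqrt (1 - k)\<close>, which makes sense
  without a unit. The iteration is dominated by the same iteration for the real number 1.\<close>

primrec qsqrt_seq :: "'a \<Rightarrow> nat \<Rightarrow> 'a" where
  "qsqrt_seq k 0 = \<zero>"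
| "qsqrt_seq k (Suc n) = (1/2) \<odot> (k \<oplus> qsqrt_seq k n \<otimes> qsqrt_seq k n)"

lemma quasi_sqrt:
  assumes k: "selfadj A k" and k1: "cnorm A k \<le> 1"
  obtains s where "selfadj A s" and "s = (1/2) \<odot> (k \<oplus> s \<otimes> s)" and "cnorm A s \<le> 1"
    and "\<And>x. \<lbrakk>x \<in> carrier A; x \<otimes> k = k \<otimes> x\<rbrakk> \<Longrightarrow> x \<otimes> s = s \<otimes> x"
proof -
  have kc: "k \<in> carrier A" "star A k = k" using k by (auto simp: selfadj_def)
  define s where "s = qsqrt_seq k"
  define r :: "nat \<Rightarrow> real" where "r = rec_nat 0 (\<lambda>_ x. (1 + x\<^sup>2)/2)"
  have r0: "r 0 = 0" and rS: "r (Suc n) = (1 + (r n)\<^sup>2)/2" for n by (simp_all add: r_def)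
  have s0: "s 0 = \<zero>" and sS: "s (Suc n) = (1/2) \<odot> (k \<oplus> s n \<otimes> s n)" for n by (simp_all add: s_def)
  have sc: "s n \<in> carrier A" for n by (induction n) (simp_all add: s0 sS kc)
  have ssa: "star A (s n) = s n" for n
    by (induction n) (simp_all add: s0 sS kc sc star_smult star_add star_mult)
  have comm: "x \<otimes> s n = s n \<otimes> x" if x: "x \<in> carrier A" "x \<otimes> k = k \<otimes> x" for x n
  proof (induction n)
    case (Suc n)
    have "x \<otimes> (s n \<otimes> s n) = (s n \<otimes> s n) \<otimes> x"
      using Suc sc x by (metis mult_assoc)
    then show ?case using x sc kc by (simp add: sS mult_add_left mult_add_right)
  qed (simp add: s0 x)
  have r_pos: "0 \<le> r n" for n by (induction n) (simp_all add: r0 rS)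
  have r_le: "r n \<le> 1" for n
  proof (induction n)
    case (Suc n)
    then have "(r n)\<^sup>2 \<le> 1" using r_pos[of n] by (simp add: power_le_one)
    then show ?case by (simp add: rS)
  qed (simp add: r0)
  have s_le: "cnorm A (s n) \<le> r n" for n
  proof (induction n)
    case (Suc n)
    have "cnorm A (s (Suc n)) \<le> (cnorm A k + cnorm A (s n) * cnorm A (s n)) / 2"
      using norm_add[of k "s n \<otimes> s n"] norm_mult[of "s n" "s n"] kc sc
      by (simp add: sS norm_smult)
    also have "\<dots> \<le> (1 + r n * r n) / 2"
      using k1 Suc norm_nonneg[OF sc] r_pos by (simp add: add_mono mult_mono)
    finally show ?case by (simp add: rS power2_eq_square)
  qed (simp add: s0 r0)
  have step: "cnorm A (s (Suc n) \<ominus> s n) \<le> r (Suc n) - r n" for n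
  proof (induction n)
    case 0
    have "s (Suc 0) \<ominus> s 0 = (1/2) \<odot> k" using kc by (simp add: sS s0 M.minus_eq M.add.inv_one)
    then show ?case using k1 kc by (simp add: norm_smult rS r0)
  next
    case (Suc n)
    have "s (Suc (Suc n)) \<ominus> s (Suc n) =
        (1/2) \<odot> ((k \<oplus> s (Suc n) \<otimes> s (Suc n)) \<ominus> (k \<oplus> s n \<otimes> s n))"
      using sc kc by (simp add: sS[of "Suc n"] sS[of n] smult_diff)
    also have "(k \<oplus> s (Suc n) \<otimes> s (Suc n)) \<ominus> (k \<oplus> s n \<otimes> s n)
        = s (Suc n) \<otimes> s (Suc n) \<ominus> s n \<otimes> s n"
      using sc[of n] sc[of "Suc n"] kc(1) by algebra
    finally have "cnorm A (s (Suc (Suc n)) \<ominus> s (Suc n))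
        = cnorm A (s (Suc n) \<otimes> s (Suc n) \<ominus> s n \<otimes> s n) / 2"
      using sc by (simp add: norm_smult)
    also have "\<dots> \<le> (cnorm A (s (Suc n)) * cnorm A (s (Suc n) \<ominus> s n)
        + cnorm A (s (Suc n) \<ominus> s n) * cnorm A (s n)) / 2"
      using norm_mult_diff[of "s (Suc n)" "s (Suc n)" "s n" "s n"] sc by simp
    also have "\<dots> \<le> (r (Suc n) * (r (Suc n) - r n) + (r (Suc n) - r n) * r n) / 2"
      using Suc s_le[of n] s_le[of "Suc n"] norm_nonneg[OF sc] r_pos norm_nonneg[of "s (Suc n) \<ominus> s n"] sc
      by (intro divide_right_mono add_mono mult_mono) (auto intro: order_trans)
    also have "\<dots> = r (Suc (Suc n)) - r (Suc n)"
      by (simp add: rS[of "Suc n"] rS[of n] field_simps power2_eq_square)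
    finally show ?case .
  qed
  \<comment> \<open>A bounded increasing sequence has summable increments, and those of
    \<open>r\<close> dominate the steps of \<open>s\<close>; the value of the limit of
    \<open>r\<close> does not enter.\<close>
  have "r n \<le> r (Suc n)" for n
    using step[of n] norm_nonneg[of "s (Suc n) \<ominus> s n"] sc by simp
  then have "convergent r"
    by (intro Bseq_mono_convergent BseqI'[of r 1]) (use r_le r_pos in \<open>auto simp: incseq_Suc_iff lift_Suc_mono_le\<close>)
  then have "summable (\<lambda>n. r (Suc n) - r n)"
    unfolding convergent_def by (auto dest: telescope_sums simp: sums_iff)
  then have "ncauchy A (cnorm A) s"
    using sc step by (intro ncauchy_summable) auto
  then obtain l where l: "nconv A (cnorm A) s l"
    using ncomplete by (auto simp: ncomplete_def)
  have lc: "l \<in> carrier A" using l by (simp add: nconv_def)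
  have "nconv A (cnorm A) (\<lambda>n. s n) (star A l)" using nconv_star[OF l] by (simp add: ssa)
  then have 1: "star A l = l" using l nconv_unique by blast
  have "nconv A (cnorm A) (\<lambda>n. s (Suc n)) ((1/2) \<odot> (k \<oplus> l \<otimes> l))"
    unfolding sS by (intro nconv_smult nconv_add nconv_mult nconv_const kc l)
  moreover have "nconv A (cnorm A) (\<lambda>n. s (Suc n)) l"
    using l LIMSEQ_Suc[of "\<lambda>n. cnorm A (s n \<ominus> l)" 0] by (auto simp: nconv_def)
  ultimately have 2: "l = (1/2) \<odot> (k \<oplus> l \<otimes> l)" using nconv_unique by blast
  have 3: "cnorm A l \<le> 1"
    using LIMSEQ_le_const2[OF nconv_norm[OF l], of 1] s_le r_le order_trans by blast
  have "x \<otimes> l = l \<otimes> x" if x: "x \<in> carrier A" "x \<otimes> k = k \<otimes> x" for x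
  proof -
    have "nconv A (cnorm A) (\<lambda>n. x \<otimes> s n) (l \<otimes> x)"
      unfolding comm[OF x] by (intro nconv_mult nconv_const l x)
    moreover have "nconv A (cnorm A) (\<lambda>n. x \<otimes> s n) (x \<otimes> l)"
      by (intro nconv_mult nconv_const l x)
    ultimately show ?thesis using nconv_unique by blast
  qed
  then show thesis using that[of l] 1 2 3 lc by (auto simp: selfadj_def)
qed

text \<open>\<open>npow x n\<close> is the power with exponent n + 1: the algebra may lack a unit to
  serve as the power with exponent 0.\<close>

primrec npow :: "'a \<Rightarrow> nat \<Rightarrow> 'a" where
  "npow x 0 = x"
| "npow x (Suc n) = npow x n \<otimes> x"

lemma npow_closed [simp, intro]: "x \<in> carrier A \<Longrightarrow> npow x n \<in> carrier A"
  by (induction n) auto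

lemma npow_add: "x \<in> carrier A \<Longrightarrow> npow x m \<otimes> npow x n = npow x (Suc (m + n))"
  by (induction n) (simp_all flip: mult_assoc)

lemma npow_selfadj:
  assumes "selfadj A x" shows "selfadj A (npow x n)"
proof (induction n)
  case (Suc n)
  have x: "x \<in> carrier A" "star A x = x" using assms by (auto simp: selfadj_def)
  have "star A (npow x (Suc n)) = npow x 0 \<otimes> npow x n"
    using Suc x by (simp add: star_mult selfadj_def)
  also have "\<dots> = npow x (Suc n)" using npow_add[OF x(1), of 0 n] by simp
  finally show ?case using x by (simp add: selfadj_def)
qed (simp add: assms)

lemma norm_square_selfadj: "selfadj A x \<Longrightarrow> cnorm A (x \<otimes> x) = (cnorm A x)\<^sup>2"
  using cstar_identity[of x] by (auto simp: selfadj_def)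

text \<open>Iterates ||x^2|| = ||x||^2; the index 2^k - 1 stands for the exponent 2^k. In the sequel
  this replaces the spectral radius formula.\<close>

lemma norm_npow_selfadj:
  assumes "selfadj A x" shows "cnorm A (npow x (2 ^ k - 1)) = cnorm A x ^ (2 ^ k)"
proof (induction k)
  case (Suc k)
  have x: "x \<in> carrier A" using assms by (simp add: selfadj_def)
  obtain j where "(2::nat) ^ k = Suc j" using not0_implies_Suc[of "2 ^ k"] by auto
  then have "Suc ((2 ^ k - 1) + (2 ^ k - 1)) = 2 ^ Suc k - (1::nat)" by simp
  then have "npow x (2 ^ Suc k - 1) = npow x (2 ^ k - 1) \<otimes> npow x (2 ^ k - 1)"
    using npow_add[OF x, of "2 ^ k - 1" "2 ^ k - 1"] by metis
  then have "cnorm A (npow x (2 ^ Suc k - 1)) = (cnorm A (npow x (2 ^ k - 1)))\<^sup>2"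
    using norm_square_selfadj[OF npow_selfadj[OF assms]] by simp
  then show ?case using Suc by (simp add: power_mult[symmetric] mult.commute)
qed simp

lemma selfadj_parts:
  assumes "x \<in> carrier A"
  obtains a b where "selfadj A a" and "selfadj A b" and "x = a \<oplus> \<i> \<odot> b"
    and "star A x = a \<oplus> (-\<i>) \<odot> b"
proof -
  let ?a = "(1/2) \<odot> (x \<oplus> star A x)" and ?b = "(-\<i>/2) \<odot> (x \<oplus> (-1) \<odot> star A x)"
  have e: "\<i> \<odot> ?b = (1/2) \<odot> x \<oplus> (-1/2) \<odot> star A x" "(-\<i>) \<odot> ?b = (-1/2) \<odot> x \<oplus> (1/2) \<odot> star A x"
    using assms by (simp_all add: smult_radd)
  have 0: "(1/2) \<odot> y \<oplus> (-1/2) \<odot> y = \<zero>" if "y \<in> carrier A" for y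
    using that smult_ladd[of y "1/2" "-1/2"] by simp
  have 1: "(1/2) \<odot> y \<oplus> (1/2) \<odot> y = y" if "y \<in> carrier A" for y
    using that smult_ladd[of y "1/2" "1/2"] by simp
  have "?a \<oplus> \<i> \<odot> ?b = ((1/2) \<odot> x \<oplus> (1/2) \<odot> x) \<oplus> ((1/2) \<odot> star A x \<oplus> (-1/2) \<odot> star A x)"
    using assms unfolding e by (simp add: smult_radd M.a_ac)
  then have 2: "x = ?a \<oplus> \<i> \<odot> ?b" using assms 0[of "star A x"] 1[of x] by simp
  have "?a \<oplus> (-\<i>) \<odot> ?b = ((1/2) \<odot> x \<oplus> (-1/2) \<odot> x) \<oplus> ((1/2) \<odot> star A x \<oplus> (1/2) \<odot> star A x)"
    using assms unfolding e by (simp add: smult_radd M.a_ac)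
  then have 3: "star A x = ?a \<oplus> (-\<i>) \<odot> ?b" using assms 0[of x] 1[of "star A x"] by simp
  have "selfadj A ?a" using assms by (simp add: selfadj_def star_smult star_add M.a_comm)
  moreover have "selfadj A ?b"
    using assms by (simp add: selfadj_def star_smult star_add smult_radd M.a_comm)
  ultimately show thesis using that 2 3 by blast
qed

end

text \<open>If a > b, division by a^(2^k - 1) bounds a by (C + D 2^k) q^(2^k - 1) with q = b/a < 1,
  and this tends to 0: exponential decay beats the linear factor.\<close>

lemma power_two_power_le:
  fixes a b C :: real
  assumes "0 \<le> a" and "0 \<le> b" and "\<And>k. a ^ (2 ^ k) \<le> (C + D * 2 ^ k) * b ^ (2 ^ k - 1)"
  shows "a \<le> b"
proof (rule ccontr)
  assume ab: "\<not> a \<le> b"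
  have pos: "a > 0" using ab assms(2) by simp
  define q where "q = b / a"
  have q: "0 \<le> q" "q < 1" using ab pos assms(2) by (auto simp: q_def)
  have le: "a \<le> (C + D * real (2 ^ k)) * q ^ (2 ^ k - 1)" for k
  proof -
    have "a ^ (2 ^ k) = a * a ^ (2 ^ k - 1)"
      using power_minus_mult[of "2 ^ k" a] by (simp add: mult.commute)
    then have "a * a ^ (2 ^ k - 1) \<le> (C + D * 2 ^ k) * b ^ (2 ^ k - 1)"
      using assms(3)[of k] by simp
    then show ?thesis using pos by (simp add: q_def power_divide pos_le_divide_eq)
  qed
  \<comment> \<open>The factor is linear in 2^k = Suc n when n = 2^k - 1, so the limit is taken over
    all n first and then along this subsequence.\<close>
  have "(\<lambda>n. (C + D * real (Suc n)) * q ^ n) \<longlonglongrightarrow> 0"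
  proof -
    have 1: "(\<lambda>n. real n * q ^ n) \<longlonglongrightarrow> 0" using powser_times_n_limit_0[of q] q by simp
    have 2: "(\<lambda>n. q ^ n) \<longlonglongrightarrow> 0" using q by (intro LIMSEQ_realpow_zero) auto
    have "(\<lambda>n. (C + D) * q ^ n + D * (real n * q ^ n)) \<longlonglongrightarrow> (C + D) * 0 + D * 0"
      by (intro tendsto_intros 1 2)
    then show ?thesis by (simp add: algebra_simps)
  qed
  then have lim: "((\<lambda>n. (C + D * real (Suc n)) * q ^ n) \<circ> (\<lambda>k. 2 ^ k - 1)) \<longlonglongrightarrow> 0"
  proof (rule LIMSEQ_subseq_LIMSEQ)
    show "strict_mono (\<lambda>k. 2 ^ k - 1 :: nat)"
      by (intro strict_monoI diff_less_mono power_strict_increasing) auto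
  qed
  have "0 < (2::nat) ^ k" for k by simp
  then have "(\<lambda>k. (C + D * real (2 ^ k)) * q ^ (2 ^ k - 1)) \<longlonglongrightarrow> 0"
    using lim unfolding comp_def by (simp add: Suc_diff_le)
  then have "a \<le> 0" using le by (intro LIMSEQ_le_const) auto
  then show False using pos by simp
qed

section \<open>Hilbert modules and their adjointable operators\<close>

text \<open>Compared with \<^locale>\<open>hilbert_module\<close>, positivity of the inner product is replaced by the
  Cauchy-Schwarz inequality, which is its only consequence needed here and which is much easier to
  verify for restricted direct sums.\<close>

locale hilb = A: cstar_algebra A + X: cvec X
  for A :: "'a cstar_algebra" and X :: "('a, 'x, 'm) hilbert_module_scheme" +
  assumes ract_closed: "\<lbrakk>\<xi> \<in> carrier X; a \<in> carrier A\<rbrakk> \<Longrightarrow> ract X \<xi> a \<in> carrier X"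
    and ract_add_left: "\<lbrakk>\<xi> \<in> carrier X; \<eta> \<in> carrier X; a \<in> carrier A\<rbrakk>
      \<Longrightarrow> ract X (\<xi> \<oplus>\<^bsub>X\<^esub> \<eta>) a = ract X \<xi> a \<oplus>\<^bsub>X\<^esub> ract X \<eta> a"
    and ract_smult_left: "\<lbrakk>\<xi> \<in> carrier X; a \<in> carrier A\<rbrakk>
      \<Longrightarrow> ract X (c \<odot>\<^bsub>X\<^esub> \<xi>) a = c \<odot>\<^bsub>X\<^esub> ract X \<xi> a"
    and ract_mult: "\<lbrakk>\<xi> \<in> carrier X; a \<in> carrier A; b \<in> carrier A\<rbrakk>
      \<Longrightarrow> ract X \<xi> (a \<otimes>\<^bsub>A\<^esub> b) = ract X (ract X \<xi> a) b"
    and ip_closed: "\<lbrakk>\<xi> \<in> carrier X; \<eta> \<in> carrier X\<rbrakk> \<Longrightarrow> ip X \<xi> \<eta> \<in> carrier A"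
    and ip_add: "\<lbrakk>\<xi> \<in> carrier X; \<eta> \<in> carrier X; \<zeta> \<in> carrier X\<rbrakk>
      \<Longrightarrow> ip X \<xi> (\<eta> \<oplus>\<^bsub>X\<^esub> \<zeta>) = ip X \<xi> \<eta> \<oplus>\<^bsub>A\<^esub> ip X \<xi> \<zeta>"
    and ip_smult: "\<lbrakk>\<xi> \<in> carrier X; \<eta> \<in> carrier X\<rbrakk>
      \<Longrightarrow> ip X \<xi> (c \<odot>\<^bsub>X\<^esub> \<eta>) = c \<odot>\<^bsub>A\<^esub> ip X \<xi> \<eta>"
    and ip_ract: "\<lbrakk>\<xi> \<in> carrier X; \<eta> \<in> carrier X; a \<in> carrier A\<rbrakk>
      \<Longrightarrow> ip X \<xi> (ract X \<eta> a) = ip X \<xi> \<eta> \<otimes>\<^bsub>A\<^esub> a"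
    and ip_star: "\<lbrakk>\<xi> \<in> carrier X; \<eta> \<in> carrier X\<rbrakk> \<Longrightarrow> star A (ip X \<xi> \<eta>) = ip X \<eta> \<xi>"
    and ip_definite: "\<xi> \<in> carrier X \<Longrightarrow> ip X \<xi> \<xi> = \<zero>\<^bsub>A\<^esub> \<longleftrightarrow> \<xi> = \<zero>\<^bsub>X\<^esub>"
    and cauchy_schwarz: "\<lbrakk>\<xi> \<in> carrier X; \<eta> \<in> carrier X\<rbrakk>
      \<Longrightarrow> cnorm A (ip X \<xi> \<eta>) \<le> hnorm A X \<xi> * hnorm A X \<eta>"
    and complete: "ncomplete X (hnorm A X)"
begin

declare ract_closed [simp, intro] ip_closed [simp, intro] ip_star [simp]

abbreviation "hn \<equiv> hnorm A X"

lemma hn_square: "\<xi> \<in> carrier X \<Longrightarrow> (hn \<xi>)\<^sup>2 = cnorm A (ip X \<xi> \<xi>)"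
  by (simp add: hnorm_def A.norm_nonneg)

lemma hn_nonneg: "\<xi> \<in> carrier X \<Longrightarrow> 0 \<le> hn \<xi>"
  by (simp add: hnorm_def A.norm_nonneg)

lemma ip_add_left: "\<lbrakk>\<xi> \<in> carrier X; \<eta> \<in> carrier X; \<zeta> \<in> carrier X\<rbrakk>
  \<Longrightarrow> ip X (\<xi> \<oplus>\<^bsub>X\<^esub> \<eta>) \<zeta> = ip X \<xi> \<zeta> \<oplus>\<^bsub>A\<^esub> ip X \<eta> \<zeta>"
  using A.star_add[of "ip X \<zeta> \<xi>" "ip X \<zeta> \<eta>"] ip_star[of \<zeta> "\<xi> \<oplus>\<^bsub>X\<^esub> \<eta>"] by (simp add: ip_add)

lemma ip_smult_left: "\<lbrakk>\<xi> \<in> carrier X; \<eta> \<in> carrier X\<rbrakk>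
  \<Longrightarrow> ip X (c \<odot>\<^bsub>X\<^esub> \<xi>) \<eta> = cnj c \<odot>\<^bsub>A\<^esub> ip X \<xi> \<eta>"
  using A.star_smult[of "ip X \<eta> \<xi>" c] ip_star[of \<eta> "c \<odot>\<^bsub>X\<^esub> \<xi>"] by (simp add: ip_smult)

lemma ip_ract_left: "\<lbrakk>\<xi> \<in> carrier X; \<eta> \<in> carrier X; a \<in> carrier A\<rbrakk>
  \<Longrightarrow> ip X (ract X \<xi> a) \<eta> = star A a \<otimes>\<^bsub>A\<^esub> ip X \<xi> \<eta>"
  using A.star_mult[of "ip X \<eta> \<xi>" a] ip_star[of \<eta> "ract X \<xi> a"] by (simp add: ip_ract)

lemma ip_zero [simp]: "\<xi> \<in> carrier X \<Longrightarrow> ip X \<xi> \<zero>\<^bsub>X\<^esub> = \<zero>\<^bsub>A\<^esub>" "\<xi> \<in> carrier X \<Longrightarrow> ip X \<zero>\<^bsub>X\<^esub> \<xi> = \<zero>\<^bsub>A\<^esub>"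
  using ip_smult[of \<xi> "\<zero>\<^bsub>X\<^esub>" 0] ip_smult_left[of "\<zero>\<^bsub>X\<^esub>" \<xi> 0] by simp_all

lemma ip_diff: "\<lbrakk>\<xi> \<in> carrier X; \<eta> \<in> carrier X; \<zeta> \<in> carrier X\<rbrakk>
  \<Longrightarrow> ip X \<xi> (\<eta> \<ominus>\<^bsub>X\<^esub> \<zeta>) = ip X \<xi> \<eta> \<ominus>\<^bsub>A\<^esub> ip X \<xi> \<zeta>"
  by (simp add: X.minus_smult A.minus_smult ip_add ip_smult)

lemma ip_diff_left: "\<lbrakk>\<xi> \<in> carrier X; \<eta> \<in> carrier X; \<zeta> \<in> carrier X\<rbrakk>
  \<Longrightarrow> ip X (\<xi> \<ominus>\<^bsub>X\<^esub> \<eta>) \<zeta> = ip X \<xi> \<zeta> \<ominus>\<^bsub>A\<^esub> ip X \<eta> \<zeta>"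
  by (simp add: X.minus_smult A.minus_smult ip_add_left ip_smult_left)

lemma hn_add: assumes "\<xi> \<in> carrier X" "\<eta> \<in> carrier X" shows "hn (\<xi> \<oplus>\<^bsub>X\<^esub> \<eta>) \<le> hn \<xi> + hn \<eta>"
proof (rule power2_le_imp_le)
  have "(hn (\<xi> \<oplus>\<^bsub>X\<^esub> \<eta>))\<^sup>2 = cnorm A ((ip X \<xi> \<xi> \<oplus>\<^bsub>A\<^esub> ip X \<eta> \<xi>) \<oplus>\<^bsub>A\<^esub> (ip X \<xi> \<eta> \<oplus>\<^bsub>A\<^esub> ip X \<eta> \<eta>))"
    using assms by (simp add: hn_square ip_add ip_add_left)
  also have "\<dots> \<le> (cnorm A (ip X \<xi> \<xi>) + cnorm A (ip X \<eta> \<xi>)) + (cnorm A (ip X \<xi> \<eta>) + cnorm A (ip X \<eta> \<eta>))"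
    using assms by (intro order_trans[OF A.norm_add] add_mono A.norm_add) auto
  also have "\<dots> \<le> ((hn \<xi>)\<^sup>2 + hn \<eta> * hn \<xi>) + (hn \<xi> * hn \<eta> + (hn \<eta>)\<^sup>2)"
    using assms by (intro add_mono cauchy_schwarz) (auto simp: hn_square)
  also have "\<dots> = (hn \<xi> + hn \<eta>)\<^sup>2" by (simp add: power2_eq_square algebra_simps)
  finally show "(hn (\<xi> \<oplus>\<^bsub>X\<^esub> \<eta>))\<^sup>2 \<le> (hn \<xi> + hn \<eta>)\<^sup>2" .
qed (use assms hn_nonneg in auto)

end

sublocale hilb \<subseteq> X: cnspace X "hnorm A X"
proof unfold_locales
  fix \<xi> assume x: "\<xi> \<in> carrier X"
  show "0 \<le> hn \<xi>" using x by (rule hn_nonneg)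
  show "hn \<xi> = 0 \<longleftrightarrow> \<xi> = \<zero>\<^bsub>X\<^esub>"
    using x hn_square[OF x] ip_definite[OF x] A.norm_eq_zero[of "ip X \<xi> \<xi>"] by auto
  show "hn (c \<odot>\<^bsub>X\<^esub> \<xi>) = cmod c * hn \<xi>" for c
    using x by (simp add: hnorm_def ip_smult ip_smult_left A.norm_smult norm_mult real_sqrt_mult)
qed (rule hn_add)

context hilb
begin

lemma ip_ext: "\<lbrakk>\<xi> \<in> carrier X; \<xi>' \<in> carrier X; \<And>\<eta>. \<eta> \<in> carrier X \<Longrightarrow> ip X \<eta> \<xi> = ip X \<eta> \<xi>'\<rbrakk> \<Longrightarrow> \<xi> = \<xi>'"
  using ip_diff[of "\<xi> \<ominus>\<^bsub>X\<^esub> \<xi>'" \<xi> \<xi>'] ip_definite[of "\<xi> \<ominus>\<^bsub>X\<^esub> \<xi>'"] X.diff_zero_iff[of \<xi> \<xi>']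
    A.diff_zero_iff by simp

lemma hn_ract:
  assumes "\<xi> \<in> carrier X" "a \<in> carrier A" shows "hn (ract X \<xi> a) \<le> hn \<xi> * cnorm A a"
proof (rule power2_le_imp_le)
  have "(hn (ract X \<xi> a))\<^sup>2 = cnorm A (star A a \<otimes>\<^bsub>A\<^esub> (ip X \<xi> \<xi> \<otimes>\<^bsub>A\<^esub> a))"
    using assms by (simp add: hn_square ip_ract ip_ract_left A.mult_assoc)
  also have "\<dots> \<le> cnorm A a * (cnorm A (ip X \<xi> \<xi>) * cnorm A a)"
    using assms by (intro order_trans[OF A.norm_mult]) (auto intro: mult_left_mono A.norm_mult A.norm_nonneg)
  also have "\<dots> = (hn \<xi> * cnorm A a)\<^sup>2" using assms by (simp flip: hn_square add: power2_eq_square algebra_simps)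
  finally show "(hn (ract X \<xi> a))\<^sup>2 \<le> (hn \<xi> * cnorm A a)\<^sup>2" .
qed (use assms hn_nonneg A.norm_nonneg in auto)

lemma ip_nconv:
  assumes "nconv X hn s l" and "\<eta> \<in> carrier X"
  shows "nconv A (cnorm A) (\<lambda>n. ip X \<eta> (s n)) (ip X \<eta> l)"
proof (rule A.nconvI_bound)
  have c: "s n \<in> carrier X" "l \<in> carrier X" for n using assms by (auto simp: nconv_def)
  then show "range (\<lambda>n. ip X \<eta> (s n)) \<subseteq> carrier A" "ip X \<eta> l \<in> carrier A" using assms(2) by auto
  show "cnorm A (ip X \<eta> (s n) \<ominus>\<^bsub>A\<^esub> ip X \<eta> l) \<le> hn \<eta> * hn (s n \<ominus>\<^bsub>X\<^esub> l)" for n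
    using c assms(2) cauchy_schwarz[of \<eta> "s n \<ominus>\<^bsub>X\<^esub> l"] by (simp add: ip_diff)
  show "(\<lambda>n. hn \<eta> * hn (s n \<ominus>\<^bsub>X\<^esub> l)) \<longlonglongrightarrow> 0"
    using tendsto_mult_left[of "\<lambda>n. hn (s n \<ominus>\<^bsub>X\<^esub> l)" 0 sequentially "hn \<eta>"] assms by (auto simp: nconv_def)
qed

text \<open>Both partners are extensional, which makes the adjoint unique as a function and lets
  \<open>carrier L\<close> be the set of first partners.\<close>

definition adjp :: "('x \<Rightarrow> 'x) \<Rightarrow> ('x \<Rightarrow> 'x) \<Rightarrow> bool"
  where "adjp T S \<longleftrightarrow> T \<in> carrier X \<rightarrow>\<^sub>E carrier X \<and> S \<in> carrier X \<rightarrow>\<^sub>E carrier X \<and> adjoint_pair X T S"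

abbreviation "L \<equiv> adjointables A X"
abbreviation "opn \<equiv> cnorm L"

lemma adjpI: "\<lbrakk>T \<in> carrier X \<rightarrow>\<^sub>E carrier X; S \<in> carrier X \<rightarrow>\<^sub>E carrier X;
    \<And>\<xi> \<eta>. \<lbrakk>\<xi> \<in> carrier X; \<eta> \<in> carrier X\<rbrakk> \<Longrightarrow> ip X (T \<xi>) \<eta> = ip X \<xi> (S \<eta>)\<rbrakk> \<Longrightarrow> adjp T S"
  by (simp add: adjp_def adjoint_pair_def)

lemma adjp_ip: "\<lbrakk>adjp T S; \<xi> \<in> carrier X; \<eta> \<in> carrier X\<rbrakk> \<Longrightarrow> ip X (T \<xi>) \<eta> = ip X \<xi> (S \<eta>)"
  by (simp add: adjp_def adjoint_pair_def)

lemma adjp_closed: "\<lbrakk>adjp T S; \<xi> \<in> carrier X\<rbrakk> \<Longrightarrow> T \<xi> \<in> carrier X" "\<lbrakk>adjp T S; \<xi> \<in> carrier X\<rbrakk> \<Longrightarrow> S \<xi> \<in> carrier X"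
  by (auto simp: adjp_def)

lemma adjp_sym: "adjp T S \<Longrightarrow> adjp S T"
proof (rule adjpI)
  fix \<xi> \<eta> assume a: "adjp T S" "\<xi> \<in> carrier X" "\<eta> \<in> carrier X"
  have "star A (ip X (T \<eta>) \<xi>) = star A (ip X \<eta> (S \<xi>))" using a adjp_ip by simp
  then show "ip X (S \<xi>) \<eta> = ip X \<xi> (T \<eta>)" using a adjp_closed[OF a(1)] by simp
qed (auto simp: adjp_def)

lemma adjp_unique: "\<lbrakk>adjp T S; adjp T S'\<rbrakk> \<Longrightarrow> S = S'"
proof -
  assume a: "adjp T S" "adjp T S'"
  have "S \<eta> = S' \<eta>" if "\<eta> \<in> carrier X" for \<eta>
    using a that by (intro ip_ext) (auto simp: adjp_closed simp flip: adjp_ip)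
  then show ?thesis using a by (intro PiE_ext[of S "carrier X" "\<lambda>_. carrier X"]) (auto simp: adjp_def)
qed

lemma carrier_L: "carrier L = {T. \<exists>S. adjp T S}"
  by (auto simp: adjointables_def adjp_def)

lemma L_simps [simp]:
  "S \<otimes>\<^bsub>L\<^esub> T = compose (carrier X) S T" "\<one>\<^bsub>L\<^esub> = (\<lambda>\<xi>\<in>carrier X. \<xi>)"
  "\<zero>\<^bsub>L\<^esub> = (\<lambda>\<xi>\<in>carrier X. \<zero>\<^bsub>X\<^esub>)" "S \<oplus>\<^bsub>L\<^esub> T = (\<lambda>\<xi>\<in>carrier X. S \<xi> \<oplus>\<^bsub>X\<^esub> T \<xi>)"
  "c \<odot>\<^bsub>L\<^esub> T = (\<lambda>\<xi>\<in>carrier X. c \<odot>\<^bsub>X\<^esub> T \<xi>)"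
  by (simp_all add: adjointables_def)

lemma star_L: "adjp T S \<Longrightarrow> star L T = S"
  unfolding adjointables_def using adjp_unique
  by (auto simp: adjp_def intro!: the_equality)

lemma adjp_star: "T \<in> carrier L \<Longrightarrow> adjp T (star L T)"
  by (auto simp: carrier_L star_L)

lemma L_closed [simp]: "\<lbrakk>T \<in> carrier L; \<xi> \<in> carrier X\<rbrakk> \<Longrightarrow> T \<xi> \<in> carrier X"
  by (auto simp: carrier_L adjp_closed)

lemma L_ext: "\<lbrakk>T \<in> carrier L; T' \<in> carrier L; \<And>\<xi>. \<xi> \<in> carrier X \<Longrightarrow> T \<xi> = T' \<xi>\<rbrakk> \<Longrightarrow> T = T'"
  by (rule PiE_ext[of T "carrier X" "\<lambda>_. carrier X"]) (auto simp: carrier_L adjp_def)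

lemma star_L_closed: "T \<in> carrier L \<Longrightarrow> star L T \<in> carrier L"
  using adjp_star adjp_sym by (auto simp: carrier_L)

lemma star_L_ip: "\<lbrakk>T \<in> carrier L; \<xi> \<in> carrier X; \<eta> \<in> carrier X\<rbrakk> \<Longrightarrow> ip X \<xi> (star L T \<eta>) = ip X (T \<xi>) \<eta>"
  using adjp_ip[OF adjp_star] by simp

lemma star_L_ip': "\<lbrakk>T \<in> carrier L; \<xi> \<in> carrier X; \<eta> \<in> carrier X\<rbrakk> \<Longrightarrow> ip X (star L T \<xi>) \<eta> = ip X \<xi> (T \<eta>)"
  using adjp_ip[OF adjp_sym[OF adjp_star]] by simp

text \<open>Moving the operator to the other side of the inner product leaves linearity of the inner
  product in its second argument; no continuity enters, so this is available for the proof of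
  boundedness.\<close>

lemma adjp_linear:
  assumes T: "adjp T S" and "\<xi> \<in> carrier X"
  shows "\<eta> \<in> carrier X \<Longrightarrow> T (\<xi> \<oplus>\<^bsub>X\<^esub> \<eta>) = T \<xi> \<oplus>\<^bsub>X\<^esub> T \<eta>" and "T (c \<odot>\<^bsub>X\<^esub> \<xi>) = c \<odot>\<^bsub>X\<^esub> T \<xi>"
    and "a \<in> carrier A \<Longrightarrow> T (ract X \<xi> a) = ract X (T \<xi>) a"
proof -
  note c = adjp_closed[OF T]
  have e: "ip X \<zeta> (T \<xi>) = ip X (S \<zeta>) \<xi>" if "\<zeta> \<in> carrier X" "\<xi> \<in> carrier X" for \<zeta> \<xi>
    using adjp_ip[OF adjp_sym[OF T]] that by simp
  show "\<eta> \<in> carrier X \<Longrightarrow> T (\<xi> \<oplus>\<^bsub>X\<^esub> \<eta>) = T \<xi> \<oplus>\<^bsub>X\<^esub> T \<eta>"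
    using assms(2) by (intro ip_ext) (simp_all add: c e ip_add)
  show "T (c \<odot>\<^bsub>X\<^esub> \<xi>) = c \<odot>\<^bsub>X\<^esub> T \<xi>"
    using assms(2) by (intro ip_ext) (simp_all add: c e ip_smult)
  show "a \<in> carrier A \<Longrightarrow> T (ract X \<xi> a) = ract X (T \<xi>) a"
    using assms(2) by (intro ip_ext) (simp_all add: c e ip_ract)
qed

lemma L_add: "\<lbrakk>T \<in> carrier L; \<xi> \<in> carrier X; \<eta> \<in> carrier X\<rbrakk> \<Longrightarrow> T (\<xi> \<oplus>\<^bsub>X\<^esub> \<eta>) = T \<xi> \<oplus>\<^bsub>X\<^esub> T \<eta>"
  and L_smult: "\<lbrakk>T \<in> carrier L; \<xi> \<in> carrier X\<rbrakk> \<Longrightarrow> T (c \<odot>\<^bsub>X\<^esub> \<xi>) = c \<odot>\<^bsub>X\<^esub> T \<xi>"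
  and L_ract: "\<lbrakk>T \<in> carrier L; \<xi> \<in> carrier X; a \<in> carrier A\<rbrakk> \<Longrightarrow> T (ract X \<xi> a) = ract X (T \<xi>) a"
  by (meson adjp_linear adjp_star)+

lemma L_zero: "T \<in> carrier L \<Longrightarrow> T \<zero>\<^bsub>X\<^esub> = \<zero>\<^bsub>X\<^esub>"
  using L_smult[of T "\<zero>\<^bsub>X\<^esub>" 0] by simp

text \<open>Automatic boundedness, by the gliding hump argument for the functionals \<open>\<langle>S e, -\<rangle> = \<langle>e, T -\<rangle>\<close>
  with \<open>e\<close> in the unit ball: they are pointwise bounded, and \<open>S e\<close> itself is the direction in which
  such a functional attains its norm.\<close>

lemma adjp_bounded:
  assumes TS: "adjp T S"
  shows "\<exists>B::real. \<forall>\<eta>\<in>carrier X. hn (S \<eta>) \<le> B * hn \<eta>"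
proof (rule ccontr)
  assume neg: "\<not> ?thesis"
  note c = adjp_closed[OF TS]
  note lin = adjp_linear[OF adjp_sym[OF TS]]
  have "\<exists>e. e \<in> carrier X \<and> hn e = 1 \<and> hn (S e) > B" if B: "B > 0" for B :: real
  proof -
    obtain \<eta> where \<eta>: "\<eta> \<in> carrier X" "hn (S \<eta>) > B * hn \<eta>" using neg by (meson not_le)
    have "\<eta> \<noteq> \<zero>\<^bsub>X\<^esub>"
    proof
      assume "\<eta> = \<zero>\<^bsub>X\<^esub>"
      then have "S \<eta> = \<zero>\<^bsub>X\<^esub>" using lin(2)[of "\<zero>\<^bsub>X\<^esub>" 0] c(2)[of "\<zero>\<^bsub>X\<^esub>"] by simp
      then show False using \<eta> \<open>\<eta> = \<zero>\<^bsub>X\<^esub>\<close> by simp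
    qed
    then have pos: "hn \<eta> > 0" using X.nm_eq_zero[OF \<eta>(1)] hn_nonneg[OF \<eta>(1)] by simp
    have "B < hn (S \<eta>) / hn \<eta>" using \<eta>(2) pos by (simp add: pos_less_divide_eq)
    then show ?thesis using \<eta>(1) pos c(2)[OF \<eta>(1)]
      by (intro exI[of _ "complex_of_real (1 / hn \<eta>) \<odot>\<^bsub>X\<^esub> \<eta>"]) (simp add: lin(2) X.nm_smult norm_divide)
  qed
  \<comment> \<open>The growth 4^n is to beat the step length 3^-n of \<open>v\<close> below: the
    values of the functionals at the limit will grow like (4/3)^n.\<close>
  then have "\<forall>n::nat. \<exists>e. e \<in> carrier X \<and> hn e = 1 \<and> hn (S e) > 4 ^ n" by simp
  then obtain e where e: "\<And>n. e n \<in> carrier X" "\<And>n. hn (e n) = 1" "\<And>n::nat. hn (S (e n)) > 4 ^ n" by metis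
  have Sc: "S (e n) \<in> carrier X" for n using c e by simp
  have Spos: "hn (S (e n)) > 0" for n using e(3)[of n] by (smt (verit) zero_less_power)
  define v where "v n = complex_of_real ((1/3) ^ n / hn (S (e n))) \<odot>\<^bsub>X\<^esub> S (e n)" for n
  have vc: "v n \<in> carrier X" for n using Sc by (simp add: v_def)
  have hnv: "hn (v n) = (1/3) ^ n" for n
    using Sc Spos[of n] unfolding v_def X.nm_smult[OF Sc] by (simp add: norm_divide norm_mult norm_power)
  have ipv: "cnorm A (ip X (S (e n)) (v n)) = (1/3) ^ n * hn (S (e n))" for n
    using Sc Spos[of n] unfolding v_def ip_smult[OF Sc Sc]
    by (simp add: A.norm_smult norm_divide norm_mult norm_power hn_square[OF Sc, symmetric] power2_eq_square)
  define P where "P n x \<longleftrightarrow> cnorm A (ip X (S (e n)) x) \<ge> (1/3) ^ n * hn (S (e n))" for n x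
  \<comment> \<open>The values of the functional at \<open>y + v n\<close> and
    \<open>y - v n\<close> differ by twice its value at \<open>v n\<close>, so at one of these two
    points it is at least as large as at \<open>v n\<close>.\<close>
  define x where "x = rec_nat \<zero>\<^bsub>X\<^esub> (\<lambda>n y. if P n (y \<oplus>\<^bsub>X\<^esub> v n) then y \<oplus>\<^bsub>X\<^esub> v n else y \<ominus>\<^bsub>X\<^esub> v n)"
  have xS: "x (Suc n) = (if P n (x n \<oplus>\<^bsub>X\<^esub> v n) then x n \<oplus>\<^bsub>X\<^esub> v n else x n \<ominus>\<^bsub>X\<^esub> v n)" for n
    by (simp add: x_def)
  have xc: "x n \<in> carrier X" for n by (induction n) (auto simp: xS vc simp: x_def)
  have Px: "P n (x (Suc n))" for n
  proof (cases "P n (x n \<oplus>\<^bsub>X\<^esub> v n)")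
    case False
    let ?f = "ip X (S (e n))"
    have fc: "?f (x n) \<in> carrier A" "?f (v n) \<in> carrier A" using Sc xc vc by auto
    have "(?f (x n) \<oplus>\<^bsub>A\<^esub> ?f (v n)) \<ominus>\<^bsub>A\<^esub> (?f (x n) \<ominus>\<^bsub>A\<^esub> ?f (v n)) = ?f (v n) \<oplus>\<^bsub>A\<^esub> ?f (v n)"
      using fc by algebra
    also have "\<dots> = 2 \<odot>\<^bsub>A\<^esub> ?f (v n)" using A.smult_ladd[OF fc(2), of 1 1] fc by simp
    finally have "2 * cnorm A (?f (v n)) \<le> cnorm A (?f (x n) \<oplus>\<^bsub>A\<^esub> ?f (v n)) + cnorm A (?f (x n) \<ominus>\<^bsub>A\<^esub> ?f (v n))"
      using fc A.nm_diff_le[of "?f (x n) \<oplus>\<^bsub>A\<^esub> ?f (v n)" "?f (x n) \<ominus>\<^bsub>A\<^esub> ?f (v n)"] by (simp add: A.norm_smult)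
    then show ?thesis using False ipv[of n] Sc xc vc unfolding P_def
      by (simp add: xS ip_add ip_diff P_def)
  qed (simp add: xS)
  have step: "hn (x (Suc n) \<ominus>\<^bsub>X\<^esub> x n) = (1/3) ^ n" for n
  proof -
    have "(x n \<oplus>\<^bsub>X\<^esub> v n) \<ominus>\<^bsub>X\<^esub> x n = v n" "(x n \<ominus>\<^bsub>X\<^esub> v n) \<ominus>\<^bsub>X\<^esub> x n = \<ominus>\<^bsub>X\<^esub> v n"
      using xc[of n] vc[of n] by algebra+
    then show ?thesis using hnv[of n] vc by (simp add: xS)
  qed
  have "ncauchy X hn x"
    using xc step by (intro X.ncauchy_summable[of x "\<lambda>n. (1/3)^n"]) auto
  then obtain l where l: "nconv X hn x l" using complete by (auto simp: ncomplete_def)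
  have lc: "l \<in> carrier X" using l by (simp add: nconv_def)
  have geo: "k \<le> m \<Longrightarrow> (\<Sum>i=k..<m. (1/3::real) ^ i) + (1/3) ^ m * (3/2) = (1/3) ^ k * (3/2)" for k m
    by (induction m rule: dec_induct) (auto simp: sum.atLeastLessThan_Suc)
  \<comment> \<open>The steps after the n-th have total length at most 3^-n / 2, so at least half of
    the value reached at step n survives in the limit.\<close>
  have near: "hn (l \<ominus>\<^bsub>X\<^esub> x (Suc n)) \<le> (1/3) ^ n / 2" for n
  proof (rule LIMSEQ_le_const)
    show "(\<lambda>m. hn (x m \<ominus>\<^bsub>X\<^esub> l) + (1/3) ^ n / 2) \<longlonglongrightarrow> (1/3) ^ n / 2"
      using l tendsto_add[of "\<lambda>m. hn (x m \<ominus>\<^bsub>X\<^esub> l)" 0 sequentially "\<lambda>_. (1/3) ^ n / 2"]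
      by (simp add: nconv_def)
    have "hn (l \<ominus>\<^bsub>X\<^esub> x (Suc n)) \<le> hn (x m \<ominus>\<^bsub>X\<^esub> l) + (1/3) ^ n / 2" if m: "m \<ge> Suc n" for m
    proof -
      have "hn (x m \<ominus>\<^bsub>X\<^esub> x (Suc n)) \<le> (\<Sum>i=Suc n..<m. (1/3) ^ i)"
        using X.telescope_le[of x "Suc n" m] xc m by (auto simp: step)
      also have "\<dots> \<le> (1/3) ^ n / 2"
      proof -
        have "0 \<le> (1/3::real) ^ m" by simp
        then have "(\<Sum>i=Suc n..<m. (1/3::real) ^ i) \<le> (1/3) ^ Suc n * (3/2)" using geo[OF m] by linarith
        then show ?thesis by simp
      qed
      finally show ?thesis using X.nm_tri[of l "x m" "x (Suc n)"] X.nm_commute[of l "x m"] lc xc by simp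
    qed
    then show "\<exists>N. \<forall>m\<ge>N. hn (l \<ominus>\<^bsub>X\<^esub> x (Suc n)) \<le> hn (x m \<ominus>\<^bsub>X\<^esub> l) + (1/3) ^ n / 2" by blast
  qed
  have "(4/3) ^ n / 2 \<le> hn (T l)" for n
  proof -
    let ?f = "ip X (S (e n))"
    have fc: "?f l \<in> carrier A" "?f (x (Suc n)) \<in> carrier A" using Sc xc lc by auto
    have "(1/3) ^ n * hn (S (e n)) \<le> cnorm A (?f (x (Suc n)))" using Px[of n] by (simp add: P_def)
    also have "\<dots> \<le> cnorm A (?f l) + cnorm A (?f (x (Suc n)) \<ominus>\<^bsub>A\<^esub> ?f l)" using fc by (intro A.nm_le) auto
    also have "cnorm A (?f (x (Suc n)) \<ominus>\<^bsub>A\<^esub> ?f l) \<le> hn (S (e n)) * hn (l \<ominus>\<^bsub>X\<^esub> x (Suc n))"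
      using Sc xc lc cauchy_schwarz[of "S (e n)" "x (Suc n) \<ominus>\<^bsub>X\<^esub> l"] X.nm_commute[of l "x (Suc n)"]
      by (simp add: ip_diff)
    also have "\<dots> \<le> hn (S (e n)) * ((1/3) ^ n / 2)"
      using near[of n] Spos[of n] by (intro mult_left_mono) auto
    finally have "(1/3) ^ n * hn (S (e n)) / 2 \<le> cnorm A (?f l)" by (simp add: mult.commute)
    moreover have "(1/3) ^ n * 4 ^ n \<le> (1/3) ^ n * hn (S (e n))"
      using e(3)[of n] by (intro mult_left_mono) auto
    moreover have "?f l = ip X (e n) (T l)" using adjp_ip[OF adjp_sym[OF TS] e(1) lc] .
    moreover have "cnorm A (ip X (e n) (T l)) \<le> hn (T l)"
      using cauchy_schwarz[of "e n" "T l"] e c lc by simp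
    moreover have "(1/3) ^ n * 4 ^ n = (4/3::real) ^ n" by (simp flip: power_mult_distrib)
    ultimately show ?thesis by simp
  qed
  then have "(4/3) ^ n \<le> 2 * hn (T l)" for n by (simp add: mult.commute)
  moreover obtain n where "2 * hn (T l) < (4/3) ^ n" using real_arch_pow[of "4/3"] by auto
  ultimately show False by (meson not_le)
qed

lemma L_bounded:
  assumes "T \<in> carrier L"
  obtains B :: real where "B \<ge> 0" and "\<And>\<xi>. \<xi> \<in> carrier X \<Longrightarrow> hn (T \<xi>) \<le> B * hn \<xi>"
proof -
  obtain B where B: "\<And>\<xi>. \<xi> \<in> carrier X \<Longrightarrow> hn (T \<xi>) \<le> B * hn \<xi>"
    using adjp_bounded[OF adjp_sym[OF adjp_star[OF assms]]] by blast
  have "hn (T \<xi>) \<le> max B 0 * hn \<xi>" if "\<xi> \<in> carrier X" for \<xi>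
    using B[OF that] hn_nonneg[OF that] mult_right_mono[of B "max B 0" "hn \<xi>"] by simp
  then show thesis using that[of "max B 0"] by simp
qed

lemma opn_eq: "opn T = (SUP \<xi>\<in>{\<xi> \<in> carrier X. hn \<xi> \<le> 1}. hn (T \<xi>))"
  by (simp add: adjointables_def)

lemma opn_le: 
  assumes "0 \<le> B" and "\<And>\<xi>. \<xi> \<in> carrier X \<Longrightarrow> hn (T \<xi>) \<le> B * hn \<xi>"
  shows "opn T \<le> B"
  unfolding opn_eq
proof (rule cSUP_least)
  show "{\<xi> \<in> carrier X. hn \<xi> \<le> 1} \<noteq> {}" by (auto intro!: exI[of _ "\<zero>\<^bsub>X\<^esub>"])
  fix \<xi> assume "\<xi> \<in> {\<xi> \<in> carrier X. hn \<xi> \<le> 1}"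
  then show "hn (T \<xi>) \<le> B" using assms(2)[of \<xi>] mult_left_mono[of "hn \<xi>" 1 B] assms(1) by simp
qed

lemma opn_bound:
  assumes T: "T \<in> carrier L" and x: "\<xi> \<in> carrier X"
  shows "hn (T \<xi>) \<le> opn T * hn \<xi>"
proof (cases "\<xi> = \<zero>\<^bsub>X\<^esub>")
  case True
  then show ?thesis using L_zero[OF T] by simp
next
  case False
  then have pos: "hn \<xi> > 0" using X.nm_eq_zero[OF x] hn_nonneg[OF x] by simp
  obtain B where B: "B \<ge> 0" "\<And>\<xi>. \<xi> \<in> carrier X \<Longrightarrow> hn (T \<xi>) \<le> B * hn \<xi>" using L_bounded[OF T] by blast
  let ?y = "complex_of_real (1 / hn \<xi>) \<odot>\<^bsub>X\<^esub> \<xi>"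
  have "hn (T ?y) \<le> opn T"
    unfolding opn_eq
  proof (rule cSUP_upper)
    show "?y \<in> {\<xi> \<in> carrier X. hn \<xi> \<le> 1}" using x pos by (simp add: X.nm_smult norm_divide)
    have "hn (T \<xi>) \<le> B" if "\<xi> \<in> carrier X" "hn \<xi> \<le> 1" for \<xi>
      using B(2)[OF that(1)] mult_left_mono[OF that(2) B(1)] by simp
    then show "bdd_above ((\<lambda>\<xi>. hn (T \<xi>)) ` {\<xi> \<in> carrier X. hn \<xi> \<le> 1})" by (auto intro!: bdd_aboveI[of _ B])
  qed
  then show ?thesis using pos x T by (simp add: L_smult X.nm_smult norm_divide pos_divide_le_eq)
qed

lemma opn_nonneg: "T \<in> carrier L \<Longrightarrow> 0 \<le> opn T"
proof -
  assume T: "T \<in> carrier L"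
  obtain B where B: "B \<ge> 0" "\<And>\<xi>. \<xi> \<in> carrier X \<Longrightarrow> hn (T \<xi>) \<le> B * hn \<xi>" using L_bounded[OF T] by blast
  have "bdd_above ((\<lambda>\<xi>. hn (T \<xi>)) ` {\<xi> \<in> carrier X. hn \<xi> \<le> 1})"
  proof (rule bdd_aboveI[of _ B])
    fix r assume "r \<in> (\<lambda>\<xi>. hn (T \<xi>)) ` {\<xi> \<in> carrier X. hn \<xi> \<le> 1}"
    then obtain \<xi> where "r = hn (T \<xi>)" "\<xi> \<in> carrier X" "hn \<xi> \<le> 1" by auto
    then show "r \<le> B" using B(2)[of \<xi>] mult_left_mono[of "hn \<xi>" 1 B] B(1) by simp
  qed
  then have "hn (T \<zero>\<^bsub>X\<^esub>) \<le> opn T" unfolding opn_eq by (intro cSUP_upper) auto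
  then show ?thesis using L_zero[OF T] by simp
qed

lemma adjp_add: "\<lbrakk>adjp T S; adjp T' S'\<rbrakk> \<Longrightarrow> adjp (T \<oplus>\<^bsub>L\<^esub> T') (S \<oplus>\<^bsub>L\<^esub> S')"
  by (rule adjpI) (auto simp: adjp_closed ip_add ip_add_left adjp_ip)

lemma adjp_smult: "adjp T S \<Longrightarrow> adjp (c \<odot>\<^bsub>L\<^esub> T) (cnj c \<odot>\<^bsub>L\<^esub> S)"
  by (rule adjpI) (auto simp: adjp_closed ip_smult ip_smult_left adjp_ip)

lemma adjp_mult: "\<lbrakk>adjp T S; adjp T' S'\<rbrakk> \<Longrightarrow> adjp (T \<otimes>\<^bsub>L\<^esub> T') (S' \<otimes>\<^bsub>L\<^esub> S)"
  by (rule adjpI) (auto simp: adjp_closed adjp_ip compose_def)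

lemma adjp_zero: "adjp \<zero>\<^bsub>L\<^esub> \<zero>\<^bsub>L\<^esub>"
  by (rule adjpI) auto

lemma adjp_one: "adjp \<one>\<^bsub>L\<^esub> \<one>\<^bsub>L\<^esub>"
  by (rule adjpI) auto

lemma cvec_L: "cvec L"
proof (rule cvecI)
  show "x \<oplus>\<^bsub>L\<^esub> y \<in> carrier L" if "x \<in> carrier L" "y \<in> carrier L" for x y
    using that adjp_add unfolding carrier_L by blast
  show "c \<odot>\<^bsub>L\<^esub> x \<in> carrier L" if "x \<in> carrier L" for c x
    using that adjp_smult unfolding carrier_L by blast
  show "\<zero>\<^bsub>L\<^esub> \<in> carrier L" using adjp_zero unfolding carrier_L by blast
  show "\<zero>\<^bsub>L\<^esub> \<oplus>\<^bsub>L\<^esub> x = x" "1 \<odot>\<^bsub>L\<^esub> x = x" if x: "x \<in> carrier L" for x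
  proof -
    have "x \<xi> = undefined" if "\<xi> \<notin> carrier X" for \<xi>
      using x that by (auto simp: carrier_L adjp_def)
    then show "\<zero>\<^bsub>L\<^esub> \<oplus>\<^bsub>L\<^esub> x = x" "1 \<odot>\<^bsub>L\<^esub> x = x"
      using L_closed[OF x] by (simp_all add: restrict_def fun_eq_iff)
  qed
  fix x y z assume x: "x \<in> carrier L"
  then have xc: "\<xi> \<in> carrier X \<Longrightarrow> x \<xi> \<in> carrier X" for \<xi> by simp
  show "0 \<odot>\<^bsub>L\<^esub> x = \<zero>\<^bsub>L\<^esub>" "(a + b) \<odot>\<^bsub>L\<^esub> x = a \<odot>\<^bsub>L\<^esub> x \<oplus>\<^bsub>L\<^esub> b \<odot>\<^bsub>L\<^esub> x" "(a * b) \<odot>\<^bsub>L\<^esub> x = a \<odot>\<^bsub>L\<^esub> (b \<odot>\<^bsub>L\<^esub> x)" for a b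
    by (auto simp: restrict_def xc X.smult_ladd intro!: ext)
  assume y: "y \<in> carrier L"
  then have yc: "\<xi> \<in> carrier X \<Longrightarrow> y \<xi> \<in> carrier X" for \<xi> by simp
  show "x \<oplus>\<^bsub>L\<^esub> y = y \<oplus>\<^bsub>L\<^esub> x" "c \<odot>\<^bsub>L\<^esub> (x \<oplus>\<^bsub>L\<^esub> y) = c \<odot>\<^bsub>L\<^esub> x \<oplus>\<^bsub>L\<^esub> c \<odot>\<^bsub>L\<^esub> y" for c
    by (auto simp: restrict_def xc yc X.smult_radd X.a_comm intro!: ext)
  assume z: "z \<in> carrier L"
  then have zc: "\<xi> \<in> carrier X \<Longrightarrow> z \<xi> \<in> carrier X" for \<xi> by simp
  show "x \<oplus>\<^bsub>L\<^esub> y \<oplus>\<^bsub>L\<^esub> z = x \<oplus>\<^bsub>L\<^esub> (y \<oplus>\<^bsub>L\<^esub> z)"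
    by (auto simp: restrict_def xc yc zc X.a_assoc intro!: ext)
qed

lemma cnspace_L: "cnspace L opn"
proof -
  interpret L: cvec L by (rule cvec_L)
  show ?thesis
  proof
    fix T assume T: "T \<in> carrier L"
    show "0 \<le> opn T" by (rule opn_nonneg[OF T])
    show "opn T = 0 \<longleftrightarrow> T = \<zero>\<^bsub>L\<^esub>"
    proof
      assume 0: "opn T = 0"
      show "T = \<zero>\<^bsub>L\<^esub>"
      proof (rule L_ext[OF T])
        show "\<zero>\<^bsub>L\<^esub> \<in> carrier L" by (rule L.zero_closed)
        fix \<xi> assume x: "\<xi> \<in> carrier X"
        then have "hn (T \<xi>) = 0" using opn_bound[OF T x] 0 hn_nonneg[of "T \<xi>"] T by simp
        then show "T \<xi> = \<zero>\<^bsub>L\<^esub> \<xi>" using X.nm_eq_zero[of "T \<xi>"] T x by simp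
      qed
    next
      assume "T = \<zero>\<^bsub>L\<^esub>"
      then have "opn T \<le> 0" by (intro opn_le) (auto simp: hn_nonneg)
      then show "opn T = 0" using opn_nonneg[OF T] by simp
    qed
    have le: "opn (c \<odot>\<^bsub>L\<^esub> T) \<le> cmod c * opn T" if T: "T \<in> carrier L" for c T
    proof (rule opn_le)
      fix \<xi> assume x: "\<xi> \<in> carrier X"
      then show "hn ((c \<odot>\<^bsub>L\<^esub> T) \<xi>) \<le> cmod c * opn T * hn \<xi>"
        using T mult_left_mono[OF opn_bound[OF T x], of "cmod c"] by (simp add: X.nm_smult mult.assoc)
    qed (use opn_nonneg[OF T] in simp)
    show "opn (c \<odot>\<^bsub>L\<^esub> T) = cmod c * opn T" for c
    proof (cases "c = 0")
      case True
      then show ?thesis using le[OF T, of 0] opn_nonneg[OF L.smult_cl[OF T], of 0] by simp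
    next
      case False
      have "T = (1/c) \<odot>\<^bsub>L\<^esub> (c \<odot>\<^bsub>L\<^esub> T)" using L.smult_smult[OF T, of "1/c" c] L.smult_1[OF T] False by simp
      then have "opn T \<le> cmod (1/c) * opn (c \<odot>\<^bsub>L\<^esub> T)" using le[OF L.smult_cl[OF T], of "1/c" c] by metis
      then show ?thesis using le[OF T, of c] False by (simp add: norm_divide field_simps)
    qed
    fix T' assume T': "T' \<in> carrier L"
    show "opn (T \<oplus>\<^bsub>L\<^esub> T') \<le> opn T + opn T'"
    proof (rule opn_le)
      fix \<xi> assume x: "\<xi> \<in> carrier X"
      then show "hn ((T \<oplus>\<^bsub>L\<^esub> T') \<xi>) \<le> (opn T + opn T') * hn \<xi>"
        using opn_bound[OF T x] opn_bound[OF T' x] X.nm_add[of "T \<xi>" "T' \<xi>"] T T'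
        by (simp add: distrib_right)
    qed (use opn_nonneg T T' in auto)
  qed
qed

lemma L_minus_apply: "\<lbrakk>T \<in> carrier L; T' \<in> carrier L; \<xi> \<in> carrier X\<rbrakk> \<Longrightarrow> (T \<ominus>\<^bsub>L\<^esub> T') \<xi> = T \<xi> \<ominus>\<^bsub>X\<^esub> T' \<xi>"
  using cvec.minus_smult[OF cvec_L, of T T'] by (simp add: X.minus_smult)

lemma opn_star_le: assumes T: "T \<in> carrier L" shows "opn (star L T) \<le> opn T"
proof (rule opn_le)
  show "0 \<le> opn T" using T by (rule opn_nonneg)
  fix \<xi> assume x: "\<xi> \<in> carrier X"
  let ?y = "star L T \<xi>"
  have y: "?y \<in> carrier X" using star_L_closed[OF T] x by simp
  have "(hn ?y)\<^sup>2 = cnorm A (ip X \<xi> (T ?y))"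
    using T x y by (simp add: hn_square star_L_ip')
  also have "\<dots> \<le> hn \<xi> * hn (T ?y)" by (rule cauchy_schwarz[OF x L_closed[OF T y]])
  also have "\<dots> \<le> hn \<xi> * (opn T * hn ?y)"
    by (rule mult_left_mono[OF opn_bound[OF T y] hn_nonneg[OF x]])
  finally have *: "hn ?y * hn ?y \<le> (opn T * hn \<xi>) * hn ?y" by (simp add: power2_eq_square algebra_simps)
  show "hn ?y \<le> opn T * hn \<xi>"
  proof (cases "hn ?y = 0")
    case True
    then show ?thesis using opn_nonneg[OF T] hn_nonneg[OF x] by simp
  next
    case False
    then show ?thesis using * hn_nonneg[OF y] by simp
  qed
qed

lemma star_L_star: "T \<in> carrier L \<Longrightarrow> star L (star L T) = T"
  using adjp_star adjp_sym star_L by blast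

lemma opn_star: "T \<in> carrier L \<Longrightarrow> opn (star L T) = opn T"
  using opn_star_le[of T] opn_star_le[of "star L T"] star_L_closed[of T] star_L_star[of T] by simp

lemma opn_mult: assumes "S \<in> carrier L" "T \<in> carrier L" shows "opn (S \<otimes>\<^bsub>L\<^esub> T) \<le> opn S * opn T"
proof (rule opn_le)
  fix \<xi> assume x: "\<xi> \<in> carrier X"
  have "hn (S (T \<xi>)) \<le> opn S * hn (T \<xi>)" by (rule opn_bound[OF assms(1) L_closed[OF assms(2) x]])
  also have "\<dots> \<le> opn S * (opn T * hn \<xi>)" by (rule mult_left_mono[OF opn_bound[OF assms(2) x] opn_nonneg[OF assms(1)]])
  finally show "hn ((S \<otimes>\<^bsub>L\<^esub> T) \<xi>) \<le> opn S * opn T * hn \<xi>" using x by (simp add: compose_def mult.assoc)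
qed (use assms opn_nonneg in auto)

lemma opn_cstar: assumes T: "T \<in> carrier L" shows "opn (star L T \<otimes>\<^bsub>L\<^esub> T) = (opn T)\<^sup>2"
proof (rule antisym)
  show "opn (star L T \<otimes>\<^bsub>L\<^esub> T) \<le> (opn T)\<^sup>2"
    using opn_mult[OF star_L_closed[OF T] T] opn_star[OF T] by (simp add: power2_eq_square)
  let ?S = "star L T \<otimes>\<^bsub>L\<^esub> T"
  have S: "?S \<in> carrier L" using adjp_mult[OF adjp_sym[OF adjp_star[OF T]] adjp_star[OF T]] unfolding carrier_L by blast
  have "opn T \<le> sqrt (opn ?S)"
  proof (rule opn_le)
    show "0 \<le> sqrt (opn ?S)" using opn_nonneg[OF S] by simp
    fix \<xi> assume x: "\<xi> \<in> carrier X"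
    have "(hn (T \<xi>))\<^sup>2 = cnorm A (ip X \<xi> (?S \<xi>))"
      using x T star_L_closed[OF T] by (simp add: hn_square compose_def star_L_ip)
    also have "\<dots> \<le> hn \<xi> * hn (?S \<xi>)" by (rule cauchy_schwarz[OF x L_closed[OF S x]])
    also have "\<dots> \<le> hn \<xi> * (opn ?S * hn \<xi>)" by (rule mult_left_mono[OF opn_bound[OF S x] hn_nonneg[OF x]])
    also have "\<dots> = (sqrt (opn ?S) * hn \<xi>)\<^sup>2" using opn_nonneg[OF S] by (simp add: power2_eq_square algebra_simps)
    finally show "hn (T \<xi>) \<le> sqrt (opn ?S) * hn \<xi>"
      by (rule power2_le_imp_le) (use opn_nonneg[OF S] hn_nonneg[OF x] in simp)
  qed
  then show "(opn T)\<^sup>2 \<le> opn ?S"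
    using power_mono[OF _ opn_nonneg[OF T], of "sqrt (opn ?S)" 2] opn_nonneg[OF S] by simp
qed

lemma L_pointwise_cauchy:
  assumes "ncauchy L opn s" and "\<xi> \<in> carrier X"
  shows "ncauchy X hn (\<lambda>n. s n \<xi>)"
proof -
  have sc: "s n \<in> carrier L" for n using assms by (auto simp: ncauchy_def)
  have "\<exists>k. \<forall>m\<ge>k. \<forall>n\<ge>k. hn (s m \<xi> \<ominus>\<^bsub>X\<^esub> s n \<xi>) < e" if e: "e > 0" for e
  proof -
    have e': "e / (hn \<xi> + 1) > 0" using e hn_nonneg[OF assms(2)] by simp
    obtain k where k: "\<And>m n. \<lbrakk>m \<ge> k; n \<ge> k\<rbrakk> \<Longrightarrow> opn (s m \<ominus>\<^bsub>L\<^esub> s n) < e / (hn \<xi> + 1)"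
      using assms(1) e' unfolding ncauchy_def by meson
    have "hn (s m \<xi> \<ominus>\<^bsub>X\<^esub> s n \<xi>) < e" if "m \<ge> k" "n \<ge> k" for m n
    proof -
      have d: "s m \<ominus>\<^bsub>L\<^esub> s n \<in> carrier L" using sc cvec_L by (meson abelian_group.minus_closed cvec_def Module.module_def)
      have "hn (s m \<xi> \<ominus>\<^bsub>X\<^esub> s n \<xi>) \<le> opn (s m \<ominus>\<^bsub>L\<^esub> s n) * hn \<xi>"
        using opn_bound[OF d assms(2)] L_minus_apply[OF sc sc assms(2)] by simp
      also have "\<dots> \<le> opn (s m \<ominus>\<^bsub>L\<^esub> s n) * (hn \<xi> + 1)"
        using opn_nonneg[OF d] by (intro mult_left_mono) auto
      also have "\<dots> < e" using k[OF that] hn_nonneg[OF assms(2)] by (simp add: pos_less_divide_eq)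
      finally show ?thesis .
    qed
    then show ?thesis by blast
  qed
  then show ?thesis using sc assms(2) by (auto simp: ncauchy_def)
qed

text \<open>The adjoints are carried along: both the operators and their adjoints converge
  pointwise, and the two limits are adjoint to each other. This makes the pointwise limit
  adjointable.\<close>

lemma ncomplete_L: "ncomplete L opn"
  unfolding ncomplete_def
proof (intro allI impI)
  fix s assume s: "ncauchy L opn s"
  interpret L: cnspace L opn by (rule cnspace_L)
  have sc: "s n \<in> carrier L" for n using s by (auto simp: ncauchy_def)
  have "opn (star L (s m) \<ominus>\<^bsub>L\<^esub> star L (s n)) = opn (s m \<ominus>\<^bsub>L\<^esub> s n)" for m n
  proof -
    have "star L (s m \<oplus>\<^bsub>L\<^esub> (-1) \<odot>\<^bsub>L\<^esub> s n) = star L (s m) \<oplus>\<^bsub>L\<^esub> cnj (-1) \<odot>\<^bsub>L\<^esub> star L (s n)"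
      by (intro star_L adjp_add adjp_smult adjp_star sc)
    then show ?thesis using opn_star[of "s m \<ominus>\<^bsub>L\<^esub> s n"] sc star_L_closed[OF sc]
      by (simp add: L.minus_smult del: L_simps)
  qed
  then have s': "ncauchy L opn (\<lambda>n. star L (s n))" using s star_L_closed by (auto simp: ncauchy_def)
  have "\<forall>\<xi>. \<exists>l. \<xi> \<in> carrier X \<longrightarrow> nconv X hn (\<lambda>n. s n \<xi>) l"
    using L_pointwise_cauchy[OF s] complete unfolding ncomplete_def by blast
  then obtain T where T: "\<And>\<xi>. \<xi> \<in> carrier X \<Longrightarrow> nconv X hn (\<lambda>n. s n \<xi>) (T \<xi>)" by metis
  have "\<forall>\<xi>. \<exists>l. \<xi> \<in> carrier X \<longrightarrow> nconv X hn (\<lambda>n. star L (s n) \<xi>) l"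
    using L_pointwise_cauchy[OF s'] complete unfolding ncomplete_def by blast
  then obtain S where S: "\<And>\<xi>. \<xi> \<in> carrier X \<Longrightarrow> nconv X hn (\<lambda>n. star L (s n) \<xi>) (S \<xi>)" by metis
  let ?T = "restrict T (carrier X)"
  have "adjp ?T (restrict S (carrier X))"
  proof (rule adjpI)
    show "?T \<in> carrier X \<rightarrow>\<^sub>E carrier X" using T by (auto simp: nconv_def)
    show "restrict S (carrier X) \<in> carrier X \<rightarrow>\<^sub>E carrier X" using S by (auto simp: nconv_def)
    fix \<xi> \<eta> assume x: "\<xi> \<in> carrier X" and y: "\<eta> \<in> carrier X"
    have Tc: "T \<xi> \<in> carrier X" using T[OF x] by (simp add: nconv_def)
    have "nconv A (cnorm A) (\<lambda>n. star A (ip X \<eta> (s n \<xi>))) (star A (ip X \<eta> (T \<xi>)))"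
      by (intro A.nconv_star ip_nconv T x y)
    moreover have "star A (ip X \<eta> (s n \<xi>)) = ip X \<xi> (star L (s n) \<eta>)" for n
      using x y sc by (simp add: star_L_ip)
    ultimately have "nconv A (cnorm A) (\<lambda>n. ip X \<xi> (star L (s n) \<eta>)) (ip X (T \<xi>) \<eta>)"
      using y Tc by simp
    moreover have "nconv A (cnorm A) (\<lambda>n. ip X \<xi> (star L (s n) \<eta>)) (ip X \<xi> (S \<eta>))"
      by (intro ip_nconv S x y)
    ultimately show "ip X (?T \<xi>) \<eta> = ip X \<xi> (restrict S (carrier X) \<eta>)"
      using x y A.nconv_unique by auto
  qed
  then have Tc: "?T \<in> carrier L" unfolding carrier_L by blast
  have "nconv L opn s ?T"
    unfolding nconv_def
  proof (intro conjI Tc LIMSEQ_I)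
    show "range s \<subseteq> carrier L" using sc by auto
    fix e :: real assume e: "e > 0"
    obtain k where k: "\<And>m n. \<lbrakk>m \<ge> k; n \<ge> k\<rbrakk> \<Longrightarrow> opn (s m \<ominus>\<^bsub>L\<^esub> s n) < e / 2"
      using s half_gt_zero[OF e] unfolding ncauchy_def by meson
    have "norm (opn (s n \<ominus>\<^bsub>L\<^esub> ?T) - 0) < e" if n: "n \<ge> k" for n
    proof -
      have "opn (s n \<ominus>\<^bsub>L\<^esub> ?T) \<le> e / 2"
      proof (rule opn_le)
        fix \<xi> assume x: "\<xi> \<in> carrier X"
        have Tx: "T \<xi> \<in> carrier X" using T[OF x] by (simp add: nconv_def)
        have "hn (s n \<xi> \<ominus>\<^bsub>X\<^esub> T \<xi>) \<le> e / 2 * hn \<xi>"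
        proof (rule LIMSEQ_le_const)
          show "(\<lambda>m. e / 2 * hn \<xi> + hn (s m \<xi> \<ominus>\<^bsub>X\<^esub> T \<xi>)) \<longlonglongrightarrow> e / 2 * hn \<xi>"
            using tendsto_add[of "\<lambda>_. e / 2 * hn \<xi>" _ sequentially "\<lambda>m. hn (s m \<xi> \<ominus>\<^bsub>X\<^esub> T \<xi>)" 0] T[OF x]
            by (simp add: nconv_def)
          have "hn (s n \<xi> \<ominus>\<^bsub>X\<^esub> T \<xi>) \<le> e / 2 * hn \<xi> + hn (s m \<xi> \<ominus>\<^bsub>X\<^esub> T \<xi>)" if m: "m \<ge> k" for m
          proof -
            have "hn (s n \<xi> \<ominus>\<^bsub>X\<^esub> s m \<xi>) \<le> opn (s n \<ominus>\<^bsub>L\<^esub> s m) * hn \<xi>"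
              using opn_bound[of "s n \<ominus>\<^bsub>L\<^esub> s m" \<xi>] x sc by (simp add: L_minus_apply)
            also have "\<dots> \<le> e / 2 * hn \<xi>"
              using k[OF n m] hn_nonneg[OF x] by (intro mult_right_mono) auto
            finally show ?thesis using X.nm_tri[of "s n \<xi>" "s m \<xi>" "T \<xi>"] sc x Tx by simp
          qed
          then show "\<exists>N. \<forall>m\<ge>N. hn (s n \<xi> \<ominus>\<^bsub>X\<^esub> T \<xi>) \<le> e / 2 * hn \<xi> + hn (s m \<xi> \<ominus>\<^bsub>X\<^esub> T \<xi>)" by blast
        qed
        then show "hn ((s n \<ominus>\<^bsub>L\<^esub> ?T) \<xi>) \<le> e / 2 * hn \<xi>"
          using L_minus_apply[OF sc[of n] Tc x] x by simp
      qed (use e in simp)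
      then show ?thesis using e opn_nonneg[of "s n \<ominus>\<^bsub>L\<^esub> ?T"] sc Tc by simp
    qed
    then show "\<exists>no. \<forall>n\<ge>no. norm (opn (s n \<ominus>\<^bsub>L\<^esub> ?T) - 0) < e" by blast
  qed
  then show "\<exists>l. nconv L opn s l" by blast
qed

lemma mult_L_closed: "\<lbrakk>S \<in> carrier L; T \<in> carrier L\<rbrakk> \<Longrightarrow> S \<otimes>\<^bsub>L\<^esub> T \<in> carrier L"
  using adjp_mult unfolding carrier_L by blast

lemma cstar_L: "cstar_algebra L"
proof (rule cstar_algebraI[OF cnspace_L ncomplete_L])
  interpret L: cvec L by (rule cvec_L)
  fix x y z c assume x: "x \<in> carrier L"
  show "star L x \<in> carrier L" by (rule star_L_closed[OF x])
  show "star L (star L x) = x" by (rule star_L_star[OF x])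
  show "star L (c \<odot>\<^bsub>L\<^esub> x) = cnj c \<odot>\<^bsub>L\<^esub> star L x" by (intro star_L adjp_smult adjp_star x)
  show "opn (star L x \<otimes>\<^bsub>L\<^esub> x) = (opn x)\<^sup>2" by (rule opn_cstar[OF x])
  assume y: "y \<in> carrier L"
  show xy: "x \<otimes>\<^bsub>L\<^esub> y \<in> carrier L" by (rule mult_L_closed[OF x y])
  show "(c \<odot>\<^bsub>L\<^esub> x) \<otimes>\<^bsub>L\<^esub> y = c \<odot>\<^bsub>L\<^esub> (x \<otimes>\<^bsub>L\<^esub> y)"
    using x y by (auto simp: compose_def restrict_def intro!: ext)
  show "x \<otimes>\<^bsub>L\<^esub> (c \<odot>\<^bsub>L\<^esub> y) = c \<odot>\<^bsub>L\<^esub> (x \<otimes>\<^bsub>L\<^esub> y)"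
    using x y by (auto simp: compose_def restrict_def L_smult intro!: ext)
  show "star L (x \<oplus>\<^bsub>L\<^esub> y) = star L x \<oplus>\<^bsub>L\<^esub> star L y" by (intro star_L adjp_add adjp_star x y)
  show "star L (x \<otimes>\<^bsub>L\<^esub> y) = star L y \<otimes>\<^bsub>L\<^esub> star L x" by (intro star_L adjp_mult adjp_star x y)
  show "opn (x \<otimes>\<^bsub>L\<^esub> y) \<le> opn x * opn y" by (rule opn_mult[OF x y])
  assume z: "z \<in> carrier L"
  show "x \<otimes>\<^bsub>L\<^esub> y \<otimes>\<^bsub>L\<^esub> z = x \<otimes>\<^bsub>L\<^esub> (y \<otimes>\<^bsub>L\<^esub> z)"
    using x y z by (auto simp: compose_def restrict_def intro!: ext)
  show "(x \<oplus>\<^bsub>L\<^esub> y) \<otimes>\<^bsub>L\<^esub> z = x \<otimes>\<^bsub>L\<^esub> z \<oplus>\<^bsub>L\<^esub> y \<otimes>\<^bsub>L\<^esub> z"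
    using x y z by (auto simp: compose_def restrict_def intro!: ext)
  show "z \<otimes>\<^bsub>L\<^esub> (x \<oplus>\<^bsub>L\<^esub> y) = z \<otimes>\<^bsub>L\<^esub> x \<oplus>\<^bsub>L\<^esub> z \<otimes>\<^bsub>L\<^esub> y"
    using x y z by (auto simp: compose_def restrict_def L_add intro!: ext)
qed

lemma one_L: "\<one>\<^bsub>L\<^esub> \<in> carrier L" "T \<in> carrier L \<Longrightarrow> \<one>\<^bsub>L\<^esub> \<otimes>\<^bsub>L\<^esub> T = T" "T \<in> carrier L \<Longrightarrow> T \<otimes>\<^bsub>L\<^esub> \<one>\<^bsub>L\<^esub> = T"
proof -
  show 1: "\<one>\<^bsub>L\<^esub> \<in> carrier L" using adjp_one unfolding carrier_L by blast
  show "\<one>\<^bsub>L\<^esub> \<otimes>\<^bsub>L\<^esub> T = T" if T: "T \<in> carrier L"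
    by (rule L_ext[OF mult_L_closed[OF 1 T] T]) (simp add: compose_def T)
  show "T \<otimes>\<^bsub>L\<^esub> \<one>\<^bsub>L\<^esub> = T" if T: "T \<in> carrier L"
    by (rule L_ext[OF mult_L_closed[OF T 1] T]) (simp add: compose_def)
qed

end

section \<open>Positivity\<close>

lemma (in cvec) neg_zero [simp]: "\<ominus> \<zero> = \<zero>"
  by (simp add: neg_smult)

text \<open>Positivity is treated with a unit first. A general algebra then acts on itself by left
  multiplication inside the unital algebra of adjointable operators, which plays the part of a
  unitization.\<close>

locale unital_cstar = cstar_algebra A for A :: "'a cstar_algebra" (structure) +
  assumes one_closed [simp, intro]: "\<one> \<in> carrier A"
    and l_one [simp]: "x \<in> carrier A \<Longrightarrow> \<one> \<otimes> x = x"
    and r_one [simp]: "x \<in> carrier A \<Longrightarrow> x \<otimes> \<one> = x"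
begin

lemma star_one [simp]: "star A \<one> = \<one>"
  using star_mult[of "\<one>" "star A \<one>"] by simp

lemmas unital_simprules [algebra cs "zero A" "add A" "a_inv A" "a_minus A" "smult A" "mult A" "star A"] =
  one_closed l_one r_one star_one

lemma norm_one: "cnorm A \<one> \<le> 1"
  using cstar_identity[of "\<one>"] norm_nonneg[of "\<one>"] by (auto simp: power2_eq_square)

lemma norm_rone: "t \<ge> 0 \<Longrightarrow> cnorm A (complex_of_real t \<odot> \<one>) \<le> t"
  using norm_one by (simp add: norm_smult mult_left_le)

text \<open>For self-adjoint p, the inequality ||t - p|| <= t says that the spectrum lies between 0
  and 2t. This encodes positivity by norms alone and visibly passes to sums.\<close>

definition psd :: "'a \<Rightarrow> bool"
  where "psd p \<longleftrightarrow> selfadj A p \<and> (\<exists>t\<ge>0. cnorm A (complex_of_real t \<odot> \<one> \<ominus> p) \<le> t)"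

lemma psd_closed: "psd p \<Longrightarrow> p \<in> carrier A" "psd p \<Longrightarrow> star A p = p"
  by (auto simp: psd_def selfadj_def)

lemma psd_shift:
  assumes "p \<in> carrier A" and "cnorm A (complex_of_real t \<odot> \<one> \<ominus> p) \<le> t" and "d \<ge> 0"
  shows "cnorm A (complex_of_real (t + d) \<odot> \<one> \<ominus> p) \<le> t + d"
proof -
  have "complex_of_real (t + d) \<odot> \<one> \<ominus> p = (complex_of_real t \<odot> \<one> \<ominus> p) \<oplus> complex_of_real d \<odot> \<one>"
    using assms(1) smult_ladd[of "\<one>" "complex_of_real t" "complex_of_real d"] by (simp add: M.minus_eq M.a_ac)
  then show ?thesis
    using norm_add[of "complex_of_real t \<odot> \<one> \<ominus> p" "complex_of_real d \<odot> \<one>"] norm_rone[OF assms(3)] assms by simp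
qed

text \<open>The fixed-point equation reads 2s = k + s^2. Thus a solution of it is one minus a square
  root of 1 - k.\<close>

lemma one_minus_square:
  assumes "s \<in> carrier A" "k \<in> carrier A" and "s = (1/2) \<odot> (k \<oplus> s \<otimes> s)"
  shows "(\<one> \<ominus> s) \<otimes> (\<one> \<ominus> s) = \<one> \<ominus> k"
proof -
  have "s \<oplus> s = 2 \<odot> s" using assms(1) smult_ladd[of s 1 1] by simp
  also have "\<dots> = k \<oplus> s \<otimes> s" using assms(1,2) by (subst assms(3)) simp
  finally have e: "s \<oplus> s = k \<oplus> s \<otimes> s" .
  have "(\<one> \<ominus> s) \<otimes> (\<one> \<ominus> s) = \<one> \<ominus> (s \<oplus> s) \<oplus> s \<otimes> s" using assms(1) by algebra
  also have "\<dots> = \<one> \<ominus> k" unfolding e using assms(1,2) by algebra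
  finally show ?thesis .
qed

text \<open>For k = 1 - p/t, of norm at most 1, the solution s of the fixed-point equation gives (1
  - s)^2 = p/t, whence r = sqrt t (1 - s). Since s has norm at most 1, r is positive in
  turn.\<close>

lemma psd_sqrt:
  assumes "psd p"
  obtains r where "psd r" and "r \<otimes> r = p" and "\<And>x. \<lbrakk>x \<in> carrier A; x \<otimes> p = p \<otimes> x\<rbrakk> \<Longrightarrow> x \<otimes> r = r \<otimes> x"
proof -
  note p = psd_closed[OF assms]
  obtain t0 where t0: "t0 \<ge> 0" "cnorm A (complex_of_real t0 \<odot> \<one> \<ominus> p) \<le> t0" using assms by (auto simp: psd_def)
  \<comment> \<open>\<open>t0\<close> may be zero, and p has to be divided by t.\<close>
  define t where "t = t0 + 1"
  have t: "t > 0" "cnorm A (complex_of_real t \<odot> \<one> \<ominus> p) \<le> t"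
    using t0 psd_shift[OF p(1) t0(2), of 1] by (simp_all add: t_def)
  define k where "k = \<one> \<ominus> (1 / complex_of_real t) \<odot> p"
  have kc: "k \<in> carrier A" "star A k = k" using p by (simp_all add: k_def star_diff star_smult)
  have "k = (1 / complex_of_real t) \<odot> (complex_of_real t \<odot> \<one> \<ominus> p)" using p t by (simp add: k_def smult_diff)
  then have "cnorm A k \<le> 1" using t p by (simp add: norm_smult norm_divide)
  then obtain s where s: "selfadj A s" "s = (1/2) \<odot> (k \<oplus> s \<otimes> s)" "cnorm A s \<le> 1"
    and comm: "\<And>x. \<lbrakk>x \<in> carrier A; x \<otimes> k = k \<otimes> x\<rbrakk> \<Longrightarrow> x \<otimes> s = s \<otimes> x"
    using quasi_sqrt[of k] kc unfolding selfadj_def by blast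
  have sc: "s \<in> carrier A" "star A s = s" using s by (auto simp: selfadj_def)
  define r where "r = complex_of_real (sqrt t) \<odot> (\<one> \<ominus> s)"
  have rc: "r \<in> carrier A" "star A r = r" using sc by (simp_all add: r_def star_smult star_diff)
  have "complex_of_real (sqrt t) \<odot> \<one> \<ominus> r = complex_of_real (sqrt t) \<odot> (\<one> \<ominus> (\<one> \<ominus> s))"
    using sc by (simp add: r_def smult_diff)
  also have "\<one> \<ominus> (\<one> \<ominus> s) = s" using sc(1) by algebra
  finally have "cnorm A (complex_of_real (sqrt t) \<odot> \<one> \<ominus> r) \<le> sqrt t"
    using s(3) sc t by (simp add: norm_smult mult_left_le)
  then have 1: "psd r" using rc t unfolding psd_def selfadj_def by (metis less_imp_le real_sqrt_ge_0_iff)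
  have tt: "complex_of_real (sqrt t) * complex_of_real (sqrt t) = complex_of_real t"
    using t by (simp flip: of_real_mult)
  have "r \<otimes> r = complex_of_real t \<odot> ((\<one> \<ominus> s) \<otimes> (\<one> \<ominus> s))"
    using sc by (simp add: r_def tt)
  also have "\<dots> = complex_of_real t \<odot> (\<one> \<ominus> k)" using one_minus_square[OF sc(1) kc(1) s(2)] by simp
  also have "\<one> \<ominus> k = (1 / complex_of_real t) \<odot> p" using p unfolding k_def by algebra
  finally have 2: "r \<otimes> r = p" using p t by simp
  have "x \<otimes> r = r \<otimes> x" if x: "x \<in> carrier A" "x \<otimes> p = p \<otimes> x" for x
  proof -
    have "x \<otimes> k = k \<otimes> x" using x p by (simp add: k_def M.minus_eq mult_add_left mult_add_right mult_neg_left mult_neg_right)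
    then have "x \<otimes> s = s \<otimes> x" using comm x by blast
    then show ?thesis using x sc by (simp add: r_def M.minus_eq mult_add_left mult_add_right mult_neg_left mult_neg_right)
  qed
  then show thesis using that 1 2 by blast
qed

text \<open>If s solves the fixed-point equation for h^2, then q = 1 - s is self-adjoint, commutes
  with h and satisfies q^2 + h^2 = 1. So \<open>norm_le_U1\<close> bounds q, and q^2 = 1 -
  h^2.\<close>

lemma square_contraction:
  assumes h: "selfadj A h" and h1: "cnorm A h \<le> 1"
  shows "cnorm A (\<one> \<ominus> h \<otimes> h) \<le> 1"
proof -
  have hc: "h \<in> carrier A" "star A h = h" using h by (auto simp: selfadj_def)
  have sa: "selfadj A (h \<otimes> h)" using hc by (simp add: selfadj_def star_mult)
  have "cnorm A (h \<otimes> h) \<le> 1" using norm_square_selfadj[OF h] h1 norm_nonneg[OF hc(1)] by (simp add: power_le_one)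
  then obtain s where s: "selfadj A s" "s = (1/2) \<odot> (h \<otimes> h \<oplus> s \<otimes> s)" 
    and comm: "\<And>x. \<lbrakk>x \<in> carrier A; x \<otimes> (h \<otimes> h) = (h \<otimes> h) \<otimes> x\<rbrakk> \<Longrightarrow> x \<otimes> s = s \<otimes> x"
    using quasi_sqrt[of "h \<otimes> h"] sa by blast
  have sc: "s \<in> carrier A" "star A s = s" using s by (auto simp: selfadj_def)
  have hs: "h \<otimes> s = s \<otimes> h" using comm[of h] hc by (simp add: mult_assoc)
  define q where "q = \<one> \<ominus> s"
  have q: "selfadj A q" using sc by (simp add: q_def selfadj_def star_diff)
  have qq: "q \<otimes> q = \<one> \<ominus> h \<otimes> h" using one_minus_square[OF sc(1) _ s(2)] hc by (simp add: q_def)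
  have qh: "q \<otimes> h = h \<otimes> q"
    using hs sc hc by (simp add: q_def M.minus_eq mult_add_left mult_add_right mult_neg_left mult_neg_right)
  have "q \<otimes> q \<oplus> h \<otimes> h = \<one>" unfolding qq using hc by algebra
  then have "(cnorm A q)\<^sup>2 \<le> 1" using norm_le_U1[OF q h qh] norm_one by simp
  then show ?thesis using norm_square_selfadj[OF q] qq by simp
qed

lemma psd_square:
  assumes h: "selfadj A h" shows "psd (h \<otimes> h)"
proof -
  have hc: "h \<in> carrier A" "star A h = h" using h by (auto simp: selfadj_def)
  have sa: "selfadj A (h \<otimes> h)" using hc by (simp add: selfadj_def star_mult)
  show ?thesis
  proof (cases "cnorm A h = 0")
    case True
    then have "h \<otimes> h = \<zero>" using hc by (simp add: norm_eq_zero)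
    then show ?thesis unfolding psd_def using sa by (auto intro!: exI[of _ 0] simp: M.minus_eq M.add.inv_one)
  next
    case False
    define c where "c = cnorm A h"
    have c: "c > 0" using False norm_nonneg[OF hc(1)] by (simp add: c_def)
    let ?h = "(1 / complex_of_real c) \<odot> h"
    have "selfadj A ?h" using hc by (simp add: selfadj_def star_smult)
    moreover have "cnorm A ?h \<le> 1" using hc c by (simp add: norm_smult norm_divide c_def)
    ultimately have "cnorm A (\<one> \<ominus> ?h \<otimes> ?h) \<le> 1" by (rule square_contraction)
    then have "cnorm A (complex_of_real (c * c) \<odot> (\<one> \<ominus> ?h \<otimes> ?h)) \<le> c * c"
      using hc c by (simp add: norm_smult mult_left_le del: of_real_mult)
    moreover have "complex_of_real (c * c) \<odot> (\<one> \<ominus> ?h \<otimes> ?h) = complex_of_real (c * c) \<odot> \<one> \<ominus> h \<otimes> h"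
      using hc c by (simp add: smult_diff)
    ultimately show ?thesis unfolding psd_def using sa c by (metis less_imp_le mult_pos_pos)
  qed
qed

lemma psd_add:
  assumes "psd p" "psd q" shows "psd (p \<oplus> q)"
proof -
  note p = psd_closed[OF assms(1)] and q = psd_closed[OF assms(2)]
  obtain t where t: "t \<ge> 0" "cnorm A (complex_of_real t \<odot> \<one> \<ominus> p) \<le> t" using assms by (auto simp: psd_def)
  obtain u where u: "u \<ge> 0" "cnorm A (complex_of_real u \<odot> \<one> \<ominus> q) \<le> u" using assms by (auto simp: psd_def)
  have "cnorm A (complex_of_real (t + u) \<odot> \<one> \<ominus> (p \<oplus> q)) \<le> t + u"
    using nm_add_diff[of "complex_of_real t \<odot> \<one>" "complex_of_real u \<odot> \<one>" p q] p q t u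
    by (simp add: smult_ladd)
  then show ?thesis unfolding psd_def selfadj_def using p q t u by (auto simp: star_add intro!: exI[of _ "t + u"])
qed

text \<open>Square roots r and s of p and -p commute and satisfy r^2 + s^2 = 0, so
  \<open>norm_le_U1\<close> forces r = 0.\<close>

lemma psd_antisym:
  assumes "psd p" "psd (\<ominus> p)" shows "p = \<zero>"
proof -
  note p = psd_closed[OF assms(1)]
  obtain r where r: "psd r" "r \<otimes> r = p" using psd_sqrt[OF assms(1)] by blast
  obtain s where s: "psd s" "s \<otimes> s = \<ominus> p"
    and comm: "\<And>x. \<lbrakk>x \<in> carrier A; x \<otimes> (\<ominus> p) = (\<ominus> p) \<otimes> x\<rbrakk> \<Longrightarrow> x \<otimes> s = s \<otimes> x"
    using psd_sqrt[OF assms(2)] by blast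
  note rc = psd_closed[OF r(1)]
  have "r \<otimes> (\<ominus> (r \<otimes> r)) = (\<ominus> (r \<otimes> r)) \<otimes> r" using rc(1) by algebra
  then have "r \<otimes> s = s \<otimes> r" using comm rc(1) r(2) by simp
  then have "(cnorm A r)\<^sup>2 \<le> cnorm A (r \<otimes> r \<oplus> s \<otimes> s)"
    using r(1) s(1) by (intro norm_le_U1) (auto simp: psd_def)
  then have "cnorm A r = 0" using r(2) s(2) p by (simp add: M.r_neg)
  then show ?thesis using r(2) rc by (auto simp: norm_eq_zero)
qed

text \<open>Stands in for the fact that y*y and yy* have the same nonzero spectrum. For z = t - y*y
  and w = t - yy* one has y z = w y, so the powers of z exceed those of t by at most a linear
  factor, which \<open>power_two_power_le\<close> removes.\<close>

lemma psd_swap: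
  assumes y: "y \<in> carrier A" and t: "t \<ge> 0" "cnorm A (complex_of_real t \<odot> \<one> \<ominus> y \<otimes> star A y) \<le> t"
  shows "cnorm A (complex_of_real t \<odot> \<one> \<ominus> star A y \<otimes> y) \<le> t"
proof -
  let ?t = "complex_of_real t"
  define z where "z = ?t \<odot> \<one> \<ominus> star A y \<otimes> y"
  define w where "w = ?t \<odot> \<one> \<ominus> y \<otimes> star A y"
  define Y where "Y = (cnorm A y)\<^sup>2"
  have c: "z \<in> carrier A" "w \<in> carrier A" using y by (simp_all add: z_def w_def)
  have zsa: "selfadj A z" using y by (simp add: selfadj_def z_def star_diff star_mult star_smult)
  have yz: "y \<otimes> z = w \<otimes> y"
    using y by (simp add: z_def w_def M.minus_eq mult_add_left mult_add_right mult_neg_left mult_neg_right mult_assoc)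
  have yzn: "y \<otimes> npow z n = npow w n \<otimes> y" for n
  proof (induction n)
    case (Suc n)
    have "y \<otimes> npow z (Suc n) = (y \<otimes> npow z n) \<otimes> z" using y c by (simp add: mult_assoc)
    also have "\<dots> = npow w n \<otimes> (y \<otimes> z)" using y c unfolding Suc by (simp add: mult_assoc)
    finally show ?case using y c by (simp add: yz mult_assoc)
  qed (simp add: yz)
  have wn: "cnorm A (npow w n) \<le> t ^ Suc n" for n
  proof (induction n)
    case (Suc n)
    have "cnorm A (npow w (Suc n)) \<le> cnorm A (npow w n) * cnorm A w" using c norm_mult by simp
    also have "\<dots> \<le> t ^ Suc n * t" using Suc t c w_def by (intro mult_mono) (auto simp: norm_nonneg)
    finally show ?case by (simp add: mult.commute)
  qed (use t w_def in simp)
  \<comment> \<open>This is the adjoint of y times a power of z, so the intertwining replaces z by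
    w, whose norm is at most t.\<close>
  have yn: "cnorm A (npow z n \<otimes> star A y) \<le> t ^ Suc n * cnorm A y" for n
  proof -
    have "npow z n \<otimes> star A y = star A (y \<otimes> npow z n)"
      using y c npow_selfadj[OF zsa, of n] by (simp add: star_mult selfadj_def)
    then have "cnorm A (npow z n \<otimes> star A y) = cnorm A (npow w n \<otimes> y)" using y c by (simp add: yzn)
    also have "\<dots> \<le> cnorm A (npow w n) * cnorm A y" using y c by (intro norm_mult) auto
    finally show ?thesis using mult_right_mono[OF wn norm_nonneg[OF y], of n] by simp
  qed
  have zn: "cnorm A (npow z n) \<le> (t + Y * real (Suc n)) * t ^ n" for n
  proof (induction n)
    case 0
    have "cnorm A z \<le> cnorm A (?t \<odot> \<one>) + cnorm A (star A y \<otimes> y)" using y unfolding z_def by (intro nm_diff_le) auto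
    then show ?case using norm_rone[OF t(1)] cstar_identity[OF y] by (simp add: Y_def)
  next
    case (Suc n)
    have "npow z (Suc n) = npow z n \<otimes> (?t \<odot> \<one> \<ominus> star A y \<otimes> y)" by (simp add: z_def[symmetric])
    also have "\<dots> = ?t \<odot> npow z n \<ominus> npow z n \<otimes> star A y \<otimes> y"
      using c y by (simp add: M.minus_eq mult_add_right mult_neg_right mult_assoc)
    finally have "cnorm A (npow z (Suc n)) \<le> t * cnorm A (npow z n) + cnorm A (npow z n \<otimes> star A y \<otimes> y)"
      using nm_diff_le[of "?t \<odot> npow z n" "npow z n \<otimes> star A y \<otimes> y"] c y t by (simp add: norm_smult)
    also have "\<dots> \<le> t * ((t + Y * real (Suc n)) * t ^ n) + (t ^ Suc n * cnorm A y) * cnorm A y"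
    proof (intro add_mono mult_left_mono Suc t)
      have "cnorm A (npow z n \<otimes> star A y \<otimes> y) \<le> cnorm A (npow z n \<otimes> star A y) * cnorm A y"
        using c y by (intro norm_mult) auto
      also have "\<dots> \<le> (t ^ Suc n * cnorm A y) * cnorm A y"
        by (rule mult_right_mono[OF yn norm_nonneg[OF y]])
      finally show "cnorm A (npow z n \<otimes> star A y \<otimes> y) \<le> (t ^ Suc n * cnorm A y) * cnorm A y" .
    qed
    also have "\<dots> = (t + Y * real (Suc (Suc n))) * t ^ Suc n"
      by (simp add: Y_def power2_eq_square algebra_simps)
    finally show ?case .
  qed
  have "cnorm A z \<le> t"
  proof (rule power_two_power_le[OF norm_nonneg[OF c(1)] t(1)])
    fix k
    have "Suc (2 ^ k - 1) = (2::nat) ^ k" by simp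
    then show "cnorm A z ^ (2 ^ k) \<le> (t + Y * 2 ^ k) * t ^ (2 ^ k - 1)"
      using zn[of "2 ^ k - 1"] norm_npow_selfadj[OF zsa, of k] by (metis of_nat_numeral of_nat_power)
  qed
  then show ?thesis by (simp add: z_def)
qed

text \<open>Kaplansky's argument: with \<open>h = b\<^sup>*b\<close> and its negative part \<open>m\<close>, both \<open>y\<^sup>*y\<close> and
  \<open>-y\<^sup>*y\<close> are positive for \<open>y = bm\<close>.\<close>

lemma psd_star_mult:
  assumes b: "b \<in> carrier A" shows "psd (star A b \<otimes> b)"
proof -
  define h where "h = star A b \<otimes> b"
  have h: "selfadj A h" "h \<in> carrier A" "star A h = h" using b by (simp_all add: selfadj_def h_def star_mult)
  obtain a where a: "psd a" "a \<otimes> a = h \<otimes> h"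
    and acomm: "\<And>x. \<lbrakk>x \<in> carrier A; x \<otimes> (h \<otimes> h) = (h \<otimes> h) \<otimes> x\<rbrakk> \<Longrightarrow> x \<otimes> a = a \<otimes> x"
    using psd_sqrt[OF psd_square[OF h(1)]] by blast
  note ac = psd_closed[OF a(1)]
  have ah: "h \<otimes> a = a \<otimes> h" using acomm[OF h(2)] h(2) by (simp add: mult_assoc)
  obtain r where r: "psd r" "r \<otimes> r = a"
    and rcomm: "\<And>x. \<lbrakk>x \<in> carrier A; x \<otimes> a = a \<otimes> x\<rbrakk> \<Longrightarrow> x \<otimes> r = r \<otimes> x"
    using psd_sqrt[OF a(1)] by blast
  note rc = psd_closed[OF r(1)]
  have rh: "h \<otimes> r = r \<otimes> h" by (rule rcomm[OF h(2) ah])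
  have ra: "a \<otimes> r = r \<otimes> a" by (rule rcomm[OF ac(1)]) simp
  define m where "m = (1/2) \<odot> (a \<ominus> h)"
  have m: "m \<in> carrier A" "star A m = m" using ac h by (simp_all add: m_def star_smult star_diff)
  have mr: "m \<otimes> r = r \<otimes> m"
    using ac h rc rh ra by (simp add: m_def M.minus_eq mult_add_left mult_add_right mult_neg_left mult_neg_right)
  have "(a \<ominus> h) \<otimes> (a \<oplus> h) = (a \<otimes> a \<ominus> h \<otimes> h) \<oplus> (a \<otimes> h \<ominus> h \<otimes> a)" using ac(1) h(2) by algebra
  also have "\<dots> = \<zero>" using ac h a(2) ah by (simp add: M.minus_eq M.r_neg)
  finally have "m \<otimes> a \<oplus> m \<otimes> h = \<zero>" using ac(1) h(2) by (simp add: m_def smult_zero flip: mult_add_right smult_radd)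
  then have mh: "m \<otimes> h = \<ominus> (m \<otimes> a)" using m ac h M.minus_equality[of "m \<otimes> h" "m \<otimes> a"] by (simp add: M.a_comm)
  \<comment> \<open>Since r is a root of a and commutes with m, g^2 = m a m; with \<open>mh\<close>
    this turns m h m into -g^2, the negative of a square.\<close>
  define g where "g = r \<otimes> m"
  have g: "g \<in> carrier A" "star A g = g" using rc m mr by (simp_all add: g_def star_mult)
  then have gg: "psd (g \<otimes> g)" by (intro psd_square) (simp add: selfadj_def)
  have "m \<otimes> a \<otimes> m = (m \<otimes> r) \<otimes> (r \<otimes> m)" using m rc r(2) by (simp flip: mult_assoc) (simp add: mult_assoc r(2))
  then have mam: "m \<otimes> a \<otimes> m = g \<otimes> g" using mr by (simp add: g_def)
  define y where "y = b \<otimes> m"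
  have y: "y \<in> carrier A" using b m by (simp add: y_def)
  have "star A y \<otimes> y = m \<otimes> h \<otimes> m" using b m by (simp add: y_def h_def star_mult mult_assoc)
  also have "\<dots> = \<ominus> (g \<otimes> g)" using m ac by (simp add: mh mult_neg_left mam)
  finally have ysy: "star A y \<otimes> y = \<ominus> (g \<otimes> g)" .
  \<comment> \<open>In real and imaginary parts, yy* + y*y = 2(u^2 + v^2). As y*y = -g^2, the
    product yy* becomes a sum of squares, and \<open>psd_swap\<close> carries its positivity over to
    y*y.\<close>
  obtain u v where uv: "selfadj A u" "selfadj A v" "y = u \<oplus> \<i> \<odot> v" "star A y = u \<oplus> (-\<i>) \<odot> v"
    using selfadj_parts[OF y] by blast
  have uvc: "u \<in> carrier A" "v \<in> carrier A" using uv by (auto simp: selfadj_def)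
  have e1: "y \<otimes> star A y = (u \<otimes> u \<oplus> v \<otimes> v) \<oplus> (\<i> \<odot> (v \<otimes> u) \<oplus> (-\<i>) \<odot> (u \<otimes> v))"
    unfolding uv(4) using uvc by (simp add: uv(3) mult_add_left mult_add_right smult_radd M.a_ac)
  have e2: "star A y \<otimes> y = (u \<otimes> u \<oplus> v \<otimes> v) \<ominus> (\<i> \<odot> (v \<otimes> u) \<oplus> (-\<i>) \<odot> (u \<otimes> v))"
    unfolding uv(4) using uvc by (simp add: uv(3) mult_add_left mult_add_right smult_radd M.a_ac minus_smult)
  have alg: "(p \<oplus> q) = ((p \<oplus> p) \<oplus> n)" if "p \<ominus> q = \<ominus> n" "p \<in> carrier A" "q \<in> carrier A" "n \<in> carrier A" for p q n
  proof -
    have "p \<oplus> q = (p \<oplus> p) \<ominus> (p \<ominus> q)" using that(2-) by algebra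
    then show ?thesis unfolding that(1) using that(2-) by (simp add: M.minus_eq)
  qed
  have yys: "y \<otimes> star A y = ((u \<otimes> u \<oplus> v \<otimes> v) \<oplus> (u \<otimes> u \<oplus> v \<otimes> v)) \<oplus> g \<otimes> g"
    unfolding e1 by (rule alg) (use ysy e2 uvc g in simp_all)
  have "psd (y \<otimes> star A y)" unfolding yys by (intro psd_add psd_square gg uv)
  then obtain t where "t \<ge> 0" "cnorm A (complex_of_real t \<odot> \<one> \<ominus> y \<otimes> star A y) \<le> t" by (auto simp: psd_def)
  then have "psd (\<ominus> (g \<otimes> g))"
    using psd_swap[OF y] y unfolding psd_def ysy[symmetric] by (auto simp: selfadj_def star_mult)
  then have "g \<otimes> g = \<zero>" by (rule psd_antisym[OF gg])
  then have "y = \<zero>" using ysy star_mult_eq_zero[OF y] by (simp add: M.add.inv_one)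
  then have "h \<otimes> m = \<zero>" using b m by (simp add: h_def y_def mult_assoc)
  then have hm: "m \<otimes> h = \<zero>" using star_mult[of h m] h m by simp
  then have "\<ominus> (m \<otimes> a) = \<zero>" using mh by simp
  then have "\<ominus> (\<ominus> (m \<otimes> a)) = \<zero>" by (simp add: M.add.inv_one)
  then have "m \<otimes> a = \<zero>" using m ac by simp
  then have "m \<otimes> m = \<zero>" using hm m ac h by (subst (2) m_def) (simp add: M.minus_eq mult_add_right mult_neg_right M.add.inv_one)
  then have "m = \<zero>" using star_mult_eq_zero[of m] m by simp
  then have "2 \<odot> ((1/2) \<odot> (a \<ominus> h)) = \<zero>" by (simp add: m_def)
  then have "a \<ominus> h = \<zero>" using ac h by simp
  then have "a = h" using ac h diff_zero_iff by simp
  then show ?thesis using a(1) by (simp add: h_def)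
qed

text \<open>With t the norm of the sum p + q, the element t - p = (t - (p + q)) + q is positive. Its
  root s commutes with the root r of p, and r^2 + s^2 = t, so \<open>norm_le_U1\<close> gives ||p||
  = ||r||^2 <= t.\<close>

lemma norm_star_mult_mono_unital:
  assumes "c \<in> carrier A" "d \<in> carrier A"
  shows "cnorm A (star A c \<otimes> c) \<le> cnorm A (star A c \<otimes> c \<oplus> star A d \<otimes> d)"
proof -
  define p where "p = star A c \<otimes> c"
  define q where "q = star A d \<otimes> d"
  have p: "psd p" and q: "psd q" using psd_star_mult assms by (auto simp: p_def q_def)
  note pc = psd_closed[OF p] and qc = psd_closed[OF q]
  define t where "t = cnorm A (p \<oplus> q)"
  have t: "t \<ge> 0" using pc qc norm_nonneg by (simp add: t_def)
  let ?t = "complex_of_real t \<odot> \<one>"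
  have "?t \<ominus> (?t \<ominus> (p \<oplus> q)) = p \<oplus> q" using pc(1) qc(1) smult_cl[OF one_closed, of "complex_of_real t"] by algebra
  then have "psd (?t \<ominus> (p \<oplus> q))"
    unfolding psd_def selfadj_def using pc qc t
    by (auto simp: star_diff star_add star_smult t_def[symmetric] intro!: exI[of _ t])
  then have "psd ((?t \<ominus> (p \<oplus> q)) \<oplus> q)" using q by (rule psd_add)
  moreover have "(?t \<ominus> (p \<oplus> q)) \<oplus> q = ?t \<ominus> p"
    using pc(1) qc(1) smult_cl[OF one_closed, of "complex_of_real t"] by algebra
  ultimately have tp: "psd (?t \<ominus> p)" by simp
  obtain r where r: "psd r" "r \<otimes> r = p" using psd_sqrt[OF p] by blast
  note rc = psd_closed[OF r(1)]
  obtain s where s: "psd s" "s \<otimes> s = ?t \<ominus> p"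
    and comm: "\<And>x. \<lbrakk>x \<in> carrier A; x \<otimes> (?t \<ominus> p) = (?t \<ominus> p) \<otimes> x\<rbrakk> \<Longrightarrow> x \<otimes> s = s \<otimes> x"
    using psd_sqrt[OF tp] by blast
  have "r \<otimes> (?t \<ominus> p) = (?t \<ominus> p) \<otimes> r"
    using rc unfolding r(2)[symmetric]
    by (simp add: M.minus_eq mult_add_left mult_add_right mult_neg_left mult_neg_right mult_assoc)
  then have "r \<otimes> s = s \<otimes> r" using comm rc by blast
  then have "(cnorm A r)\<^sup>2 \<le> cnorm A (r \<otimes> r \<oplus> s \<otimes> s)"
    using r(1) s(1) by (intro norm_le_U1) (auto simp: psd_def)
  also have "r \<otimes> r \<oplus> s \<otimes> s = ?t"
    unfolding r(2) s(2) using pc(1) smult_cl[OF one_closed, of "complex_of_real t"] by algebra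
  finally have "(cnorm A r)\<^sup>2 \<le> t" using norm_rone[OF t] by simp
  then show ?thesis using r norm_square_selfadj[of r] by (simp add: p_def q_def t_def psd_def)
qed

end

lemma (in hilb) unital_cstar_L: "unital_cstar L"
  by (intro unital_cstar.intro cstar_L unital_cstar_axioms.intro one_L)

section \<open>The algebra as a Hilbert module over itself\<close>

lemma self_corr_simps [simp]:
  "carrier (self_corr D) = carrier D" "x \<oplus>\<^bsub>self_corr D\<^esub> y = x \<oplus>\<^bsub>D\<^esub> y" "\<zero>\<^bsub>self_corr D\<^esub> = \<zero>\<^bsub>D\<^esub>"
  "c \<odot>\<^bsub>self_corr D\<^esub> x = c \<odot>\<^bsub>D\<^esub> x" "ract (self_corr D) x a = x \<otimes>\<^bsub>D\<^esub> a"
  "ip (self_corr D) x y = star D x \<otimes>\<^bsub>D\<^esub> y" "lact (self_corr D) a = (\<lambda>b\<in>carrier D. a \<otimes>\<^bsub>D\<^esub> b)"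
  by (simp_all add: self_corr_def)

lemma self_corr_minus [simp]: "x \<ominus>\<^bsub>self_corr D\<^esub> y = x \<ominus>\<^bsub>D\<^esub> y"
  by (simp add: a_minus_def a_inv_def m_inv_def self_corr_def)

context cstar_algebra
begin

lemma hnorm_self: "x \<in> carrier A \<Longrightarrow> hnorm A (self_corr A) x = cnorm A x"
  by (simp add: hnorm_def cstar_identity norm_nonneg)

lemma hilb_self: "hilb A (self_corr A)"
proof (intro hilb.intro hilb_axioms.intro)
  show "cstar_algebra A" by (rule cstar_algebra_axioms)
  show "cvec (self_corr A)"
    by (rule cvecI) (simp_all add: M.a_ac smult_ladd smult_radd)
  show "ncomplete (self_corr A) (hnorm A (self_corr A))"
  proof -
    have "ncauchy (self_corr A) (hnorm A (self_corr A)) s \<longleftrightarrow> ncauchy A (cnorm A) s" for s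
    proof (cases "range s \<subseteq> carrier A")
      case True
      then have "s n \<in> carrier A" for n by auto
      then show ?thesis using True by (simp add: ncauchy_def hnorm_self)
    qed (simp add: ncauchy_def)
    moreover have "nconv (self_corr A) (hnorm A (self_corr A)) s l \<longleftrightarrow> nconv A (cnorm A) s l" for s l
    proof (cases "range s \<subseteq> carrier A \<and> l \<in> carrier A")
      case True
      then have "s n \<in> carrier A" for n by auto
      then show ?thesis using True by (simp add: nconv_def hnorm_self)
    qed (auto simp: nconv_def)
    ultimately show ?thesis using ncomplete by (simp add: ncomplete_def)
  qed
  fix \<xi> assume x: "\<xi> \<in> carrier (self_corr A)"
  show "ip (self_corr A) \<xi> \<xi> = \<zero> \<longleftrightarrow> \<xi> = \<zero>\<^bsub>self_corr A\<^esub>" using x star_mult_eq_zero[of \<xi>] by auto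
  fix \<eta> assume y: "\<eta> \<in> carrier (self_corr A)"
  show "cnorm A (ip (self_corr A) \<xi> \<eta>) \<le> hnorm A (self_corr A) \<xi> * hnorm A (self_corr A) \<eta>"
    using x y norm_mult[of "star A \<xi>" \<eta>] by (simp add: hnorm_self)
qed (simp_all add: mult_assoc mult_add_left mult_add_right star_mult)

end

sublocale cstar_algebra \<subseteq> S: hilb A "self_corr A"
  rewrites "carrier (self_corr A) = carrier A"
    and "ip (self_corr A) = (\<lambda>x y. star A x \<otimes> y)"
  by (rule hilb_self) (simp_all add: fun_eq_iff)

text \<open>The left regular representation, which is the left action of \<open>self_corr A\<close>.
  It is isometric, so estimates in the unital algebra of adjointables come back to A.\<close>

definition lmul :: "'a cstar_algebra \<Rightarrow> 'a \<Rightarrow> 'a \<Rightarrow> 'a"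
  where "lmul A a = (\<lambda>b\<in>carrier A. a \<otimes>\<^bsub>A\<^esub> b)"

context cstar_algebra
begin

lemma adjp_lmul: "a \<in> carrier A \<Longrightarrow> S.adjp (lmul A a) (lmul A (star A a))"
  by (rule S.adjpI) (auto simp: lmul_def star_mult mult_assoc)

lemma lmul_closed [simp]: "a \<in> carrier A \<Longrightarrow> lmul A a \<in> carrier S.L"
  using adjp_lmul unfolding S.carrier_L by blast

lemma lmul_apply [simp]: "x \<in> carrier A \<Longrightarrow> lmul A a x = a \<otimes> x"
  by (simp add: lmul_def)

lemma star_lmul: "a \<in> carrier A \<Longrightarrow> star S.L (lmul A a) = lmul A (star A a)"
  by (rule S.star_L[OF adjp_lmul])

lemma norm_lmul: assumes a: "a \<in> carrier A" shows "S.opn (lmul A a) = cnorm A a"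
proof (rule antisym)
  show "S.opn (lmul A a) \<le> cnorm A a"
    using a by (intro S.opn_le) (simp_all add: norm_nonneg hnorm_self norm_mult)
  have "(cnorm A a)\<^sup>2 = cnorm A (a \<otimes> star A a)" using cstar_identity'[OF a] by simp
  also have "\<dots> \<le> S.opn (lmul A a) * cnorm A a"
    using S.opn_bound[OF lmul_closed[OF a], of "star A a"] a by (simp add: hnorm_self)
  finally show "cnorm A a \<le> S.opn (lmul A a)"
    using norm_nonneg[OF a] S.opn_nonneg[OF lmul_closed[OF a]]
    by (cases "cnorm A a = 0") (simp_all add: power2_eq_square)
qed

lemma lmul_add: "\<lbrakk>a \<in> carrier A; b \<in> carrier A\<rbrakk> \<Longrightarrow> lmul A (a \<oplus> b) = lmul A a \<oplus>\<^bsub>S.L\<^esub> lmul A b"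
  by (auto simp: lmul_def mult_add_left intro!: ext)

lemma lmul_mult: "\<lbrakk>a \<in> carrier A; b \<in> carrier A\<rbrakk> \<Longrightarrow> lmul A (a \<otimes> b) = lmul A a \<otimes>\<^bsub>S.L\<^esub> lmul A b"
  by (auto simp: lmul_def mult_assoc compose_def intro!: ext)

lemma lmul_smult: "a \<in> carrier A \<Longrightarrow> lmul A (c \<odot> a) = c \<odot>\<^bsub>S.L\<^esub> lmul A a"
  by (auto simp: lmul_def restrict_def intro!: ext)

lemma norm_star_mult_mono:
  assumes "c \<in> carrier A" "d \<in> carrier A"
  shows "cnorm A (star A c \<otimes> c) \<le> cnorm A (star A c \<otimes> c \<oplus> star A d \<otimes> d)"
proof -
  interpret U: unital_cstar S.L by (rule S.unital_cstar_L)
  have "lmul A (star A c \<otimes> c \<oplus> star A d \<otimes> d) = star S.L (lmul A c) \<otimes>\<^bsub>S.L\<^esub> lmul A c \<oplus>\<^bsub>S.L\<^esub> star S.L (lmul A d) \<otimes>\<^bsub>S.L\<^esub> lmul A d"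
    "lmul A (star A c \<otimes> c) = star S.L (lmul A c) \<otimes>\<^bsub>S.L\<^esub> lmul A c"
    using assms by (simp_all add: lmul_add lmul_mult star_lmul del: S.L_simps)
  then show ?thesis
    using U.norm_star_mult_mono_unital[of "lmul A c" "lmul A d"] assms
      norm_lmul[of "star A c \<otimes> c \<oplus> star A d \<otimes> d"] norm_lmul[of "star A c \<otimes> c"]
    by (simp del: S.L_simps)
qed

text \<open>The element is the value at x of the operator 1 - h^2, with h acting by left
  multiplication, and \<open>square_contraction\<close> applies to that operator.\<close>

lemma square_contraction_left:
  assumes h: "selfadj A h" "cnorm A h \<le> 1" and x: "x \<in> carrier A"
  shows "cnorm A (x \<ominus> h \<otimes> h \<otimes> x) \<le> cnorm A x"
proof -
  interpret U: unital_cstar S.L by (rule S.unital_cstar_L)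
  have hc: "h \<in> carrier A" "star A h = h" using h by (auto simp: selfadj_def)
  have "selfadj S.L (lmul A h)" using hc by (simp add: selfadj_def star_lmul)
  then have le: "S.opn (\<one>\<^bsub>S.L\<^esub> \<ominus>\<^bsub>S.L\<^esub> lmul A (h \<otimes> h)) \<le> 1"
    using U.square_contraction[of "lmul A h"] h hc by (simp add: norm_lmul lmul_mult del: S.L_simps)
  let ?T = "\<one>\<^bsub>S.L\<^esub> \<ominus>\<^bsub>S.L\<^esub> lmul A (h \<otimes> h)"
  have T: "?T \<in> carrier S.L" using hc U.one_closed by (simp del: S.L_simps)
  have "?T x = x \<ominus> h \<otimes> h \<otimes> x"
    using S.L_minus_apply[OF U.one_closed lmul_closed, of "h \<otimes> h" x] hc x by simp
  then have "cnorm A (x \<ominus> h \<otimes> h \<otimes> x) \<le> S.opn ?T * cnorm A x"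
    using S.opn_bound[OF T, of x] x hc by (simp add: hnorm_self)
  also have "\<dots> \<le> 1 * cnorm A x" by (rule mult_right_mono[OF le norm_nonneg[OF x]])
  finally show ?thesis by simp
qed

end

section \<open>The Cauchy-Schwarz inequality for Hilbert modules\<close>

context hilbert_module
begin

text \<open>The substance is Cauchy-Schwarz. With c the inner product of \<eta> and \<zeta>, n the
  norm of that of \<eta> with itself, and \<theta> = \<eta> c - n \<zeta>, expansion gives 2n c*c +
  <\<theta>,\<theta>> = c*<\<eta>,\<eta>>c + n^2 <\<zeta>,\<zeta>>. Monotonicity of the norm
  discards <\<theta>,\<theta>>; the first term on the right has norm at most n ||c||^2 and is
  absorbed on the left. Positivity of inner products is used only here.\<close>

lemma hilb: "hilb A X"
proof -
  interpret X': cvec X by (rule cvec.intro) (rule X.module_axioms)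
  note [simp] = ip_closed ract_closed ip_star
  have ip_add_left: "ip X (\<xi> \<oplus>\<^bsub>X\<^esub> \<eta>) \<zeta> = ip X \<xi> \<zeta> \<oplus>\<^bsub>A\<^esub> ip X \<eta> \<zeta>"
    if "\<xi> \<in> carrier X" "\<eta> \<in> carrier X" "\<zeta> \<in> carrier X" for \<xi> \<eta> \<zeta>
    using that A.star_add[of "ip X \<zeta> \<xi>" "ip X \<zeta> \<eta>"] ip_star[of \<zeta> "\<xi> \<oplus>\<^bsub>X\<^esub> \<eta>"] by (simp add: ip_add)
  have ip_smult_left: "ip X (c \<odot>\<^bsub>X\<^esub> \<xi>) \<eta> = cnj c \<odot>\<^bsub>A\<^esub> ip X \<xi> \<eta>"
    if "\<xi> \<in> carrier X" "\<eta> \<in> carrier X" for \<xi> \<eta> c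
    using that A.star_smult[of "ip X \<eta> \<xi>" c] ip_star[of \<eta> "c \<odot>\<^bsub>X\<^esub> \<xi>"] by (simp add: ip_smult)
  have ip_ract_left: "ip X (ract X \<xi> a) \<eta> = star A a \<otimes>\<^bsub>A\<^esub> ip X \<xi> \<eta>"
    if "\<xi> \<in> carrier X" "\<eta> \<in> carrier X" "a \<in> carrier A" for \<xi> \<eta> a
    using that A.star_mult[of "ip X \<eta> \<xi>" a] ip_star[of \<eta> "ract X \<xi> a"] by (simp add: ip_ract)
  have cs: "cnorm A (ip X \<eta> \<zeta>) \<le> hnorm A X \<eta> * hnorm A X \<zeta>" if y: "\<eta> \<in> carrier X" and z: "\<zeta> \<in> carrier X" for \<eta> \<zeta>
  proof -
    define c where "c = ip X \<eta> \<zeta>"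
    define n where "n = cnorm A (ip X \<eta> \<eta>)"
    have cc: "c \<in> carrier A" "star A c = ip X \<zeta> \<eta>" using y z by (simp_all add: c_def)
    have n: "n \<ge> 0" using y by (simp add: n_def A.norm_nonneg)
    obtain b where b: "b \<in> carrier A" "ip X \<eta> \<eta> = star A b \<otimes>\<^bsub>A\<^esub> b"
      using ip_positive[OF y] by (auto simp: positive_def)
    have nb: "n = (cnorm A b)\<^sup>2" using b by (simp add: n_def A.cstar_identity)
    define \<theta> where "\<theta> = ract X \<eta> c \<oplus>\<^bsub>X\<^esub> (- complex_of_real n) \<odot>\<^bsub>X\<^esub> \<zeta>"
    have \<theta>: "\<theta> \<in> carrier X" using y z cc by (simp add: \<theta>_def)
    obtain d where d: "d \<in> carrier A" "ip X \<theta> \<theta> = star A d \<otimes>\<^bsub>A\<^esub> d"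
      using ip_positive[OF \<theta>] by (auto simp: positive_def)
    define w where "w = star A c \<otimes>\<^bsub>A\<^esub> c"
    define v where "v = star A c \<otimes>\<^bsub>A\<^esub> (star A b \<otimes>\<^bsub>A\<^esub> (b \<otimes>\<^bsub>A\<^esub> c))"
    have wc: "w \<in> carrier A" and vc: "v \<in> carrier A" using y z cc b by (simp_all add: w_def v_def)
    have "ip X \<theta> \<theta> = (v \<oplus>\<^bsub>A\<^esub> (- complex_of_real n) \<odot>\<^bsub>A\<^esub> w) \<oplus>\<^bsub>A\<^esub>
        ((- complex_of_real n) \<odot>\<^bsub>A\<^esub> w \<oplus>\<^bsub>A\<^esub> complex_of_real (n\<^sup>2) \<odot>\<^bsub>A\<^esub> ip X \<zeta> \<zeta>)"
      using y z cc b unfolding \<theta>_def w_def v_def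
      by (simp add: ip_add ip_add_left ip_smult ip_smult_left ip_ract ip_ract_left A.mult_assoc
          A.smult_radd A.mult_add_left A.mult_add_right c_def[symmetric] power2_eq_square A.M.a_ac)
    then have dd: "star A d \<otimes>\<^bsub>A\<^esub> d = (v \<oplus>\<^bsub>A\<^esub> (- complex_of_real n) \<odot>\<^bsub>A\<^esub> w) \<oplus>\<^bsub>A\<^esub>
        ((- complex_of_real n) \<odot>\<^bsub>A\<^esub> w \<oplus>\<^bsub>A\<^esub> complex_of_real (n\<^sup>2) \<odot>\<^bsub>A\<^esub> ip X \<zeta> \<zeta>)" by (simp add: d)
    define e where "e = complex_of_real (sqrt (2 * n)) \<odot>\<^bsub>A\<^esub> c"
    have ec: "e \<in> carrier A" using cc by (simp add: e_def)
    have ee: "star A e \<otimes>\<^bsub>A\<^esub> e = complex_of_real (2 * n) \<odot>\<^bsub>A\<^esub> w"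
    proof -
      have "complex_of_real (sqrt (2 * n)) * complex_of_real (sqrt (2 * n)) = complex_of_real (2 * n)"
        using n by (simp flip: of_real_mult)
      then show ?thesis using cc(1) by (simp add: e_def w_def A.star_smult del: of_real_mult)
    qed
    have half: "(- complex_of_real n) \<odot>\<^bsub>A\<^esub> w = \<ominus>\<^bsub>A\<^esub> (complex_of_real n \<odot>\<^bsub>A\<^esub> w)" using wc by (simp add: A.neg_smult)
    have two: "complex_of_real (2 * n) \<odot>\<^bsub>A\<^esub> w = complex_of_real n \<odot>\<^bsub>A\<^esub> w \<oplus>\<^bsub>A\<^esub> complex_of_real n \<odot>\<^bsub>A\<^esub> w"
      using A.smult_ladd[OF wc, of "complex_of_real n" "complex_of_real n"] by simp
    have alg: "(p \<oplus>\<^bsub>A\<^esub> p) \<oplus>\<^bsub>A\<^esub> ((v \<oplus>\<^bsub>A\<^esub> \<ominus>\<^bsub>A\<^esub> p) \<oplus>\<^bsub>A\<^esub> (\<ominus>\<^bsub>A\<^esub> p \<oplus>\<^bsub>A\<^esub> u)) = v \<oplus>\<^bsub>A\<^esub> u"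
      if "p \<in> carrier A" "u \<in> carrier A" for p u
      using that vc by algebra
    have sum: "star A e \<otimes>\<^bsub>A\<^esub> e \<oplus>\<^bsub>A\<^esub> star A d \<otimes>\<^bsub>A\<^esub> d = v \<oplus>\<^bsub>A\<^esub> complex_of_real (n\<^sup>2) \<odot>\<^bsub>A\<^esub> ip X \<zeta> \<zeta>"
      unfolding ee dd half two by (rule alg) (use wc z in simp_all)
    have "2 * n * (cnorm A c)\<^sup>2 = cnorm A (star A e \<otimes>\<^bsub>A\<^esub> e)"
      using wc n cc(1) by (simp add: ee A.norm_smult norm_mult) (simp add: w_def A.cstar_identity)
    also have "\<dots> \<le> cnorm A (v \<oplus>\<^bsub>A\<^esub> complex_of_real (n\<^sup>2) \<odot>\<^bsub>A\<^esub> ip X \<zeta> \<zeta>)"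
      using A.norm_star_mult_mono[OF ec d(1)] by (simp add: sum)
    also have "\<dots> \<le> cnorm A v + n\<^sup>2 * cnorm A (ip X \<zeta> \<zeta>)"
      using A.norm_add[OF vc, of "complex_of_real (n\<^sup>2) \<odot>\<^bsub>A\<^esub> ip X \<zeta> \<zeta>"] z n by (simp add: A.norm_smult norm_power)
    also have "cnorm A v = cnorm A (star A (b \<otimes>\<^bsub>A\<^esub> c) \<otimes>\<^bsub>A\<^esub> (b \<otimes>\<^bsub>A\<^esub> c))"
      using b(1) cc(1) by (simp add: v_def A.star_mult A.mult_assoc)
    also have "\<dots> = (cnorm A (b \<otimes>\<^bsub>A\<^esub> c))\<^sup>2" using b(1) cc(1) by (simp add: A.cstar_identity)
    also have "\<dots> \<le> (cnorm A b * cnorm A c)\<^sup>2" using b cc by (intro power_mono A.norm_mult A.norm_nonneg) auto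
    also have "\<dots> = n * (cnorm A c)\<^sup>2" by (simp add: nb power_mult_distrib)
    finally have main: "n * (cnorm A c)\<^sup>2 \<le> n * (n * cnorm A (ip X \<zeta> \<zeta>))" by (simp add: power2_eq_square)
    have "(cnorm A c)\<^sup>2 \<le> n * cnorm A (ip X \<zeta> \<zeta>)"
    proof (cases "n = 0")
      case True
      then have "\<eta> = \<zero>\<^bsub>X\<^esub>" using y ip_definite[OF y] A.norm_eq_zero[of "ip X \<eta> \<eta>"] by (simp add: n_def)
      then have "c = \<zero>\<^bsub>A\<^esub>" using z ip_smult_left[of "\<zero>\<^bsub>X\<^esub>" \<zeta> 0] by (simp add: c_def)
      then show ?thesis using n z A.norm_nonneg by simp
    qed (use main n in simp)
    then have "(cnorm A c)\<^sup>2 \<le> (hnorm A X \<eta> * hnorm A X \<zeta>)\<^sup>2"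
      using n y z by (simp add: hnorm_def power_mult_distrib A.norm_nonneg flip: n_def)
    then show ?thesis unfolding c_def
      by (rule power2_le_imp_le) (simp add: hnorm_def A.norm_nonneg y z)
  qed
  have "cnspace X (hnorm A X)"
  proof
    fix \<xi> assume x: "\<xi> \<in> carrier X"
    show "0 \<le> hnorm A X \<xi>" using x by (simp add: hnorm_def A.norm_nonneg)
    show "hnorm A X \<xi> = 0 \<longleftrightarrow> \<xi> = \<zero>\<^bsub>X\<^esub>"
      using x ip_definite[OF x] A.norm_eq_zero[of "ip X \<xi> \<xi>"] by (simp add: hnorm_def)
    show "hnorm A X (c \<odot>\<^bsub>X\<^esub> \<xi>) = cmod c * hnorm A X \<xi>" for c
      using x by (simp add: hnorm_def ip_smult ip_smult_left A.norm_smult norm_mult real_sqrt_mult)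
    fix \<eta> assume y: "\<eta> \<in> carrier X"
    show "hnorm A X (\<xi> \<oplus>\<^bsub>X\<^esub> \<eta>) \<le> hnorm A X \<xi> + hnorm A X \<eta>"
    proof (rule power2_le_imp_le)
      have sq: "(hnorm A X \<zeta>)\<^sup>2 = cnorm A (ip X \<zeta> \<zeta>)" if "\<zeta> \<in> carrier X" for \<zeta>
        using that by (simp add: hnorm_def A.norm_nonneg)
      have "(hnorm A X (\<xi> \<oplus>\<^bsub>X\<^esub> \<eta>))\<^sup>2 = cnorm A ((ip X \<xi> \<xi> \<oplus>\<^bsub>A\<^esub> ip X \<eta> \<xi>) \<oplus>\<^bsub>A\<^esub> (ip X \<xi> \<eta> \<oplus>\<^bsub>A\<^esub> ip X \<eta> \<eta>))"
        using x y by (simp add: sq ip_add ip_add_left)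
      also have "\<dots> \<le> (cnorm A (ip X \<xi> \<xi>) + cnorm A (ip X \<eta> \<xi>)) + (cnorm A (ip X \<xi> \<eta>) + cnorm A (ip X \<eta> \<eta>))"
        using x y by (intro order_trans[OF A.norm_add] add_mono A.norm_add) auto
      also have "\<dots> \<le> ((hnorm A X \<xi>)\<^sup>2 + hnorm A X \<eta> * hnorm A X \<xi>) + (hnorm A X \<xi> * hnorm A X \<eta> + (hnorm A X \<eta>)\<^sup>2)"
        using x y by (intro add_mono cs) (auto simp: sq)
      also have "\<dots> = (hnorm A X \<xi> + hnorm A X \<eta>)\<^sup>2" by (simp add: power2_eq_square algebra_simps)
      finally show "(hnorm A X (\<xi> \<oplus>\<^bsub>X\<^esub> \<eta>))\<^sup>2 \<le> (hnorm A X \<xi> + hnorm A X \<eta>)\<^sup>2" .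
    qed (use x y in \<open>simp add: hnorm_def A.norm_nonneg\<close>)
  qed
  then have "ncomplete X (hnorm A X)" using complete by (simp add: cnspace.mcomplete_iff)
  then show ?thesis
    by (intro hilb.intro hilb_axioms.intro A.cstar_algebra_axioms X'.cvec_axioms)
      (simp_all add: ract_add_left ract_smult_left ract_mult ip_add ip_smult ip_ract ip_definite cs)
qed

end

section \<open>Approximate units and *-homomorphisms\<close>

context cstar_algebra
begin

text \<open>In unital notation, \<open>qpow g n = 1 - (1 - g)\<^sup>n\<close>, and \<open>1 - qmean g n\<close> is the Cesaro mean of the
  powers \<open>(1 - g)\<^sup>j\<close> for \<open>j < n\<close>. If \<open>g = h\<^sup>2\<close> with \<open>\<parallel>h\<parallel> \<le> 1\<close>, these powers are contractions, and
  \<open>g (1 - qmean g n) = qpow g n / n\<close> tends to 0.\<close>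

primrec qpow :: "'a \<Rightarrow> nat \<Rightarrow> 'a" where
  "qpow g 0 = \<zero>"
| "qpow g (Suc n) = qpow g n \<oplus> (g \<ominus> g \<otimes> qpow g n)"

primrec qsum :: "'a \<Rightarrow> nat \<Rightarrow> 'a" where
  "qsum g 0 = \<zero>"
| "qsum g (Suc n) = qsum g n \<oplus> qpow g n"

definition qmean :: "'a \<Rightarrow> nat \<Rightarrow> 'a"
  where "qmean g n = (1 / of_nat n) \<odot> qsum g n"

text \<open>Stated for any subspace stable under left multiplication by \<open>g\<close>, so that
  one induction covers the carrier, commutants and ideals.\<close>

lemma qpow_mem:
  assumes "submodule S complex_ring A" and "g \<in> S" and "\<And>s. s \<in> S \<Longrightarrow> g \<otimes> s \<in> S"
  shows "qpow g n \<in> S"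
proof (induction n)
  case (Suc n)
  have "g \<otimes> qpow g n \<in> S" using Suc assms(3) by blast
  then have "g \<ominus> g \<otimes> qpow g n \<in> S" using assms submodule_minus[OF cvec_axioms] by blast
  then show ?case using assms(1) Suc by (simp add: submodule_iff)
qed (use assms in \<open>simp add: submodule_iff\<close>)

lemma qsum_mem:
  assumes "submodule S complex_ring A" and "g \<in> S" and "\<And>s. s \<in> S \<Longrightarrow> g \<otimes> s \<in> S"
  shows "qsum g n \<in> S"
proof (induction n)
  case (Suc n)
  then show ?case using assms(1) qpow_mem[OF assms, of n] by (simp add: submodule_iff)
qed (use assms in \<open>simp add: submodule_iff\<close>)

lemma qmean_mem:
  assumes "submodule S complex_ring A" and "g \<in> S" and "\<And>s. s \<in> S \<Longrightarrow> g \<otimes> s \<in> S"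
  shows "qmean g n \<in> S"
  using assms(1) qsum_mem[OF assms, of n] unfolding qmean_def submodule_iff by blast

lemma submodule_carrier: "submodule (carrier A) complex_ring A"
  by (simp add: submodule_iff)

lemma qpow_closed [simp, intro]: "g \<in> carrier A \<Longrightarrow> qpow g n \<in> carrier A"
  and qsum_closed [simp, intro]: "g \<in> carrier A \<Longrightarrow> qsum g n \<in> carrier A"
  and qmean_closed [simp, intro]: "g \<in> carrier A \<Longrightarrow> qmean g n \<in> carrier A"
  by (simp_all add: qpow_mem[OF submodule_carrier] qsum_mem[OF submodule_carrier] qmean_mem[OF submodule_carrier])

lemma qmean_commute:
  assumes "x \<in> carrier A" "g \<in> carrier A" "x \<otimes> g = g \<otimes> x"
  shows "x \<otimes> qmean g n = qmean g n \<otimes> x"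
proof -
  let ?S = "{s \<in> carrier A. x \<otimes> s = s \<otimes> x}"
  have "submodule ?S complex_ring A" using assms by (auto simp: submodule_iff mult_add_left mult_add_right)
  moreover have "g \<otimes> s \<in> ?S" if "s \<in> ?S" for s
    using that assms by (auto simp: mult_assoc) (metis mult_assoc)
  ultimately show ?thesis using qmean_mem[of ?S g n] assms by blast
qed

lemma qmean_selfadj:
  assumes "selfadj A g" shows "star A (qmean g n) = qmean g n"
proof -
  have g: "g \<in> carrier A" "star A g = g" using assms by (auto simp: selfadj_def)
  have c: "g \<otimes> qpow g m = qpow g m \<otimes> g" for m
  proof (induction m)
    case (Suc m)
    then show ?case using g
      by (simp add: M.minus_eq mult_add_left mult_add_right mult_neg_left mult_neg_right flip: mult_assoc)
  qed (simp add: g)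
  have p: "star A (qpow g m) = qpow g m" for m
  proof (induction m)
    case (Suc m)
    then show ?case using g by (simp add: star_add star_diff star_mult c[symmetric])
  qed simp
  have "star A (qsum g m) = qsum g m" for m
    by (induction m) (simp_all add: star_add g p)
  then show ?thesis using g by (simp add: qmean_def star_smult)
qed

end

locale small_square = cstar_algebra A for A :: "'a cstar_algebra" (structure) +
  fixes h g
  assumes h: "selfadj A h" and h1: "cnorm A h \<le> 1" and g_eq: "g = h \<otimes> h"
begin

lemma hc: "h \<in> carrier A" "star A h = h" using h by (auto simp: selfadj_def)

lemma gc [simp, intro]: "g \<in> carrier A" using hc by (simp add: g_eq)

lemma selfadj_g: "selfadj A g" using hc by (simp add: selfadj_def g_eq star_mult)

lemma qpow_Suc_mult:
  assumes x: "x \<in> carrier A"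
  shows "qpow g (Suc n) \<otimes> x = qpow g n \<otimes> x \<oplus> g \<otimes> (x \<ominus> qpow g n \<otimes> x)"
  using x gc qpow_closed[OF gc, of n] unfolding qpow.simps by algebra

lemma qpow_contraction: "x \<in> carrier A \<Longrightarrow> cnorm A (x \<ominus> qpow g n \<otimes> x) \<le> cnorm A x"
proof (induction n)
  case (Suc n)
  let ?y = "x \<ominus> qpow g n \<otimes> x"
  have yc: "?y \<in> carrier A" using Suc by simp
  have "x \<ominus> qpow g (Suc n) \<otimes> x = ?y \<ominus> g \<otimes> ?y"
    unfolding qpow_Suc_mult[OF Suc.prems] using Suc.prems gc qpow_closed[OF gc, of n] by algebra
  also have "cnorm A \<dots> \<le> cnorm A ?y"
    using square_contraction_left[OF h h1 yc] by (simp add: g_eq)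
  finally show ?case using Suc by simp
qed (simp add: M.minus_eq)

lemma norm_qpow_mult: assumes x: "x \<in> carrier A" shows "cnorm A (qpow g n \<otimes> x) \<le> 2 * cnorm A x"
  using nm_le[of "qpow g n \<otimes> x" x] qpow_contraction[OF x, of n] nm_commute[of "qpow g n \<otimes> x" x] x by simp

text \<open>A bound of Bernoulli type, useful when g is small, whereas \<open>norm_qpow_mult\<close>
  is uniform in n. The former controls the truncation error in \<open>bounded_lift_1\<close>, the
  latter the decay of the means.\<close>

lemma norm_qpow_mult': assumes x: "x \<in> carrier A" shows "cnorm A (qpow g n \<otimes> x) \<le> real n * cnorm A g * cnorm A x"
proof (induction n)
  case (Suc n)
  have "cnorm A (qpow g (Suc n) \<otimes> x) \<le> cnorm A (qpow g n \<otimes> x) + cnorm A (g \<otimes> (x \<ominus> qpow g n \<otimes> x))"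
    unfolding qpow_Suc_mult[OF x] using x by (intro norm_add) auto
  also have "\<dots> \<le> real n * cnorm A g * cnorm A x + cnorm A g * cnorm A x"
  proof (rule add_mono[OF Suc])
    have "cnorm A (g \<otimes> (x \<ominus> qpow g n \<otimes> x)) \<le> cnorm A g * cnorm A (x \<ominus> qpow g n \<otimes> x)"
      using x by (intro norm_mult) auto
    also have "\<dots> \<le> cnorm A g * cnorm A x"
      by (rule mult_left_mono[OF qpow_contraction[OF x] norm_nonneg[OF gc]])
    finally show "cnorm A (g \<otimes> (x \<ominus> qpow g n \<otimes> x)) \<le> cnorm A g * cnorm A x" .
  qed
  finally show ?case by (simp add: algebra_simps)
qed (simp add: x)

lemma qsum_mult:
  assumes x: "x \<in> carrier A"
  shows "cnorm A (of_nat n \<odot> x \<ominus> qsum g n \<otimes> x) \<le> real n * cnorm A x" (is ?a)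
    and "g \<otimes> (of_nat n \<odot> x \<ominus> qsum g n \<otimes> x) = qpow g n \<otimes> x" (is ?b)
    and "cnorm A (qsum g n \<otimes> x) \<le> real n * (real n * cnorm A g * cnorm A x)" (is ?c)
proof -
  have S: "of_nat (Suc n) \<odot> x \<ominus> qsum g (Suc n) \<otimes> x = (of_nat n \<odot> x \<ominus> qsum g n \<otimes> x) \<oplus> (x \<ominus> qpow g n \<otimes> x)" for n
    using x smult_ladd[OF x, of "of_nat n" 1] smult_ladd[OF x, of 1 "of_nat n"] gc
    by (simp add: mult_add_left M.minus_eq M.minus_add M.a_ac)
  show ?a
  proof (induction n)
    case (Suc n)
    show ?case unfolding S
      using norm_add[of "of_nat n \<odot> x \<ominus> qsum g n \<otimes> x" "x \<ominus> qpow g n \<otimes> x"] Suc qpow_contraction[OF x, of n] x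
      by (simp add: algebra_simps)
  qed (simp add: x M.minus_eq)
  show ?b
  proof (induction n)
    case (Suc n)
    show ?case unfolding S
      using Suc x by (simp add: mult_add_right qpow_Suc_mult[OF x] del: qpow.simps)
  qed (simp add: x M.minus_eq)
  show ?c
  proof (induction n)
    case (Suc n)
    have "cnorm A (qsum g (Suc n) \<otimes> x) \<le> cnorm A (qsum g n \<otimes> x) + cnorm A (qpow g n \<otimes> x)"
      using x norm_add by (simp add: mult_add_left)
    also have "\<dots> \<le> real n * (real n * cnorm A g * cnorm A x) + real n * cnorm A g * cnorm A x"
      using Suc norm_qpow_mult'[OF x] by (intro add_mono)
    also have "\<dots> = real n * real (Suc n) * (cnorm A g * cnorm A x)" by (simp add: algebra_simps)
    also have "\<dots> \<le> real (Suc n) * real (Suc n) * (cnorm A g * cnorm A x)"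
      using x by (intro mult_right_mono) (auto simp: norm_nonneg)
    finally show ?case by (simp add: algebra_simps)
  qed (simp add: x)
qed

lemma minus_qmean:
  assumes "x \<in> carrier A" "n > 0"
  shows "x \<ominus> qmean g n \<otimes> x = (1 / of_nat n) \<odot> (of_nat n \<odot> x \<ominus> qsum g n \<otimes> x)"
  using assms by (simp add: qmean_def smult_diff)

lemma qmean_contraction:
  assumes "x \<in> carrier A" "n > 0" shows "cnorm A (x \<ominus> qmean g n \<otimes> x) \<le> cnorm A x"
  unfolding minus_qmean[OF assms] using qsum_mult(1)[OF assms(1), of n] assms
  by (simp add: norm_smult norm_divide pos_divide_le_eq mult.commute)

lemma qmean_decay:
  assumes "x \<in> carrier A" "n > 0" shows "cnorm A (g \<otimes> (x \<ominus> qmean g n \<otimes> x)) \<le> 2 / real n * cnorm A x"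
  unfolding minus_qmean[OF assms] using qsum_mult(2)[OF assms(1), of n] norm_qpow_mult[OF assms(1), of n] assms
  by (simp add: norm_smult norm_divide divide_right_mono)

lemma qmean_small:
  assumes "x \<in> carrier A" "n > 0" shows "cnorm A (qmean g n \<otimes> x) \<le> real n * cnorm A g * cnorm A x"
  using qsum_mult(3)[OF assms(1), of n] assms unfolding qmean_def
  by (simp add: norm_smult norm_divide pos_divide_le_eq mult.commute)

text \<open>Let z = (1 - e) g. As everything commutes, ||(1 - e) h||^2 = ||(1 - e) z|| <= ||z||. And
  ||z||^2 = ||g (1 - e) z*|| is at most (2/n) ||z|| by \<open>qmean_decay\<close>.\<close>

lemma qmean_h:
  assumes n: "n > 0" shows "(cnorm A (h \<ominus> qmean g n \<otimes> h))\<^sup>2 \<le> 2 / real n"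
proof -
  define e where "e = qmean g n"
  have e: "e \<in> carrier A" "star A e = e" using qmean_selfadj[OF selfadj_g] by (simp_all add: e_def)
  have eh: "h \<otimes> e = e \<otimes> h" unfolding e_def using hc by (intro qmean_commute) (auto simp: g_eq mult_assoc)
  have eg: "g \<otimes> e = e \<otimes> g" unfolding e_def by (intro qmean_commute) auto
  define z where "z = g \<ominus> e \<otimes> g"
  have z: "z \<in> carrier A" using e by (simp add: z_def)
  have sz: "star A z = g \<ominus> g \<otimes> e"
    using e selfadj_g by (simp add: z_def star_diff star_mult selfadj_def)
  have "z \<otimes> star A z = g \<otimes> (star A z \<ominus> e \<otimes> star A z)"
    using e gc eg unfolding sz by (simp add: z_def M.minus_eq mult_add_left mult_add_right mult_neg_left mult_neg_right flip: mult_assoc)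
  then have "(cnorm A z)\<^sup>2 \<le> 2 / real n * cnorm A z"
    using qmean_decay[of "star A z" n] z n cstar_identity'[OF z] by (simp add: e_def)
  then have zn: "cnorm A z \<le> 2 / real n"
    using norm_nonneg[OF z] n mult_le_cancel_right_pos[of "cnorm A z" "cnorm A z" "2 / real n"]
    by (cases "cnorm A z = 0") (auto simp: power2_eq_square)
  have "star A (h \<ominus> e \<otimes> h) = h \<ominus> e \<otimes> h" using hc e eh by (simp add: star_diff star_mult)
  moreover have "e \<otimes> h \<otimes> e = e \<otimes> e \<otimes> h" using hc e eh by (simp add: mult_assoc)
  ultimately have "star A (h \<ominus> e \<otimes> h) \<otimes> (h \<ominus> e \<otimes> h) = z \<ominus> e \<otimes> z"
    using hc e eh by (simp add: z_def g_eq M.minus_eq M.minus_add mult_add_left mult_add_right mult_neg_left mult_neg_right flip: mult_assoc)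
  then have "(cnorm A (h \<ominus> e \<otimes> h))\<^sup>2 \<le> cnorm A z"
    using cstar_identity[of "h \<ominus> e \<otimes> h"] qmean_contraction[OF z n] hc e by (simp add: e_def)
  then show ?thesis using zn by (simp add: e_def)
qed

end

context cstar_algebra
begin

text \<open>For h = xx* and e the mean for g = h^2, ||x - ex||^2 = ||(1 - e) h (1 - e)|| is at most
  ||h - eh||, whose square \<open>qmean_h\<close> bounds by 2/n; hence the fourth power. Taking g =
  h^2 avoids a square root of xx*.\<close>

lemma qmean_approx:
  assumes x: "x \<in> carrier A" "cnorm A x \<le> 1" and n: "n > 0"
  defines "g \<equiv> (x \<otimes> star A x) \<otimes> (x \<otimes> star A x)"
  shows "cnorm A (x \<ominus> qmean g n \<otimes> x) ^ 4 \<le> 2 / real n"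
proof -
  define h where "h = x \<otimes> star A x"
  have hh: "h \<in> carrier A" "star A h = h" using x by (simp_all add: h_def star_mult)
  have h1: "cnorm A h \<le> 1" unfolding h_def using x by (simp add: cstar_identity' power_le_one norm_nonneg)
  interpret small_square A h g using hh h1 by unfold_locales (simp_all add: selfadj_def g_def h_def)
  define e where "e = qmean g n"
  have e: "e \<in> carrier A" "star A e = e" using qmean_selfadj[OF selfadj_g] by (simp_all add: e_def)
  define y where "y = h \<ominus> e \<otimes> h"
  have y: "y \<in> carrier A" using hh e by (simp add: y_def)
  have sy: "star A y = h \<ominus> h \<otimes> e" using hh e by (simp add: y_def star_diff star_mult)
  have "(x \<ominus> e \<otimes> x) \<otimes> star A (x \<ominus> e \<otimes> x) = star A (star A y \<ominus> e \<otimes> star A y)"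
    using x e hh by (simp add: sy star_diff star_mult) (simp add: h_def M.minus_eq mult_add_left mult_add_right mult_neg_left mult_neg_right mult_assoc)
  then have "(cnorm A (x \<ominus> e \<otimes> x))\<^sup>2 = cnorm A (star A y \<ominus> e \<otimes> star A y)"
    using cstar_identity'[of "x \<ominus> e \<otimes> x"] x e y by simp
  also have "\<dots> \<le> cnorm A y" using qmean_contraction[of "star A y" n] y n by (simp add: e_def)
  finally have "((cnorm A (x \<ominus> e \<otimes> x))\<^sup>2)\<^sup>2 \<le> (cnorm A y)\<^sup>2" by (intro power_mono) auto
  also have "\<dots> \<le> 2 / real n" using qmean_h[OF n] by (simp add: y_def e_def)
  finally show ?thesis by (simp add: e_def flip: power_mult)
qed

lemma qmean_approx_tendsto:
  assumes x: "x \<in> carrier A" "cnorm A x \<le> 1" and e: "e > 0"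
  defines "g \<equiv> (x \<otimes> star A x) \<otimes> (x \<otimes> star A x)"
  obtains n where "n > 0" and "cnorm A (x \<ominus> qmean g n \<otimes> x) < e"
proof -
  obtain n :: nat where n: "2 / e ^ 4 < real n" using reals_Archimedean2 by blast
  have e4: "e ^ 4 > 0" using e by simp
  have "0 < 2 / e ^ 4" using e by simp
  then have n0: "n > 0" using n by (metis less_trans of_nat_0_less_iff)
  have "2 / real n < e ^ 4" using n n0 e4 by (simp add: field_simps)
  then have "cnorm A (x \<ominus> qmean g n \<otimes> x) ^ 4 < e ^ 4"
    using qmean_approx[OF x n0] unfolding g_def by simp
  then have "cnorm A (x \<ominus> qmean g n \<otimes> x) < e" using e power_less_imp_less_base[of _ 4 e] by simp
  then show thesis using that n0 by blast
qed

text \<open>Each x is a limit of products \<open>qmean g n \<otimes> x\<close>, so products are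
  dense. This turns membership of products into membership of all elements.\<close>

lemma closed_submodule_products:
  assumes V: "submodule V complex_ring A" "ncl A (cnorm A) V \<subseteq> V"
    and prod: "\<And>x y. \<lbrakk>x \<in> carrier A; y \<in> carrier A\<rbrakk> \<Longrightarrow> x \<otimes> y \<in> V"
  shows "V = carrier A"
proof
  show "V \<subseteq> carrier A" using V by (simp add: submodule_iff)
  show "carrier A \<subseteq> V"
  proof
    fix x assume x: "x \<in> carrier A"
    \<comment> \<open>Scales x into the unit ball, by a divisor that is nonzero also for x =
      0.\<close>
    define c where "c = complex_of_real (cnorm A x + 1)"
    have c: "cmod c = cnorm A x + 1" using norm_nonneg[OF x] by (simp add: c_def del: of_real_add)
    then have c0: "c \<noteq> 0" using norm_nonneg[OF x] by auto
    let ?x = "(1/c) \<odot> x"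
    have x1: "?x \<in> carrier A" "cnorm A ?x \<le> 1" using x c norm_nonneg[OF x] by (simp_all add: norm_smult norm_divide)
    have "?x \<in> ncl A (cnorm A) V"
    proof (rule nclI[OF x1(1)])
      fix e :: real assume e: "e > 0"
      define g where "g = (?x \<otimes> star A ?x) \<otimes> (?x \<otimes> star A ?x)"
      have gc: "g \<in> carrier A" using x1 by (simp add: g_def del: mult_smult_left mult_smult_right)
      obtain n where n: "n > 0" "cnorm A (?x \<ominus> qmean g n \<otimes> ?x) < e"
        using qmean_approx_tendsto[OF x1 e] unfolding g_def by blast
      have "qmean g n \<otimes> ?x \<in> V" using gc x1 by (intro prod) auto
      moreover have "qmean g n \<otimes> ?x \<in> carrier A" using gc x1(1) by blast
      ultimately show "\<exists>y\<in>V. y \<in> carrier A \<and> cnorm A (?x \<ominus> y) < e" using n(2) by blast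
    qed
    then have "c \<odot> ?x \<in> V" using V unfolding submodule_iff by blast
    then show "x \<in> V" using x c0 by simp
  qed
qed

text \<open>Allows one factor of a product to vary by linearity and density while the other stays
  fixed; \<open>compact_kernel_lift\<close> rests on this.\<close>

lemma closed_submodule_mult_left:
  assumes V: "submodule V complex_ring A" "ncl A (cnorm A) V \<subseteq> V" and t: "t \<in> carrier A"
  shows "submodule {x \<in> carrier A. t \<otimes> x \<in> V} complex_ring A"
    and "ncl A (cnorm A) {x \<in> carrier A. t \<otimes> x \<in> V} \<subseteq> {x \<in> carrier A. t \<otimes> x \<in> V}"
proof -
  show "submodule {x \<in> carrier A. t \<otimes> x \<in> V} complex_ring A"
    using V(1) t unfolding submodule_iff by (auto simp: mult_add_right mult_smult_right)
  show "ncl A (cnorm A) {x \<in> carrier A. t \<otimes> x \<in> V} \<subseteq> {x \<in> carrier A. t \<otimes> x \<in> V}"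
  proof
    fix x assume x: "x \<in> ncl A (cnorm A) {x \<in> carrier A. t \<otimes> x \<in> V}"
    have "t \<in> ncl A (cnorm A) {t}" using ncl_superset[of "{t}"] t by blast
    from ncl_mult[OF _ this x, of V] have "t \<otimes> x \<in> ncl A (cnorm A) V" by auto
    then show "x \<in> {x \<in> carrier A. t \<otimes> x \<in> V}" using x V(2) ncl_carrier by blast
  qed
qed

lemma closed_submodule_mult_right:
  assumes V: "submodule V complex_ring A" "ncl A (cnorm A) V \<subseteq> V" and t: "t \<in> carrier A"
  shows "submodule {x \<in> carrier A. x \<otimes> t \<in> V} complex_ring A"
    and "ncl A (cnorm A) {x \<in> carrier A. x \<otimes> t \<in> V} \<subseteq> {x \<in> carrier A. x \<otimes> t \<in> V}"
proof -
  show "submodule {x \<in> carrier A. x \<otimes> t \<in> V} complex_ring A"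
    using V(1) t unfolding submodule_iff by (auto simp: mult_add_left mult_smult_left)
  show "ncl A (cnorm A) {x \<in> carrier A. x \<otimes> t \<in> V} \<subseteq> {x \<in> carrier A. x \<otimes> t \<in> V}"
  proof
    fix x assume x: "x \<in> ncl A (cnorm A) {x \<in> carrier A. x \<otimes> t \<in> V}"
    have "t \<in> ncl A (cnorm A) {t}" using ncl_superset[of "{t}"] t by blast
    from ncl_mult[OF _ x this, of V] have "x \<otimes> t \<in> ncl A (cnorm A) V" by auto
    then show "x \<in> {x \<in> carrier A. x \<otimes> t \<in> V}" using x V(2) ncl_carrier by blast
  qed
qed

end

section \<open>Contractivity and closed range of *-homomorphisms\<close>

locale cstar_hom = A: cstar_algebra A + B: cstar_algebra B
  for A :: "'a cstar_algebra" and B :: "'b cstar_algebra" +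
  fixes f :: "'a \<Rightarrow> 'b"
  assumes hom: "star_hom A B f"
begin

lemma map_closed [simp, intro]: "x \<in> carrier A \<Longrightarrow> f x \<in> carrier B"
  using hom by (auto simp: star_hom_def linear_map_def)

lemma map_add: "\<lbrakk>x \<in> carrier A; y \<in> carrier A\<rbrakk> \<Longrightarrow> f (x \<oplus>\<^bsub>A\<^esub> y) = f x \<oplus>\<^bsub>B\<^esub> f y"
  using hom by (auto simp: star_hom_def linear_map_def)

lemma map_smult: "x \<in> carrier A \<Longrightarrow> f (c \<odot>\<^bsub>A\<^esub> x) = c \<odot>\<^bsub>B\<^esub> f x"
  using hom by (auto simp: star_hom_def linear_map_def)

lemma map_mult: "\<lbrakk>x \<in> carrier A; y \<in> carrier A\<rbrakk> \<Longrightarrow> f (x \<otimes>\<^bsub>A\<^esub> y) = f x \<otimes>\<^bsub>B\<^esub> f y"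
  using hom by (auto simp: star_hom_def linear_map_def)

lemma map_star: "x \<in> carrier A \<Longrightarrow> f (star A x) = star B (f x)"
  using hom by (auto simp: star_hom_def linear_map_def)

lemma map_zero [simp]: "f \<zero>\<^bsub>A\<^esub> = \<zero>\<^bsub>B\<^esub>"
  using map_smult[of "\<zero>\<^bsub>A\<^esub>" 0] by simp

lemma map_diff: "\<lbrakk>x \<in> carrier A; y \<in> carrier A\<rbrakk> \<Longrightarrow> f (x \<ominus>\<^bsub>A\<^esub> y) = f x \<ominus>\<^bsub>B\<^esub> f y"
  by (simp add: A.minus_smult B.minus_smult map_add map_smult)

text \<open>With \<open>s = (h\<^sup>2 + s\<^sup>2)/2\<close>, the element \<open>(1 - f s) + \<i> f h\<close> is unitary.\<close>

lemma norm_selfadj_le_1: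
  assumes "selfadj A h" "cnorm A h \<le> 1" shows "cnorm B (f h) \<le> 1"
proof -
  have hc: "h \<in> carrier A" "star A h = h" using assms by (auto simp: selfadj_def)
  have sa: "selfadj A (h \<otimes>\<^bsub>A\<^esub> h)" using hc by (simp add: selfadj_def A.star_mult)
  have le: "cnorm A (h \<otimes>\<^bsub>A\<^esub> h) \<le> 1"
    using A.norm_square_selfadj[OF assms(1)] assms A.norm_nonneg[OF hc(1)] by (simp add: power_le_one)
  obtain s where s: "selfadj A s" "s = (1/2) \<odot>\<^bsub>A\<^esub> (h \<otimes>\<^bsub>A\<^esub> h \<oplus>\<^bsub>A\<^esub> s \<otimes>\<^bsub>A\<^esub> s)" "cnorm A s \<le> 1"
    and comm: "\<And>x. \<lbrakk>x \<in> carrier A; x \<otimes>\<^bsub>A\<^esub> (h \<otimes>\<^bsub>A\<^esub> h) = (h \<otimes>\<^bsub>A\<^esub> h) \<otimes>\<^bsub>A\<^esub> x\<rbrakk> \<Longrightarrow> x \<otimes>\<^bsub>A\<^esub> s = s \<otimes>\<^bsub>A\<^esub> x"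
    by (rule A.quasi_sqrt[OF sa le]) (rule that, assumption, assumption, assumption, blast)
  have sc: "s \<in> carrier A" "star A s = s" using s by (auto simp: selfadj_def)
  have hs: "h \<otimes>\<^bsub>A\<^esub> s = s \<otimes>\<^bsub>A\<^esub> h" using comm[of h] hc by (simp add: A.mult_assoc)
  interpret U: unital_cstar B.S.L by (rule B.S.unital_cstar_L)
  define p where "p = lmul B (f h)"
  define t where "t = lmul B (f s)"
  have pc: "p \<in> carrier B.S.L" and tc: "t \<in> carrier B.S.L" using hc sc by (simp_all add: p_def t_def)
  have p: "selfadj B.S.L p"
    using hc map_star[of h] pc by (simp add: selfadj_def p_def B.star_lmul)
  have t: "star B.S.L t = t"
    using sc map_star[of s] by (simp add: t_def B.star_lmul)
  have "f s = (1/2) \<odot>\<^bsub>B\<^esub> (f h \<otimes>\<^bsub>B\<^esub> f h \<oplus>\<^bsub>B\<^esub> f s \<otimes>\<^bsub>B\<^esub> f s)"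
    using hc sc by (subst s(2)) (simp add: map_smult map_add map_mult)
  then have "t = lmul B ((1/2) \<odot>\<^bsub>B\<^esub> (f h \<otimes>\<^bsub>B\<^esub> f h \<oplus>\<^bsub>B\<^esub> f s \<otimes>\<^bsub>B\<^esub> f s))" unfolding t_def by (rule arg_cong)
  also have "\<dots> = (1/2) \<odot>\<^bsub>B.S.L\<^esub> (p \<otimes>\<^bsub>B.S.L\<^esub> p \<oplus>\<^bsub>B.S.L\<^esub> t \<otimes>\<^bsub>B.S.L\<^esub> t)"
    using hc sc by (simp add: p_def t_def B.lmul_add B.lmul_mult B.lmul_smult del: B.S.L_simps)
  finally have teq: "t = (1/2) \<odot>\<^bsub>B.S.L\<^esub> (p \<otimes>\<^bsub>B.S.L\<^esub> p \<oplus>\<^bsub>B.S.L\<^esub> t \<otimes>\<^bsub>B.S.L\<^esub> t)" .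
  define q where "q = \<one>\<^bsub>B.S.L\<^esub> \<ominus>\<^bsub>B.S.L\<^esub> t"
  have qc: "q \<in> carrier B.S.L" unfolding q_def using tc U.one_closed by (rule U.M.minus_closed[rotated])
  have q: "selfadj B.S.L q" using qc t tc U.star_one U.star_diff[OF U.one_closed tc]
    by (simp add: selfadj_def q_def del: B.S.L_simps)
  have pt: "p \<otimes>\<^bsub>B.S.L\<^esub> t = t \<otimes>\<^bsub>B.S.L\<^esub> p"
    using hs hc sc map_mult[of h s] map_mult[of s h]
    by (simp add: p_def t_def del: B.S.L_simps flip: B.lmul_mult)
  then have pq: "p \<otimes>\<^bsub>B.S.L\<^esub> q = q \<otimes>\<^bsub>B.S.L\<^esub> p"
    using pc tc by (simp add: q_def U.M.minus_eq U.mult_add_left U.mult_add_right U.mult_neg_left U.mult_neg_right del: B.S.L_simps)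
  have "q \<otimes>\<^bsub>B.S.L\<^esub> q = \<one>\<^bsub>B.S.L\<^esub> \<ominus>\<^bsub>B.S.L\<^esub> p \<otimes>\<^bsub>B.S.L\<^esub> p"
    unfolding q_def using tc pc teq by (intro U.one_minus_square U.mult_closed)
  moreover have "p \<otimes>\<^bsub>B.S.L\<^esub> p \<oplus>\<^bsub>B.S.L\<^esub> (\<one>\<^bsub>B.S.L\<^esub> \<ominus>\<^bsub>B.S.L\<^esub> p \<otimes>\<^bsub>B.S.L\<^esub> p) = \<one>\<^bsub>B.S.L\<^esub>"
    using pc U.one_closed by algebra
  ultimately have "(B.S.opn p)\<^sup>2 \<le> B.S.opn \<one>\<^bsub>B.S.L\<^esub>"
    using U.norm_le_U1[OF p q pq] by (simp del: B.S.L_simps)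
  also have "\<dots> \<le> 1" by (rule U.norm_one)
  finally have "(cnorm B (f h))\<^sup>2 \<le> 1" using hc by (simp add: p_def B.norm_lmul)
  then show ?thesis using power2_le_imp_le[of "cnorm B (f h)" 1] by simp
qed

text \<open>Scaling x*x to norm one reduces the claim to a self-adjoint contraction, through the
  C*-identity on both sides.\<close>

lemma norm_map_le: assumes x: "x \<in> carrier A" shows "cnorm B (f x) \<le> cnorm A x"
proof (cases "cnorm A x = 0")
  case True
  then show ?thesis using x by (simp add: A.norm_eq_zero)
next
  case False
  define c where "c = complex_of_real (1 / (cnorm A x)\<^sup>2)"
  have pos: "cnorm A x > 0" using False A.norm_nonneg[OF x] by simp
  let ?h = "c \<odot>\<^bsub>A\<^esub> (star A x \<otimes>\<^bsub>A\<^esub> x)"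
  have "selfadj A ?h" using x by (simp add: selfadj_def A.star_smult A.star_mult c_def)
  moreover have "cnorm A ?h \<le> 1" using x pos by (simp add: A.norm_smult A.cstar_identity c_def norm_divide norm_power)
  ultimately have "cnorm B (f ?h) \<le> 1" by (rule norm_selfadj_le_1)
  then have "cmod c * (cnorm B (f x))\<^sup>2 \<le> 1"
    using x by (simp add: map_smult map_mult map_star B.norm_smult B.cstar_identity)
  then have "(cnorm B (f x))\<^sup>2 \<le> (cnorm A x)\<^sup>2" using pos by (simp add: c_def norm_divide norm_power pos_divide_le_eq)
  then show ?thesis by (rule power2_le_imp_le) (use pos in simp)
qed

lemma norm_map_diff: "\<lbrakk>x \<in> carrier A; y \<in> carrier A\<rbrakk> \<Longrightarrow> cnorm B (f x \<ominus>\<^bsub>B\<^esub> f y) \<le> cnorm A (x \<ominus>\<^bsub>A\<^esub> y)"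
  using norm_map_le[of "x \<ominus>\<^bsub>A\<^esub> y"] by (simp add: map_diff)

lemma ncl_map:
  assumes "x \<in> ncl A (cnorm A) S" and "\<And>y. y \<in> S \<Longrightarrow> f y \<in> T"
  shows "f x \<in> ncl B (cnorm B) T"
proof (rule B.nclI)
  have x: "x \<in> carrier A" using assms by (simp add: ncl_def)
  then show "f x \<in> carrier B" by blast
  fix e :: real assume "e > 0"
  then obtain y where y: "y \<in> S" "y \<in> carrier A" "cnorm A (x \<ominus>\<^bsub>A\<^esub> y) < e" using A.nclE[OF assms(1)] by blast
  then show "\<exists>z\<in>T. z \<in> carrier B \<and> cnorm B (f x \<ominus>\<^bsub>B\<^esub> z) < e"
    using norm_map_diff[OF x y(2)] assms(2) by (intro bexI[of _ "f y"]) auto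
qed

lemma nconv_map:
  assumes "nconv A (cnorm A) s l" shows "nconv B (cnorm B) (\<lambda>n. f (s n)) (f l)"
proof (rule B.nconvI_bound)
  have c: "s n \<in> carrier A" "l \<in> carrier A" for n using assms by (auto simp: nconv_def)
  then show "range (\<lambda>n. f (s n)) \<subseteq> carrier B" "f l \<in> carrier B" by auto
  show "cnorm B (f (s n) \<ominus>\<^bsub>B\<^esub> f l) \<le> cnorm A (s n \<ominus>\<^bsub>A\<^esub> l)" for n using c by (intro norm_map_diff)
  show "(\<lambda>n. cnorm A (s n \<ominus>\<^bsub>A\<^esub> l)) \<longlonglongrightarrow> 0" using assms by (simp add: nconv_def)
qed

lemma preimage_submodule:
  assumes "submodule T complex_ring B" shows "submodule {x \<in> carrier A. f x \<in> T} complex_ring A"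
  using assms by (auto simp: A.submodule_iff B.submodule_iff map_add map_smult)

lemma preimage_closed:
  assumes "ncl B (cnorm B) T \<subseteq> T"
  shows "ncl A (cnorm A) {x \<in> carrier A. f x \<in> T} \<subseteq> {x \<in> carrier A. f x \<in> T}"
proof
  fix x assume x: "x \<in> ncl A (cnorm A) {x \<in> carrier A. f x \<in> T}"
  then have "f x \<in> ncl B (cnorm B) T" by (rule ncl_map) auto
  then show "x \<in> {x \<in> carrier A. f x \<in> T}" using x assms by (auto simp: ncl_def)
qed

lemma kernel_subalgebra: "cstar_subalgebra A {x \<in> carrier A. f x = \<zero>\<^bsub>B\<^esub>}"
proof -
  have "submodule {\<zero>\<^bsub>B\<^esub>} complex_ring B" by (simp add: B.submodule_iff)
  note 1 = preimage_submodule[OF this] preimage_closed[OF B.ncl_zero]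
  show ?thesis
    unfolding A.cstar_subalgebra_iff using 1 by (auto simp: map_mult map_star)
qed

lemma image_submodule: "submodule (f ` carrier A) complex_ring B"
proof -
  have "\<zero>\<^bsub>B\<^esub> \<in> f ` carrier A" using map_zero by (metis A.M.zero_closed imageI)
  then show ?thesis unfolding B.submodule_iff by (auto simp flip: map_add map_smult)
qed

lemma map_qpow: "g \<in> carrier A \<Longrightarrow> f (A.qpow g n) = B.qpow (f g) n"
  by (induction n) (simp_all add: map_add map_diff map_mult)

lemma map_qmean: "g \<in> carrier A \<Longrightarrow> f (A.qmean g n) = B.qmean (f g) n"
proof -
  assume g: "g \<in> carrier A"
  have "f (A.qsum g m) = B.qsum (f g) m" for m
    using g by (induction m) (simp_all add: map_add map_qpow)
  then show ?thesis using g by (simp add: A.qmean_def B.qmean_def map_smult)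
qed

text \<open>A self-adjoint element of the closure of the range is approximated by \<open>f x\<close> with a bound on
  the norm of \<open>x\<close>, on truncating a self-adjoint \<open>x\<close> with \<open>f x\<close> near \<open>y\<close> by the factor
  \<open>1 - qmean (x\<^sup>2/2N) N\<close>.\<close>

lemma bounded_lift_1:
  assumes y: "y \<in> ncl B (cnorm B) (f ` carrier A)" "selfadj B y" "cnorm B y \<le> 1"
  obtains x where "selfadj A x" and "cnorm A x \<le> 2" and "cnorm B (y \<ominus>\<^bsub>B\<^esub> f x) \<le> 4/5"
proof -
  have yc: "y \<in> carrier B" "star B y = y" using y by (auto simp: selfadj_def)
  obtain x0 where x0: "x0 \<in> carrier A" "cnorm B (y \<ominus>\<^bsub>B\<^esub> f x0) < 1/10"
    using B.nclE[OF y(1), of "1/10"] by auto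
  define x where "x = (1/2) \<odot>\<^bsub>A\<^esub> (x0 \<oplus>\<^bsub>A\<^esub> star A x0)"
  have x: "x \<in> carrier A" "star A x = x" using x0 by (simp_all add: x_def A.star_smult A.star_add A.M.a_comm)
  have "y = (1/2) \<odot>\<^bsub>B\<^esub> (y \<oplus>\<^bsub>B\<^esub> star B y)"
    using yc B.smult_ladd[of y "1/2" "1/2"] by (simp add: B.smult_radd)
  moreover have "f x = (1/2) \<odot>\<^bsub>B\<^esub> (f x0 \<oplus>\<^bsub>B\<^esub> star B (f x0))" using x0 by (simp add: x_def map_smult map_add map_star)
  ultimately have "cnorm B (y \<ominus>\<^bsub>B\<^esub> f x) = 1/2 * cnorm B ((y \<oplus>\<^bsub>B\<^esub> star B y) \<ominus>\<^bsub>B\<^esub> (f x0 \<oplus>\<^bsub>B\<^esub> star B (f x0)))"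
    using B.nm_smult_diff[of "y \<oplus>\<^bsub>B\<^esub> star B y" "f x0 \<oplus>\<^bsub>B\<^esub> star B (f x0)" "1/2"] yc x0 by simp
  also have "\<dots> \<le> 1/2 * (cnorm B (y \<ominus>\<^bsub>B\<^esub> f x0) + cnorm B (star B y \<ominus>\<^bsub>B\<^esub> star B (f x0)))"
    using yc(1) x0 by (intro mult_left_mono B.nm_add_diff) auto
  also have "\<dots> < 1/10" using yc(1) x0 by (simp add: B.norm_star_diff)
  finally have fx: "cnorm B (y \<ominus>\<^bsub>B\<^esub> f x) < 1/10" .
  then have fx1: "cnorm B (f x) \<le> 11/10"
    using B.nm_le[of "f x" y] B.nm_commute[of y "f x"] yc x y(3) by simp
  \<comment> \<open>With M = 2N at least ||x||^2, the element h = x / sqrt M is a contraction. Then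
    ||x'||^2 = M ||h - eh||^2 is at most 2N * (2/N) = 4, whatever the norm of x.\<close>
  obtain N :: nat where "(cnorm A x)\<^sup>2 + 1 < real N" using reals_Archimedean2 by blast
  moreover have "0 \<le> (cnorm A x)\<^sup>2" by simp
  ultimately have "(cnorm A x)\<^sup>2 \<le> 2 * real N" "0 < real N" by linarith+
  then have N: "(cnorm A x)\<^sup>2 \<le> 2 * real N" "N > 0" by simp_all
  define M where "M = 2 * real N"
  have M: "M > 0" using N by (simp add: M_def)
  define c where "c = complex_of_real (1 / sqrt M)"
  have cc: "cmod c = 1 / sqrt M" "cnj c = c" "c * c = complex_of_real (1/M)" "c \<noteq> 0"
    using M by (simp_all add: c_def norm_divide flip: of_real_mult)
  define h where "h = c \<odot>\<^bsub>A\<^esub> x"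
  define g where "g = h \<otimes>\<^bsub>A\<^esub> h"
  have hc: "h \<in> carrier A" using x by (simp add: h_def)
  have h: "selfadj A h" using x cc by (simp add: h_def selfadj_def A.star_smult)
  have "cnorm A x \<le> sqrt M" using N by (simp add: M_def real_le_rsqrt)
  then have h1: "cnorm A h \<le> 1" using x cc M by (simp add: h_def A.norm_smult)
  interpret sA: small_square A h g by unfold_locales (use h h1 g_def in auto)
  interpret sB: small_square B "f h" "f g"
    using hc norm_map_le[OF hc] h h1 by unfold_locales (auto simp: g_def selfadj_def map_mult simp flip: map_star)
  define e where "e = A.qmean g N"
  have e: "e \<in> carrier A" "star A e = e" using A.qmean_selfadj[OF sA.selfadj_g] by (simp_all add: e_def)
  have he: "h \<otimes>\<^bsub>A\<^esub> e = e \<otimes>\<^bsub>A\<^esub> h" unfolding e_def using hc by (intro A.qmean_commute) (auto simp: g_def A.mult_assoc)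
  have "x = (1/c) \<odot>\<^bsub>A\<^esub> h" using x cc by (simp add: h_def)
  then have xe: "x \<otimes>\<^bsub>A\<^esub> e = e \<otimes>\<^bsub>A\<^esub> x" using he hc e by simp
  define x' where "x' = x \<ominus>\<^bsub>A\<^esub> e \<otimes>\<^bsub>A\<^esub> x"
  have x': "selfadj A x'" using x e xe by (simp add: selfadj_def x'_def A.star_diff A.star_mult)
  have "x' = (1/c) \<odot>\<^bsub>A\<^esub> (h \<ominus>\<^bsub>A\<^esub> e \<otimes>\<^bsub>A\<^esub> h)" using x e cc by (simp add: x'_def h_def A.smult_diff)
  then have "cnorm A x' = sqrt M * cnorm A (h \<ominus>\<^bsub>A\<^esub> e \<otimes>\<^bsub>A\<^esub> h)"
    using hc e cc by (simp add: A.norm_smult norm_divide)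
  then have "(cnorm A x')\<^sup>2 \<le> M * (2 / real N)"
    using mult_left_mono[OF sA.qmean_h[OF N(2)], of M] M by (simp add: power_mult_distrib e_def)
  also have "\<dots> = 2\<^sup>2" using N by (simp add: M_def)
  finally have 1: "cnorm A x' \<le> 2" by (rule power2_le_imp_le) simp
  have "cnorm B (f g) = (cnorm B (f h))\<^sup>2" using B.norm_square_selfadj[OF sB.h] by (simp add: sB.g_eq)
  also have "\<dots> = (cnorm B (f x))\<^sup>2 / M"
    using x M cc by (simp add: h_def map_smult B.norm_smult power_divide)
  also have "\<dots> \<le> (11/10)\<^sup>2 / M" using fx1 x M by (intro divide_right_mono power_mono) (auto simp: B.norm_nonneg)
  finally have fg: "cnorm B (f g) \<le> (11/10)\<^sup>2 / M" .
  have "cnorm B (f e \<otimes>\<^bsub>B\<^esub> f x) \<le> real N * cnorm B (f g) * cnorm B (f x)"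
    using sB.qmean_small[of "f x" N] x N by (simp add: e_def map_qmean)
  also have "\<dots> \<le> real N * ((11/10)\<^sup>2 / M) * (11/10)"
    using fg fx1 x by (intro mult_mono mult_left_mono) (auto simp: B.norm_nonneg M_def)
  \<comment> \<open>As M = 2N, the left side is (11/10)^3 / 2, which is below 7/10; together with
    the 1/10 of \<open>fx\<close> this yields the factor 4/5.\<close>
  also have "\<dots> \<le> 7/10" using N by (simp add: M_def power2_eq_square)
  finally have fe: "cnorm B (f e \<otimes>\<^bsub>B\<^esub> f x) \<le> 7/10" .
  have "y \<ominus>\<^bsub>B\<^esub> f x' = (y \<ominus>\<^bsub>B\<^esub> f x) \<oplus>\<^bsub>B\<^esub> f e \<otimes>\<^bsub>B\<^esub> f x"
  proof -
    have c: "f x \<in> carrier B" "f e \<in> carrier B" using x e by auto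
    have "f x' = f x \<ominus>\<^bsub>B\<^esub> f e \<otimes>\<^bsub>B\<^esub> f x" using x e by (simp add: x'_def map_diff map_mult)
    then show ?thesis using yc(1) c by algebra
  qed
  then have "cnorm B (y \<ominus>\<^bsub>B\<^esub> f x') \<le> 1/10 + 7/10"
    using B.norm_add[of "y \<ominus>\<^bsub>B\<^esub> f x" "f e \<otimes>\<^bsub>B\<^esub> f x"] fx fe yc x e by simp
  then show thesis using that[of x'] x' 1 by simp
qed

lemma bounded_lift:
  assumes y: "y \<in> ncl B (cnorm B) (f ` carrier A)" "selfadj B y" "cnorm B y \<le> c" and c: "c > 0"
  obtains x where "selfadj A x" and "cnorm A x \<le> 2 * c" and "cnorm B (y \<ominus>\<^bsub>B\<^esub> f x) \<le> 4/5 * c"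
proof -
  have yc: "y \<in> carrier B" "star B y = y" using y by (auto simp: selfadj_def)
  let ?c = "complex_of_real c"
  let ?y = "(1/?c) \<odot>\<^bsub>B\<^esub> y"
  have "?y \<in> ncl B (cnorm B) (f ` carrier A)"
    using B.ncl_submodule[OF image_submodule] y(1) by (simp add: B.submodule_iff)
  moreover have "selfadj B ?y" using yc by (simp add: selfadj_def B.star_smult)
  moreover have "cnorm B ?y \<le> 1" using yc y(3) c by (simp add: B.norm_smult norm_divide)
  ultimately obtain x where x: "selfadj A x" "cnorm A x \<le> 2" "cnorm B (?y \<ominus>\<^bsub>B\<^esub> f x) \<le> 4/5"
    by (rule bounded_lift_1)
  have xc: "x \<in> carrier A" using x by (simp add: selfadj_def)
  have "selfadj A (?c \<odot>\<^bsub>A\<^esub> x)" using x by (simp add: selfadj_def A.star_smult)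
  moreover have "cnorm A (?c \<odot>\<^bsub>A\<^esub> x) \<le> 2 * c" using x xc c by (simp add: A.norm_smult)
  moreover have "y \<ominus>\<^bsub>B\<^esub> f (?c \<odot>\<^bsub>A\<^esub> x) = ?c \<odot>\<^bsub>B\<^esub> (?y \<ominus>\<^bsub>B\<^esub> f x)"
    using yc xc c by (simp add: map_smult B.smult_diff)
  then have "cnorm B (y \<ominus>\<^bsub>B\<^esub> f (?c \<odot>\<^bsub>A\<^esub> x)) \<le> 4/5 * c"
    using x(3) yc xc c by (simp add: B.norm_smult mult.commute)
  ultimately show thesis by (rule that)
qed

text \<open>Successive approximation, as in the open mapping theorem: each residual is approximated
  by the image of an element of norm at most twice its bound, which leaves 4/5 of that bound. The
  corrections are dominated by a geometric series, and their sum is a preimage.\<close>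

lemma closed_range_selfadj:
  assumes y: "y \<in> ncl B (cnorm B) (f ` carrier A)" "selfadj B y"
  shows "y \<in> f ` carrier A"
proof -
  let ?R = "ncl B (cnorm B) (f ` carrier A)"
  have yc: "y \<in> carrier B" "star B y = y" using y by (auto simp: selfadj_def)
  note R = B.ncl_submodule[OF image_submodule]
  \<comment> \<open>Positive even for y = 0, because \<open>bounded_lift\<close> divides by its
    bound.\<close>
  define C where "C = cnorm B y + 1"
  have C: "C > 0" using B.norm_nonneg[OF yc(1)] by (simp add: C_def)
  have "\<exists>x. z \<in> ?R \<and> selfadj B z \<and> cnorm B z \<le> c \<and> c > 0 \<longrightarrow>
      selfadj A x \<and> cnorm A x \<le> 2 * c \<and> cnorm B (z \<ominus>\<^bsub>B\<^esub> f x) \<le> 4/5 * c" for z c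
  proof (cases "z \<in> ?R \<and> selfadj B z \<and> cnorm B z \<le> c \<and> c > 0")
    case True
    then obtain x where "selfadj A x" "cnorm A x \<le> 2 * c" "cnorm B (z \<ominus>\<^bsub>B\<^esub> f x) \<le> 4/5 * c"
      using bounded_lift[of z c] by blast
    then show ?thesis by blast
  qed auto
  then obtain F where F: "\<And>z c. \<lbrakk>z \<in> ?R; selfadj B z; cnorm B z \<le> c; c > 0\<rbrakk> \<Longrightarrow>
      selfadj A (F z c) \<and> cnorm A (F z c) \<le> 2 * c \<and> cnorm B (z \<ominus>\<^bsub>B\<^esub> f (F z c)) \<le> 4/5 * c" by metis
  define s where "s = rec_nat \<zero>\<^bsub>A\<^esub> (\<lambda>n x. x \<oplus>\<^bsub>A\<^esub> F (y \<ominus>\<^bsub>B\<^esub> f x) (C * (4/5) ^ n))"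
  have s0: "s 0 = \<zero>\<^bsub>A\<^esub>" and sS: "s (Suc n) = s n \<oplus>\<^bsub>A\<^esub> F (y \<ominus>\<^bsub>B\<^esub> f (s n)) (C * (4/5) ^ n)" for n
    by (simp_all add: s_def)
  have incr: "selfadj A (F (y \<ominus>\<^bsub>B\<^esub> f (s n)) (C * (4/5) ^ n)) \<and> cnorm A (F (y \<ominus>\<^bsub>B\<^esub> f (s n)) (C * (4/5) ^ n)) \<le> 2 * (C * (4/5) ^ n)
      \<and> cnorm B ((y \<ominus>\<^bsub>B\<^esub> f (s n)) \<ominus>\<^bsub>B\<^esub> f (F (y \<ominus>\<^bsub>B\<^esub> f (s n)) (C * (4/5) ^ n))) \<le> 4/5 * (C * (4/5) ^ n)"
      if a: "selfadj A (s n)" "cnorm B (y \<ominus>\<^bsub>B\<^esub> f (s n)) \<le> C * (4/5) ^ n" for n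
    proof (rule F)
      have sc: "s n \<in> carrier A" "star A (s n) = s n" using a by (auto simp: selfadj_def)
      have "f (s n) \<in> ?R" using sc B.ncl_superset[of "f ` carrier A"] by blast
      then show "y \<ominus>\<^bsub>B\<^esub> f (s n) \<in> ?R" using submodule_minus[OF B.cvec_axioms R y(1)] by blast
      show "selfadj B (y \<ominus>\<^bsub>B\<^esub> f (s n))" using sc yc map_star[of "s n"] by (simp add: selfadj_def B.star_diff)
    qed (use a C in auto)
  have inv: "selfadj A (s n) \<and> cnorm B (y \<ominus>\<^bsub>B\<^esub> f (s n)) \<le> C * (4/5) ^ n" for n
    proof (induction n)
      case 0
      then show ?case using yc by (simp add: s0 selfadj_def C_def B.M.minus_eq)
    next
      case (Suc n)
      define w where "w = F (y \<ominus>\<^bsub>B\<^esub> f (s n)) (C * (4/5) ^ n)"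
      have w: "selfadj A w" "cnorm B ((y \<ominus>\<^bsub>B\<^esub> f (s n)) \<ominus>\<^bsub>B\<^esub> f w) \<le> 4/5 * (C * (4/5) ^ n)"
        using incr[of n] Suc unfolding w_def by blast+
      have c: "s n \<in> carrier A" "w \<in> carrier A" "star A (s n) = s n" "star A w = w"
        using w Suc by (auto simp: selfadj_def)
      have sSn: "s (Suc n) = s n \<oplus>\<^bsub>A\<^esub> w" by (simp add: sS w_def)
      have "y \<ominus>\<^bsub>B\<^esub> f (s (Suc n)) = (y \<ominus>\<^bsub>B\<^esub> f (s n)) \<ominus>\<^bsub>B\<^esub> f w"
        using map_closed[OF c(1)] map_closed[OF c(2)] yc(1) unfolding sSn map_add[OF c(1,2)] by algebra
      then show ?case using w c by (simp add: sSn selfadj_def A.star_add)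
    qed
  have sc: "s n \<in> carrier A" for n using inv[of n] by (simp add: selfadj_def)
  have step: "cnorm A (s (Suc n) \<ominus>\<^bsub>A\<^esub> s n) \<le> 2 * C * (4/5) ^ n" for n
  proof -
    define w where "w = F (y \<ominus>\<^bsub>B\<^esub> f (s n)) (C * (4/5) ^ n)"
    have w: "w \<in> carrier A" "cnorm A w \<le> 2 * (C * (4/5) ^ n)"
      using incr[of n] inv[of n] unfolding w_def selfadj_def by blast+
    have "s (Suc n) \<ominus>\<^bsub>A\<^esub> s n = w"
      unfolding sS w_def[symmetric] using w(1) sc[of n] by algebra
    then show ?thesis using w by simp
  qed
  have "ncauchy A (cnorm A) s"
    by (rule A.ncauchy_summable[where b = "\<lambda>n. 2 * C * (4/5) ^ n"]) (use sc step in \<open>auto intro!: summable_mult\<close>)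
  then obtain l where l: "nconv A (cnorm A) s l" using A.ncomplete by (auto simp: ncomplete_def)
  have "nconv B (cnorm B) (\<lambda>n. f (s n)) y"
  proof (rule B.nconvI_bound)
    show "range (\<lambda>n. f (s n)) \<subseteq> carrier B" "y \<in> carrier B" using sc yc by auto
    show "cnorm B (f (s n) \<ominus>\<^bsub>B\<^esub> y) \<le> C * (4/5) ^ n" for n
      using inv[of n] B.nm_commute[of y "f (s n)"] yc sc by simp
    show "(\<lambda>n. C * (4/5) ^ n) \<longlonglongrightarrow> 0"
      using tendsto_mult_left[OF LIMSEQ_realpow_zero[of "4/5::real"], of C] by simp
  qed
  then have "y = f l" using nconv_map[OF l] B.nconv_unique by blast
  then show ?thesis using l by (auto simp: nconv_def)
qed

text \<open>The closure of the range is a subspace stable under adjoints, so it contains the real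
  and imaginary parts of each of its elements.\<close>

theorem closed_range: "ncl B (cnorm B) (f ` carrier A) \<subseteq> f ` carrier A"
proof
  let ?R = "ncl B (cnorm B) (f ` carrier A)"
  fix y assume y: "y \<in> ?R"
  note R = B.ncl_submodule[OF image_submodule, unfolded B.submodule_iff]
  note I = image_submodule[unfolded B.submodule_iff]
  have yc: "y \<in> carrier B" using y by (simp add: ncl_def)
  have sy: "star B y \<in> ?R" by (rule B.ncl_star[OF _ y]) (auto simp flip: map_star)
  obtain a b where ab: "selfadj B a" "selfadj B b" "y = a \<oplus>\<^bsub>B\<^esub> \<i> \<odot>\<^bsub>B\<^esub> b" "star B y = a \<oplus>\<^bsub>B\<^esub> (-\<i>) \<odot>\<^bsub>B\<^esub> b"
    using B.selfadj_parts[OF yc] by blast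
  have c: "a \<in> carrier B" "b \<in> carrier B" using ab by (auto simp: selfadj_def)
  have "y \<oplus>\<^bsub>B\<^esub> star B y = (a \<oplus>\<^bsub>B\<^esub> a) \<oplus>\<^bsub>B\<^esub> (\<i> \<odot>\<^bsub>B\<^esub> b \<oplus>\<^bsub>B\<^esub> (-\<i>) \<odot>\<^bsub>B\<^esub> b)"
    unfolding ab(4) using c by (simp add: ab(3) B.M.a_ac)
  also have "a \<oplus>\<^bsub>B\<^esub> a = 2 \<odot>\<^bsub>B\<^esub> a" using c B.smult_ladd[of a 1 1] by simp
  also have "\<i> \<odot>\<^bsub>B\<^esub> b \<oplus>\<^bsub>B\<^esub> (-\<i>) \<odot>\<^bsub>B\<^esub> b = \<zero>\<^bsub>B\<^esub>" using c B.smult_ladd[of b \<i> "-\<i>"] by simp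
  finally have "a = (1/2) \<odot>\<^bsub>B\<^esub> (y \<oplus>\<^bsub>B\<^esub> star B y)" using c by simp
  then have aR: "a \<in> ?R" using R y sy by simp
  have "y \<ominus>\<^bsub>B\<^esub> a = \<i> \<odot>\<^bsub>B\<^esub> b" unfolding ab(3) using c(1) B.smult_cl[OF c(2), of \<i>] by algebra
  then have "b = (-\<i>) \<odot>\<^bsub>B\<^esub> (y \<ominus>\<^bsub>B\<^esub> a)" using c by simp
  then have bR: "b \<in> ?R" using R submodule_minus[OF B.cvec_axioms B.ncl_submodule[OF image_submodule] y aR] by simp
  have "a \<in> f ` carrier A" "b \<in> f ` carrier A" using closed_range_selfadj ab aR bR by blast+
  then show "y \<in> f ` carrier A" unfolding ab(3) using I by blast
qed

lemma image_subalgebra: "cstar_subalgebra B (f ` carrier A)"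
  unfolding B.cstar_subalgebra_iff using image_submodule closed_range
  by (auto simp flip: map_mult map_star)

lemma range_generated:
  assumes "generated_by B G" and "G \<subseteq> f ` carrier A"
  shows "f ` carrier A = carrier B"
  using assms image_subalgebra unfolding generated_by_def by blast

end

text \<open>The set on which two *-homomorphisms agree is a C*-subalgebra; it is closed because both
  are contractive.\<close>

lemma cstar_hom_eqI:
  assumes "cstar_hom A B f" and "cstar_hom A B g" and "generated_by A G"
    and "G \<subseteq> carrier A" and "\<And>x. x \<in> G \<Longrightarrow> f x = g x" and "x \<in> carrier A"
  shows "f x = g x"
proof -
  interpret F: cstar_hom A B f by fact
  interpret G: cstar_hom A B g by fact
  let ?E = "{x \<in> carrier A. f x = g x}"
  have "cstar_subalgebra A ?E"
    unfolding F.A.cstar_subalgebra_iff F.A.submodule_iff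
  proof (intro conjI ballI allI subsetI)
    fix x assume x: "x \<in> ncl A (cnorm A) ?E"
    then have xc: "x \<in> carrier A" by (simp add: ncl_def)
    have "f x = g x"
    proof (rule F.B.nm_diff_lt_eqI)
      fix e :: real assume e: "e > 0"
      obtain y where y: "y \<in> ?E" "y \<in> carrier A" "cnorm A (x \<ominus>\<^bsub>A\<^esub> y) < e/2" using F.A.nclE[OF x half_gt_zero[OF e]] by blast
      have "cnorm B (f x \<ominus>\<^bsub>B\<^esub> g x) \<le> cnorm B (f x \<ominus>\<^bsub>B\<^esub> f y) + cnorm B (g y \<ominus>\<^bsub>B\<^esub> g x)"
        using F.B.nm_tri[of "f x" "f y" "g x"] y xc by simp
      also have "\<dots> \<le> e/2 + e/2"
        using F.norm_map_diff[OF xc y(2)] G.norm_map_diff[OF y(2) xc] F.A.nm_commute[OF xc y(2)] y(3)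
        by (intro add_mono) auto
      finally show "cnorm B (f x \<ominus>\<^bsub>B\<^esub> g x) \<le> e" by simp
    qed (use xc in auto)
    then show "x \<in> ?E" using xc by simp
  qed (auto simp: F.map_add G.map_add F.map_smult G.map_smult F.map_mult G.map_mult F.map_star G.map_star)
  then have "?E = carrier A" using assms(3-5) unfolding generated_by_def by blast
  then show ?thesis using assms(6) by blast
qed

lemma cstar_homI:
  "\<lbrakk>cstar_algebra A; cstar_algebra B; star_hom A B f\<rbrakk> \<Longrightarrow> cstar_hom A B f"
  by (simp add: cstar_hom_def cstar_hom_axioms_def)

lemma star_hom_comp:
  "\<lbrakk>star_hom A B f; star_hom B C g\<rbrakk> \<Longrightarrow> star_hom A C (\<lambda>x. g (f x))"
  by (auto simp: star_hom_def linear_map_def Pi_iff)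

lemma star_hom_carrier_update:
  "\<lbrakk>star_hom A B f; S \<subseteq> carrier B; \<And>x. x \<in> carrier A \<Longrightarrow> f x \<in> S\<rbrakk> \<Longrightarrow> star_hom A (B\<lparr>carrier := S\<rparr>) f"
  by (auto simp: star_hom_def linear_map_def)

lemma star_hom_carrier_update_dest:
  "\<lbrakk>star_hom A (B\<lparr>carrier := S\<rparr>) f; S \<subseteq> carrier B\<rbrakk> \<Longrightarrow> star_hom A B f"
  by (auto simp: star_hom_def linear_map_def Pi_iff)

lemma star_hom_carrier_restrict:
  "\<lbrakk>star_hom A B f; S \<subseteq> carrier A\<rbrakk> \<Longrightarrow> star_hom (A\<lparr>carrier := S\<rparr>) B f"
  by (auto simp: star_hom_def linear_map_def subset_iff)

section \<open>Images, quotients, pullbacks\<close>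

text \<open>Conditions on a surjection that make its target a C*-algebra; \<open>q_norm_le\<close>
  and \<open>q_lift\<close> together say that the target has the quotient norm. Quotients by ideals
  and copies along injections are both instances, so completeness and the norm axioms are derived
  once for both.\<close>

locale cstar_image = A: cstar_algebra A for A :: "'a cstar_algebra" +
  fixes Q :: "'q cstar_algebra" and q :: "'a \<Rightarrow> 'q"
  assumes onto: "q ` carrier A = carrier Q"
    and q_zero: "q \<zero>\<^bsub>A\<^esub> = \<zero>\<^bsub>Q\<^esub>"
    and q_add: "\<lbrakk>x \<in> carrier A; y \<in> carrier A\<rbrakk> \<Longrightarrow> q (x \<oplus>\<^bsub>A\<^esub> y) = q x \<oplus>\<^bsub>Q\<^esub> q y"
    and q_smult: "x \<in> carrier A \<Longrightarrow> q (c \<odot>\<^bsub>A\<^esub> x) = c \<odot>\<^bsub>Q\<^esub> q x"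
    and q_mult: "\<lbrakk>x \<in> carrier A; y \<in> carrier A\<rbrakk> \<Longrightarrow> q (x \<otimes>\<^bsub>A\<^esub> y) = q x \<otimes>\<^bsub>Q\<^esub> q y"
    and q_star: "x \<in> carrier A \<Longrightarrow> q (star A x) = star Q (q x)"
    and q_norm_nonneg: "x \<in> carrier A \<Longrightarrow> 0 \<le> cnorm Q (q x)"
    and q_norm_le: "x \<in> carrier A \<Longrightarrow> cnorm Q (q x) \<le> cnorm A x"
    and q_lift: "\<lbrakk>x \<in> carrier A; e > 0\<rbrakk> \<Longrightarrow> \<exists>y\<in>carrier A. q y = q x \<and> cnorm A y < cnorm Q (q x) + e"
    and q_norm_zero: "\<lbrakk>x \<in> carrier A; cnorm Q (q x) = 0\<rbrakk> \<Longrightarrow> q x = \<zero>\<^bsub>Q\<^esub>"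
    and q_cstar: "x \<in> carrier A \<Longrightarrow> (cnorm Q (q x))\<^sup>2 \<le> cnorm Q (q (star A x \<otimes>\<^bsub>A\<^esub> x))"
begin

lemma q_closed: "x \<in> carrier A \<Longrightarrow> q x \<in> carrier Q"
  using onto by blast

lemma carrier_Q_E: "\<lbrakk>u \<in> carrier Q; \<And>x. \<lbrakk>x \<in> carrier A; u = q x\<rbrakk> \<Longrightarrow> P\<rbrakk> \<Longrightarrow> P"
  using onto by blast

lemma cvec_Q: "cvec Q"
  by (rule cvecI; (elim carrier_Q_E)?)
    (simp_all add: q_closed A.M.a_ac A.smult_ladd A.smult_radd
      flip: q_zero q_add q_smult)

lemma le_mult_epsilon:
  fixes r a b :: real
  assumes "0 \<le> a" "0 \<le> b" and "\<And>e. e > 0 \<Longrightarrow> r \<le> (a + e) * (b + e)"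
  shows "r \<le> a * b"
proof (rule tendsto_lowerbound)
  show "((\<lambda>e. (a + e) * (b + e)) \<longlongrightarrow> a * b) (at_right 0)"
    by (rule tendsto_eq_intros | simp)+
  show "eventually (\<lambda>e. r \<le> (a + e) * (b + e)) (at_right 0)"
    using assms(3) by (simp add: eventually_at_right_less eventually_mono[OF eventually_at_right_less])
qed simp

lemma norm_Q_mult:
  assumes x: "x \<in> carrier A" and y: "y \<in> carrier A"
  shows "cnorm Q (q (x \<otimes>\<^bsub>A\<^esub> y)) \<le> cnorm Q (q x) * cnorm Q (q y)"
proof (rule le_mult_epsilon[OF q_norm_nonneg[OF x] q_norm_nonneg[OF y]])
  fix e :: real assume e: "e > 0"
  obtain x' where x': "x' \<in> carrier A" "q x' = q x" "cnorm A x' < cnorm Q (q x) + e" using q_lift[OF x e] by blast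
  obtain y' where y': "y' \<in> carrier A" "q y' = q y" "cnorm A y' < cnorm Q (q y) + e" using q_lift[OF y e] by blast
  have "cnorm Q (q (x \<otimes>\<^bsub>A\<^esub> y)) = cnorm Q (q (x' \<otimes>\<^bsub>A\<^esub> y'))" using x y x' y' by (simp add: q_mult)
  also have "\<dots> \<le> cnorm A x' * cnorm A y'"
    using q_norm_le[of "x' \<otimes>\<^bsub>A\<^esub> y'"] A.norm_mult[of x' y'] x' y' by simp
  also have "\<dots> \<le> (cnorm Q (q x) + e) * (cnorm Q (q y) + e)"
    using x' y' A.norm_nonneg q_norm_nonneg[OF x] e by (intro mult_mono) auto
  finally show "cnorm Q (q (x \<otimes>\<^bsub>A\<^esub> y)) \<le> (cnorm Q (q x) + e) * (cnorm Q (q y) + e)" .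
qed

lemma norm_Q_star_le:
  assumes x: "x \<in> carrier A" shows "cnorm Q (q (star A x)) \<le> cnorm Q (q x)"
proof (rule field_le_epsilon)
  fix e :: real assume e: "e > 0"
  obtain x' where x': "x' \<in> carrier A" "q x' = q x" "cnorm A x' < cnorm Q (q x) + e" using q_lift[OF x e] by blast
  then have "cnorm Q (q (star A x)) = cnorm Q (q (star A x'))" using x by (simp add: q_star)
  also have "\<dots> \<le> cnorm A x'" using q_norm_le[of "star A x'"] x' by simp
  finally show "cnorm Q (q (star A x)) \<le> cnorm Q (q x) + e" using x' by simp
qed

lemma cnspace_Q: "cnspace Q (cnorm Q)"
proof (intro cnspace.intro cvec_Q cnspace_axioms.intro)
  interpret Q: cvec Q by (rule cvec_Q)
  fix u assume u: "u \<in> carrier Q"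
  then obtain x where x: "x \<in> carrier A" "u = q x" by (rule carrier_Q_E)
  show "0 \<le> cnorm Q u" using x q_norm_nonneg by simp
  have 0: "cnorm Q \<zero>\<^bsub>Q\<^esub> = 0"
    using q_norm_le[of "\<zero>\<^bsub>A\<^esub>"] q_norm_nonneg[of "\<zero>\<^bsub>A\<^esub>"] by (simp add: q_zero)
  show "cnorm Q u = 0 \<longleftrightarrow> u = \<zero>\<^bsub>Q\<^esub>" using q_norm_zero[OF x(1)] x(2) 0 by metis
  have le: "cnorm Q (c \<odot>\<^bsub>Q\<^esub> q x) \<le> cmod c * cnorm Q (q x)" if x: "x \<in> carrier A" for c x
  proof (rule field_le_epsilon)
    fix e :: real assume e: "e > 0"
    then have e': "e / (cmod c + 1) > 0" by (simp add: add_nonneg_pos)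
    obtain x' where x': "x' \<in> carrier A" "q x' = q x" "cnorm A x' < cnorm Q (q x) + e / (cmod c + 1)"
      using q_lift[OF x e'] by blast
    have "cnorm Q (c \<odot>\<^bsub>Q\<^esub> q x) = cnorm Q (q (c \<odot>\<^bsub>A\<^esub> x'))" using x' by (simp add: q_smult)
    also have "\<dots> \<le> cmod c * cnorm A x'" using q_norm_le[of "c \<odot>\<^bsub>A\<^esub> x'"] x' by (simp add: A.norm_smult)
    also have "\<dots> \<le> cmod c * (cnorm Q (q x) + e / (cmod c + 1))" using x' by (intro mult_left_mono) auto
    also have "\<dots> = cmod c * cnorm Q (q x) + cmod c * (e / (cmod c + 1))" by (simp add: distrib_left)
    also have "cmod c * (e / (cmod c + 1)) \<le> (cmod c + 1) * (e / (cmod c + 1))" using e' by (intro mult_right_mono) auto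
    also have "\<dots> = e" using add_nonneg_pos[OF norm_ge_zero zero_less_one, of c] by simp
    finally show "cnorm Q (c \<odot>\<^bsub>Q\<^esub> q x) \<le> cmod c * cnorm Q (q x) + e" by simp
  qed
  show "cnorm Q (c \<odot>\<^bsub>Q\<^esub> u) = cmod c * cnorm Q u" for c
  proof (cases "c = 0")
    case True
    then show ?thesis using u 0 by simp
  next
    case False
    have "cnorm Q u \<le> cmod (1/c) * cnorm Q (c \<odot>\<^bsub>Q\<^esub> u)"
      using le[of "c \<odot>\<^bsub>A\<^esub> x" "1/c"] x u False by (simp add: q_smult)
    then show ?thesis using le[OF x(1), of c] x(2) False by (simp add: norm_divide field_simps)
  qed
  fix v assume "v \<in> carrier Q"
  then obtain y where y: "y \<in> carrier A" "v = q y" by (rule carrier_Q_E)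
  show "cnorm Q (u \<oplus>\<^bsub>Q\<^esub> v) \<le> cnorm Q u + cnorm Q v"
  proof (rule field_le_epsilon)
    fix e :: real assume e: "e > 0"
    obtain x' where x': "x' \<in> carrier A" "q x' = q x" "cnorm A x' < cnorm Q (q x) + e/2"
      using q_lift[OF x(1) half_gt_zero[OF e]] by blast
    obtain y' where y': "y' \<in> carrier A" "q y' = q y" "cnorm A y' < cnorm Q (q y) + e/2"
      using q_lift[OF y(1) half_gt_zero[OF e]] by blast
    have "cnorm Q (u \<oplus>\<^bsub>Q\<^esub> v) = cnorm Q (q (x' \<oplus>\<^bsub>A\<^esub> y'))" using x y x' y' by (simp add: q_add)
    also have "\<dots> \<le> cnorm A x' + cnorm A y'"
      using q_norm_le[of "x' \<oplus>\<^bsub>A\<^esub> y'"] A.norm_add[of x' y'] x' y' by simp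
    finally show "cnorm Q (u \<oplus>\<^bsub>Q\<^esub> v) \<le> cnorm Q u + cnorm Q v + e" using x' y' x y by simp
  qed
qed

lemma q_diff: "\<lbrakk>x \<in> carrier A; y \<in> carrier A\<rbrakk> \<Longrightarrow> q (x \<ominus>\<^bsub>A\<^esub> y) = q x \<ominus>\<^bsub>Q\<^esub> q y"
  using cvec.minus_smult[OF cvec_Q, of "q x" "q y"] by (simp add: A.minus_smult q_add q_smult q_closed)

text \<open>Consecutive differences of norm at most 2^-n lift to elements of norm at most 2 * 2^-n,
  the slack in \<open>q_lift\<close> being 2^-n. The lifted series converges in A, and its limit is
  pushed down.\<close>

lemma ncomplete_Q: "ncomplete Q (cnorm Q)"
proof -
  interpret Q: cnspace Q "cnorm Q" by (rule cnspace_Q)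
  show ?thesis
  proof (rule Q.ncomplete_geometricI)
    fix t :: "nat \<Rightarrow> 'q"
    assume t: "range t \<subseteq> carrier Q" "\<And>n. cnorm Q (t (Suc n) \<ominus>\<^bsub>Q\<^esub> t n) \<le> (1/2) ^ n"
    have tc: "t n \<in> carrier Q" for n using t(1) by auto
    have "\<exists>d. d \<in> carrier A \<and> q d = t (Suc n) \<ominus>\<^bsub>Q\<^esub> t n \<and> cnorm A d \<le> 2 * (1/2) ^ n" for n
    proof -
      have "t (Suc n) \<ominus>\<^bsub>Q\<^esub> t n \<in> carrier Q" using tc by simp
      then obtain x where x: "x \<in> carrier A" "t (Suc n) \<ominus>\<^bsub>Q\<^esub> t n = q x" by (rule carrier_Q_E)
      have "(1/2::real) ^ n > 0" by simp
      then obtain d where "d \<in> carrier A" "q d = q x" "cnorm A d < cnorm Q (q x) + (1/2) ^ n"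
        using q_lift[OF x(1)] by blast
      then show ?thesis using x t(2)[of n] by (intro exI[of _ d]) auto
    qed
    then obtain d where d: "\<And>n. d n \<in> carrier A" "\<And>n. q (d n) = t (Suc n) \<ominus>\<^bsub>Q\<^esub> t n"
      "\<And>n. cnorm A (d n) \<le> 2 * (1/2) ^ n" by metis
    obtain x0 where x0: "x0 \<in> carrier A" "t 0 = q x0" using tc[of 0] by (rule carrier_Q_E)
    define s where "s = rec_nat x0 (\<lambda>n x. x \<oplus>\<^bsub>A\<^esub> d n)"
    have s0: "s 0 = x0" and sS: "s (Suc n) = s n \<oplus>\<^bsub>A\<^esub> d n" for n by (simp_all add: s_def)
    have sc: "s n \<in> carrier A" for n by (induction n) (simp_all add: s0 sS x0 d)
    have qs: "q (s n) = t n" for n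
    proof (induction n)
      case (Suc n)
      then show ?case using sc d tc Q.vs_swap_sum[of "t (Suc n)" "t n"] by (simp add: sS q_add Q.M.a_comm)
    qed (simp add: s0 x0)
    have step: "cnorm A (s (Suc n) \<ominus>\<^bsub>A\<^esub> s n) \<le> 2 * (1/2) ^ n" for n
    proof -
      have "s (Suc n) \<ominus>\<^bsub>A\<^esub> s n = d n" unfolding sS using sc[of n] d(1)[of n] by algebra
      then show ?thesis using d by simp
    qed
    have "ncauchy A (cnorm A) s"
      by (rule A.ncauchy_summable[where b = "\<lambda>n. 2 * (1/2) ^ n"]) (use sc step in \<open>auto intro!: summable_mult\<close>)
    then obtain l where l: "nconv A (cnorm A) s l" using A.ncomplete by (auto simp: ncomplete_def)
    have lc: "l \<in> carrier A" using l by (simp add: nconv_def)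
    have "nconv Q (cnorm Q) t (q l)"
    proof (rule Q.nconvI_bound[OF t(1) q_closed[OF lc]])
      show "cnorm Q (t n \<ominus>\<^bsub>Q\<^esub> q l) \<le> cnorm A (s n \<ominus>\<^bsub>A\<^esub> l)" for n
        using q_norm_le[of "s n \<ominus>\<^bsub>A\<^esub> l"] sc lc by (simp add: q_diff qs)
      show "(\<lambda>n. cnorm A (s n \<ominus>\<^bsub>A\<^esub> l)) \<longlonglongrightarrow> 0" using l by (simp add: nconv_def)
    qed
    then show "\<exists>l. nconv Q (cnorm Q) t l" by blast
  qed
qed

lemma cstar_Q: "cstar_algebra Q"
proof (rule cstar_algebraI[OF cnspace_Q ncomplete_Q])
  fix u assume "u \<in> carrier Q"
  then obtain x where x: "x \<in> carrier A" "u = q x" by (rule carrier_Q_E)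
  show "cnorm Q (star Q u \<otimes>\<^bsub>Q\<^esub> u) = (cnorm Q u)\<^sup>2"
  proof (rule antisym)
    have "cnorm Q (star Q u \<otimes>\<^bsub>Q\<^esub> u) \<le> cnorm Q (q (star A x)) * cnorm Q (q x)"
      using norm_Q_mult[of "star A x" x] x by (simp add: q_mult q_star)
    also have "\<dots> \<le> cnorm Q (q x) * cnorm Q (q x)"
      by (rule mult_right_mono[OF norm_Q_star_le q_norm_nonneg]) (use x in auto)
    finally show "cnorm Q (star Q u \<otimes>\<^bsub>Q\<^esub> u) \<le> (cnorm Q u)\<^sup>2" by (simp add: x power2_eq_square)
    show "(cnorm Q u)\<^sup>2 \<le> cnorm Q (star Q u \<otimes>\<^bsub>Q\<^esub> u)"
      using q_cstar[OF x(1)] x by (simp add: q_mult q_star)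
  qed
qed ((elim carrier_Q_E)?; (simp add: q_closed norm_Q_mult A.mult_assoc A.mult_add_left A.mult_add_right
      A.star_smult A.star_add A.star_mult flip: q_add q_smult q_mult q_star; fail)?;
    (simp add: norm_Q_mult flip: q_mult)?)+

lemma star_hom_q: "star_hom A Q q"
  by (auto simp: star_hom_def linear_map_def q_closed q_add q_smult q_mult q_star)

end

section \<open>Quotients by closed ideals\<close>

locale ideal_quotient = cstar_algebra A for A :: "'a cstar_algebra" (structure) +
  fixes K :: "'a set"
  assumes ideal: "closed_ideal A K"
begin

lemma K_sub: "submodule K complex_ring A"
  and K_mult: "\<lbrakk>a \<in> carrier A; k \<in> K\<rbrakk> \<Longrightarrow> a \<otimes> k \<in> K" "\<lbrakk>a \<in> carrier A; k \<in> K\<rbrakk> \<Longrightarrow> k \<otimes> a \<in> K"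
  and K_closed: "ncl A (cnorm A) K \<subseteq> K"
  using ideal by (auto simp: closed_ideal_iff)

lemma K_carrier: "k \<in> K \<Longrightarrow> k \<in> carrier A"
  using K_sub by (auto simp: submodule_iff)

lemma K_ops: "\<zero> \<in> K" "\<lbrakk>x \<in> K; y \<in> K\<rbrakk> \<Longrightarrow> x \<oplus> y \<in> K" "x \<in> K \<Longrightarrow> c \<odot> x \<in> K" "\<lbrakk>x \<in> K; y \<in> K\<rbrakk> \<Longrightarrow> x \<ominus> y \<in> K"
  "x \<in> K \<Longrightarrow> \<ominus> x \<in> K"
  using K_sub submodule_minus[OF cvec_axioms K_sub] neg_smult K_carrier by (auto simp: submodule_iff)

lemma approximate_unit:
  assumes k: "k \<in> carrier A" and e: "e > 0" and J: "submodule J complex_ring A" "\<And>a x. \<lbrakk>a \<in> carrier A; x \<in> J\<rbrakk> \<Longrightarrow> x \<otimes> a \<in> J"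
    "\<And>a x. \<lbrakk>a \<in> carrier A; x \<in> J\<rbrakk> \<Longrightarrow> a \<otimes> x \<in> J" and kJ: "k \<in> J"
  obtains u where "u \<in> J" and "star A u = u" and "cnorm A (k \<ominus> u \<otimes> k) < e"
    and "\<And>x. x \<in> carrier A \<Longrightarrow> cnorm A (x \<ominus> u \<otimes> x) \<le> cnorm A x"
proof -
  define c where "c = complex_of_real (cnorm A k + 1)"
  have c: "cmod c = cnorm A k + 1" using norm_nonneg[OF k] by (simp add: c_def del: of_real_add)
  then have c0: "c \<noteq> 0" "cmod c > 0" using norm_nonneg[OF k] by auto
  define x where "x = (1/c) \<odot> k"
  have x: "x \<in> carrier A" "cnorm A x \<le> 1" using k c norm_nonneg[OF k] by (simp_all add: x_def norm_smult norm_divide)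
  have xJ: "x \<in> J" using kJ J(1) by (simp add: x_def submodule_iff)
  define h where "h = x \<otimes> star A x"
  define g where "g = h \<otimes> h"
  have hc: "h \<in> carrier A" using x by (simp add: h_def)
  have hJ: "h \<in> J" using xJ x J by (simp add: h_def)
  interpret small_square A h g
    using x by unfold_locales (simp_all add: h_def g_def selfadj_def star_mult cstar_identity' power_le_one norm_nonneg)
  have "e / cmod c > 0" using e c0 by simp
  then obtain n where n: "n > 0" "cnorm A (x \<ominus> qmean g n \<otimes> x) < e / cmod c"
    using qmean_approx_tendsto[OF x] unfolding g_def h_def by blast
  have gJ: "g \<in> J" using hJ hc J by (simp add: g_def)
  have "qmean g n \<in> J" by (rule qmean_mem[OF J(1) gJ]) (use J(3) gc in blast)
  moreover have "star A (qmean g n) = qmean g n" by (rule qmean_selfadj[OF selfadj_g])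
  moreover have "cnorm A (k \<ominus> qmean g n \<otimes> k) < e"
  proof -
    have "k \<ominus> qmean g n \<otimes> k = c \<odot> (x \<ominus> qmean g n \<otimes> x)" using k c0 by (simp add: x_def smult_diff)
    then show ?thesis using n(2) x c0 by (simp add: norm_smult pos_less_divide_eq mult.commute)
  qed
  ultimately show thesis using that[of "qmean g n"] qmean_contraction n(1) by blast
qed

text \<open>k*u lies in the ideal as soon as u does, and k* is a limit of such elements since k is
  one of elements uk with u self-adjoint.\<close>

lemma K_star: assumes k: "k \<in> K" shows "star A k \<in> K"
proof -
  note kc = K_carrier[OF k]
  have "star A k \<in> ncl A (cnorm A) K"
  proof (rule nclI)
    fix e :: real assume e: "e > 0"
    obtain u where u: "u \<in> K" "star A u = u" "cnorm A (k \<ominus> u \<otimes> k) < e"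
      using approximate_unit[OF kc e K_sub K_mult(2) K_mult(1) k] by blast
    have uc: "u \<in> carrier A" using u K_carrier by blast
    have "star A k \<otimes> u \<in> K" using u kc K_mult by simp
    moreover have "cnorm A (star A k \<ominus> star A k \<otimes> u) < e"
      using norm_star_diff[of k "u \<otimes> k"] u kc uc by (simp add: star_mult)
    ultimately show "\<exists>y\<in>K. y \<in> carrier A \<and> cnorm A (star A k \<ominus> y) < e" using K_carrier by blast
  qed (use kc in simp)
  then show ?thesis using K_closed by blast
qed

definition coset :: "'a \<Rightarrow> 'a set"
  where "coset x = {y \<in> carrier A. x \<ominus> y \<in> K}"

definition rep :: "'a set \<Rightarrow> 'a"
  where "rep S = (SOME y. y \<in> S)"

text \<open>The operations are computed on chosen representatives; that cosets do not depend on the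
  choice is checked when \<open>quot\<close> is interpreted below.\<close>

definition Quot :: "'a set cstar_algebra"
  where "Quot = \<lparr>carrier = coset ` carrier A,
    monoid.mult = (\<lambda>S T. coset (rep S \<otimes> rep T)), one = {}, zero = coset \<zero>,
    add = (\<lambda>S T. coset (rep S \<oplus> rep T)), Module.module.smult = (\<lambda>c S. coset (c \<odot> rep S)),
    star = (\<lambda>S. coset (star A (rep S))), cnorm = (\<lambda>S. INF y\<in>S. cnorm A y)\<rparr>"

lemma coset_self: "x \<in> carrier A \<Longrightarrow> x \<in> coset x"
  using K_ops(1) by (simp add: coset_def M.minus_eq M.r_neg)

lemma coset_eq_iff: assumes x: "x \<in> carrier A" and y: "y \<in> carrier A"
  shows "coset x = coset y \<longleftrightarrow> x \<ominus> y \<in> K"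
proof
  assume "coset x = coset y"
  then have "y \<in> coset x" using coset_self[OF y] by simp
  then show "x \<ominus> y \<in> K" by (simp add: coset_def)
next
  assume xy: "x \<ominus> y \<in> K"
  have "x \<ominus> z \<in> K \<longleftrightarrow> y \<ominus> z \<in> K" if z: "z \<in> carrier A" for z
  proof -
    have "x \<ominus> z = (x \<ominus> y) \<oplus> (y \<ominus> z)" "y \<ominus> z = (x \<ominus> z) \<ominus> (x \<ominus> y)" using x y z by algebra+
    then show ?thesis using K_ops xy by metis
  qed
  then show "coset x = coset y" by (auto simp: coset_def)
qed

lemma rep_coset: assumes "x \<in> carrier A"
  shows "rep (coset x) \<in> carrier A" and "coset (rep (coset x)) = coset x" and "rep (coset x) \<ominus> x \<in> K"
proof -
  have "rep (coset x) \<in> coset x" unfolding rep_def using coset_self[OF assms] by (rule someI)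
  then have 1: "rep (coset x) \<in> carrier A" "x \<ominus> rep (coset x) \<in> K" by (auto simp: coset_def)
  have "rep (coset x) \<ominus> x = \<ominus> (x \<ominus> rep (coset x))" using 1(1) assms by algebra
  then show "rep (coset x) \<in> carrier A" "rep (coset x) \<ominus> x \<in> K" using 1 K_ops(5) by auto
  then show "coset (rep (coset x)) = coset x" using coset_eq_iff assms by blast
qed

lemma Quot_norm_le: "\<lbrakk>x \<in> carrier A; y \<in> coset x\<rbrakk> \<Longrightarrow> cnorm Quot (coset x) \<le> cnorm A y"
  unfolding Quot_def by (auto intro!: cINF_lower bdd_belowI2[of _ 0] simp: coset_def norm_nonneg)

lemma Quot_norm_lift:
  assumes "x \<in> carrier A" and "e > 0"
  shows "\<exists>y\<in>coset x. cnorm A y < cnorm Quot (coset x) + e"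
proof (rule ccontr)
  assume "\<not> ?thesis"
  then have "cnorm Quot (coset x) + e \<le> (INF y\<in>coset x. cnorm A y)"
    using coset_self[OF assms(1)] by (intro cINF_greatest) (auto simp: not_less)
  then show False using assms(2) by (simp add: Quot_def)
qed

lemma Quot_norm_greatest:
  "\<lbrakk>x \<in> carrier A; \<And>y. y \<in> coset x \<Longrightarrow> r \<le> cnorm A y\<rbrakk> \<Longrightarrow> r \<le> cnorm Quot (coset x)"
  unfolding Quot_def using coset_self by (auto intro!: cINF_greatest)

text \<open>Let y represent the coset of x*x and k = x*x - y. For u in K, x - xu represents the
  coset of x, and the square of its norm is ||(1 - u)(y + k)(1 - u)|| <= ||y|| + ||k - ku||. A
  suitable u makes the last term small.\<close>

lemma Quot_cstar:
  assumes x: "x \<in> carrier A" shows "(cnorm Quot (coset x))\<^sup>2 \<le> cnorm Quot (coset (star A x \<otimes> x))"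
proof (rule Quot_norm_greatest)
  let ?p = "star A x \<otimes> x"
  have pc: "?p \<in> carrier A" using x by simp
  fix y assume "y \<in> coset ?p"
  then have y: "y \<in> carrier A" "?p \<ominus> y \<in> K" by (auto simp: coset_def)
  define k where "k = ?p \<ominus> y"
  have kK: "k \<in> K" "star A k \<in> K" and kc: "k \<in> carrier A" using y K_carrier K_star by (auto simp: k_def)
  have pyk: "?p = y \<oplus> k" unfolding k_def using y(1) pc by algebra
  show "(cnorm Quot (coset x))\<^sup>2 \<le> cnorm A y"
  proof (rule field_le_epsilon)
    fix e :: real assume e: "e > 0"
    \<comment> \<open>Chosen for the adjoint of k, because \<open>approximate_unit\<close>
      multiplies from the left while k - ku is to be small.\<close>
    obtain u where u: "u \<in> K" "star A u = u" "cnorm A (star A k \<ominus> u \<otimes> star A k) < e"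
      and contr: "\<And>x. x \<in> carrier A \<Longrightarrow> cnorm A (x \<ominus> u \<otimes> x) \<le> cnorm A x"
      using approximate_unit[OF star_closed[OF kc] e K_sub K_mult(2) K_mult(1) kK(2)] by blast
    have uc: "u \<in> carrier A" using u K_carrier by blast
    have contr': "cnorm A (w \<ominus> w \<otimes> u) \<le> cnorm A w" if w: "w \<in> carrier A" for w
    proof -
      have "star A (w \<ominus> w \<otimes> u) = star A w \<ominus> u \<otimes> star A w" using w uc u by (simp add: star_diff star_mult)
      then show ?thesis using contr[of "star A w"] w uc norm_star[of "w \<ominus> w \<otimes> u"] by simp
    qed
    let ?z = "x \<ominus> x \<otimes> u"
    have zc: "?z \<in> carrier A" using x uc by simp
    have "x \<ominus> ?z = x \<otimes> u" using x uc by algebra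
    then have "?z \<in> coset x" using zc K_mult(1)[OF x u(1)] by (simp add: coset_def)
    then have "(cnorm Quot (coset x))\<^sup>2 \<le> (cnorm A ?z)\<^sup>2"
      using Quot_norm_le[OF x] Quot_norm_greatest[OF x, of 0] by (intro power_mono) (auto simp: norm_nonneg coset_def)
    also have "\<dots> = cnorm A (star A ?z \<otimes> ?z)" using cstar_identity[OF zc] by simp
    also have "star A ?z = star A x \<ominus> u \<otimes> star A x" using x uc u(2) by (simp add: star_diff star_mult)
    also have "(star A x \<ominus> u \<otimes> star A x) \<otimes> ?z = (?p \<ominus> ?p \<otimes> u) \<ominus> u \<otimes> (?p \<ominus> ?p \<otimes> u)"
      using x uc u(2) by (simp add: star_diff star_mult M.minus_eq M.minus_add mult_add_left mult_add_right mult_neg_left mult_neg_right mult_assoc M.a_ac)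
    also have "\<dots> = ((y \<ominus> y \<otimes> u) \<ominus> u \<otimes> (y \<ominus> y \<otimes> u)) \<oplus> ((k \<ominus> k \<otimes> u) \<ominus> u \<otimes> (k \<ominus> k \<otimes> u))"
      unfolding pyk using y(1) kc uc by algebra
    also have "cnorm A \<dots> \<le> cnorm A (y \<ominus> y \<otimes> u) + cnorm A (k \<ominus> k \<otimes> u)"
      using y(1) kc uc by (intro order_trans[OF norm_add] add_mono contr) auto
    also have "\<dots> \<le> cnorm A y + e"
    proof (rule add_mono[OF contr'[OF y(1)]])
      have "star A (star A k \<ominus> u \<otimes> star A k) = k \<ominus> k \<otimes> u" using kc uc u(2) by (simp add: star_diff star_mult)
      then show "cnorm A (k \<ominus> k \<otimes> u) \<le> e" using u(3) norm_star[of "star A k \<ominus> u \<otimes> star A k"] kc uc by simp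
    qed
    finally show "(cnorm Quot (coset x))\<^sup>2 \<le> cnorm A y + e" .
  qed
qed (use x in simp)

sublocale quot: cstar_image A Quot coset
proof unfold_locales
  show "coset ` carrier A = carrier Quot" "coset \<zero> = \<zero>\<^bsub>Quot\<^esub>" by (simp_all add: Quot_def)
  fix x assume x: "x \<in> carrier A"
  note rx = rep_coset[OF x]
  show "coset (c \<odot> x) = c \<odot>\<^bsub>Quot\<^esub> coset x" for c
  proof -
    have "coset (c \<odot> rep (coset x)) = coset (c \<odot> x)"
      using rx x K_ops(3)[OF rx(3), of c] by (simp add: coset_eq_iff smult_diff)
    then show ?thesis by (simp add: Quot_def)
  qed
  show "coset (star A x) = star Quot (coset x)"
  proof -
    have "coset (star A (rep (coset x))) = coset (star A x)"
      using rx x K_star[OF rx(3)] by (simp add: coset_eq_iff star_diff)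
    then show ?thesis by (simp add: Quot_def)
  qed
  show "0 \<le> cnorm Quot (coset x)" by (rule Quot_norm_greatest[OF x]) (simp add: coset_def norm_nonneg)
  show "cnorm Quot (coset x) \<le> cnorm A x" by (rule Quot_norm_le[OF x coset_self[OF x]])
  show "\<exists>y\<in>carrier A. coset y = coset x \<and> cnorm A y < cnorm Quot (coset x) + e" if e: "e > 0" for e
  proof -
    obtain y where y: "y \<in> coset x" "cnorm A y < cnorm Quot (coset x) + e" using Quot_norm_lift[OF x e] by blast
    then have yc: "y \<in> carrier A" "x \<ominus> y \<in> K" by (auto simp: coset_def)
    then have "coset y = coset x" using coset_eq_iff[OF x yc(1)] by simp
    then show ?thesis using y yc by blast
  qed
  show "coset x = \<zero>\<^bsub>Quot\<^esub>" if 0: "cnorm Quot (coset x) = 0"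
  proof -
    have "x \<in> ncl A (cnorm A) K"
    proof (rule nclI[OF x])
      fix e :: real assume e: "e > 0"
      obtain y where y: "y \<in> coset x" "cnorm A y < e" using Quot_norm_lift[OF x e] 0 by auto
      then have yc: "y \<in> carrier A" "x \<ominus> y \<in> K" by (auto simp: coset_def)
      have "x \<ominus> (x \<ominus> y) = y" using x yc(1) by algebra
      then show "\<exists>y\<in>K. y \<in> carrier A \<and> cnorm A (x \<ominus> y) < e"
        using yc y x by (intro bexI[of _ "x \<ominus> y"]) auto
    qed
    then have "x \<in> K" using K_closed by blast
    then have "coset x = coset \<zero>" using x by (simp add: coset_eq_iff M.minus_eq)
    then show ?thesis by (simp add: Quot_def)
  qed
  show "(cnorm Quot (coset x))\<^sup>2 \<le> cnorm Quot (coset (star A x \<otimes> x))" by (rule Quot_cstar[OF x])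
  fix y assume y: "y \<in> carrier A"
  note ry = rep_coset[OF y]
  have "rep (coset x) \<oplus> rep (coset y) \<ominus> (x \<oplus> y) = (rep (coset x) \<ominus> x) \<oplus> (rep (coset y) \<ominus> y)"
    using rx(1) ry(1) x y by algebra
  then have "coset (rep (coset x) \<oplus> rep (coset y)) = coset (x \<oplus> y)"
    using rx ry x y K_ops(2) by (simp add: coset_eq_iff)
  then show "coset (x \<oplus> y) = coset x \<oplus>\<^bsub>Quot\<^esub> coset y" by (simp add: Quot_def)
  have "rep (coset x) \<otimes> rep (coset y) \<ominus> x \<otimes> y
      = rep (coset x) \<otimes> (rep (coset y) \<ominus> y) \<oplus> (rep (coset x) \<ominus> x) \<otimes> y"
    using rx(1) ry(1) x y by algebra
  then have "coset (rep (coset x) \<otimes> rep (coset y)) = coset (x \<otimes> y)"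
    using rx ry x y K_ops(2) K_mult by (simp add: coset_eq_iff)
  then show "coset (x \<otimes> y) = coset x \<otimes>\<^bsub>Quot\<^esub> coset y" by (simp add: Quot_def)
qed

lemma coset_zero_iff: "x \<in> carrier A \<Longrightarrow> coset x = \<zero>\<^bsub>Quot\<^esub> \<longleftrightarrow> x \<in> K"
  using coset_eq_iff[of x \<zero>] by (simp add: Quot_def M.minus_eq)

end

text \<open>A copy of the algebra along an injection; it moves an algebra into the type over which
  the universal property quantifies.\<close>

definition transport :: "'a cstar_algebra \<Rightarrow> ('a \<Rightarrow> 'b) \<Rightarrow> 'b cstar_algebra"
  where "transport A j = (let i = inv_into (carrier A) j in
    \<lparr>carrier = j ` carrier A,
     monoid.mult = (\<lambda>u v. j (i u \<otimes>\<^bsub>A\<^esub> i v)), one = undefined, zero = j \<zero>\<^bsub>A\<^esub>,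
     add = (\<lambda>u v. j (i u \<oplus>\<^bsub>A\<^esub> i v)), Module.module.smult = (\<lambda>c u. j (c \<odot>\<^bsub>A\<^esub> i u)),
     star = (\<lambda>u. j (star A (i u))), cnorm = (\<lambda>u. cnorm A (i u))\<rparr>)"

lemma (in cstar_algebra) transport:
  assumes j: "inj_on j (carrier A)"
  shows "cstar_algebra (transport A j)" and "star_hom A (transport A j) j"
    and "star_hom (transport A j) A (inv_into (carrier A) j)"
proof -
  have i [simp]: "inv_into (carrier A) j (j x) = x" if "x \<in> carrier A" for x using j that by simp
  interpret I: cstar_image A "transport A j" j
    by unfold_locales
      (auto simp: transport_def Let_def norm_nonneg norm_eq_zero cstar_identity intro!: bexI[of _ "_ :: 'a"])
  show "cstar_algebra (transport A j)" by (rule I.cstar_Q)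
  show "star_hom A (transport A j) j" by (rule I.star_hom_q)
  show "star_hom (transport A j) A (inv_into (carrier A) j)"
    by (auto simp: star_hom_def linear_map_def transport_def Let_def)
qed

section \<open>Pullbacks\<close>

locale cstar_pullback = F: cstar_hom A C f + G: cstar_hom B C g
  for A :: "'a cstar_algebra" and B :: "'b cstar_algebra" and C :: "'c cstar_algebra" and f g
begin

abbreviation "P \<equiv> pullback A B f g"

lemma carrier_P: "(a, b) \<in> carrier P \<longleftrightarrow> a \<in> carrier A \<and> b \<in> carrier B \<and> f a = g b"
  by (simp add: pullback_def)

lemma P_simps [simp]:
  "(a, b) \<otimes>\<^bsub>P\<^esub> (a', b') = (a \<otimes>\<^bsub>A\<^esub> a', b \<otimes>\<^bsub>B\<^esub> b')" "(a, b) \<oplus>\<^bsub>P\<^esub> (a', b') = (a \<oplus>\<^bsub>A\<^esub> a', b \<oplus>\<^bsub>B\<^esub> b')"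
  "\<zero>\<^bsub>P\<^esub> = (\<zero>\<^bsub>A\<^esub>, \<zero>\<^bsub>B\<^esub>)" "c \<odot>\<^bsub>P\<^esub> (a, b) = (c \<odot>\<^bsub>A\<^esub> a, c \<odot>\<^bsub>B\<^esub> b)" "star P (a, b) = (star A a, star B b)"
  "cnorm P (a, b) = max (cnorm A a) (cnorm B b)"
  by (simp_all add: pullback_def)

lemma cnspace_P: "cnspace P (cnorm P)"
proof (intro cnspace.intro cnspace_axioms.intro)
  show "cvec P"
    by (rule cvecI)
      (auto simp: carrier_P F.map_add G.map_add F.map_smult G.map_smult F.A.M.a_ac G.A.M.a_ac
        F.A.smult_ladd G.A.smult_ladd F.A.smult_radd G.A.smult_radd)
  fix u v c assume u: "u \<in> carrier P"
  then obtain a b where ab: "u = (a, b)" "a \<in> carrier A" "b \<in> carrier B" by (cases u) (auto simp: carrier_P)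
  show "0 \<le> cnorm P u" using ab F.A.norm_nonneg by (simp add: le_max_iff_disj)
  show "cnorm P u = 0 \<longleftrightarrow> u = \<zero>\<^bsub>P\<^esub>"
    using ab F.A.norm_nonneg[of a] G.A.norm_nonneg[of b] F.A.norm_eq_zero[of a] G.A.norm_eq_zero[of b]
    by (auto simp: max_def)
  show "cnorm P (c \<odot>\<^bsub>P\<^esub> u) = cmod c * cnorm P u"
    using ab by (simp add: F.A.norm_smult G.A.norm_smult max_mult_distrib_left)
  assume "v \<in> carrier P"
  then obtain a' b' where ab': "v = (a', b')" "a' \<in> carrier A" "b' \<in> carrier B" by (cases v) (auto simp: carrier_P)
  show "cnorm P (u \<oplus>\<^bsub>P\<^esub> v) \<le> cnorm P u + cnorm P v"
    using ab ab' F.A.norm_add[of a a'] G.A.norm_add[of b b'] by (simp add: max_def)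
qed

lemma P_minus: "\<lbrakk>(a, b) \<in> carrier P; (a', b') \<in> carrier P\<rbrakk> \<Longrightarrow> (a, b) \<ominus>\<^bsub>P\<^esub> (a', b') = (a \<ominus>\<^bsub>A\<^esub> a', b \<ominus>\<^bsub>B\<^esub> b')"
  using cvec.minus_smult[OF cnspace.axioms(1)[OF cnspace_P], of "(a, b)" "(a', b')"]
  by (auto simp: carrier_P F.A.minus_smult G.A.minus_smult)

lemma ncomplete_P: "ncomplete P (cnorm P)"
  unfolding ncomplete_def
proof (intro allI impI)
  fix s assume s: "ncauchy P (cnorm P) s"
  define a where "a n = fst (s n)" for n
  define b where "b n = snd (s n)" for n
  have ab: "s n = (a n, b n)" for n by (simp add: a_def b_def)
  have sP: "(a n, b n) \<in> carrier P" for n using s by (auto simp: ncauchy_def ab[symmetric])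
  then have c: "a n \<in> carrier A" "b n \<in> carrier B" "f (a n) = g (b n)" for n by (auto simp: carrier_P)
  have "\<exists>k. \<forall>m\<ge>k. \<forall>n\<ge>k. cnorm A (a m \<ominus>\<^bsub>A\<^esub> a n) < e \<and> cnorm B (b m \<ominus>\<^bsub>B\<^esub> b n) < e" if "e > 0" for e
    using s that by (auto simp: ncauchy_def ab P_minus[OF sP sP])
  then have "ncauchy A (cnorm A) a" "ncauchy B (cnorm B) b" using c unfolding ncauchy_def by blast+
  then obtain l k where l: "nconv A (cnorm A) a l" and k: "nconv B (cnorm B) b k"
    using F.A.ncomplete G.A.ncomplete unfolding ncomplete_def by blast
  have "nconv C (cnorm C) (\<lambda>n. f (a n)) (g k)" unfolding c(3) by (rule G.nconv_map[OF k])
  then have "f l = g k" using F.nconv_map[OF l] F.B.nconv_unique by blast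
  then have lk: "(l, k) \<in> carrier P" using l k by (auto simp: nconv_def carrier_P)
  have "(\<lambda>n. max (cnorm A (a n \<ominus>\<^bsub>A\<^esub> l)) (cnorm B (b n \<ominus>\<^bsub>B\<^esub> k))) \<longlonglongrightarrow> max 0 0"
    using l k unfolding nconv_def by (intro tendsto_max) auto
  then have "nconv P (cnorm P) s (l, k)"
    using sP lk by (auto simp: nconv_def ab P_minus)
  then show "\<exists>l. nconv P (cnorm P) s l" by blast
qed

lemma cstar_P: "cstar_algebra P"
proof (rule cstar_algebraI[OF cnspace_P ncomplete_P])
  fix u assume "u \<in> carrier P"
  then obtain a b where ab: "u = (a, b)" "a \<in> carrier A" "b \<in> carrier B" "f a = g b" by (cases u) (auto simp: carrier_P)
  have mx: "max (x\<^sup>2) (y\<^sup>2) = (max x y)\<^sup>2" if "0 \<le> x" "0 \<le> y" for x y :: real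
    using that by (auto simp: max_def power2_le_iff_abs_le intro: power_mono antisym)
  show "star P u \<in> carrier P" using ab by (simp add: carrier_P F.map_star G.map_star)
  show "star P (star P u) = u" using ab by simp
  show "star P (c \<odot>\<^bsub>P\<^esub> u) = cnj c \<odot>\<^bsub>P\<^esub> star P u" for c using ab by (simp add: F.A.star_smult G.A.star_smult)
  show "cnorm P (star P u \<otimes>\<^bsub>P\<^esub> u) = (cnorm P u)\<^sup>2"
    using ab mx by (simp add: F.A.cstar_identity G.A.cstar_identity F.A.norm_nonneg G.A.norm_nonneg)
  fix v assume "v \<in> carrier P"
  then obtain a' b' where ab': "v = (a', b')" "a' \<in> carrier A" "b' \<in> carrier B" "f a' = g b'" by (cases v) (auto simp: carrier_P)
  show "u \<otimes>\<^bsub>P\<^esub> v \<in> carrier P" using ab ab' by (simp add: carrier_P F.map_mult G.map_mult)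
  show "(c \<odot>\<^bsub>P\<^esub> u) \<otimes>\<^bsub>P\<^esub> v = c \<odot>\<^bsub>P\<^esub> (u \<otimes>\<^bsub>P\<^esub> v)" "u \<otimes>\<^bsub>P\<^esub> (c \<odot>\<^bsub>P\<^esub> v) = c \<odot>\<^bsub>P\<^esub> (u \<otimes>\<^bsub>P\<^esub> v)" for c using ab ab' by simp_all
  show "star P (u \<oplus>\<^bsub>P\<^esub> v) = star P u \<oplus>\<^bsub>P\<^esub> star P v" using ab ab' by (simp add: F.A.star_add G.A.star_add)
  show "star P (u \<otimes>\<^bsub>P\<^esub> v) = star P v \<otimes>\<^bsub>P\<^esub> star P u" using ab ab' by (simp add: F.A.star_mult G.A.star_mult)
  have "cnorm A (a \<otimes>\<^bsub>A\<^esub> a') \<le> cnorm A a * cnorm A a'" "cnorm B (b \<otimes>\<^bsub>B\<^esub> b') \<le> cnorm B b * cnorm B b'"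
    using ab ab' F.A.norm_mult G.A.norm_mult by blast+
  moreover have "cnorm A a * cnorm A a' \<le> cnorm P u * cnorm P v" "cnorm B b * cnorm B b' \<le> cnorm P u * cnorm P v"
    using ab ab' F.A.norm_nonneg G.A.norm_nonneg by (auto intro!: mult_mono simp: le_max_iff_disj)
  ultimately show "cnorm P (u \<otimes>\<^bsub>P\<^esub> v) \<le> cnorm P u * cnorm P v" using ab ab' by auto
  fix w assume "w \<in> carrier P"
  then obtain a'' b'' where ab'': "w = (a'', b'')" "a'' \<in> carrier A" "b'' \<in> carrier B" by (cases w) (auto simp: carrier_P)
  show "u \<otimes>\<^bsub>P\<^esub> v \<otimes>\<^bsub>P\<^esub> w = u \<otimes>\<^bsub>P\<^esub> (v \<otimes>\<^bsub>P\<^esub> w)" "(u \<oplus>\<^bsub>P\<^esub> v) \<otimes>\<^bsub>P\<^esub> w = u \<otimes>\<^bsub>P\<^esub> w \<oplus>\<^bsub>P\<^esub> v \<otimes>\<^bsub>P\<^esub> w"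
    "w \<otimes>\<^bsub>P\<^esub> (u \<oplus>\<^bsub>P\<^esub> v) = w \<otimes>\<^bsub>P\<^esub> u \<oplus>\<^bsub>P\<^esub> w \<otimes>\<^bsub>P\<^esub> v"
    using ab ab' ab''
    by (simp_all add: F.A.mult_assoc G.A.mult_assoc F.A.mult_add_left G.A.mult_add_left F.A.mult_add_right G.A.mult_add_right)
qed

lemma star_hom_fst: "star_hom P A fst" and star_hom_snd: "star_hom P B snd"
  by (auto simp: star_hom_def linear_map_def carrier_P)

lemma star_hom_pair:
  assumes "star_hom D A h" "star_hom D B k" and "\<And>x. x \<in> carrier D \<Longrightarrow> f (h x) = g (k x)"
  shows "star_hom D P (\<lambda>x. (h x, k x))"
  using assms by (auto simp: star_hom_def linear_map_def carrier_P Pi_iff)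

end

section \<open>Compact operators\<close>

declare (in hilb) L_simps [simp del]

context cstar_algebra
begin

lemma lin_span_submodule:
  assumes "S \<subseteq> carrier A" shows "submodule (lin_span A S) complex_ring A"
  unfolding lin_span_def hull_def submodule_iff
  using assms submodule_carrier unfolding submodule_iff by blast

lemma lin_span_superset: "S \<subseteq> lin_span A S"
  by (auto simp: lin_span_def hull_def)

lemma lin_span_least: "\<lbrakk>submodule T complex_ring A; S \<subseteq> T\<rbrakk> \<Longrightarrow> lin_span A S \<subseteq> T"
  by (auto simp: lin_span_def hull_def)

text \<open>Products are extended bilinearly: the right factor runs through the span while the left
  one is a generator, then the left factor does.\<close>

lemma lin_span_subalgebra:
  assumes G: "G \<subseteq> carrier A" and mult: "\<And>x y. \<lbrakk>x \<in> G; y \<in> G\<rbrakk> \<Longrightarrow> x \<otimes> y \<in> G"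
    and star: "\<And>x. x \<in> G \<Longrightarrow> star A x \<in> G"
  shows "cstar_subalgebra A (ncl A (cnorm A) (lin_span A G))"
proof (rule cstar_subalgebra_ncl[OF lin_span_submodule[OF G]])
  let ?L = "lin_span A G"
  note sub = lin_span_submodule[OF G, unfolded submodule_iff]
  have Lc: "?L \<subseteq> carrier A" using sub by (rule conjunct1)
  have Gc: "g \<in> carrier A" "g \<in> ?L" if "g \<in> G" for g using G lin_span_superset that by blast+
  have 1: "?L \<subseteq> {y \<in> carrier A. x \<otimes> y \<in> ?L}" if x: "x \<in> G" for x
  proof (rule lin_span_least)
    show "submodule {y \<in> carrier A. x \<otimes> y \<in> ?L} complex_ring A"
      unfolding submodule_iff using sub Gc(1)[OF x] by (auto simp: mult_add_right mult_smult_right)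
    show "G \<subseteq> {y \<in> carrier A. x \<otimes> y \<in> ?L}" using x Gc mult by auto
  qed
  have 2: "?L \<subseteq> {x \<in> carrier A. x \<otimes> y \<in> ?L}" if y: "y \<in> ?L" for y
  proof (rule lin_span_least)
    have yc: "y \<in> carrier A" using y Lc by blast
    show "submodule {x \<in> carrier A. x \<otimes> y \<in> ?L} complex_ring A"
      unfolding submodule_iff using sub yc by (auto simp: mult_add_left mult_smult_left)
    show "G \<subseteq> {x \<in> carrier A. x \<otimes> y \<in> ?L}" using y Gc 1 by auto
  qed
  show "x \<otimes> y \<in> ?L" if "x \<in> ?L" "y \<in> ?L" for x y using 2 that by blast
  have 3: "?L \<subseteq> {x \<in> carrier A. star A x \<in> ?L}"
  proof (rule lin_span_least)
    show "submodule {x \<in> carrier A. star A x \<in> ?L} complex_ring A"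
      unfolding submodule_iff using sub by (auto simp: star_add star_smult)
    show "G \<subseteq> {x \<in> carrier A. star A x \<in> ?L}" using Gc star by auto
  qed
  show "star A x \<in> ?L" if "x \<in> ?L" for x using 3 that by blast
qed

end

definition rank_ones :: "('a, 'x, 'm) hilbert_module_scheme \<Rightarrow> ('x \<Rightarrow> 'x) set"
  where "rank_ones X = {rank_one X \<xi> \<eta> | \<xi> \<eta>. \<xi> \<in> carrier X \<and> \<eta> \<in> carrier X}"

context hilb
begin

abbreviation "fin \<equiv> lin_span L (rank_ones X)"
abbreviation "K \<equiv> compacts A X"
abbreviation "KA \<equiv> compact_algebra A X"

lemma adjp_rank_one:
  "\<lbrakk>\<xi> \<in> carrier X; \<eta> \<in> carrier X\<rbrakk> \<Longrightarrow> adjp (rank_one X \<xi> \<eta>) (rank_one X \<eta> \<xi>)"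
  by (rule adjpI) (auto simp: rank_one_def ip_ract ip_ract_left)

lemma rank_one_L: "\<lbrakk>\<xi> \<in> carrier X; \<eta> \<in> carrier X\<rbrakk> \<Longrightarrow> rank_one X \<xi> \<eta> \<in> carrier L"
  using adjp_rank_one unfolding carrier_L by blast

lemma star_rank_one: "\<lbrakk>\<xi> \<in> carrier X; \<eta> \<in> carrier X\<rbrakk> \<Longrightarrow> star L (rank_one X \<xi> \<eta>) = rank_one X \<eta> \<xi>"
  by (rule star_L[OF adjp_rank_one])

lemma rank_one_apply: "\<zeta> \<in> carrier X \<Longrightarrow> rank_one X \<xi> \<eta> \<zeta> = ract X \<xi> (ip X \<eta> \<zeta>)"
  by (simp add: rank_one_def)

lemma mult_rank_one:
  "\<lbrakk>T \<in> carrier L; \<xi> \<in> carrier X; \<eta> \<in> carrier X\<rbrakk> \<Longrightarrow> T \<otimes>\<^bsub>L\<^esub> rank_one X \<xi> \<eta> = rank_one X (T \<xi>) \<eta>"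
  by (auto simp: L_simps rank_one_def compose_def L_ract intro!: ext)

lemma rank_one_mult:
  "\<lbrakk>T \<in> carrier L; \<xi> \<in> carrier X; \<eta> \<in> carrier X\<rbrakk> \<Longrightarrow> rank_one X \<xi> \<eta> \<otimes>\<^bsub>L\<^esub> T = rank_one X \<xi> (star L T \<eta>)"
  by (auto simp: L_simps rank_one_def compose_def star_L_ip' intro!: ext)

lemma smult_rank_one:
  "\<lbrakk>\<xi> \<in> carrier X; \<eta> \<in> carrier X\<rbrakk> \<Longrightarrow> c \<odot>\<^bsub>L\<^esub> rank_one X \<xi> \<eta> = rank_one X (c \<odot>\<^bsub>X\<^esub> \<xi>) \<eta>"
  by (auto simp: L_simps rank_one_def restrict_def ract_smult_left intro!: ext)

lemma opn_rank_one: "\<lbrakk>\<xi> \<in> carrier X; \<eta> \<in> carrier X\<rbrakk> \<Longrightarrow> opn (rank_one X \<xi> \<eta>) \<le> hn \<xi> * hn \<eta>"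
proof (rule opn_le)
  fix \<zeta> assume x: "\<xi> \<in> carrier X" and y: "\<eta> \<in> carrier X" and z: "\<zeta> \<in> carrier X"
  have "hn (rank_one X \<xi> \<eta> \<zeta>) \<le> hn \<xi> * cnorm A (ip X \<eta> \<zeta>)"
    using x y z hn_ract[of \<xi> "ip X \<eta> \<zeta>"] by (simp add: rank_one_apply)
  also have "\<dots> \<le> hn \<xi> * (hn \<eta> * hn \<zeta>)" using x y z by (intro mult_left_mono cauchy_schwarz hn_nonneg)
  finally show "hn (rank_one X \<xi> \<eta> \<zeta>) \<le> hn \<xi> * hn \<eta> * hn \<zeta>" by (simp add: mult.assoc)
qed (simp add: hn_nonneg)

lemma rank_ones_L: "rank_ones X \<subseteq> carrier L"
  by (auto simp: rank_ones_def rank_one_L)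

lemma fin_submodule: "submodule fin complex_ring L"
  by (rule cstar_algebra.lin_span_submodule[OF cstar_L rank_ones_L])

lemma compacts_eq: "K = ncl L opn fin"
  using cnspace.closure_of_eq[OF cnspace_L] by (simp add: compacts_def rank_ones_def)

lemma fin_L: "fin \<subseteq> carrier L"
  using fin_submodule unfolding cvec.submodule_iff[OF cvec_L] by (rule conjunct1)

lemma fin_K: "fin \<subseteq> K"
  unfolding compacts_eq by (rule cnspace.ncl_superset[OF cnspace_L fin_L])

lemma K_L: "K \<subseteq> carrier L"
  unfolding compacts_eq by (rule cnspace.ncl_carrier[OF cnspace_L])

lemma rank_one_K: "\<lbrakk>\<xi> \<in> carrier X; \<eta> \<in> carrier X\<rbrakk> \<Longrightarrow> rank_one X \<xi> \<eta> \<in> K"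
  using fin_K cstar_algebra.lin_span_superset[OF cstar_L, of "rank_ones X"] by (auto simp: rank_ones_def)

text \<open>The induction principle for compact operators, on which all later identities between
  them are based.\<close>

lemma K_least:
  assumes "submodule V complex_ring L" and "ncl L opn V \<subseteq> V"
    and "\<And>\<xi> \<eta>. \<lbrakk>\<xi> \<in> carrier X; \<eta> \<in> carrier X\<rbrakk> \<Longrightarrow> rank_one X \<xi> \<eta> \<in> V"
  shows "K \<subseteq> V"
proof -
  have "rank_ones X \<subseteq> V" using assms(3) by (auto simp: rank_ones_def)
  then have "fin \<subseteq> V" by (rule cstar_algebra.lin_span_least[OF cstar_L assms(1)])
  then show ?thesis unfolding compacts_eq by (rule cnspace.ncl_minimal[OF cnspace_L _ assms(2)])
qed

lemma K_submodule: "submodule K complex_ring L"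
  unfolding compacts_eq by (rule cnspace.ncl_submodule[OF cnspace_L fin_submodule])

lemma K_closed: "ncl L opn K \<subseteq> K"
  unfolding compacts_eq using cnspace.ncl_idem[OF cnspace_L] by simp

lemma K_left: assumes T: "T \<in> carrier L" and S: "S \<in> K" shows "T \<otimes>\<^bsub>L\<^esub> S \<in> K"
proof -
  interpret L: cstar_algebra L by (rule cstar_L)
  note sub = K_submodule[unfolded L.submodule_iff]
  let ?V = "{S \<in> carrier L. T \<otimes>\<^bsub>L\<^esub> S \<in> K}"
  have "K \<subseteq> ?V"
  proof (rule K_least)
    show "submodule ?V complex_ring L"
      using sub T unfolding L.submodule_iff
      by (auto simp: L.mult_add_right subset_iff)
    show "ncl L opn ?V \<subseteq> ?V"
    proof
      fix S assume S: "S \<in> ncl L opn ?V"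
      have "T \<in> ncl L opn {T}" using L.ncl_superset[of "{T}"] T by blast
      then have "T \<otimes>\<^bsub>L\<^esub> S \<in> ncl L opn K" using S by (intro L.ncl_mult[of "{T}" ?V]) auto
      then show "S \<in> ?V" using S K_closed by (auto simp: ncl_def)
    qed
    show "rank_one X \<xi> \<eta> \<in> ?V" if "\<xi> \<in> carrier X" "\<eta> \<in> carrier X" for \<xi> \<eta>
      using that T mult_rank_one[OF T that] rank_one_K rank_one_L by (simp)
  qed
  then show ?thesis using S by blast
qed

lemma K_star: assumes S: "S \<in> K" shows "star L S \<in> K"
proof -
  interpret L: cstar_algebra L by (rule cstar_L)
  note sub = K_submodule[unfolded L.submodule_iff]
  let ?V = "{S \<in> carrier L. star L S \<in> K}"
  have "K \<subseteq> ?V"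
  proof (rule K_least)
    show "submodule ?V complex_ring L"
      using sub unfolding L.submodule_iff
      by (auto simp: L.star_add L.star_smult subset_iff)
    show "ncl L opn ?V \<subseteq> ?V"
    proof
      fix S assume S: "S \<in> ncl L opn ?V"
      then have "star L S \<in> ncl L opn K" by (intro L.ncl_star[of ?V]) auto
      then show "S \<in> ?V" using S K_closed by (auto simp: ncl_def)
    qed
    show "rank_one X \<xi> \<eta> \<in> ?V" if "\<xi> \<in> carrier X" "\<eta> \<in> carrier X" for \<xi> \<eta>
      using that rank_one_K rank_one_L by (simp add: star_rank_one)
  qed
  then show ?thesis using S by blast
qed

lemma K_subalgebra: "cstar_subalgebra L K"
  unfolding cstar_algebra.cstar_subalgebra_iff[OF cstar_L]
proof (intro conjI ballI K_submodule K_closed)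
  show "S \<otimes>\<^bsub>L\<^esub> T \<in> K" if "S \<in> K" "T \<in> K" for S T using that K_L by (intro K_left) auto
qed (rule K_star)

lemma cstar_KA: "cstar_algebra KA"
  unfolding compact_algebra_def by (rule cstar_algebra.cstar_algebra_carrier_update[OF cstar_L K_subalgebra])

lemma KA_simps [simp]:
  "carrier KA = K" "S \<otimes>\<^bsub>KA\<^esub> T = S \<otimes>\<^bsub>L\<^esub> T" "\<zero>\<^bsub>KA\<^esub> = \<zero>\<^bsub>L\<^esub>" "S \<oplus>\<^bsub>KA\<^esub> T = S \<oplus>\<^bsub>L\<^esub> T"
  "c \<odot>\<^bsub>KA\<^esub> T = c \<odot>\<^bsub>L\<^esub> T" "star KA T = star L T" "cnorm KA = opn"
  by (simp_all add: compact_algebra_def)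

lemma KA_minus: "\<lbrakk>S \<in> K; T \<in> K\<rbrakk> \<Longrightarrow> S \<ominus>\<^bsub>KA\<^esub> T = S \<ominus>\<^bsub>L\<^esub> T"
  unfolding compact_algebra_def by (rule minus_carrier_update[OF cvec_L K_submodule])

lemma KA_least:
  assumes V: "submodule V complex_ring KA" "ncl KA opn V \<subseteq> V"
    and r: "\<And>\<xi> \<eta>. \<lbrakk>\<xi> \<in> carrier X; \<eta> \<in> carrier X\<rbrakk> \<Longrightarrow> rank_one X \<xi> \<eta> \<in> V"
  shows "V = K"
proof -
  interpret KA: cstar_algebra KA by (rule cstar_KA)
  interpret L: cstar_algebra L by (rule cstar_L)
  have VK: "V \<subseteq> K" using V by (simp add: KA.submodule_iff)
  have "submodule V complex_ring L"
    using V(1) K_L unfolding KA.submodule_iff L.submodule_iff by (auto)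
  moreover have "ncl L opn V \<subseteq> V"
  proof
    fix T assume T: "T \<in> ncl L opn V"
    then have TK: "T \<in> K" using L.ncl_mono[OF VK] K_closed by blast
    have "T \<in> ncl KA opn V"
      using T TK VK by (auto simp: ncl_def KA_minus subset_iff)
    then show "T \<in> V" using V(2) by blast
  qed
  ultimately have "K \<subseteq> V" using r by (intro K_least)
  then show ?thesis using VK by blast
qed

lemma generated_KA: "generated_by KA (rank_ones X)"
  unfolding generated_by_def
proof (intro allI impI)
  fix S assume "cstar_subalgebra KA S \<and> rank_ones X \<subseteq> S"
  then have S: "submodule S complex_ring KA" "ncl KA opn S \<subseteq> S" and r: "rank_ones X \<subseteq> S"
    unfolding cstar_algebra.cstar_subalgebra_iff[OF cstar_KA] by simp_all
  have "rank_one X \<xi> \<eta> \<in> rank_ones X" if "\<xi> \<in> carrier X" "\<eta> \<in> carrier X" for \<xi> \<eta>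
    using that unfolding rank_ones_def by blast
  then have "S = K" using r by (intro KA_least[OF S]) blast
  then show "S = carrier KA" by simp
qed

lemma rank_ones_K: "rank_ones X \<subseteq> carrier KA"
proof
  fix r assume "r \<in> rank_ones X"
  then obtain \<xi> \<eta> where r: "r = rank_one X \<xi> \<eta>" "\<xi> \<in> carrier X" "\<eta> \<in> carrier X" unfolding rank_ones_def by blast
  show "r \<in> carrier KA" unfolding r KA_simps using r(2,3) by (rule rank_one_K)
qed

lemma KA_hom_eqI:
  assumes "cstar_algebra D" and "star_hom KA D F" and "star_hom KA D F'"
    and "\<And>\<xi> \<eta>. \<lbrakk>\<xi> \<in> carrier X; \<eta> \<in> carrier X\<rbrakk> \<Longrightarrow> F (rank_one X \<xi> \<eta>) = F' (rank_one X \<xi> \<eta>)"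
    and "T \<in> K"
  shows "F T = F' T"
proof -
  have 1: "cstar_hom KA D F" by (rule cstar_homI[OF cstar_KA assms(1,2)])
  have 2: "cstar_hom KA D F'" by (rule cstar_homI[OF cstar_KA assms(1,3)])
  have 3: "F x = F' x" if x: "x \<in> rank_ones X" for x
  proof -
    obtain \<xi> \<eta> where "x = rank_one X \<xi> \<eta>" "\<xi> \<in> carrier X" "\<eta> \<in> carrier X"
      using x unfolding rank_ones_def by blast
    then show "F x = F' x" using assms(4)[of \<xi> \<eta>] by simp
  qed
  have 4: "T \<in> carrier KA" using assms(5) by simp
  show ?thesis by (rule cstar_hom_eqI[OF 1 2 generated_KA rank_ones_K 3 4])
qed

end

section \<open>The homomorphism \<open>\<psi>\<^sup>+\<close> of compact operators\<close>

locale hilbert_map = X: hilb A X + Y: hilb B Y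
  for A :: "'a cstar_algebra" and X :: "('a, 'x, 'm) hilbert_module_scheme"
    and B :: "'b cstar_algebra" and Y :: "('b, 'y, 'n) hilbert_module_scheme" +
  fixes \<psi> :: "'x \<Rightarrow> 'y" and \<psi>A :: "'a \<Rightarrow> 'b"
  assumes lin: "linear_map X Y \<psi>" and homA: "star_hom A B \<psi>A"
    and C1: "\<lbrakk>\<xi> \<in> carrier X; \<eta> \<in> carrier X\<rbrakk> \<Longrightarrow> ip Y (\<psi> \<xi>) (\<psi> \<eta>) = \<psi>A (ip X \<xi> \<eta>)"
begin

sublocale H: cstar_hom A B \<psi>A
  by unfold_locales (rule homA)

lemma psi_closed [simp, intro]: "\<xi> \<in> carrier X \<Longrightarrow> \<psi> \<xi> \<in> carrier Y"
  and psi_add: "\<lbrakk>\<xi> \<in> carrier X; \<eta> \<in> carrier X\<rbrakk> \<Longrightarrow> \<psi> (\<xi> \<oplus>\<^bsub>X\<^esub> \<eta>) = \<psi> \<xi> \<oplus>\<^bsub>Y\<^esub> \<psi> \<eta>"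
  and psi_smult: "\<xi> \<in> carrier X \<Longrightarrow> \<psi> (c \<odot>\<^bsub>X\<^esub> \<xi>) = c \<odot>\<^bsub>Y\<^esub> \<psi> \<xi>"
  using lin by (auto simp: linear_map_def)

lemma psi_norm: assumes x: "\<xi> \<in> carrier X" shows "Y.hn (\<psi> \<xi>) \<le> X.hn \<xi>"
proof (rule power2_le_imp_le)
  show "(Y.hn (\<psi> \<xi>))\<^sup>2 \<le> (X.hn \<xi>)\<^sup>2"
    unfolding X.hn_square[OF x] Y.hn_square[OF psi_closed[OF x]] C1[OF x x]
    by (rule H.norm_map_le) (simp add: x)
qed (simp add: X.hn_nonneg x)

text \<open>Right linearity is forced by (C1): the inner product of the difference with itself
  expands to zero.\<close>

lemma psi_ract:
  assumes x: "\<xi> \<in> carrier X" and a: "a \<in> carrier A"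
  shows "\<psi> (ract X \<xi> a) = ract Y (\<psi> \<xi>) (\<psi>A a)"
proof -
  let ?u = "\<psi> (ract X \<xi> a)" and ?v = "ract Y (\<psi> \<xi>) (\<psi>A a)"
  have c: "?u \<in> carrier Y" "?v \<in> carrier Y" using x a by simp_all
  have "ip Y (?u \<ominus>\<^bsub>Y\<^esub> ?v) (?u \<ominus>\<^bsub>Y\<^esub> ?v) = \<zero>\<^bsub>B\<^esub>"
    using x a c by (simp add: Y.ip_diff Y.ip_diff_left C1 X.ip_ract X.ip_ract_left Y.ip_ract Y.ip_ract_left
        H.map_mult H.map_star Y.A.mult_assoc Y.A.M.minus_eq Y.A.M.r_neg)
  then show ?thesis using Y.ip_definite[of "?u \<ominus>\<^bsub>Y\<^esub> ?v"] c Y.X.diff_zero_iff by simp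
qed

definition intertw :: "('x \<Rightarrow> 'x) \<Rightarrow> ('y \<Rightarrow> 'y) \<Rightarrow> bool"
  where "intertw s \<sigma> \<longleftrightarrow> s \<in> carrier X.L \<and> \<sigma> \<in> carrier Y.L \<and> (\<forall>\<xi>\<in>carrier X. \<sigma> (\<psi> \<xi>) = \<psi> (s \<xi>))"

text \<open>Matching finite sums of rank-one operators. This is a relation, since an operator has
  many such representations and the dependence of \<tau> on t alone is only a consequence of the
  estimate in \<open>G0_norm_le\<close>.\<close>

inductive_set G0 :: "(('x \<Rightarrow> 'x) \<times> ('y \<Rightarrow> 'y)) set" where
  zero: "(\<zero>\<^bsub>X.L\<^esub>, \<zero>\<^bsub>Y.L\<^esub>) \<in> G0"
| add_rank: "\<lbrakk>(t, \<tau>) \<in> G0; \<xi> \<in> carrier X; \<eta> \<in> carrier X\<rbrakk>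
    \<Longrightarrow> (t \<oplus>\<^bsub>X.L\<^esub> rank_one X \<xi> \<eta>, \<tau> \<oplus>\<^bsub>Y.L\<^esub> rank_one Y (\<psi> \<xi>) (\<psi> \<eta>)) \<in> G0"

context
begin

interpretation LX: cstar_algebra X.L by (rule X.cstar_L)
interpretation LY: cstar_algebra Y.L by (rule Y.cstar_L)

lemma G0_closed: "(t, \<tau>) \<in> G0 \<Longrightarrow> t \<in> carrier X.L \<and> \<tau> \<in> carrier Y.L"
  by (induction rule: G0.induct) (auto simp: X.rank_one_L Y.rank_one_L)

lemma intertw_rank_one:
  "\<lbrakk>\<xi> \<in> carrier X; \<eta> \<in> carrier X\<rbrakk> \<Longrightarrow> intertw (rank_one X \<xi> \<eta>) (rank_one Y (\<psi> \<xi>) (\<psi> \<eta>))"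
  by (simp add: intertw_def X.rank_one_L Y.rank_one_L X.rank_one_apply Y.rank_one_apply psi_ract C1)

lemma intertw_add: "\<lbrakk>intertw s \<sigma>; intertw t \<tau>\<rbrakk> \<Longrightarrow> intertw (s \<oplus>\<^bsub>X.L\<^esub> t) (\<sigma> \<oplus>\<^bsub>Y.L\<^esub> \<tau>)"
  using LX.M.a_closed[of s t] LY.M.a_closed[of \<sigma> \<tau>] unfolding intertw_def by (simp add: psi_add X.L_simps(4) Y.L_simps(4))

lemma intertw_mult: "\<lbrakk>intertw s \<sigma>; intertw t \<tau>\<rbrakk> \<Longrightarrow> intertw (s \<otimes>\<^bsub>X.L\<^esub> t) (\<sigma> \<otimes>\<^bsub>Y.L\<^esub> \<tau>)"
  using LX.mult_closed[of s t] LY.mult_closed[of \<sigma> \<tau>] unfolding intertw_def by (simp add: compose_def X.L_simps(1) Y.L_simps(1))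

lemma psi_zero [simp]: "\<psi> \<zero>\<^bsub>X\<^esub> = \<zero>\<^bsub>Y\<^esub>"
  using psi_smult[of "\<zero>\<^bsub>X\<^esub>" 0] by simp

lemma psi_diff: "\<lbrakk>\<xi> \<in> carrier X; \<eta> \<in> carrier X\<rbrakk> \<Longrightarrow> \<psi> (\<xi> \<ominus>\<^bsub>X\<^esub> \<eta>) = \<psi> \<xi> \<ominus>\<^bsub>Y\<^esub> \<psi> \<eta>"
  by (simp add: X.X.minus_smult Y.X.minus_smult psi_add psi_smult)

lemma nconv_psi:
  assumes "nconv X X.hn s l" shows "nconv Y Y.hn (\<lambda>n. \<psi> (s n)) (\<psi> l)"
proof (rule Y.X.nconvI_bound)
  have c: "s n \<in> carrier X" "l \<in> carrier X" for n using assms by (auto simp: nconv_def)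
  then show "range (\<lambda>n. \<psi> (s n)) \<subseteq> carrier Y" "\<psi> l \<in> carrier Y" by auto
  show "Y.hn (\<psi> (s n) \<ominus>\<^bsub>Y\<^esub> \<psi> l) \<le> X.hn (s n \<ominus>\<^bsub>X\<^esub> l)" for n
    using psi_norm[of "s n \<ominus>\<^bsub>X\<^esub> l"] c by (simp add: psi_diff)
  show "(\<lambda>n. X.hn (s n \<ominus>\<^bsub>X\<^esub> l)) \<longlonglongrightarrow> 0" using assms by (simp add: nconv_def)
qed

lemma G0_intertw: "(t, \<tau>) \<in> G0 \<Longrightarrow> intertw t \<tau>"
proof (induction rule: G0.induct)
  case zero
  have "\<zero>\<^bsub>Y.L\<^esub> (\<psi> \<xi>) = \<psi> (\<zero>\<^bsub>X.L\<^esub> \<xi>)" if "\<xi> \<in> carrier X" for \<xi>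
    using that by (simp add: X.L_simps Y.L_simps)
  then show ?case by (simp add: intertw_def)
next
  case (add_rank t \<tau> \<xi> \<eta>)
  then show ?case by (intro intertw_add intertw_rank_one)
qed

lemma G0_add: "\<lbrakk>(t, \<tau>) \<in> G0; (s, \<sigma>) \<in> G0\<rbrakk> \<Longrightarrow> (s \<oplus>\<^bsub>X.L\<^esub> t, \<sigma> \<oplus>\<^bsub>Y.L\<^esub> \<tau>) \<in> G0"
proof (induction rule: G0.induct)
  case zero
  then show ?case using G0_closed[OF zero] by (simp)
next
  case (add_rank t \<tau> \<xi> \<eta>)
  have "(s \<oplus>\<^bsub>X.L\<^esub> t \<oplus>\<^bsub>X.L\<^esub> rank_one X \<xi> \<eta>, \<sigma> \<oplus>\<^bsub>Y.L\<^esub> \<tau> \<oplus>\<^bsub>Y.L\<^esub> rank_one Y (\<psi> \<xi>) (\<psi> \<eta>)) \<in> G0"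
    using add_rank by (intro G0.add_rank) auto
  then show ?case
    using add_rank G0_closed[OF add_rank(1)] G0_closed[OF add_rank(5)]
    by (simp add: LX.M.a_assoc LY.M.a_assoc X.rank_one_L Y.rank_one_L)
qed

lemma G0_smult: "(t, \<tau>) \<in> G0 \<Longrightarrow> (c \<odot>\<^bsub>X.L\<^esub> t, c \<odot>\<^bsub>Y.L\<^esub> \<tau>) \<in> G0"
proof (induction rule: G0.induct)
  case zero
  then show ?case using G0.zero by (simp)
next
  case (add_rank t \<tau> \<xi> \<eta>)
  have "(c \<odot>\<^bsub>X.L\<^esub> t \<oplus>\<^bsub>X.L\<^esub> rank_one X (c \<odot>\<^bsub>X\<^esub> \<xi>) \<eta>, c \<odot>\<^bsub>Y.L\<^esub> \<tau> \<oplus>\<^bsub>Y.L\<^esub> rank_one Y (\<psi> (c \<odot>\<^bsub>X\<^esub> \<xi>)) (\<psi> \<eta>)) \<in> G0"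
    using add_rank by (intro G0.add_rank) auto
  then show ?case
    using add_rank(2,3) G0_closed[OF add_rank(1)]
      X.smult_rank_one[of \<xi> \<eta> c] Y.smult_rank_one[of "\<psi> \<xi>" "\<psi> \<eta>" c]
    by (simp add: LX.smult_radd LY.smult_radd X.rank_one_L Y.rank_one_L psi_smult)
qed

lemma G0_star: "(t, \<tau>) \<in> G0 \<Longrightarrow> (star X.L t, star Y.L \<tau>) \<in> G0"
proof (induction rule: G0.induct)
  case zero
  then show ?case using G0.zero by (simp)
next
  case (add_rank t \<tau> \<xi> \<eta>)
  have "(star X.L t \<oplus>\<^bsub>X.L\<^esub> rank_one X \<eta> \<xi>, star Y.L \<tau> \<oplus>\<^bsub>Y.L\<^esub> rank_one Y (\<psi> \<eta>) (\<psi> \<xi>)) \<in> G0"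
    using add_rank by (intro G0.add_rank) auto
  then show ?case
    using add_rank(2,3) G0_closed[OF add_rank(1)]
    by (simp add: LX.star_add LY.star_add X.rank_one_L Y.rank_one_L X.star_rank_one Y.star_rank_one)
qed

lemma G0_intertw_mult: "(t, \<tau>) \<in> G0 \<Longrightarrow> intertw s \<sigma> \<Longrightarrow> (s \<otimes>\<^bsub>X.L\<^esub> t, \<sigma> \<otimes>\<^bsub>Y.L\<^esub> \<tau>) \<in> G0"
proof (induction rule: G0.induct)
  case zero
  then show ?case using G0.zero by (simp add: intertw_def)
next
  case (add_rank t \<tau> \<xi> \<eta>)
  have s: "s \<in> carrier X.L" "\<sigma> \<in> carrier Y.L" "\<sigma> (\<psi> \<xi>) = \<psi> (s \<xi>)" using add_rank by (auto simp: intertw_def)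
  have "(s \<otimes>\<^bsub>X.L\<^esub> t \<oplus>\<^bsub>X.L\<^esub> rank_one X (s \<xi>) \<eta>, \<sigma> \<otimes>\<^bsub>Y.L\<^esub> \<tau> \<oplus>\<^bsub>Y.L\<^esub> rank_one Y (\<psi> (s \<xi>)) (\<psi> \<eta>)) \<in> G0"
    using add_rank s by (intro G0.add_rank) auto
  then show ?case
    using add_rank(2,3) s G0_closed[OF add_rank(1)]
      X.mult_rank_one[of s \<xi> \<eta>] Y.mult_rank_one[of \<sigma> "\<psi> \<xi>" "\<psi> \<eta>"]
    by (simp add: LX.mult_add_right LY.mult_add_right X.rank_one_L Y.rank_one_L)
qed

text \<open>An intertwined \<sigma> acts on the rank-one operator of \<psi> \<xi> and \<psi> \<eta>
  by replacing \<xi> with s \<xi>. So C may be taken as the sum of the products of norms of the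
  vectors that occur in t.\<close>

lemma G0_bound:
  "(t, \<tau>) \<in> G0 \<Longrightarrow> \<exists>C\<ge>0. \<forall>s \<sigma>. intertw s \<sigma> \<longrightarrow> Y.opn (\<sigma> \<otimes>\<^bsub>Y.L\<^esub> \<tau>) \<le> C * X.opn s"
proof (induction rule: G0.induct)
  case zero
  then show ?case by (intro exI[of _ 0]) (auto simp: intertw_def)
next
  case (add_rank t \<tau> \<xi> \<eta>)
  then obtain C where C: "C \<ge> 0" "\<And>s \<sigma>. intertw s \<sigma> \<Longrightarrow> Y.opn (\<sigma> \<otimes>\<^bsub>Y.L\<^esub> \<tau>) \<le> C * X.opn s" by blast
  let ?r = "rank_one Y (\<psi> \<xi>) (\<psi> \<eta>)"
  have "Y.opn (\<sigma> \<otimes>\<^bsub>Y.L\<^esub> (\<tau> \<oplus>\<^bsub>Y.L\<^esub> ?r)) \<le> (C + X.hn \<xi> * X.hn \<eta>) * X.opn s" if i: "intertw s \<sigma>" for s \<sigma>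
  proof -
    have s: "s \<in> carrier X.L" "\<sigma> \<in> carrier Y.L" "\<sigma> (\<psi> \<xi>) = \<psi> (s \<xi>)" using add_rank i by (auto simp: intertw_def)
    have c: "\<tau> \<in> carrier Y.L" "?r \<in> carrier Y.L" using G0_closed[OF add_rank(1)] add_rank(2,3) by (auto simp: Y.rank_one_L)
    have "Y.opn (\<sigma> \<otimes>\<^bsub>Y.L\<^esub> (\<tau> \<oplus>\<^bsub>Y.L\<^esub> ?r)) \<le> Y.opn (\<sigma> \<otimes>\<^bsub>Y.L\<^esub> \<tau>) + Y.opn (\<sigma> \<otimes>\<^bsub>Y.L\<^esub> ?r)"
      using s c LY.norm_add by (simp add: LY.mult_add_right)
    also have "\<sigma> \<otimes>\<^bsub>Y.L\<^esub> ?r = rank_one Y (\<psi> (s \<xi>)) (\<psi> \<eta>)"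
      using Y.mult_rank_one[of \<sigma> "\<psi> \<xi>" "\<psi> \<eta>"] s add_rank(2,3) by (simp)
    also have "Y.opn \<dots> \<le> Y.hn (\<psi> (s \<xi>)) * Y.hn (\<psi> \<eta>)" using s add_rank(2,3) by (intro Y.opn_rank_one) auto
    also have "\<dots> \<le> (X.opn s * X.hn \<xi>) * X.hn \<eta>"
    proof (rule mult_mono)
      show "Y.hn (\<psi> (s \<xi>)) \<le> X.opn s * X.hn \<xi>"
        using psi_norm[of "s \<xi>"] X.opn_bound[OF s(1) add_rank(2)] s(1) add_rank(2) by simp
    qed (use s add_rank(2,3) X.opn_nonneg X.hn_nonneg Y.hn_nonneg psi_norm in auto)
    finally show ?thesis using C(2)[OF i] by (simp add: algebra_simps)
  qed
  then show ?case using C(1) add_rank(2,3) X.hn_nonneg by (intro exI[of _ "C + X.hn \<xi> * X.hn \<eta>"]) auto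
qed

lemma intertw_npow: "intertw s \<sigma> \<Longrightarrow> intertw (LX.npow s n) (LY.npow \<sigma> n)"
  by (induction n) (auto intro: intertw_mult)

text \<open>The bound of the previous lemma involves an uncontrolled constant, which disappears on
  applying it to high powers of \<open>\<tau>\<^sup>*\<tau>\<close>.\<close>

lemma G0_norm_le: assumes "(t, \<tau>) \<in> G0" shows "Y.opn \<tau> \<le> X.opn t"
proof -
  have c: "t \<in> carrier X.L" "\<tau> \<in> carrier Y.L" using G0_closed[OF assms] by auto
  obtain C where C: "C \<ge> 0" "\<And>s \<sigma>. intertw s \<sigma> \<Longrightarrow> Y.opn (\<sigma> \<otimes>\<^bsub>Y.L\<^esub> \<tau>) \<le> C * X.opn s"
    using G0_bound[OF assms] by blast
  have it: "intertw (star X.L t) (star Y.L \<tau>)" by (rule G0_intertw[OF G0_star[OF assms]])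
  define w where "w = star X.L t \<otimes>\<^bsub>X.L\<^esub> t"
  define p where "p = star Y.L \<tau> \<otimes>\<^bsub>Y.L\<^esub> \<tau>"
  have wc: "w \<in> carrier X.L" and pc: "p \<in> carrier Y.L" using c by (simp_all add: w_def p_def)
  have psa: "selfadj Y.L p" using c by (simp add: p_def selfadj_def LY.star_mult)
  have wp: "intertw w p" unfolding w_def p_def by (intro intertw_mult it G0_intertw assms)
  have wn: "X.opn (LX.npow w n) \<le> X.opn w ^ Suc n" for n
  proof (induction n)
    case (Suc n)
    have "X.opn (LX.npow w (Suc n)) \<le> X.opn (LX.npow w n) * X.opn w"
      using LX.norm_mult[of "LX.npow w n" w] wc by (simp)
    also have "\<dots> \<le> X.opn w ^ Suc n * X.opn w" using Suc LX.norm_nonneg[OF wc] by (rule mult_right_mono)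
    finally show ?case by (simp add: mult.commute)
  qed simp
  have pn: "Y.opn (LY.npow p (Suc n)) \<le> C * X.opn t * X.opn w ^ Suc n" for n
  proof -
    have "LY.npow p (Suc n) = (LY.npow p n \<otimes>\<^bsub>Y.L\<^esub> star Y.L \<tau>) \<otimes>\<^bsub>Y.L\<^esub> \<tau>"
      using pc c by (simp add: LY.mult_assoc p_def[symmetric])
    then have "Y.opn (LY.npow p (Suc n)) \<le> C * X.opn (LX.npow w n \<otimes>\<^bsub>X.L\<^esub> star X.L t)"
      using C(2)[OF intertw_mult[OF intertw_npow[OF wp, of n] it]] by (simp del: LY.npow.simps)
    also have "\<dots> \<le> C * (X.opn (LX.npow w n) * X.opn t)"
      using LX.norm_mult[of "LX.npow w n" "star X.L t"] wc c C(1) by (intro mult_left_mono) (simp_all)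
    also have "\<dots> \<le> C * (X.opn w ^ Suc n * X.opn t)"
      using wn[of n] C(1) LX.norm_nonneg[OF c(1)] by (intro mult_left_mono mult_right_mono)
    finally show ?thesis by (simp add: algebra_simps)
  qed
  have "Y.opn p \<le> X.opn w"
  proof (rule power_two_power_le[where D = 0])
    show "0 \<le> Y.opn p" "0 \<le> X.opn w" using LX.norm_nonneg[OF wc] LY.norm_nonneg[OF pc] by auto
    fix k
    have pos: "0 \<le> C * X.opn t" using C(1) LX.norm_nonneg[OF c(1)] by simp
    \<comment> \<open>The summand \<open>Y.opn p\<close> covers k = 0, where the exponent 2^k - 1 =
      0 is out of the range of \<open>pn\<close>.\<close>
    show "Y.opn p ^ 2 ^ k \<le> (C * X.opn t + Y.opn p + 0 * 2 ^ k) * X.opn w ^ (2 ^ k - 1)"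
    proof (cases k)
      case 0
      then show ?thesis using pos by simp
    next
      case (Suc j)
      have "(2::nat) ^ k \<ge> 2" using Suc one_le_power[of "2::nat" j] by simp
      then obtain n where n: "2 ^ k - 1 = Suc n" by (cases "2 ^ k - 1 :: nat") auto
      have "Y.opn p ^ 2 ^ k = Y.opn (LY.npow p (Suc n))" using LY.norm_npow_selfadj[OF psa, of k] n by metis
      also have "\<dots> \<le> C * X.opn t * X.opn w ^ Suc n" by (rule pn)
      also have "\<dots> \<le> (C * X.opn t + Y.opn p) * X.opn w ^ Suc n"
        using LX.norm_nonneg[OF wc] LY.norm_nonneg[OF pc] by (intro mult_right_mono) auto
      finally show ?thesis unfolding n by simp
    qed
  qed
  then have "(Y.opn \<tau>)\<^sup>2 \<le> (X.opn t)\<^sup>2" using LX.cstar_identity[OF c(1)] LY.cstar_identity[OF c(2)] by (simp add: w_def p_def)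
  then show ?thesis by (rule power2_le_imp_le) (rule LX.norm_nonneg[OF c(1)])
qed

text \<open>The closure of \<open>G0\<close>, which is the graph of \<open>\<psi>\<^sup>+\<close>:
  the norm estimate passes to limits and makes the relation single-valued, and every compact
  operator is in its domain.\<close>

definition Gc :: "('x \<Rightarrow> 'x) \<Rightarrow> ('y \<Rightarrow> 'y) \<Rightarrow> bool"
  where "Gc T U \<longleftrightarrow> (\<exists>t \<tau>. (\<forall>n. (t n, \<tau> n) \<in> G0) \<and> nconv X.L X.opn t T \<and> nconv Y.L Y.opn \<tau> U)"

lemma GcI: "\<lbrakk>\<And>n. (t n, \<tau> n) \<in> G0; nconv X.L X.opn t T; nconv Y.L Y.opn \<tau> U\<rbrakk> \<Longrightarrow> Gc T U"
  unfolding Gc_def by blast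

lemma Gc_closed: "Gc T U \<Longrightarrow> T \<in> carrier X.L" "Gc T U \<Longrightarrow> U \<in> carrier Y.L"
  by (auto simp: Gc_def nconv_def)

lemma Gc_add: assumes "Gc T U" "Gc T' U'" shows "Gc (T \<oplus>\<^bsub>X.L\<^esub> T') (U \<oplus>\<^bsub>Y.L\<^esub> U')"
proof -
  obtain t \<tau> where 1: "\<And>n. (t n, \<tau> n) \<in> G0" "nconv X.L X.opn t T" "nconv Y.L Y.opn \<tau> U"
    using assms(1) unfolding Gc_def by blast
  obtain t' \<tau>' where 2: "\<And>n. (t' n, \<tau>' n) \<in> G0" "nconv X.L X.opn t' T'" "nconv Y.L Y.opn \<tau>' U'"
    using assms(2) unfolding Gc_def by blast
  show ?thesis by (rule GcI[OF G0_add[OF 2(1) 1(1)] LX.nconv_add[OF 1(2) 2(2)] LY.nconv_add[OF 1(3) 2(3)]])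
qed

lemma Gc_mult: assumes "Gc T U" "Gc T' U'" shows "Gc (T \<otimes>\<^bsub>X.L\<^esub> T') (U \<otimes>\<^bsub>Y.L\<^esub> U')"
proof -
  obtain t \<tau> where 1: "\<And>n. (t n, \<tau> n) \<in> G0" "nconv X.L X.opn t T" "nconv Y.L Y.opn \<tau> U"
    using assms(1) unfolding Gc_def by blast
  obtain t' \<tau>' where 2: "\<And>n. (t' n, \<tau>' n) \<in> G0" "nconv X.L X.opn t' T'" "nconv Y.L Y.opn \<tau>' U'"
    using assms(2) unfolding Gc_def by blast
  show ?thesis
    by (rule GcI[OF G0_intertw_mult[OF 2(1) G0_intertw[OF 1(1)]] LX.nconv_mult[OF 1(2) 2(2)] LY.nconv_mult[OF 1(3) 2(3)]])
qed

lemma Gc_smult: assumes "Gc T U" shows "Gc (c \<odot>\<^bsub>X.L\<^esub> T) (c \<odot>\<^bsub>Y.L\<^esub> U)"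
proof -
  obtain t \<tau> where 1: "\<And>n. (t n, \<tau> n) \<in> G0" "nconv X.L X.opn t T" "nconv Y.L Y.opn \<tau> U"
    using assms(1) unfolding Gc_def by blast
  show ?thesis by (rule GcI[OF G0_smult[OF 1(1)] LX.nconv_smult[OF 1(2)] LY.nconv_smult[OF 1(3)]])
qed

lemma Gc_star: assumes "Gc T U" shows "Gc (star X.L T) (star Y.L U)"
proof -
  obtain t \<tau> where 1: "\<And>n. (t n, \<tau> n) \<in> G0" "nconv X.L X.opn t T" "nconv Y.L Y.opn \<tau> U"
    using assms(1) unfolding Gc_def by blast
  show ?thesis by (rule GcI[OF G0_star[OF 1(1)] LX.nconv_star[OF 1(2)] LY.nconv_star[OF 1(3)]])
qed

lemma Gc_norm: assumes "Gc T U" shows "Y.opn U \<le> X.opn T"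
proof -
  obtain t \<tau> where 1: "\<And>n. (t n, \<tau> n) \<in> G0" "nconv X.L X.opn t T" "nconv Y.L Y.opn \<tau> U"
    using assms(1) unfolding Gc_def by blast
  show ?thesis
    by (rule LIMSEQ_le[OF LY.nconv_norm[OF 1(3)] LX.nconv_norm[OF 1(2)]]) (use G0_norm_le[OF 1(1)] in blast)
qed

lemma Gc_unique: assumes "Gc T U" "Gc T U'" shows "U = U'"
proof -
  have c: "T \<in> carrier X.L" "U \<in> carrier Y.L" "U' \<in> carrier Y.L" using assms Gc_closed by auto
  have "Gc (T \<oplus>\<^bsub>X.L\<^esub> (-1) \<odot>\<^bsub>X.L\<^esub> T) (U \<oplus>\<^bsub>Y.L\<^esub> (-1) \<odot>\<^bsub>Y.L\<^esub> U')" by (rule Gc_add[OF assms(1) Gc_smult[OF assms(2)]])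
  then have "Y.opn (U \<ominus>\<^bsub>Y.L\<^esub> U') \<le> X.opn (T \<ominus>\<^bsub>X.L\<^esub> T)"
    using Gc_norm c LX.minus_smult[of T T] LY.minus_smult[of U U'] by (simp)
  then have "Y.opn (U \<ominus>\<^bsub>Y.L\<^esub> U') = 0" using c LY.norm_nonneg[of "U \<ominus>\<^bsub>Y.L\<^esub> U'"] by (simp)
  then show ?thesis using LY.nm_diff_zero c by blast
qed

lemma fin_G0: assumes "t \<in> X.fin" shows "\<exists>\<tau>. (t, \<tau>) \<in> G0"
proof -
  let ?V = "{t. \<exists>\<tau>. (t, \<tau>) \<in> G0}"
  have "submodule ?V complex_ring X.L"
    unfolding LX.submodule_iff
    using G0_closed G0.zero G0_add G0_smult by (auto) blast+
  moreover have "rank_ones X \<subseteq> ?V"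
  proof
    fix r assume "r \<in> rank_ones X"
    then obtain \<xi> \<eta> where r: "r = rank_one X \<xi> \<eta>" "\<xi> \<in> carrier X" "\<eta> \<in> carrier X" by (auto simp: rank_ones_def)
    then have "(\<zero>\<^bsub>X.L\<^esub> \<oplus>\<^bsub>X.L\<^esub> r, \<zero>\<^bsub>Y.L\<^esub> \<oplus>\<^bsub>Y.L\<^esub> rank_one Y (\<psi> \<xi>) (\<psi> \<eta>)) \<in> G0"
      unfolding r(1) by (intro G0.add_rank G0.zero)
    moreover have "\<zero>\<^bsub>X.L\<^esub> \<oplus>\<^bsub>X.L\<^esub> r = r" using r X.rank_one_L LX.M.l_zero by blast
    ultimately show "r \<in> ?V" by auto
  qed
  ultimately show ?thesis using LX.lin_span_least assms by blast
qed

lemma G0_fin: "(t, \<tau>) \<in> G0 \<Longrightarrow> \<tau> \<in> Y.fin"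
proof (induction rule: G0.induct)
  case zero
  then show ?case using Y.fin_submodule unfolding LY.submodule_iff by blast
next
  case (add_rank t \<tau> \<xi> \<eta>)
  have "rank_one Y (\<psi> \<xi>) (\<psi> \<eta>) \<in> rank_ones Y" using add_rank(2,3) unfolding rank_ones_def by blast
  then have "rank_one Y (\<psi> \<xi>) (\<psi> \<eta>) \<in> Y.fin" using LY.lin_span_superset[of "rank_ones Y"] by blast
  then show ?case using Y.fin_submodule add_rank unfolding LY.submodule_iff by blast
qed

lemma Gc_K: "Gc T U \<Longrightarrow> U \<in> Y.K"
  unfolding Gc_def Y.compacts_eq using LY.nconv_mem_ncl G0_fin by metis

lemma K_Gc: assumes T: "T \<in> X.K" shows "\<exists>U. Gc T U"
proof -
  obtain t where t: "\<And>n. t n \<in> X.fin" "nconv X.L X.opn t T"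
    using LX.ncl_sequence[of T X.fin] T unfolding X.compacts_eq by blast
  obtain \<tau> where \<tau>: "\<And>n. (t n, \<tau> n) \<in> G0" using fin_G0[OF t(1)] by metis
  have c: "t n \<in> carrier X.L" "\<tau> n \<in> carrier Y.L" for n using G0_closed[OF \<tau>] by auto
  have le: "Y.opn (\<tau> m \<ominus>\<^bsub>Y.L\<^esub> \<tau> n) \<le> X.opn (t m \<ominus>\<^bsub>X.L\<^esub> t n)" for m n
    using G0_norm_le[OF G0_add[OF G0_smult[OF \<tau>[of n], of "-1"] \<tau>[of m]]]
      LX.minus_smult[OF c(1) c(1), of m n] LY.minus_smult[OF c(2) c(2), of m n] by (simp)
  have "ncauchy Y.L Y.opn \<tau>"
    using LX.ncauchy_nconv[OF t(2)] c(2) le unfolding ncauchy_def by (meson image_subsetI le_less_trans)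
  then obtain U where "nconv Y.L Y.opn \<tau> U" using LY.ncomplete by (auto simp: ncomplete_def)
  then show ?thesis using GcI[OF \<tau> t(2)] by blast
qed

lemma compact_map_exists:
  "\<exists>F. F \<in> extensional X.K \<and> star_hom X.KA Y.KA F \<and>
    (\<forall>\<xi>\<in>carrier X. \<forall>\<eta>\<in>carrier X. F (rank_one X \<xi> \<eta>) = rank_one Y (\<psi> \<xi>) (\<psi> \<eta>))"
proof -
  define F where "F = (\<lambda>T\<in>X.K. THE U. Gc T U)"
  have F: "Gc T (F T)" if T: "T \<in> X.K" for T
  proof -
    obtain U where U: "Gc T U" using K_Gc[OF T] by blast
    have "Gc T (THE U. Gc T U)" by (rule theI[of "Gc T", OF U]) (rule Gc_unique[OF _ U])
    then show ?thesis using T by (simp add: F_def)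
  qed
  have F_eq: "F T = U" if "T \<in> X.K" "Gc T U" for T U using F[OF that(1)] that(2) Gc_unique[of T "F T" U] by simp
  note K = X.K_submodule[unfolded LX.submodule_iff]
  have "star_hom X.KA Y.KA F"
    unfolding star_hom_def linear_map_def
  proof (intro conjI ballI allI)
    show "F \<in> carrier X.KA \<rightarrow> carrier Y.KA" using F Gc_K by auto
    fix S T c assume "S \<in> carrier X.KA"
    then have S: "S \<in> X.K" by simp
    have 1: "c \<odot>\<^bsub>X.L\<^esub> S \<in> X.K" using S K by blast
    show "F (c \<odot>\<^bsub>X.KA\<^esub> S) = c \<odot>\<^bsub>Y.KA\<^esub> F S" using F_eq[OF 1 Gc_smult[OF F[OF S]]] by simp
    show "F (star X.KA S) = star Y.KA (F S)" using F_eq[OF X.K_star[OF S] Gc_star[OF F[OF S]]] by simp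
    assume "T \<in> carrier X.KA"
    then have T: "T \<in> X.K" by simp
    have 2: "S \<oplus>\<^bsub>X.L\<^esub> T \<in> X.K" using S T K by blast
    show "F (S \<oplus>\<^bsub>X.KA\<^esub> T) = F S \<oplus>\<^bsub>Y.KA\<^esub> F T" using F_eq[OF 2 Gc_add[OF F[OF S] F[OF T]]] by simp
    show "F (S \<otimes>\<^bsub>X.KA\<^esub> T) = F S \<otimes>\<^bsub>Y.KA\<^esub> F T"
      using F_eq[OF X.K_left[OF subsetD[OF X.K_L S] T] Gc_mult[OF F[OF S] F[OF T]]] by simp
  qed
  moreover have "F (rank_one X \<xi> \<eta>) = rank_one Y (\<psi> \<xi>) (\<psi> \<eta>)" if "\<xi> \<in> carrier X" "\<eta> \<in> carrier X" for \<xi> \<eta>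
  proof (rule F_eq[OF X.rank_one_K[OF that]])
    let ?r = "rank_one X \<xi> \<eta>" and ?r' = "rank_one Y (\<psi> \<xi>) (\<psi> \<eta>)"
    have c: "?r \<in> carrier X.L" "?r' \<in> carrier Y.L" using that X.rank_one_L Y.rank_one_L by auto
    have "(\<zero>\<^bsub>X.L\<^esub> \<oplus>\<^bsub>X.L\<^esub> ?r, \<zero>\<^bsub>Y.L\<^esub> \<oplus>\<^bsub>Y.L\<^esub> ?r') \<in> G0" using that by (intro G0.add_rank G0.zero)
    then have "(?r, ?r') \<in> G0" using c by (simp)
    then show "Gc ?r ?r'" using GcI[of "\<lambda>_. ?r" "\<lambda>_. ?r'"] LX.nconv_const LY.nconv_const c by blast
  qed
  moreover have "F \<in> extensional X.K" by (simp add: F_def)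
  ultimately show ?thesis by blast
qed

end

abbreviation "cm \<equiv> compact_map A X B Y \<psi>"

lemma compact_map:
  shows compact_map_hom: "star_hom X.KA Y.KA cm"
    and compact_map_rank_one: "\<lbrakk>\<xi> \<in> carrier X; \<eta> \<in> carrier X\<rbrakk> \<Longrightarrow> cm (rank_one X \<xi> \<eta>) = rank_one Y (\<psi> \<xi>) (\<psi> \<eta>)"
proof -
  let ?P = "\<lambda>F. F \<in> extensional X.K \<and> star_hom X.KA Y.KA F \<and>
    (\<forall>\<xi>\<in>carrier X. \<forall>\<eta>\<in>carrier X. F (rank_one X \<xi> \<eta>) = rank_one Y (\<psi> \<xi>) (\<psi> \<eta>))"
  obtain F where F: "?P F" using compact_map_exists by blast
  have "F' = F" if "?P F'" for F'
    using that F X.KA_hom_eqI[OF Y.cstar_KA, of F' F] by (intro extensionalityI[of F' X.K F]) auto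
  then have "?P (THE F. ?P F)" using F by (intro theI[of ?P F])
  then have "?P cm" by (simp add: compact_map_def)
  then show "star_hom X.KA Y.KA cm"
    "\<lbrakk>\<xi> \<in> carrier X; \<eta> \<in> carrier X\<rbrakk> \<Longrightarrow> cm (rank_one X \<xi> \<eta>) = rank_one Y (\<psi> \<xi>) (\<psi> \<eta>)" by blast+
qed

lemma cstar_hom_cm: "cstar_hom X.KA Y.KA cm"
  by (rule cstar_homI[OF X.cstar_KA Y.cstar_KA compact_map_hom])

lemma compact_map_K: "T \<in> X.K \<Longrightarrow> cm T \<in> Y.K"
  using compact_map_hom by (auto simp: star_hom_def linear_map_def)

text \<open>Induction over compact operators, with closedness from contractivity of
  \<open>cm\<close> and \<psi>. When \<psi> is surjective this determines \<open>cm T\<close>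
  completely.\<close>

lemma compact_map_intertw:
  assumes T: "T \<in> X.K" and x: "\<xi> \<in> carrier X" shows "cm T (\<psi> \<xi>) = \<psi> (T \<xi>)"
proof -
  interpret LX: cstar_algebra X.L by (rule X.cstar_L)
  interpret LY: cstar_algebra Y.L by (rule Y.cstar_L)
  interpret F: cstar_hom X.KA Y.KA cm by (rule cstar_hom_cm)
  note K = X.K_submodule[unfolded LX.submodule_iff]
  let ?V = "{T \<in> X.K. \<forall>\<xi>\<in>carrier X. cm T (\<psi> \<xi>) = \<psi> (T \<xi>)}"
  have L: "T \<in> X.K \<Longrightarrow> T \<in> carrier X.L" "T \<in> X.K \<Longrightarrow> cm T \<in> carrier Y.L" for T
    using X.K_L Y.K_L compact_map_K by blast+
  have "X.K \<subseteq> ?V"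
  proof (rule X.K_least)
    show "submodule ?V complex_ring X.L"
      unfolding LX.submodule_iff
    proof (intro conjI ballI allI subsetI)
      show "\<zero>\<^bsub>X.L\<^esub> \<in> ?V" using K F.map_zero by (simp add: X.L_simps(3) Y.L_simps(3))
      fix S c assume S: "S \<in> ?V"
      then show "S \<in> carrier X.L" using L by blast
      show "c \<odot>\<^bsub>X.L\<^esub> S \<in> ?V" using S K F.map_smult[of S c] L by (auto simp: psi_smult X.L_simps(5) Y.L_simps(5))
      fix T assume T: "T \<in> ?V"
      show "S \<oplus>\<^bsub>X.L\<^esub> T \<in> ?V" using S T K F.map_add[of S T] L by (auto simp: psi_add X.L_simps(4) Y.L_simps(4))
    qed
    show "ncl X.L X.opn ?V \<subseteq> ?V"
    proof
      fix T assume T: "T \<in> ncl X.L X.opn ?V"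
      have TK: "T \<in> X.K" using T LX.ncl_mono[of ?V X.K] X.K_closed by blast
      have "cm T (\<psi> \<xi>) = \<psi> (T \<xi>)" if x: "\<xi> \<in> carrier X" for \<xi>
      proof (rule Y.X.nm_diff_lt_eqI)
        show "cm T (\<psi> \<xi>) \<in> carrier Y" "\<psi> (T \<xi>) \<in> carrier Y" using L[OF TK] x by auto
        fix e :: real assume e: "e > 0"
        \<comment> \<open>The factor 2 is for the two error terms below, each at most d times the
          norm of \<xi>; the summand 1 admits \<xi> = 0.\<close>
        define d where "d = e / (2 * (X.hn \<xi> + 1))"
        have d: "d > 0" "2 * d * X.hn \<xi> \<le> e"
          using e X.hn_nonneg[OF x] by (auto simp: d_def divide_simps)
        obtain S where S: "S \<in> ?V" "X.opn (T \<ominus>\<^bsub>X.L\<^esub> S) < d" using LX.nclE[OF T d(1)] by blast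
        then have SK: "S \<in> X.K" "cm S (\<psi> \<xi>) = \<psi> (S \<xi>)" using x by auto
        have n1: "Y.opn (cm T \<ominus>\<^bsub>Y.L\<^esub> cm S) \<le> X.opn (T \<ominus>\<^bsub>X.L\<^esub> S)"
          using F.norm_map_diff[of T S] TK SK by (simp add: X.KA_minus Y.KA_minus compact_map_K)
        have "Y.hn (cm T (\<psi> \<xi>) \<ominus>\<^bsub>Y\<^esub> cm S (\<psi> \<xi>)) \<le> Y.opn (cm T \<ominus>\<^bsub>Y.L\<^esub> cm S) * Y.hn (\<psi> \<xi>)"
          using Y.opn_bound[of "cm T \<ominus>\<^bsub>Y.L\<^esub> cm S" "\<psi> \<xi>"] L[OF TK] L[OF SK(1)] x LY.M.minus_closed
          by (simp add: Y.L_minus_apply)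
        also have "\<dots> \<le> d * X.hn \<xi>"
          using n1 S(2) psi_norm[OF x] d(1) Y.hn_nonneg[of "\<psi> \<xi>"] x by (intro mult_mono) auto
        finally have 1: "Y.hn (cm T (\<psi> \<xi>) \<ominus>\<^bsub>Y\<^esub> \<psi> (S \<xi>)) \<le> d * X.hn \<xi>" by (simp add: SK)
        have "Y.hn (\<psi> (S \<xi>) \<ominus>\<^bsub>Y\<^esub> \<psi> (T \<xi>)) \<le> X.hn (S \<xi> \<ominus>\<^bsub>X\<^esub> T \<xi>)"
          using psi_norm[of "S \<xi> \<ominus>\<^bsub>X\<^esub> T \<xi>"] L[OF TK] L[OF SK(1)] x by (simp add: psi_diff)
        also have "\<dots> = X.hn ((T \<ominus>\<^bsub>X.L\<^esub> S) \<xi>)"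
          using L[OF TK] L[OF SK(1)] x X.X.nm_commute[of "S \<xi>" "T \<xi>"] by (simp add: X.L_minus_apply)
        also have "\<dots> \<le> X.opn (T \<ominus>\<^bsub>X.L\<^esub> S) * X.hn \<xi>"
          using L[OF TK] L[OF SK(1)] x LX.M.minus_closed by (intro X.opn_bound) auto
        also have "\<dots> \<le> d * X.hn \<xi>" using S(2) X.hn_nonneg[OF x] by (intro mult_right_mono) auto
        finally have 2: "Y.hn (\<psi> (S \<xi>) \<ominus>\<^bsub>Y\<^esub> \<psi> (T \<xi>)) \<le> d * X.hn \<xi>" .
        show "Y.hn (cm T (\<psi> \<xi>) \<ominus>\<^bsub>Y\<^esub> \<psi> (T \<xi>)) \<le> e"
          using Y.X.nm_tri[of "cm T (\<psi> \<xi>)" "\<psi> (S \<xi>)" "\<psi> (T \<xi>)"] L[OF TK] L[OF SK(1)] x 1 2 d(2) by simp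
      qed
      then show "T \<in> ?V" using TK by blast
    qed
    show "rank_one X \<xi> \<eta> \<in> ?V" if "\<xi> \<in> carrier X" "\<eta> \<in> carrier X" for \<xi> \<eta>
      using that by (simp add: X.rank_one_K compact_map_rank_one X.rank_one_apply Y.rank_one_apply psi_ract C1)
  qed
  then show ?thesis using T x by blast
qed

end

section \<open>Compact operators on an algebra over itself\<close>

context cstar_algebra
begin

lemma rank_one_self: "\<lbrakk>a \<in> carrier A; b \<in> carrier A\<rbrakk> \<Longrightarrow> rank_one (self_corr A) a b = lmul A (a \<otimes> star A b)"
  by (auto simp: rank_one_def lmul_def mult_assoc intro!: ext)

lemma cstar_hom_lmul_L: "cstar_hom A S.L (lmul A)"
  by (rule cstar_homI[OF cstar_algebra_axioms S.cstar_L])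
    (auto simp: star_hom_def linear_map_def lmul_add lmul_mult lmul_smult star_lmul)

text \<open>The range of \<open>lmul\<close> is closed and contains the rank-one operators, hence
  all compacts. Conversely the x with compact \<open>lmul A x\<close> form a closed subspace that
  contains all products.\<close>

lemma compacts_self: "compacts A (self_corr A) = lmul A ` carrier A"
proof
  interpret L: cstar_algebra S.L by (rule S.cstar_L)
  interpret lm: cstar_hom A S.L "lmul A" by (rule cstar_hom_lmul_L)
  show "compacts A (self_corr A) \<subseteq> lmul A ` carrier A"
    by (rule S.K_least[OF lm.image_submodule lm.closed_range]) (auto simp: rank_one_self)
  have "{x \<in> carrier A. lmul A x \<in> S.K} = carrier A"
  proof (rule closed_submodule_products[OF lm.preimage_submodule[OF S.K_submodule] lm.preimage_closed[OF S.K_closed]])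
    fix x y assume xy: "x \<in> carrier A" "y \<in> carrier A"
    then have "rank_one (self_corr A) x (star A y) \<in> S.K" by (intro S.rank_one_K) auto
    then show "x \<otimes> y \<in> {x \<in> carrier A. lmul A x \<in> S.K}" using xy by (simp add: rank_one_self)
  qed
  then show "lmul A ` carrier A \<subseteq> compacts A (self_corr A)" by blast
qed

lemma inj_on_lmul: "inj_on (lmul A) (carrier A)"
proof (rule inj_onI)
  interpret L: cstar_algebra S.L by (rule S.cstar_L)
  interpret lm: cstar_hom A S.L "lmul A" by (rule cstar_hom_lmul_L)
  fix x y assume xy: "x \<in> carrier A" "y \<in> carrier A" "lmul A x = lmul A y"
  then have "cnorm A (x \<ominus> y) = 0"
    using norm_lmul[of "x \<ominus> y"] lm.map_diff[of x y] L.nm_diff_zero' by simp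
  then show "x = y" using xy nm_diff_zero by blast
qed

lemma star_hom_lmul: "star_hom A S.KA (lmul A)"
  unfolding compact_algebra_def
  by (rule star_hom_carrier_update[OF cstar_hom.hom[OF cstar_hom_lmul_L] S.K_L]) (simp add: compacts_self)

lemma star_hom_lmul_inv: "star_hom S.KA A (inv_into (carrier A) (lmul A))"
proof -
  have i [simp]: "inv_into (carrier A) (lmul A) (lmul A x) = x" if "x \<in> carrier A" for x using that inj_on_lmul by simp
  interpret lm: cstar_hom A S.KA "lmul A" by (rule cstar_homI[OF cstar_algebra_axioms S.cstar_KA star_hom_lmul])
  have c: "carrier S.KA = lmul A ` carrier A" by (simp add: compacts_self)
  show ?thesis
    unfolding star_hom_def linear_map_def c ball_simps
    using lm.map_add[symmetric] lm.map_smult[symmetric] lm.map_mult[symmetric] lm.map_star[symmetric]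
    by (auto simp del: S.KA_simps)
qed

end

section \<open>Covariant representations\<close>

locale hcorr = hilb A X
  for A :: "'a cstar_algebra" and X :: "('a, 'x) correspondence" +
  assumes lact_hom: "star_hom A (adjointables A X) (lact X)"
begin

sublocale lact: cstar_hom A L "lact X"
  by (rule cstar_homI[OF A.cstar_algebra_axioms cstar_L lact_hom])

abbreviation "J \<equiv> katsura_ideal A X"

lemma J_K: "a \<in> J \<Longrightarrow> a \<in> carrier A" "a \<in> J \<Longrightarrow> lact X a \<in> K"
  by (simp_all add: katsura_ideal_def)

lemma lker_iff: "a \<in> lker A X \<longleftrightarrow> a \<in> carrier A \<and> lact X a = \<zero>\<^bsub>L\<^esub>"
  by (auto simp: lker_def a_kernel_def')
lemma lker_star: "a \<in> lker A X \<Longrightarrow> star A a \<in> lker A X"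
  using lact.map_star[of a] by (simp add: lker_iff)

lemma lker_mult: "\<lbrakk>a \<in> carrier A; b \<in> lker A X\<rbrakk> \<Longrightarrow> a \<otimes>\<^bsub>A\<^esub> b \<in> lker A X"
  using lact.map_mult[of a b] A.mult_closed[of a b] by (simp add: lker_iff)

text \<open>The kernel is stable under adjoints, so such an element annihilates its own
  adjoint.\<close>

lemma J_lker: assumes "a \<in> J" "a \<in> lker A X" shows "a = \<zero>\<^bsub>A\<^esub>"
proof (rule A.mult_star_eq_zero)
  show "a \<in> carrier A" using assms(1) by (rule J_K)
  show "a \<otimes>\<^bsub>A\<^esub> star A a = \<zero>\<^bsub>A\<^esub>" using assms(1) lker_star[OF assms(2)] by (simp add: katsura_ideal_def)
qed

lemma JI:
  "\<lbrakk>a \<in> carrier A; lact X a \<in> K; \<And>b. b \<in> lker A X \<Longrightarrow> a \<otimes>\<^bsub>A\<^esub> b = \<zero>\<^bsub>A\<^esub>\<rbrakk> \<Longrightarrow> a \<in> J"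
  by (simp add: katsura_ideal_def)

end

lemma (in correspondence) hcorr: "hcorr A X"
  by (intro hcorr.intro hilb hcorr_axioms.intro lact_hom)

text \<open>Only (C1) and (C2). These already determine the map \<open>cpt\<close> on compact
  operators, in terms of which covariance becomes one equation that can be examined separately for
  each representation.\<close>

locale toeplitz_rep = X: hcorr A X + D: cstar_algebra D
  for A :: "'a cstar_algebra" and X :: "('a, 'x) correspondence" and D :: "'d cstar_algebra" +
  fixes \<rho>X :: "'x \<Rightarrow> 'd" and \<rho>A :: "'a \<Rightarrow> 'd"
  assumes rep_lin: "linear_map X D \<rho>X" and rep_hom: "star_hom A D \<rho>A"
    and rep_ip: "\<lbrakk>\<xi> \<in> carrier X; \<eta> \<in> carrier X\<rbrakk> \<Longrightarrow> star D (\<rho>X \<xi>) \<otimes>\<^bsub>D\<^esub> \<rho>X \<eta> = \<rho>A (ip X \<xi> \<eta>)"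
    and rep_lact: "\<lbrakk>a \<in> carrier A; \<xi> \<in> carrier X\<rbrakk> \<Longrightarrow> \<rho>X (lact X a \<xi>) = \<rho>A a \<otimes>\<^bsub>D\<^esub> \<rho>X \<xi>"
begin

sublocale hp: hilbert_map A X D "self_corr D" \<rho>X \<rho>A
  by unfold_locales (use rep_lin rep_hom rep_ip in \<open>auto simp: linear_map_def\<close>)

lemma rep_closed [simp, intro]: "\<xi> \<in> carrier X \<Longrightarrow> \<rho>X \<xi> \<in> carrier D"
  using hp.psi_closed by simp

text \<open>The induced map on compact operators followed by the identification of the compacts on D
  with D.\<close>

definition cpt :: "('x \<Rightarrow> 'x) \<Rightarrow> 'd"
  where "cpt T = inv_into (carrier D) (lmul D) (compact_map A X D (self_corr D) \<rho>X T)"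

lemma cpt_hom: "star_hom X.KA D cpt"
  unfolding cpt_def by (rule star_hom_comp[OF hp.compact_map_hom D.star_hom_lmul_inv])

lemma cpt_rank_one:
  "\<lbrakk>\<xi> \<in> carrier X; \<eta> \<in> carrier X\<rbrakk> \<Longrightarrow> cpt (rank_one X \<xi> \<eta>) = \<rho>X \<xi> \<otimes>\<^bsub>D\<^esub> star D (\<rho>X \<eta>)"
  by (simp add: cpt_def hp.compact_map_rank_one D.rank_one_self inv_into_f_f[OF D.inj_on_lmul])

lemma lmul_cpt: "T \<in> X.K \<Longrightarrow> lmul D (cpt T) = compact_map A X D (self_corr D) \<rho>X T"
  unfolding cpt_def using hp.compact_map_K[of T] by (intro f_inv_into_f) (simp add: D.compacts_self)

lemma cpt_closed: "T \<in> X.K \<Longrightarrow> cpt T \<in> carrier D"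
  using cpt_hom by (auto simp: star_hom_def linear_map_def)

lemma cpt_unique:
  assumes "star_hom X.KA D F"
    and "\<And>\<xi> \<eta>. \<lbrakk>\<xi> \<in> carrier X; \<eta> \<in> carrier X\<rbrakk> \<Longrightarrow> F (rank_one X \<xi> \<eta>) = \<rho>X \<xi> \<otimes>\<^bsub>D\<^esub> star D (\<rho>X \<eta>)"
    and "T \<in> X.K"
  shows "F T = cpt T"
  by (rule X.KA_hom_eqI[OF D.cstar_algebra_axioms assms(1) cpt_hom _ assms(3)]) (simp add: assms(2) cpt_rank_one)

lemma lact_self: "lact (self_corr D) = lmul D"
  by (auto simp: lmul_def)

text \<open>D acts on itself faithfully and by compact operators. Consequently (C3) holds for every
  representation on D.\<close>

lemma katsura_self: "katsura_ideal D (self_corr D) = carrier D"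
proof -
  have z: "b = \<zero>\<^bsub>D\<^esub>" if "b \<in> lker D (self_corr D)" for b
  proof -
    have b: "b \<in> carrier D" "lmul D b = \<zero>\<^bsub>D.S.L\<^esub>" using that by (auto simp: lker_def a_kernel_def' lact_self)
    have "lmul D \<zero>\<^bsub>D\<^esub> = \<zero>\<^bsub>D.S.L\<^esub>" by (rule cstar_hom.map_zero[OF D.cstar_hom_lmul_L])
    then show ?thesis using b inj_onD[OF D.inj_on_lmul, of b "\<zero>\<^bsub>D\<^esub>"] by simp
  qed
  have "x \<otimes>\<^bsub>D\<^esub> b = \<zero>\<^bsub>D\<^esub>" if "x \<in> carrier D" "b \<in> lker D (self_corr D)" for x b
    using that(1) unfolding z[OF that(2)] by (rule D.mult_zero_right)
  then show ?thesis by (auto simp: katsura_ideal_def lact_self D.compacts_self)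
qed

lemma covariant_iff: "covariant_rep A X D \<rho>X \<rho>A \<longleftrightarrow> (\<forall>a\<in>X.J. \<rho>A a = cpt (lact X a))"
proof -
  have "lmul D (\<rho>A a) = compact_map A X D (self_corr D) \<rho>X (lact X a) \<longleftrightarrow> \<rho>A a = cpt (lact X a)"
    if "a \<in> X.J" for a
    using X.J_K[OF that] inj_on_eq_iff[OF D.inj_on_lmul, of "\<rho>A a" "cpt (lact X a)"]
    by (simp add: lmul_cpt cpt_closed)
  moreover have "\<rho>A ` X.J \<subseteq> carrier D" using X.J_K(1) by auto
  ultimately show ?thesis
    unfolding covariant_rep_def corr_morphism_def lact_self katsura_self
    using rep_hom hp.lin hp.C1 rep_lact by simp
qed

text \<open>A homomorphism with these values on rank-one operators must be \<open>cpt\<close>, so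
  covariance may be checked with whichever description of it is convenient.\<close>

lemma covariantI:
  assumes "star_hom X.KA D F"
    and "\<And>\<xi> \<eta>. \<lbrakk>\<xi> \<in> carrier X; \<eta> \<in> carrier X\<rbrakk> \<Longrightarrow> F (rank_one X \<xi> \<eta>) = \<rho>X \<xi> \<otimes>\<^bsub>D\<^esub> star D (\<rho>X \<eta>)"
    and "\<And>a. a \<in> X.J \<Longrightarrow> \<rho>A a = F (lact X a)"
  shows "covariant_rep A X D \<rho>X \<rho>A"
  unfolding covariant_iff using assms(3) cpt_unique[OF assms(1,2)] X.J_K by simp

end

lemma toeplitz_repI:
  assumes X: "hcorr A X" and D: "cstar_algebra D" and cov: "covariant_rep A X D \<rho>X \<rho>A"
  shows "toeplitz_rep A X D \<rho>X \<rho>A"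
proof (intro toeplitz_rep.intro toeplitz_rep_axioms.intro X D)
  show "linear_map X D \<rho>X" "star_hom A D \<rho>A"
    "\<lbrakk>\<xi> \<in> carrier X; \<eta> \<in> carrier X\<rbrakk> \<Longrightarrow> star D (\<rho>X \<xi>) \<otimes>\<^bsub>D\<^esub> \<rho>X \<eta> = \<rho>A (ip X \<xi> \<eta>)" for \<xi> \<eta>
    using cov by (auto simp: covariant_rep_def corr_morphism_def linear_map_def)
  fix a \<xi> assume "a \<in> carrier A" "\<xi> \<in> carrier X"
  moreover have "\<rho>X \<xi> \<in> carrier D" using cov \<open>\<xi> \<in> carrier X\<close> by (auto simp: covariant_rep_def corr_morphism_def linear_map_def)
  ultimately show "\<rho>X (lact X a \<xi>) = \<rho>A a \<otimes>\<^bsub>D\<^esub> \<rho>X \<xi>"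
    using cov by (auto simp: covariant_rep_def corr_morphism_def)
qed

lemma (in toeplitz_rep) covariant_comp:
  assumes cov: "covariant_rep A X D \<rho>X \<rho>A" and E: "cstar_algebra E" and f: "star_hom D E f"
  shows "covariant_rep A X E (\<lambda>\<xi>. f (\<rho>X \<xi>)) (\<lambda>a. f (\<rho>A a))"
proof -
  interpret f: cstar_hom D E f by (rule cstar_homI[OF D.cstar_algebra_axioms E f])
  interpret c: toeplitz_rep A X E "\<lambda>\<xi>. f (\<rho>X \<xi>)" "\<lambda>a. f (\<rho>A a)"
  proof unfold_locales
    show "linear_map X E (\<lambda>\<xi>. f (\<rho>X \<xi>))"
      using rep_lin by (auto simp: linear_map_def Pi_iff f.map_add f.map_smult)
    show "star_hom A E (\<lambda>a. f (\<rho>A a))" by (rule star_hom_comp[OF rep_hom f])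
    show "star E (f (\<rho>X \<xi>)) \<otimes>\<^bsub>E\<^esub> f (\<rho>X \<eta>) = f (\<rho>A (ip X \<xi> \<eta>))" if "\<xi> \<in> carrier X" "\<eta> \<in> carrier X" for \<xi> \<eta>
      using that by (simp flip: rep_ip f.map_star f.map_mult)
    show "f (\<rho>X (lact X a \<xi>)) = f (\<rho>A a) \<otimes>\<^bsub>E\<^esub> f (\<rho>X \<xi>)" if "a \<in> carrier A" "\<xi> \<in> carrier X" for a \<xi>
      using that by (simp add: rep_lact f.map_mult)
  qed
  show ?thesis
    by (rule c.covariantI[OF star_hom_comp[OF cpt_hom f]])
      (use cov in \<open>simp_all add: cpt_rank_one f.map_mult f.map_star covariant_iff\<close>)
qed

lemma (in toeplitz_rep) covariant_restrict:
  assumes cov: "covariant_rep A X D \<rho>X \<rho>A" and E: "cstar_subalgebra D E"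
    and X: "\<And>\<xi>. \<xi> \<in> carrier X \<Longrightarrow> \<rho>X \<xi> \<in> E" and A: "\<And>a. a \<in> carrier A \<Longrightarrow> \<rho>A a \<in> E"
  shows "covariant_rep A X (D\<lparr>carrier := E\<rparr>) \<rho>X \<rho>A"
proof -
  let ?E = "D\<lparr>carrier := E\<rparr>"
  have Es: "submodule E complex_ring D" "ncl D (cnorm D) E \<subseteq> E" "E \<subseteq> carrier D"
    and Em: "\<And>x y. \<lbrakk>x \<in> E; y \<in> E\<rbrakk> \<Longrightarrow> x \<otimes>\<^bsub>D\<^esub> y \<in> E" and Est: "\<And>x. x \<in> E \<Longrightarrow> star D x \<in> E"
    using E unfolding D.cstar_subalgebra_iff D.submodule_iff by simp_all
  interpret E: cstar_algebra ?E by (rule D.cstar_algebra_carrier_update[OF E])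
  interpret c: toeplitz_rep A X ?E \<rho>X \<rho>A
  proof unfold_locales
    show "linear_map X ?E \<rho>X" using rep_lin X by (auto simp: linear_map_def)
    show "star_hom A ?E \<rho>A" by (rule star_hom_carrier_update[OF rep_hom Es(3) A])
  qed (simp_all add: rep_ip rep_lact)
  interpret F: cstar_hom X.KA D cpt by (rule cstar_homI[OF X.cstar_KA D.cstar_algebra_axioms cpt_hom])
  have "cstar_subalgebra X.KA {T \<in> carrier X.KA. cpt T \<in> E}"
    unfolding F.A.cstar_subalgebra_iff
  proof (intro conjI F.preimage_submodule F.preimage_closed Es ballI)
    fix S assume S: "S \<in> {T \<in> carrier X.KA. cpt T \<in> E}"
    show "star X.KA S \<in> {T \<in> carrier X.KA. cpt T \<in> E}"
      using S F.A.star_closed[of S] F.map_star[of S] Est by simp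
    fix T assume T: "T \<in> {T \<in> carrier X.KA. cpt T \<in> E}"
    show "S \<otimes>\<^bsub>X.KA\<^esub> T \<in> {T \<in> carrier X.KA. cpt T \<in> E}"
      using S T F.A.mult_closed[of S T] F.map_mult[of S T] Em by simp
  qed
  moreover have "rank_ones X \<subseteq> {T \<in> carrier X.KA. cpt T \<in> E}"
    using X Em Est X.rank_one_K by (auto simp: rank_ones_def cpt_rank_one)
  ultimately have cE: "{T \<in> carrier X.KA. cpt T \<in> E} = carrier X.KA"
    using X.generated_KA unfolding generated_by_def by blast
  show ?thesis
    by (rule c.covariantI[OF star_hom_carrier_update[OF cpt_hom Es(3)]])
      (use cov cE in \<open>auto simp: cpt_rank_one covariant_iff\<close>)
qed

section \<open>Words in the generators of a representation\<close>

context toeplitz_rep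
begin

text \<open>Symbols outside the carriers denote zero, so that every code has a value in D.\<close>

definition letter :: "'x + 'x + 'a \<Rightarrow> 'd" where
  "letter l = (case l of
      Inl \<xi> \<Rightarrow> if \<xi> \<in> carrier X then \<rho>X \<xi> else \<zero>\<^bsub>D\<^esub>
    | Inr (Inl \<xi>) \<Rightarrow> if \<xi> \<in> carrier X then star D (\<rho>X \<xi>) else \<zero>\<^bsub>D\<^esub>
    | Inr (Inr a) \<Rightarrow> if a \<in> carrier A then \<rho>A a else \<zero>\<^bsub>D\<^esub>)"

text \<open>The empty word denotes zero, as there may be no unit; for this reason
  \<open>word_mult\<close> treats empty words apart from concatenation.\<close>

fun word :: "('x + 'x + 'a) list \<Rightarrow> 'd" where
  "word [] = \<zero>\<^bsub>D\<^esub>"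
| "word [l] = letter l"
| "word (l # l' # w) = letter l \<otimes>\<^bsub>D\<^esub> word (l' # w)"

definition words :: "('x + 'x + 'a) list list \<Rightarrow> 'd" where
  "words ws = foldr (\<lambda>w y. word w \<oplus>\<^bsub>D\<^esub> y) ws \<zero>\<^bsub>D\<^esub>"

lemma letter_closed [simp]: "letter l \<in> carrier D"
  by (auto simp: letter_def split: sum.split)

lemma word_closed [simp]: "word w \<in> carrier D"
  by (induction w rule: word.induct) (auto)

lemma words_simps [simp]: "words [] = \<zero>\<^bsub>D\<^esub>" "words (w # ws) = word w \<oplus>\<^bsub>D\<^esub> words ws"
  by (simp_all add: words_def)

lemma words_closed [simp]: "words ws \<in> carrier D"
  by (induction ws) auto

lemma word_append: "\<lbrakk>v \<noteq> []; w \<noteq> []\<rbrakk> \<Longrightarrow> word (v @ w) = word v \<otimes>\<^bsub>D\<^esub> word w"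
proof (induction v rule: word.induct)
  case (2 l)
  then show ?case by (cases w) auto
next
  case (3 l l' w)
  then show ?case by (simp add: D.mult_assoc)
qed simp

lemma word_mult: "word v \<otimes>\<^bsub>D\<^esub> word w \<in> range word"
proof (cases "v = [] \<or> w = []")
  case True
  then have "word v \<otimes>\<^bsub>D\<^esub> word w = word []" by auto
  then show ?thesis by blast
next
  case False
  then show ?thesis using word_append[of v w] by (metis rangeI)
qed

lemma letter_star: "star D (letter l) \<in> range letter"
proof (cases l)
  case (Inl \<xi>)
  then have "star D (letter l) = letter (Inr (Inl \<xi>))" by (simp add: letter_def)
  then show ?thesis by blast
next
  case (Inr m)
  show ?thesis
  proof (cases m)
    case (Inl \<xi>)
    then have "star D (letter l) = letter (Inl \<xi>)" using Inr by (simp add: letter_def)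
    then show ?thesis by blast
  next
    case (Inr a)
    then have "star D (letter l) = letter (Inr (Inr (if a \<in> carrier A then star A a else a)))"
      using \<open>l = Inr m\<close> by (simp add: letter_def hp.H.map_star)
    then show ?thesis by blast
  qed
qed

lemma letter_smult: "c \<odot>\<^bsub>D\<^esub> letter l \<in> range letter"
proof (cases l)
  case (Inl \<xi>)
  then have "c \<odot>\<^bsub>D\<^esub> letter l = letter (Inl (if \<xi> \<in> carrier X then c \<odot>\<^bsub>X\<^esub> \<xi> else \<xi>))"
    using hp.psi_smult by (simp add: letter_def)
  then show ?thesis by blast
next
  case (Inr m)
  show ?thesis
  proof (cases m)
    case (Inl \<xi>)
    then have "c \<odot>\<^bsub>D\<^esub> letter l = letter (Inr (Inl (if \<xi> \<in> carrier X then cnj c \<odot>\<^bsub>X\<^esub> \<xi> else \<xi>)))"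
      using Inr hp.psi_smult by (simp add: letter_def D.star_smult)
    then show ?thesis by blast
  next
    case (Inr a)
    then have "c \<odot>\<^bsub>D\<^esub> letter l = letter (Inr (Inr (if a \<in> carrier A then c \<odot>\<^bsub>A\<^esub> a else a)))"
      using \<open>l = Inr m\<close> by (simp add: letter_def hp.H.map_smult)
    then show ?thesis by blast
  qed
qed

lemma word_star: "star D (word w) \<in> range word"
proof (induction w rule: word.induct)
  case 1
  have "star D (word []) = word []" by simp
  then show ?case by blast
next
  case (2 l)
  obtain l' where "star D (letter l) = letter l'" using letter_star by blast
  then have "star D (word [l]) = word [l']" by simp
  then show ?case by blast
next
  case (3 l l' w)
  then obtain v where v: "star D (word (l' # w)) = word v" by blast
  obtain m where "star D (letter l) = letter m" using letter_star by blast
  then have "star D (word (l # l' # w)) = word v \<otimes>\<^bsub>D\<^esub> word [m]" using v by (simp add: D.star_mult)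
  then show ?case using word_mult by metis
qed

lemma word_smult: "c \<odot>\<^bsub>D\<^esub> word w \<in> range word"
proof (cases w rule: word.cases)
  case 1
  then have "c \<odot>\<^bsub>D\<^esub> word w = word []" by simp
  then show ?thesis by blast
next
  case (2 l)
  obtain l' where "c \<odot>\<^bsub>D\<^esub> letter l = letter l'" using letter_smult by blast
  then have "c \<odot>\<^bsub>D\<^esub> word w = word [l']" using 2 by simp
  then show ?thesis by blast
next
  case (3 l l' v)
  obtain m where "c \<odot>\<^bsub>D\<^esub> letter l = letter m" using letter_smult by blast
  then have "c \<odot>\<^bsub>D\<^esub> word w = word [m] \<otimes>\<^bsub>D\<^esub> word (l' # v)" using 3 by (simp flip: D.mult_smult_left)
  then show ?thesis using word_mult by metis
qed

lemma words_append: "words (vs @ ws) = words vs \<oplus>\<^bsub>D\<^esub> words ws"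
  by (induction vs) (simp_all add: D.M.a_assoc)

lemma word_in_words: "x \<in> range word \<Longrightarrow> x \<in> range words"
proof (elim rangeE)
  fix w assume "x = word w"
  then have "x = words [w]" by simp
  then show "x \<in> range words" by (rule range_eqI)
qed

lemma words_add: "\<lbrakk>x \<in> range words; y \<in> range words\<rbrakk> \<Longrightarrow> x \<oplus>\<^bsub>D\<^esub> y \<in> range words"
  by (elim rangeE) (simp flip: words_append)

lemma words_smult: "c \<odot>\<^bsub>D\<^esub> words ws \<in> range words"
proof (induction ws)
  case Nil
  have "c \<odot>\<^bsub>D\<^esub> words [] = words []" by simp
  then show ?case by (rule range_eqI)
next
  case (Cons w ws)
  then show ?case using word_smult[of c w] by (simp add: D.smult_r_distr words_add word_in_words)
qed

lemma words_star: "star D (words ws) \<in> range words"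
proof (induction ws)
  case Nil
  then show ?case using words_simps(1) by (metis D.star_zero rangeI)
next
  case (Cons w ws)
  then show ?case using word_star[of w] by (simp add: D.star_add words_add word_in_words)
qed

lemma word_mult_words: "word v \<otimes>\<^bsub>D\<^esub> words ws \<in> range words"
proof (induction ws)
  case Nil
  then show ?case using words_simps(1) by (metis D.mult_zero_right word_closed rangeI)
next
  case (Cons w ws)
  then show ?case using word_mult[of v w] by (simp add: D.mult_add_right words_add word_in_words)
qed

lemma words_mult: "words vs \<otimes>\<^bsub>D\<^esub> words ws \<in> range words"
proof (induction vs)
  case Nil
  then show ?case using words_simps(1) by (metis D.mult_zero_left words_closed rangeI)
next
  case (Cons v vs)
  then show ?case using word_mult_words[of v ws] by (simp add: D.mult_add_left words_add)
qed

lemma cstar_subalgebra_words: "cstar_subalgebra D (ncl D (cnorm D) (range words))"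
proof (rule D.cstar_subalgebra_ncl)
  have "\<zero>\<^bsub>D\<^esub> \<in> range words" using words_simps(1) by (metis rangeI)
  then show "submodule (range words) complex_ring D"
    unfolding D.submodule_iff using words_add words_smult by auto
qed (use words_mult words_star in auto)

lemma rep_words: "\<xi> \<in> carrier X \<Longrightarrow> \<rho>X \<xi> \<in> range words" "a \<in> carrier A \<Longrightarrow> \<rho>A a \<in> range words"
proof -
  have "letter l \<in> range words" for l using word_in_words[OF rangeI[of word "[l]"]] by simp
  from this[of "Inl \<xi>"] this[of "Inr (Inr a)"]
  show "\<xi> \<in> carrier X \<Longrightarrow> \<rho>X \<xi> \<in> range words" "a \<in> carrier A \<Longrightarrow> \<rho>A a \<in> range words"
    by (simp_all add: letter_def)
qed

text \<open>The subalgebra generated by a representation embeds into the type of codes, on choosing for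
  each element a sequence of sums of words that converges to it.\<close>

lemma universal_hom:
  fixes OX :: "'o cstar_algebra" and \<pi>X :: "'x \<Rightarrow> 'o" and \<pi>A :: "'a \<Rightarrow> 'o"
  assumes univ: "universal_covariant_rep A X OX \<pi>X \<pi>A" and cov: "covariant_rep A X D \<rho>X \<rho>A"
  obtains P where "star_hom OX D P" and "\<And>\<xi>. \<xi> \<in> carrier X \<Longrightarrow> P (\<pi>X \<xi>) = \<rho>X \<xi>"
    and "\<And>a. a \<in> carrier A \<Longrightarrow> P (\<pi>A a) = \<rho>A a"
proof -
  define E where "E = ncl D (cnorm D) (range words)"
  have E: "cstar_subalgebra D E" unfolding E_def by (rule cstar_subalgebra_words)
  have EC: "E \<subseteq> carrier D" unfolding E_def by (rule D.ncl_carrier)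
  have sup: "range words \<subseteq> E" unfolding E_def by (rule D.ncl_superset) auto
  let ?E = "D\<lparr>carrier := E\<rparr>"
  interpret E: cstar_algebra ?E by (rule D.cstar_algebra_carrier_update[OF E])
  have covE: "covariant_rep A X ?E \<rho>X \<rho>A"
    by (rule covariant_restrict[OF cov E]) (use sup rep_words in blast)+
  interpret c: toeplitz_rep A X ?E \<rho>X \<rho>A by (rule toeplitz_repI[OF X.hcorr_axioms E.cstar_algebra_axioms covE])
  define j :: "'d \<Rightarrow> ('a, 'x) rep_code" where "j x = (SOME c. nconv D (cnorm D) (\<lambda>n. words (c n)) x)" for x
  have j: "nconv D (cnorm D) (\<lambda>n. words (j x n)) x" if x: "x \<in> E" for x
  proof -
    obtain s where s: "\<And>n. s n \<in> range words" "nconv D (cnorm D) s x"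
      using D.ncl_sequence x unfolding E_def by metis
    have "\<forall>n. \<exists>c. s n = words c" using s(1) by blast
    then obtain c where "\<And>n. s n = words (c n)" by metis
    then have "s = (\<lambda>n. words (c n))" by blast
    then have "nconv D (cnorm D) (\<lambda>n. words (c n)) x" using s(2) by simp
    then show ?thesis unfolding j_def by (rule someI[of "\<lambda>c. nconv D (cnorm D) (\<lambda>n. words (c n)) x"])
  qed
  have "inj_on j (carrier ?E)"
  proof (rule inj_onI)
    fix x y assume "x \<in> carrier ?E" "y \<in> carrier ?E" "j x = j y"
    then show "x = y" using j[of x] j[of y] D.nconv_unique by simp
  qed
  note T = E.transport[OF this]
  let ?T = "transport ?E j" and ?i = "inv_into (carrier ?E) j"
  \<comment> \<open>The universal property speaks of algebras over the type of codes.
    \<open>?T\<close> is the copy there of the generated subalgebra, and \<open>?i\<close> leads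
    back from it.\<close>
  have "covariant_rep A X ?T (\<lambda>\<xi>. j (\<rho>X \<xi>)) (\<lambda>a. j (\<rho>A a))"
    by (rule c.covariant_comp[OF covE T(1,2)])
  then obtain P where P: "star_hom OX ?T P" "\<forall>\<xi>\<in>carrier X. j (\<rho>X \<xi>) = P (\<pi>X \<xi>)" "\<forall>a\<in>carrier A. j (\<rho>A a) = P (\<pi>A a)"
    using univ T(1) unfolding universal_covariant_rep_def by blast
  have i: "?i (j x) = x" if "x \<in> E" for x using that \<open>inj_on j (carrier ?E)\<close> by simp
  show thesis
  proof (rule that)
    show "star_hom OX D (\<lambda>x. ?i (P x))"
      by (rule star_hom_carrier_update_dest[OF star_hom_comp[OF P(1) T(3)] EC])
    show "?i (P (\<pi>X \<xi>)) = \<rho>X \<xi>" if x: "\<xi> \<in> carrier X" for \<xi>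
      using P(2) x i[of "\<rho>X \<xi>"] sup rep_words(1)[OF x] by (metis subsetD)
    show "?i (P (\<pi>A a)) = \<rho>A a" if a: "a \<in> carrier A" for a
      using P(3) a i[of "\<rho>A a"] sup rep_words(2)[OF a] by (metis subsetD)
  qed
qed

end

section \<open>Quotient correspondences\<close>

text \<open>A surjective pair with (C1) and (C2). Surjectivity turns (C4) into a consequence, by
  \<open>cm_lact\<close>, while the behaviour on Katsura ideals is stated where it is used, since
  for the projections of the restricted sum it has to be proved first.\<close>

locale corr_quotient = S: hcorr R S + X: hcorr A X + h: hilbert_map R S A X p pA
  for R :: "'r cstar_algebra" and S :: "('r, 's) correspondence"
    and A :: "'a cstar_algebra" and X :: "('a, 'x) correspondence" and p pA +
  assumes p_onto: "p ` carrier S = carrier X" and pA_onto: "pA ` carrier R = carrier A"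
    and p_lact: "\<lbrakk>r \<in> carrier R; s \<in> carrier S\<rbrakk> \<Longrightarrow> p (lact S r s) = lact X (pA r) (p s)"
begin

text \<open>Both operators take the value p (r s) at p s, and p is onto.\<close>

lemma cm_lact:
  assumes r: "r \<in> carrier R" "lact S r \<in> S.K" shows "h.cm (lact S r) = lact X (pA r)"
proof (rule X.L_ext)
  show "h.cm (lact S r) \<in> carrier X.L" using h.compact_map_K[OF r(2)] X.K_L by blast
  show "lact X (pA r) \<in> carrier X.L" using r by (intro X.lact.map_closed h.H.map_closed)
  fix \<xi> assume "\<xi> \<in> carrier X"
  then obtain s where s: "s \<in> carrier S" "\<xi> = p s" using p_onto by blast
  then show "h.cm (lact S r) \<xi> = lact X (pA r) \<xi>"
    using h.compact_map_intertw[OF r(2) s(1)] p_lact[OF r(1) s(1)] by simp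
qed

text \<open>The composite of the two maps on compact operators has the values on rank-one operators
  that \<open>covariantI\<close> asks for, so covariance for X at \<open>pA r\<close> is covariance
  for S at r.\<close>

lemma pull:
  assumes rep: "toeplitz_rep A X D \<rho>X \<rho>A" and cov: "covariant_rep A X D \<rho>X \<rho>A" and J: "pA ` S.J \<subseteq> X.J"
  shows "covariant_rep R S D (\<lambda>s. \<rho>X (p s)) (\<lambda>r. \<rho>A (pA r))"
proof -
  interpret rep: toeplitz_rep A X D \<rho>X \<rho>A by (rule rep)
  interpret c: toeplitz_rep R S D "\<lambda>s. \<rho>X (p s)" "\<lambda>r. \<rho>A (pA r)"
  proof unfold_locales
    show "linear_map S D (\<lambda>s. \<rho>X (p s))"
      using h.lin rep.rep_lin by (auto simp: linear_map_def Pi_iff)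
    show "star_hom R D (\<lambda>r. \<rho>A (pA r))" by (rule star_hom_comp[OF h.homA rep.rep_hom])
  qed (simp_all add: rep.rep_ip h.C1 p_lact rep.rep_lact)
  show ?thesis
  proof (rule c.covariantI[OF star_hom_comp[OF h.compact_map_hom rep.cpt_hom]])
    fix r assume r: "r \<in> S.J"
    then have "\<rho>A (pA r) = rep.cpt (lact X (pA r))" using cov J by (auto simp: rep.covariant_iff)
    then show "\<rho>A (pA r) = rep.cpt (h.cm (lact S r))" using S.J_K[OF r] by (simp add: cm_lact)
  qed (simp add: h.compact_map_rank_one rep.cpt_rank_one)
qed

lemma lift:
  assumes rep: "toeplitz_rep R S D \<pi>S \<pi>R" and cov: "covariant_rep R S D \<pi>S \<pi>R"
    and K: "closed_ideal D K" and ker: "\<And>r. \<lbrakk>r \<in> carrier R; pA r = \<zero>\<^bsub>A\<^esub>\<rbrakk> \<Longrightarrow> \<pi>R r \<in> K"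
    and J: "X.J \<subseteq> pA ` S.J"
  obtains \<rho>X \<rho>A where "covariant_rep A X (ideal_quotient.Quot D K) \<rho>X \<rho>A"
    and "\<And>s. s \<in> carrier S \<Longrightarrow> \<rho>X (p s) = ideal_quotient.coset D K (\<pi>S s)"
    and "\<And>r. r \<in> carrier R \<Longrightarrow> \<rho>A (pA r) = ideal_quotient.coset D K (\<pi>R r)"
proof -
  interpret rep: toeplitz_rep R S D \<pi>S \<pi>R by (rule rep)
  interpret q: ideal_quotient D K by unfold_locales (rule K)
  interpret Q: cstar_algebra q.Quot by (rule q.quot.cstar_Q)
  interpret Qh: cstar_hom D q.Quot q.coset
    by (rule cstar_homI[OF rep.D.cstar_algebra_axioms Q.cstar_algebra_axioms q.quot.star_hom_q])
  define \<rho>X where "\<rho>X \<xi> = q.coset (\<pi>S (inv_into (carrier S) p \<xi>))" for \<xi>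
  define \<rho>A where "\<rho>A a = q.coset (\<pi>R (inv_into (carrier R) pA a))" for a
  have eqX: "q.coset (\<pi>S s) = q.coset (\<pi>S t)" if s: "s \<in> carrier S" "t \<in> carrier S" "p s = p t" for s t
  proof -
    let ?d = "s \<ominus>\<^bsub>S\<^esub> t"
    have d: "?d \<in> carrier S" "p ?d = \<zero>\<^bsub>X\<^esub>" using s h.psi_diff X.X.diff_zero_iff by simp_all
    \<comment> \<open>Only the kernel on coefficients is assumed to go into K; the kernel of p
      follows, because the inner square of d is such a coefficient and the C*-identity holds in the
      quotient.\<close>
    then have "pA (ip S ?d ?d) = \<zero>\<^bsub>A\<^esub>" using h.C1[of ?d ?d] by simp
    then have "star D (\<pi>S ?d) \<otimes>\<^bsub>D\<^esub> \<pi>S ?d \<in> K" using d ker[of "ip S ?d ?d"] by (simp add: rep.rep_ip)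
    then have "star q.Quot (q.coset (\<pi>S ?d)) \<otimes>\<^bsub>q.Quot\<^esub> q.coset (\<pi>S ?d) = \<zero>\<^bsub>q.Quot\<^esub>"
      using d by (simp add: q.coset_zero_iff flip: Qh.map_star Qh.map_mult)
    then have "q.coset (\<pi>S ?d) = \<zero>\<^bsub>q.Quot\<^esub>" by (rule Q.star_mult_eq_zero[rotated]) (simp add: d)
    then have "q.coset (\<pi>S s) \<ominus>\<^bsub>q.Quot\<^esub> q.coset (\<pi>S t) = \<zero>\<^bsub>q.Quot\<^esub>"
      using s rep.hp.psi_diff by (simp add: Qh.map_diff)
    then show ?thesis using s Q.diff_zero_iff by simp
  qed
  have eqA: "q.coset (\<pi>R r) = q.coset (\<pi>R t)" if r: "r \<in> carrier R" "t \<in> carrier R" "pA r = pA t" for r t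
  proof -
    have "pA (r \<ominus>\<^bsub>R\<^esub> t) = \<zero>\<^bsub>A\<^esub>" using r X.A.diff_zero_iff by (simp add: h.H.map_diff)
    then have "\<pi>R r \<ominus>\<^bsub>D\<^esub> \<pi>R t \<in> K" using r ker[of "r \<ominus>\<^bsub>R\<^esub> t"] by (simp add: rep.hp.H.map_diff)
    then show ?thesis using r by (simp add: q.coset_eq_iff)
  qed
  have rX: "\<rho>X (p s) = q.coset (\<pi>S s)" if s: "s \<in> carrier S" for s
  proof -
    have "p s \<in> p ` carrier S" using s by (rule imageI)
    from inv_into_into[OF this] f_inv_into_f[OF this] show ?thesis unfolding \<rho>X_def by (intro eqX s)
  qed
  have rA: "\<rho>A (pA r) = q.coset (\<pi>R r)" if r: "r \<in> carrier R" for r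
  proof -
    have "pA r \<in> pA ` carrier R" using r by (rule imageI)
    from inv_into_into[OF this] f_inv_into_f[OF this] show ?thesis unfolding \<rho>A_def by (intro eqA r)
  qed
  note psi = h.psi_add[symmetric] h.psi_smult[symmetric] rep.hp.psi_add rep.hp.psi_smult
  note hom = h.H.map_add[symmetric] h.H.map_smult[symmetric] h.H.map_mult[symmetric] h.H.map_star[symmetric]
    rep.hp.H.map_add rep.hp.H.map_smult rep.hp.H.map_mult rep.hp.H.map_star
  interpret c: toeplitz_rep A X q.Quot \<rho>X \<rho>A
  proof unfold_locales
    show "linear_map X q.Quot \<rho>X"
      unfolding linear_map_def p_onto[symmetric] using psi
      by (auto simp: rX Qh.map_add Qh.map_smult)
    show "star_hom A q.Quot \<rho>A"
      unfolding star_hom_def linear_map_def pA_onto[symmetric] using hom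
      by (auto simp: rA Qh.map_add Qh.map_smult Qh.map_mult Qh.map_star)
    show "star q.Quot (\<rho>X \<xi>) \<otimes>\<^bsub>q.Quot\<^esub> \<rho>X \<eta> = \<rho>A (ip X \<xi> \<eta>)" if xy: "\<xi> \<in> carrier X" "\<eta> \<in> carrier X" for \<xi> \<eta>
    proof -
      obtain s t where s: "s \<in> carrier S" "\<xi> = p s" "t \<in> carrier S" "\<eta> = p t" using xy p_onto by blast
      then show ?thesis by (simp add: rX rA h.C1 rep.rep_ip flip: Qh.map_star Qh.map_mult)
    qed
    show "\<rho>X (lact X a \<xi>) = \<rho>A a \<otimes>\<^bsub>q.Quot\<^esub> \<rho>X \<xi>" if ax: "a \<in> carrier A" "\<xi> \<in> carrier X" for a \<xi>
    proof -
      obtain r s where s: "r \<in> carrier R" "a = pA r" "s \<in> carrier S" "\<xi> = p s" using ax p_onto pA_onto by blast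
      then have "\<rho>X (p (lact S r s)) = q.coset (\<pi>R r) \<otimes>\<^bsub>q.Quot\<^esub> q.coset (\<pi>S s)"
        by (simp add: rX rep.rep_lact Qh.map_mult)
      then show ?thesis using s by (simp add: rX rA p_lact)
    qed
  qed
  \<comment> \<open>This carries covariance to the quotient: the equation for S at r, pushed down,
    becomes the one for X at \<open>pA r\<close>, and every element of the Katsura ideal of X has
    such a lift r.\<close>
  have cptq: "q.coset (rep.cpt T) = c.cpt (h.cm T)" if T: "T \<in> S.K" for T
    by (rule S.KA_hom_eqI[OF Q.cstar_algebra_axioms star_hom_comp[OF rep.cpt_hom Qh.hom]
          star_hom_comp[OF h.compact_map_hom c.cpt_hom] _ T])
      (simp add: rep.cpt_rank_one h.compact_map_rank_one c.cpt_rank_one rX Qh.map_mult Qh.map_star)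
  have "covariant_rep A X q.Quot \<rho>X \<rho>A"
    unfolding c.covariant_iff
  proof
    fix a assume "a \<in> X.J"
    then obtain r where r: "r \<in> S.J" "a = pA r" using J by blast
    then have "\<rho>A a = q.coset (rep.cpt (lact S r))" using cov S.J_K by (simp add: rA rep.covariant_iff)
    then show "\<rho>A a = c.cpt (lact X a)" using r S.J_K by (simp add: cptq cm_lact)
  qed
  then show thesis using rX rA by (rule that)
qed

text \<open>The representation on the quotient by K yields P, and P \<Phi> agrees with the quotient
  map on generators, hence everywhere. So whatever \<Phi> kills lies in K.\<close>

lemma kernel_le:
  fixes OX :: "'o cstar_algebra"
  assumes rep: "toeplitz_rep R S D \<pi>S \<pi>R" and cov: "covariant_rep R S D \<pi>S \<pi>R"
    and gen: "generated_by D (\<pi>S ` carrier S \<union> \<pi>R ` carrier R)"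
    and univ: "universal_covariant_rep A X OX \<pi>X \<pi>A"
    and \<Phi>: "star_hom D OX \<Phi>" "\<And>s. s \<in> carrier S \<Longrightarrow> \<Phi> (\<pi>S s) = \<pi>X (p s)" "\<And>r. r \<in> carrier R \<Longrightarrow> \<Phi> (\<pi>R r) = \<pi>A (pA r)"
    and K: "closed_ideal D K" and ker: "\<And>r. \<lbrakk>r \<in> carrier R; pA r = \<zero>\<^bsub>A\<^esub>\<rbrakk> \<Longrightarrow> \<pi>R r \<in> K"
    and J: "X.J \<subseteq> pA ` S.J"
    and d: "d \<in> carrier D" "\<Phi> d = \<zero>\<^bsub>OX\<^esub>"
  shows "d \<in> K"
proof -
  interpret rep: toeplitz_rep R S D \<pi>S \<pi>R by (rule rep)
  interpret q: ideal_quotient D K by unfold_locales (rule K)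
  have OX: "cstar_algebra OX" using univ by (simp add: universal_covariant_rep_def)
  obtain \<rho>X \<rho>A where \<rho>: "covariant_rep A X q.Quot \<rho>X \<rho>A"
    "\<And>s. s \<in> carrier S \<Longrightarrow> \<rho>X (p s) = q.coset (\<pi>S s)" "\<And>r. r \<in> carrier R \<Longrightarrow> \<rho>A (pA r) = q.coset (\<pi>R r)"
    using lift[OF rep cov K ker J] by metis
  interpret \<rho>: toeplitz_rep A X q.Quot \<rho>X \<rho>A by (rule toeplitz_repI[OF X.hcorr_axioms q.quot.cstar_Q \<rho>(1)])
  obtain P where P: "star_hom OX q.Quot P" "\<And>\<xi>. \<xi> \<in> carrier X \<Longrightarrow> P (\<pi>X \<xi>) = \<rho>X \<xi>"
    "\<And>a. a \<in> carrier A \<Longrightarrow> P (\<pi>A a) = \<rho>A a"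
    using \<rho>.universal_hom[OF univ \<rho>(1)] by metis
  interpret P: cstar_hom OX q.Quot P by (rule cstar_homI[OF OX q.quot.cstar_Q P(1)])
  have "P (\<Phi> d) = q.coset d"
  proof (rule cstar_hom_eqI[OF _ _ gen])
    show "cstar_hom D q.Quot (\<lambda>d. P (\<Phi> d))" "cstar_hom D q.Quot q.coset"
      by (intro cstar_homI rep.D.cstar_algebra_axioms q.quot.cstar_Q star_hom_comp[OF \<Phi>(1) P(1)] q.quot.star_hom_q)+
    show "\<pi>S ` carrier S \<union> \<pi>R ` carrier R \<subseteq> carrier D" by auto
    show "P (\<Phi> x) = q.coset x" if "x \<in> \<pi>S ` carrier S \<union> \<pi>R ` carrier R" for x
      using that by (auto simp: \<Phi> P \<rho>)
  qed (rule d)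
  then have "q.coset d = \<zero>\<^bsub>q.Quot\<^esub>" using d by simp
  then show ?thesis using q.coset_zero_iff d by simp
qed

text \<open>Supplies the invariance of the kernel of \<open>pA\<close> that
  \<open>orthogonal_ideals\<close> requires.\<close>

lemma ip_lact_kernel:
  assumes r: "r \<in> carrier R" "pA r = \<zero>\<^bsub>A\<^esub>" and s: "s \<in> carrier S"
  shows "pA (ip S (lact S r s) (lact S r s)) = \<zero>\<^bsub>A\<^esub>"
proof -
  have "lact X \<zero>\<^bsub>A\<^esub> (p s) = \<zero>\<^bsub>X\<^esub>" using s by (simp add: X.L_simps)
  then have "p (lact S r s) = \<zero>\<^bsub>X\<^esub>" using r s by (simp add: p_lact)
  then show ?thesis using r s h.C1[of "lact S r s" "lact S r s"] by simp
qed

text \<open>Split a preimage r of a as i + k, with i in the complement and k in the kernel. Products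
  of i with the kernel lie in both summands and vanish, so i is in the Katsura ideal. Then
  \<open>pA k = a - pA i\<close> is in the Katsura ideal of A, and it acts as zero because p is
  onto, so it is zero and a = \<open>pA i\<close>.\<close>

lemma katsura_onto:
  assumes K: "lact S ` carrier R \<subseteq> S.K" and compl: "complemented R (lker R S)" and J: "pA ` S.J \<subseteq> X.J"
  shows "X.J \<subseteq> pA ` S.J"
proof
  fix a assume a: "a \<in> X.J"
  then have "a \<in> pA ` carrier R" using X.J_K(1) by (simp add: pA_onto)
  then obtain r where r: "r \<in> carrier R" "a = pA r" by blast
  obtain I where I: "closed_ideal R I" "I <+>\<^bsub>R\<^esub> lker R S = carrier R" "I \<inter> lker R S = {\<zero>\<^bsub>R\<^esub>}"
    using compl unfolding complemented_def by blast
  obtain i k where ik: "i \<in> I" "k \<in> lker R S" "r = i \<oplus>\<^bsub>R\<^esub> k"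
    using r(1) unfolding I(2)[symmetric] set_add_def' by blast
  have c: "i \<in> carrier R" "k \<in> carrier R"
    using ik I(1) S.lker_iff unfolding S.A.closed_ideal_iff S.A.submodule_iff by auto
  have i: "i \<in> S.J"
  proof (rule S.JI[OF c(1)])
    show "lact S i \<in> S.K" using K c by blast
    fix b assume b: "b \<in> lker R S"
    then have "i \<otimes>\<^bsub>R\<^esub> b \<in> I" using I(1) ik(1) S.lker_iff unfolding S.A.closed_ideal_iff by simp
    moreover have "i \<otimes>\<^bsub>R\<^esub> b \<in> lker R S" by (rule S.lker_mult[OF c(1) b])
    ultimately show "i \<otimes>\<^bsub>R\<^esub> b = \<zero>\<^bsub>R\<^esub>" using I(3) by (metis IntI singletonD)
  qed
  have "lact X (pA k) = \<zero>\<^bsub>X.L\<^esub>"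
  proof (rule X.L_ext)
    show "lact X (pA k) \<in> carrier X.L" using c by (intro X.lact.map_closed h.H.map_closed)
    show "\<zero>\<^bsub>X.L\<^esub> \<in> carrier X.L" by (rule X.lact.B.M.zero_closed)
    fix \<xi> assume "\<xi> \<in> carrier X"
    then obtain s where s: "s \<in> carrier S" "\<xi> = p s" using p_onto by blast
    show "lact X (pA k) \<xi> = \<zero>\<^bsub>X.L\<^esub> \<xi>"
      using p_lact[OF c(2) s(1)] ik(2) s by (simp add: S.lker_iff S.L_simps X.L_simps)
  qed
  then have "pA k \<in> lker A X" using c by (simp add: X.lker_iff)
  moreover have "pA k \<in> X.J"
  proof -
    have pi: "pA i \<in> X.J" using J i by blast
    have "pA k = a \<ominus>\<^bsub>A\<^esub> pA i" unfolding r(2) ik(3)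
      using c by (simp add: h.H.map_add X.A.add_diff_cancel)
    moreover have "a \<ominus>\<^bsub>A\<^esub> pA i \<in> X.J"
    proof (rule X.JI)
      have ac: "a \<in> carrier A" "pA i \<in> carrier A" using r c by auto
      then show "a \<ominus>\<^bsub>A\<^esub> pA i \<in> carrier A" by simp
      show "lact X (a \<ominus>\<^bsub>A\<^esub> pA i) \<in> X.K"
        using X.J_K(2)[OF a] X.J_K(2)[OF pi] ac submodule_minus[OF X.cvec_L X.K_submodule]
        by (simp add: X.lact.map_diff)
      fix b assume b: "b \<in> lker A X"
      then have "b \<in> carrier A" by (simp add: X.lker_iff)
      then show "(a \<ominus>\<^bsub>A\<^esub> pA i) \<otimes>\<^bsub>A\<^esub> b = \<zero>\<^bsub>A\<^esub>"
        using a pi b ac unfolding katsura_ideal_def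
        by (simp add: X.A.minus_smult X.A.mult_add_left X.A.mult_smult_left)
    qed
    ultimately show ?thesis by simp
  qed
  ultimately have "pA k = \<zero>\<^bsub>A\<^esub>" by (intro X.J_lker)
  then have "a = pA i" using r ik c by (simp add: h.H.map_add)
  then show "a \<in> pA ` S.J" using i by blast
qed

end

section \<open>Orthogonal ideals\<close>

text \<open>The variable middle factor makes the left annihilator a two-sided ideal: a factor on the
  right of y is absorbed into z.\<close>

lemma (in cstar_algebra) closed_ideal_annihilator:
  assumes T: "T \<subseteq> carrier A"
  shows "closed_ideal A {y \<in> carrier A. \<forall>z\<in>carrier A. \<forall>t\<in>T. y \<otimes> (z \<otimes> t) = \<zero>}" (is "closed_ideal A ?K")
  unfolding closed_ideal_iff
proof (intro conjI ballI)
  have c: "t \<in> carrier A" if "t \<in> T" for t using T that by blast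
  show "submodule ?K complex_ring A"
    unfolding submodule_iff using c by (auto simp: mult_add_left mult_smult_left)
  fix a y assume a: "a \<in> carrier A" and y: "y \<in> ?K"
  show "a \<otimes> y \<in> ?K" using a y c by (auto simp: mult_assoc)
  have "y \<otimes> a \<otimes> (z \<otimes> t) = \<zero>" if z: "z \<in> carrier A" "t \<in> T" for z t
  proof -
    have "y \<otimes> ((a \<otimes> z) \<otimes> t) = \<zero>" using y z mult_closed[OF a z(1)] by blast
    then show ?thesis using y a z c by (simp add: mult_assoc)
  qed
  then show "y \<otimes> a \<in> ?K" using a y by simp
next
  show "ncl A (cnorm A) ?K \<subseteq> ?K"
  proof
    fix y assume y: "y \<in> ncl A (cnorm A) ?K"
    have "y \<otimes> (z \<otimes> t) \<in> ncl A (cnorm A) {\<zero>}" if z: "z \<in> carrier A" "t \<in> T" for z t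
    proof (rule ncl_mult[OF _ y])
      have "z \<otimes> t \<in> carrier A" using z T by (intro mult_closed) auto
      then show "z \<otimes> t \<in> ncl A (cnorm A) {z \<otimes> t}" using ncl_superset[of "{z \<otimes> t}"] by blast
    qed (use z in auto)
    then show "y \<in> ?K" using ncl_zero y ncl_carrier by blast
  qed
qed

section \<open>Words without adjoints, and normal forms\<close>

context toeplitz_rep
begin

text \<open>Products of vectors \<open>\<rho>X \<xi>\<close> without adjoints, possibly ending in a
  coefficient \<open>\<rho>A a\<close>, and coefficients alone.\<close>

inductive_set V :: "'d set" where
  A: "a \<in> carrier A \<Longrightarrow> \<rho>A a \<in> V"
| X: "\<xi> \<in> carrier X \<Longrightarrow> \<rho>X \<xi> \<in> V"
| mult: "\<lbrakk>\<xi> \<in> carrier X; u \<in> V\<rbrakk> \<Longrightarrow> \<rho>X \<xi> \<otimes>\<^bsub>D\<^esub> u \<in> V"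

lemma V_closed: "u \<in> V \<Longrightarrow> u \<in> carrier D"
  by (induction rule: V.induct) auto

lemma V_left: assumes "u \<in> V" and c: "c \<in> carrier A" shows "\<rho>A c \<otimes>\<^bsub>D\<^esub> u \<in> V"
  using assms(1)
proof cases
  case (A a)
  then show ?thesis using c V.A[of "c \<otimes>\<^bsub>A\<^esub> a"] by (simp add: hp.H.map_mult)
next
  case (X \<xi>)
  then show ?thesis using c V.X[of "lact X c \<xi>"] by (simp add: rep_lact)
next
  case (mult \<xi> v)
  then show ?thesis using c V.mult[of "lact X c \<xi>" v] V_closed[of v] by (simp add: rep_lact D.mult_assoc)
qed

lemma V_mult: "\<lbrakk>u \<in> V; v \<in> V\<rbrakk> \<Longrightarrow> u \<otimes>\<^bsub>D\<^esub> v \<in> V"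
proof (induction rule: V.induct)
  case (mult \<xi> u)
  then show ?case using V.mult[of \<xi> "u \<otimes>\<^bsub>D\<^esub> v"] V_closed by (simp add: D.mult_assoc)
qed (simp_all add: V_left V.mult)

text \<open>The second alternative occurs when v is a coefficient, which is absorbed into the
  vector; otherwise the first letter of v cancels against \<xi> and leaves an inner product.\<close>

lemma rep_star_mult:
  assumes x: "\<xi> \<in> carrier X" and v: "v \<in> V"
  shows "star D (\<rho>X \<xi>) \<otimes>\<^bsub>D\<^esub> v \<in> V \<or> (\<exists>\<zeta>\<in>carrier X. star D (\<rho>X \<xi>) \<otimes>\<^bsub>D\<^esub> v = star D (\<rho>X \<zeta>))"
  using v
proof cases
  case (A a)
  then have "star D (\<rho>X \<xi>) \<otimes>\<^bsub>D\<^esub> v = star D (\<rho>X (lact X (star A a) \<xi>))"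
    using x by (simp add: rep_lact D.star_mult hp.H.map_star)
  moreover have "lact X (star A a) \<xi> \<in> carrier X" using x A by simp
  ultimately show ?thesis by (intro disjI2 bexI)
next
  case (X \<eta>)
  then show ?thesis using x V.A[of "ip X \<xi> \<eta>"] by (simp add: rep_ip)
next
  case (mult \<eta> w)
  then have "star D (\<rho>X \<xi>) \<otimes>\<^bsub>D\<^esub> v = \<rho>A (ip X \<xi> \<eta>) \<otimes>\<^bsub>D\<^esub> w"
    using x V_closed by (simp flip: D.mult_assoc rep_ip)
  then show ?thesis using x mult V_left by simp
qed

text \<open>Adjacent letters cancel in pairs to coefficients until the shorter word is used up;
  according to which word that is, the rest is in V or the adjoint of an element of V.\<close>

lemma V_star_mult: "\<lbrakk>u \<in> V; v \<in> V\<rbrakk> \<Longrightarrow> star D u \<otimes>\<^bsub>D\<^esub> v \<in> V \<union> star D ` V"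
proof (induction arbitrary: v rule: V.induct)
  case (A a)
  then show ?case using V_left[of v "star A a"] by (simp add: hp.H.map_star)
next
  case (X \<xi>)
  from rep_star_mult[OF this] show ?case
  proof (elim disjE bexE)
    fix \<zeta> assume z: "\<zeta> \<in> carrier X" "star D (\<rho>X \<xi>) \<otimes>\<^bsub>D\<^esub> v = star D (\<rho>X \<zeta>)"
    show ?thesis unfolding z(2) using V.X[OF z(1)] by (intro UnI2 imageI)
  qed (rule UnI1)
next
  case (mult \<xi> u)
  have c: "\<rho>X \<xi> \<in> carrier D" "u \<in> carrier D" "v \<in> carrier D" using mult V_closed by auto
  have eq: "star D (\<rho>X \<xi> \<otimes>\<^bsub>D\<^esub> u) \<otimes>\<^bsub>D\<^esub> v = star D u \<otimes>\<^bsub>D\<^esub> (star D (\<rho>X \<xi>) \<otimes>\<^bsub>D\<^esub> v)"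
    using c by (simp add: D.star_mult D.mult_assoc)
  from rep_star_mult[OF mult(1,4)] show ?case
  proof (elim disjE bexE)
    assume "star D (\<rho>X \<xi>) \<otimes>\<^bsub>D\<^esub> v \<in> V"
    then show ?thesis unfolding eq by (rule mult.IH)
  next
    fix \<zeta> assume z: "\<zeta> \<in> carrier X" "star D (\<rho>X \<xi>) \<otimes>\<^bsub>D\<^esub> v = star D (\<rho>X \<zeta>)"
    have "star D (\<rho>X \<xi> \<otimes>\<^bsub>D\<^esub> u) \<otimes>\<^bsub>D\<^esub> v = star D (\<rho>X \<zeta> \<otimes>\<^bsub>D\<^esub> u)"
      unfolding eq using z c by (simp add: D.star_mult)
    then show ?thesis using V.mult[OF z(1) mult(2)] by simp
  qed
qed

text \<open>Normal forms with all adjoints on the right. Their span is a dense *-subalgebra, so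
  identities in D are checked on them alone.\<close>

definition VV :: "'d set" where "VV = V \<union> star D ` V \<union> {u \<otimes>\<^bsub>D\<^esub> star D v | u v. u \<in> V \<and> v \<in> V}"

lemma VV_I: "u \<in> V \<Longrightarrow> u \<in> VV" "u \<in> V \<Longrightarrow> star D u \<in> VV" "\<lbrakk>u \<in> V; v \<in> V\<rbrakk> \<Longrightarrow> u \<otimes>\<^bsub>D\<^esub> star D v \<in> VV"
  by (auto simp: VV_def)

lemma VV_E:
  assumes "x \<in> VV"
  obtains "x \<in> V" | u where "u \<in> V" "x = star D u" | u v where "u \<in> V" "v \<in> V" "x = u \<otimes>\<^bsub>D\<^esub> star D v"
  using assms by (auto simp: VV_def)

lemma VV_closed: "x \<in> VV \<Longrightarrow> x \<in> carrier D"
  by (erule VV_E) (auto simp: V_closed)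

lemma VV_star: "x \<in> VV \<Longrightarrow> star D x \<in> VV"
  by (erule VV_E) (auto simp: V_closed VV_I D.star_mult)

lemma V_VV: assumes u: "u \<in> V" and x: "x \<in> VV" shows "u \<otimes>\<^bsub>D\<^esub> x \<in> VV"
  using x
proof (cases rule: VV_E)
  case (3 v w)
  then have "u \<otimes>\<^bsub>D\<^esub> x = (u \<otimes>\<^bsub>D\<^esub> v) \<otimes>\<^bsub>D\<^esub> star D w" using u V_closed by (simp add: D.mult_assoc)
  then show ?thesis using 3 u VV_I(3)[OF V_mult] by simp
qed (use u in \<open>auto intro: VV_I V_mult\<close>)

lemma star_V_V: assumes u: "u \<in> V" and v: "v \<in> V" shows "star D u \<otimes>\<^bsub>D\<^esub> v \<in> VV"
  using V_star_mult[OF u v] by (auto intro: VV_I)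

lemma VV_star_V: assumes x: "x \<in> VV" and u: "u \<in> V" shows "x \<otimes>\<^bsub>D\<^esub> star D u \<in> VV"
proof -
  have "star D (x \<otimes>\<^bsub>D\<^esub> star D u) = u \<otimes>\<^bsub>D\<^esub> star D x" using x u V_closed VV_closed by (simp add: D.star_mult)
  then have "star D (x \<otimes>\<^bsub>D\<^esub> star D u) \<in> VV" using V_VV[OF u VV_star[OF x]] by simp
  then have "star D (star D (x \<otimes>\<^bsub>D\<^esub> star D u)) \<in> VV" by (rule VV_star)
  then show ?thesis using x u V_closed VV_closed by simp
qed

lemma star_V_VV: assumes u: "u \<in> V" and x: "x \<in> VV" shows "star D u \<otimes>\<^bsub>D\<^esub> x \<in> VV"
  using x
proof (cases rule: VV_E)
  case 1
  then show ?thesis by (rule star_V_V[OF u])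
next
  case (2 v)
  then have "star D u \<otimes>\<^bsub>D\<^esub> x = star D (v \<otimes>\<^bsub>D\<^esub> u)" using u V_closed by (simp add: D.star_mult)
  then show ?thesis using 2 u VV_I(2)[OF V_mult] by simp
next
  case (3 v w)
  then have "star D u \<otimes>\<^bsub>D\<^esub> x = (star D u \<otimes>\<^bsub>D\<^esub> v) \<otimes>\<^bsub>D\<^esub> star D w" using u V_closed by (simp add: D.mult_assoc)
  then show ?thesis using VV_star_V[OF star_V_V[OF u 3(1)] 3(2)] by simp
qed

lemma VV_mult: assumes x: "x \<in> VV" and y: "y \<in> VV" shows "x \<otimes>\<^bsub>D\<^esub> y \<in> VV"
  using x
proof (cases rule: VV_E)
  case (3 u v)
  then have "x \<otimes>\<^bsub>D\<^esub> y = u \<otimes>\<^bsub>D\<^esub> (star D v \<otimes>\<^bsub>D\<^esub> y)" using y V_closed VV_closed by (simp add: D.mult_assoc)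
  then show ?thesis using V_VV[OF 3(1) star_V_VV[OF 3(2) y]] by simp
qed (use y V_VV star_V_VV in auto)

lemma carrier_VV:
  assumes "generated_by D (\<rho>X ` carrier X \<union> \<rho>A ` carrier A)"
  shows "ncl D (cnorm D) (lin_span D VV) = carrier D"
proof -
  have c: "VV \<subseteq> carrier D" using VV_closed by blast
  have "cstar_subalgebra D (ncl D (cnorm D) (lin_span D VV))"
    by (rule D.lin_span_subalgebra[OF c VV_mult VV_star])
  moreover have "lin_span D VV \<subseteq> carrier D" using D.lin_span_submodule[OF c] unfolding D.submodule_iff by (rule conjunct1)
  then have "VV \<subseteq> ncl D (cnorm D) (lin_span D VV)" using D.lin_span_superset D.ncl_superset by blast
  then have "\<rho>X ` carrier X \<union> \<rho>A ` carrier A \<subseteq> ncl D (cnorm D) (lin_span D VV)"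
    using V.A V.X VV_I(1) by blast
  ultimately show ?thesis using assms unfolding generated_by_def by blast
qed

text \<open>Let \<zeta> = b \<xi>. If all of I annihilates z, then ||\<rho>(\<zeta>) z||^2 is the
  norm of z* \<rho>(<\<zeta>,\<zeta>>) z and vanishes, because the inner square of \<zeta> is again
  in I. So annihilation moves past one letter for all b at once, which is what the induction along
  the word needs.\<close>

lemma V_annihilates:
  assumes I: "I \<subseteq> carrier A" "\<And>b c. \<lbrakk>b \<in> I; c \<in> carrier A\<rbrakk> \<Longrightarrow> b \<otimes>\<^bsub>A\<^esub> c \<in> I"
    and ip: "\<And>b \<xi>. \<lbrakk>b \<in> I; \<xi> \<in> carrier X\<rbrakk> \<Longrightarrow> ip X (lact X b \<xi>) (lact X b \<xi>) \<in> I"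
    and u: "u \<in> V" and z: "z \<in> carrier D" "\<And>b. b \<in> I \<Longrightarrow> \<rho>A b \<otimes>\<^bsub>D\<^esub> z = \<zero>\<^bsub>D\<^esub>" and b: "b \<in> I"
  shows "\<rho>A b \<otimes>\<^bsub>D\<^esub> (u \<otimes>\<^bsub>D\<^esub> z) = \<zero>\<^bsub>D\<^esub>"
proof -
  have x: "\<rho>A b \<otimes>\<^bsub>D\<^esub> (\<rho>X \<xi> \<otimes>\<^bsub>D\<^esub> y) = \<zero>\<^bsub>D\<^esub>"
    if \<xi>: "\<xi> \<in> carrier X" and b: "b \<in> I" and y: "y \<in> carrier D" "\<And>b. b \<in> I \<Longrightarrow> \<rho>A b \<otimes>\<^bsub>D\<^esub> y = \<zero>\<^bsub>D\<^esub>" for \<xi> b y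
  proof -
    let ?\<zeta> = "lact X b \<xi>"
    have bc: "b \<in> carrier A" using b I by blast
    have zc: "?\<zeta> \<in> carrier X" using bc \<xi> by simp
    have "star D (\<rho>X ?\<zeta> \<otimes>\<^bsub>D\<^esub> y) \<otimes>\<^bsub>D\<^esub> (\<rho>X ?\<zeta> \<otimes>\<^bsub>D\<^esub> y) = star D y \<otimes>\<^bsub>D\<^esub> ((star D (\<rho>X ?\<zeta>) \<otimes>\<^bsub>D\<^esub> \<rho>X ?\<zeta>) \<otimes>\<^bsub>D\<^esub> y)"
      using rep_closed[OF zc] y by (simp add: D.star_mult D.mult_assoc)
    also have "\<dots> = \<zero>\<^bsub>D\<^esub>" using y ip[OF b \<xi>] by (simp add: rep_ip[OF zc zc])
    finally have "\<rho>X ?\<zeta> \<otimes>\<^bsub>D\<^esub> y = \<zero>\<^bsub>D\<^esub>" by (rule D.star_mult_eq_zero[rotated]) (simp add: rep_closed[OF zc] y)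
    then show ?thesis using bc \<xi> y by (simp add: rep_lact flip: D.mult_assoc)
  qed
  from u b show ?thesis
  proof (induction arbitrary: b rule: V.induct)
    case (A c)
    have "\<rho>A (b \<otimes>\<^bsub>A\<^esub> c) \<otimes>\<^bsub>D\<^esub> z = \<zero>\<^bsub>D\<^esub>" using A by (intro z(2) I(2))
    then show ?case using A I(1) z(1) by (simp add: hp.H.map_mult D.mult_assoc subset_iff)
  next
    case (X \<xi>)
    then show ?case using z by (intro x)
  next
    case (mult \<xi> u)
    have "\<rho>A b \<otimes>\<^bsub>D\<^esub> (\<rho>X \<xi> \<otimes>\<^bsub>D\<^esub> (u \<otimes>\<^bsub>D\<^esub> z)) = \<zero>\<^bsub>D\<^esub>"
      using mult V_closed z(1) by (intro x) simp_all
    then show ?case using mult V_closed z(1) by (simp add: D.mult_assoc)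
  qed
qed

text \<open>Annihilation by an ideal that the left action preserves propagates to the right through the words
  in \<open>V\<close> and, on taking adjoints, to the left through their adjoints.\<close>

lemma orthogonal_ideals:
  assumes gen: "generated_by D (\<rho>X ` carrier X \<union> \<rho>A ` carrier A)"
    and I: "I \<subseteq> carrier A" "\<And>b c. \<lbrakk>b \<in> I; c \<in> carrier A\<rbrakk> \<Longrightarrow> b \<otimes>\<^bsub>A\<^esub> c \<in> I" "\<And>b. b \<in> I \<Longrightarrow> star A b \<in> I"
      "\<And>b \<xi>. \<lbrakk>b \<in> I; \<xi> \<in> carrier X\<rbrakk> \<Longrightarrow> ip X (lact X b \<xi>) (lact X b \<xi>) \<in> I"
    and I': "I' \<subseteq> carrier A" "\<And>b c. \<lbrakk>b \<in> I'; c \<in> carrier A\<rbrakk> \<Longrightarrow> b \<otimes>\<^bsub>A\<^esub> c \<in> I'" "\<And>b. b \<in> I' \<Longrightarrow> star A b \<in> I'"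
      "\<And>b \<xi>. \<lbrakk>b \<in> I'; \<xi> \<in> carrier X\<rbrakk> \<Longrightarrow> ip X (lact X b \<xi>) (lact X b \<xi>) \<in> I'"
    and orth: "\<And>a b. \<lbrakk>a \<in> I; b \<in> I'\<rbrakk> \<Longrightarrow> b \<otimes>\<^bsub>A\<^esub> a = \<zero>\<^bsub>A\<^esub>"
    and a: "a \<in> I" and b: "b \<in> I'" and x: "x \<in> carrier D"
  shows "\<rho>A b \<otimes>\<^bsub>D\<^esub> (x \<otimes>\<^bsub>D\<^esub> \<rho>A a) = \<zero>\<^bsub>D\<^esub>"
proof -
  have ac: "a \<in> carrier A" and bc: "b \<in> carrier A" using a b I(1) I'(1) by auto
  let ?N = "{x \<in> carrier D. \<rho>A b \<otimes>\<^bsub>D\<^esub> (x \<otimes>\<^bsub>D\<^esub> \<rho>A a) = \<zero>\<^bsub>D\<^esub>}"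
  have orth0: "\<rho>A b' \<otimes>\<^bsub>D\<^esub> \<rho>A a' = \<zero>\<^bsub>D\<^esub>" "\<rho>A a' \<otimes>\<^bsub>D\<^esub> \<rho>A b' = \<zero>\<^bsub>D\<^esub>" if a': "a' \<in> I" "b' \<in> I'" for a' b'
  proof -
    have c: "a' \<in> carrier A" "b' \<in> carrier A" using a' I(1) I'(1) by auto
    then show "\<rho>A b' \<otimes>\<^bsub>D\<^esub> \<rho>A a' = \<zero>\<^bsub>D\<^esub>" using orth[OF a'] hp.H.map_mult[of b' a'] by simp
    have "star A (star A b' \<otimes>\<^bsub>A\<^esub> star A a') = \<zero>\<^bsub>A\<^esub>" using orth[OF I(3)[OF a'(1)] I'(3)[OF a'(2)]] by simp
    then have "a' \<otimes>\<^bsub>A\<^esub> b' = \<zero>\<^bsub>A\<^esub>" using c by (simp add: X.A.star_mult)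
    then show "\<rho>A a' \<otimes>\<^bsub>D\<^esub> \<rho>A b' = \<zero>\<^bsub>D\<^esub>" using c hp.H.map_mult[of a' b'] by simp
  qed
  have 1: "\<rho>A b' \<otimes>\<^bsub>D\<^esub> (u \<otimes>\<^bsub>D\<^esub> \<rho>A a) = \<zero>\<^bsub>D\<^esub>" if "u \<in> V" "b' \<in> I'" for u b'
    by (rule V_annihilates[OF I'(1,2,4) that(1)]) (use ac a orth0 that in auto)
  have 2: "\<rho>A b' \<otimes>\<^bsub>D\<^esub> (star D v \<otimes>\<^bsub>D\<^esub> \<rho>A a) = \<zero>\<^bsub>D\<^esub>" if v: "v \<in> V" "b' \<in> I'" for v b'
  proof -
    have b': "b' \<in> carrier A" "star A b' \<in> I'" using v I' by auto
    have "\<rho>A (star A a) \<otimes>\<^bsub>D\<^esub> (v \<otimes>\<^bsub>D\<^esub> \<rho>A (star A b')) = \<zero>\<^bsub>D\<^esub>"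
      by (rule V_annihilates[OF I(1,2,4) v(1)]) (use b' I(3)[OF a] orth0(2) in auto)
    then have "star D (\<rho>A (star A a) \<otimes>\<^bsub>D\<^esub> (v \<otimes>\<^bsub>D\<^esub> \<rho>A (star A b'))) = \<zero>\<^bsub>D\<^esub>" by simp
    then show ?thesis using V_closed[OF v(1)] b' ac by (simp add: D.star_mult hp.H.map_star D.mult_assoc)
  qed
  have 3: "\<rho>A b \<otimes>\<^bsub>D\<^esub> ((u \<otimes>\<^bsub>D\<^esub> star D v) \<otimes>\<^bsub>D\<^esub> \<rho>A a) = \<zero>\<^bsub>D\<^esub>" if "u \<in> V" "v \<in> V" for u v
  proof -
    have c: "u \<in> carrier D" "v \<in> carrier D" using that V_closed by auto
    have "\<rho>A b \<otimes>\<^bsub>D\<^esub> (u \<otimes>\<^bsub>D\<^esub> (star D v \<otimes>\<^bsub>D\<^esub> \<rho>A a)) = \<zero>\<^bsub>D\<^esub>"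
      by (rule V_annihilates[OF I'(1,2,4) that(1)]) (use c ac b 2 that in auto)
    then show ?thesis using c ac bc by (simp add: D.mult_assoc)
  qed
  have sub: "submodule ?N complex_ring D"
    unfolding D.submodule_iff using ac bc
    by (auto simp: D.mult_add_left D.mult_add_right D.mult_smult_left D.mult_smult_right)
  have "VV \<subseteq> ?N"
  proof
    fix x assume x: "x \<in> VV"
    then have "\<rho>A b \<otimes>\<^bsub>D\<^esub> (x \<otimes>\<^bsub>D\<^esub> \<rho>A a) = \<zero>\<^bsub>D\<^esub>" by (cases rule: VV_E) (simp_all add: 1 2 3 b)
    then show "x \<in> ?N" using VV_closed[OF x] by simp
  qed
  then have "lin_span D VV \<subseteq> ?N" by (rule D.lin_span_least[OF sub])
  moreover have "ncl D (cnorm D) ?N \<subseteq> ?N"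
  proof
    fix x assume x: "x \<in> ncl D (cnorm D) ?N"
    then have xc: "x \<in> carrier D" using D.ncl_carrier by blast
    have s: "c \<in> ncl D (cnorm D) {c}" if "c \<in> carrier D" for c using D.ncl_superset[of "{c}"] that by blast
    have "x \<otimes>\<^bsub>D\<^esub> \<rho>A a \<in> ncl D (cnorm D) {y \<in> carrier D. \<rho>A b \<otimes>\<^bsub>D\<^esub> y = \<zero>\<^bsub>D\<^esub>}"
      by (rule D.ncl_mult[OF _ x s]) (use ac in auto)
    then have "\<rho>A b \<otimes>\<^bsub>D\<^esub> (x \<otimes>\<^bsub>D\<^esub> \<rho>A a) \<in> ncl D (cnorm D) {\<zero>\<^bsub>D\<^esub>}"
      by (rule D.ncl_mult[OF _ s, rotated 2]) (use bc in auto)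
    then show "x \<in> ?N" using D.ncl_zero xc by blast
  qed
  ultimately have "ncl D (cnorm D) (lin_span D VV) \<subseteq> ?N" by (rule D.ncl_minimal)
  then show ?thesis using carrier_VV[OF gen] x by blast
qed

end

section \<open>The restricted direct sum\<close>

locale restricted = f: corr_quotient A X C Z \<psi>X \<psi>A + g: corr_quotient B Y C Z \<omega>Y \<omega>B
  for A :: "'a cstar_algebra" and X :: "('a, 'x) correspondence"
    and B :: "'b cstar_algebra" and Y :: "('b, 'y) correspondence"
    and C :: "'c cstar_algebra" and Z :: "('c, 'z) correspondence"
    and \<psi>X \<psi>A \<omega>Y \<omega>B
begin

sublocale P: cstar_pullback A B C \<psi>A \<omega>B
  by (intro cstar_pullback.intro f.h.H.cstar_hom_axioms g.h.H.cstar_hom_axioms)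

abbreviation "R \<equiv> pullback A B \<psi>A \<omega>B"
abbreviation "S \<equiv> restricted_sum X Y \<psi>X \<omega>Y"

lemma carrier_S: "(\<xi>, \<eta>) \<in> carrier S \<longleftrightarrow> \<xi> \<in> carrier X \<and> \<eta> \<in> carrier Y \<and> \<psi>X \<xi> = \<omega>Y \<eta>"
  by (simp add: restricted_sum_def Let_def)

lemma S_simps [simp]:
  "\<zero>\<^bsub>S\<^esub> = (\<zero>\<^bsub>X\<^esub>, \<zero>\<^bsub>Y\<^esub>)" "(\<xi>, \<eta>) \<oplus>\<^bsub>S\<^esub> (\<xi>', \<eta>') = (\<xi> \<oplus>\<^bsub>X\<^esub> \<xi>', \<eta> \<oplus>\<^bsub>Y\<^esub> \<eta>')"
  "c \<odot>\<^bsub>S\<^esub> (\<xi>, \<eta>) = (c \<odot>\<^bsub>X\<^esub> \<xi>, c \<odot>\<^bsub>Y\<^esub> \<eta>)" "ract S (\<xi>, \<eta>) (a, b) = (ract X \<xi> a, ract Y \<eta> b)"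
  "ip S (\<xi>, \<eta>) (\<xi>', \<eta>') = (ip X \<xi> \<xi>', ip Y \<eta> \<eta>')"
  by (simp_all add: restricted_sum_def Let_def)

lemma lact_S: "(\<xi>, \<eta>) \<in> carrier S \<Longrightarrow> lact S (a, b) (\<xi>, \<eta>) = (lact X a \<xi>, lact Y b \<eta>)"
  by (simp add: restricted_sum_def Let_def)

lemma lact_S_restrict: "lact S (a, b) = (\<lambda>(\<xi>, \<eta>)\<in>carrier S. (lact X a \<xi>, lact Y b \<eta>))"
  by (simp add: restricted_sum_def Let_def)

lemma S_E: assumes "s \<in> carrier S"
  obtains \<xi> \<eta> where "s = (\<xi>, \<eta>)" "\<xi> \<in> carrier X" "\<eta> \<in> carrier Y" "\<psi>X \<xi> = \<omega>Y \<eta>"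
  using assms by (cases s) (auto simp: carrier_S)

lemma R_E: assumes "r \<in> carrier R"
  obtains a b where "r = (a, b)" "a \<in> carrier A" "b \<in> carrier B" "\<psi>A a = \<omega>B b"
  using assms by (cases r) (auto simp: P.carrier_P)

lemma hnorm_S: "\<lbrakk>\<xi> \<in> carrier X; \<eta> \<in> carrier Y\<rbrakk> \<Longrightarrow> hnorm R S (\<xi>, \<eta>) = max (f.S.hn \<xi>) (g.S.hn \<eta>)"
  by (auto simp: hnorm_def max_def)

lemma cvec_S: "cvec S"
  by (rule cvecI; (elim S_E)?)
    (simp_all add: carrier_S f.h.psi_add g.h.psi_add f.h.psi_smult g.h.psi_smult f.S.X.M.a_ac g.S.X.M.a_ac
      f.S.X.smult_ladd g.S.X.smult_ladd f.S.X.smult_radd g.S.X.smult_radd)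

lemma S_minus: "\<lbrakk>(\<xi>, \<eta>) \<in> carrier S; (\<xi>', \<eta>') \<in> carrier S\<rbrakk> \<Longrightarrow> (\<xi>, \<eta>) \<ominus>\<^bsub>S\<^esub> (\<xi>', \<eta>') = (\<xi> \<ominus>\<^bsub>X\<^esub> \<xi>', \<eta> \<ominus>\<^bsub>Y\<^esub> \<eta>')"
  using cvec.minus_smult[OF cvec_S, of "(\<xi>, \<eta>)" "(\<xi>', \<eta>')"]
  by (auto simp: carrier_S f.S.X.minus_smult g.S.X.minus_smult)

lemma ncomplete_S: "ncomplete S (hnorm R S)"
  unfolding ncomplete_def
proof (intro allI impI)
  fix s assume s: "ncauchy S (hnorm R S) s"
  define x where "x n = fst (s n)" for n
  define y where "y n = snd (s n)" for n
  have xy: "s n = (x n, y n)" for n by (simp add: x_def y_def)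
  have sS: "(x n, y n) \<in> carrier S" for n using s by (auto simp: ncauchy_def xy[symmetric])
  then have c: "x n \<in> carrier X" "y n \<in> carrier Y" "\<psi>X (x n) = \<omega>Y (y n)" for n by (auto simp: carrier_S)
  have "\<exists>k. \<forall>m\<ge>k. \<forall>n\<ge>k. f.S.hn (x m \<ominus>\<^bsub>X\<^esub> x n) < e \<and> g.S.hn (y m \<ominus>\<^bsub>Y\<^esub> y n) < e" if "e > 0" for e
    using s that c by (auto simp: ncauchy_def xy S_minus[OF sS sS] hnorm_S)
  then have "ncauchy X f.S.hn x" "ncauchy Y g.S.hn y" using c unfolding ncauchy_def by blast+
  then obtain l k where l: "nconv X f.S.hn x l" and k: "nconv Y g.S.hn y k"
    using f.S.complete g.S.complete unfolding ncomplete_def by blast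
  have "nconv Z f.X.hn (\<lambda>n. \<psi>X (x n)) (\<omega>Y k)" unfolding c(3) by (rule g.h.nconv_psi[OF k])
  then have "\<psi>X l = \<omega>Y k" using f.h.nconv_psi[OF l] f.X.X.nconv_unique by blast
  then have lk: "(l, k) \<in> carrier S" "l \<in> carrier X" "k \<in> carrier Y" using l k by (auto simp: nconv_def carrier_S)
  have "(\<lambda>n. max (f.S.hn (x n \<ominus>\<^bsub>X\<^esub> l)) (g.S.hn (y n \<ominus>\<^bsub>Y\<^esub> k))) \<longlonglongrightarrow> max 0 0"
    using l k unfolding nconv_def by (intro tendsto_max) auto
  then have "nconv S (hnorm R S) s (l, k)"
    using sS lk c by (auto simp: nconv_def xy S_minus hnorm_S)
  then show "\<exists>l. nconv S (hnorm R S) s l" by blast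
qed

sublocale S: hilb R S
proof (intro hilb.intro hilb_axioms.intro P.cstar_P cvec_S ncomplete_S)
  fix \<xi> \<eta> assume x: "\<xi> \<in> carrier S" and y: "\<eta> \<in> carrier S"
  show "ip S \<xi> \<eta> \<in> carrier R"
    using x y by (elim S_E) (simp add: P.carrier_P flip: f.h.C1 g.h.C1)
  show "ip S \<xi> (c \<odot>\<^bsub>S\<^esub> \<eta>) = c \<odot>\<^bsub>R\<^esub> ip S \<xi> \<eta>" for c
    using x y by (elim S_E) (simp add: f.S.ip_smult g.S.ip_smult)
  show "star R (ip S \<xi> \<eta>) = ip S \<eta> \<xi>" using x y by (elim S_E) simp
  show "cnorm R (ip S \<xi> \<eta>) \<le> hnorm R S \<xi> * hnorm R S \<eta>"
  proof -
    obtain x1 y1 x2 y2 where e: "\<xi> = (x1, y1)" "\<eta> = (x2, y2)"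
      and c: "x1 \<in> carrier X" "y1 \<in> carrier Y" "x2 \<in> carrier X" "y2 \<in> carrier Y"
      using x y by (elim S_E)
    have "cnorm A (ip X x1 x2) \<le> max (f.S.hn x1) (g.S.hn y1) * max (f.S.hn x2) (g.S.hn y2)"
      using c by (intro order_trans[OF f.S.cauchy_schwarz] mult_mono) (auto simp: f.S.hn_nonneg le_max_iff_disj)
    moreover have "cnorm B (ip Y y1 y2) \<le> max (f.S.hn x1) (g.S.hn y1) * max (f.S.hn x2) (g.S.hn y2)"
      using c by (intro order_trans[OF g.S.cauchy_schwarz] mult_mono) (auto simp: f.S.hn_nonneg g.S.hn_nonneg le_max_iff_disj)
    ultimately show ?thesis using c by (simp add: e hnorm_S)
  qed
  show "ip S \<xi> (\<eta> \<oplus>\<^bsub>S\<^esub> \<zeta>) = ip S \<xi> \<eta> \<oplus>\<^bsub>R\<^esub> ip S \<xi> \<zeta>" if "\<zeta> \<in> carrier S" for \<zeta>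
    using x y that by (elim S_E) (simp add: f.S.ip_add g.S.ip_add)
  fix a assume a: "a \<in> carrier R"
  show "ract S \<xi> a \<in> carrier S"
    using x a by (elim S_E R_E) (simp add: carrier_S f.h.psi_ract g.h.psi_ract)
  show "ract S (\<xi> \<oplus>\<^bsub>S\<^esub> \<eta>) a = ract S \<xi> a \<oplus>\<^bsub>S\<^esub> ract S \<eta> a"
    using x y a by (elim S_E R_E) (simp add: f.S.ract_add_left g.S.ract_add_left)
  show "ract S (c \<odot>\<^bsub>S\<^esub> \<xi>) a = c \<odot>\<^bsub>S\<^esub> ract S \<xi> a" for c
    using x a by (elim S_E R_E) (simp add: f.S.ract_smult_left g.S.ract_smult_left)
  show "ip S \<xi> (ract S \<eta> a) = ip S \<xi> \<eta> \<otimes>\<^bsub>R\<^esub> a"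
    using x y a by (elim S_E R_E) (simp add: f.S.ip_ract g.S.ip_ract)
  show "ract S \<xi> (a \<otimes>\<^bsub>R\<^esub> b) = ract S (ract S \<xi> a) b" if "b \<in> carrier R" for b
    using x a that by (elim S_E R_E) (simp add: f.S.ract_mult g.S.ract_mult)
next
  fix \<xi> assume "\<xi> \<in> carrier S"
  then show "ip S \<xi> \<xi> = \<zero>\<^bsub>R\<^esub> \<longleftrightarrow> \<xi> = \<zero>\<^bsub>S\<^esub>"
    by (elim S_E) (simp add: f.S.ip_definite g.S.ip_definite)
qed

lemma lact_S_adjp:
  assumes r: "r \<in> carrier R" shows "S.adjp (lact S r) (lact S (star R r))"
proof (rule S.adjpI)
  obtain a b where ab: "r = (a, b)" "a \<in> carrier A" "b \<in> carrier B" "\<psi>A a = \<omega>B b" using r by (rule R_E)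
  have cl: "lact S (a', b') \<in> carrier S \<rightarrow>\<^sub>E carrier S"
    if "a' \<in> carrier A" "b' \<in> carrier B" "\<psi>A a' = \<omega>B b'" for a' b'
    unfolding lact_S_restrict using that
    by (auto simp: carrier_S f.p_lact g.p_lact)
  show "lact S r \<in> carrier S \<rightarrow>\<^sub>E carrier S" using cl ab by simp
  show "lact S (star R r) \<in> carrier S \<rightarrow>\<^sub>E carrier S"
    using cl[of "star A a" "star B b"] ab by (simp add: f.h.H.map_star g.h.H.map_star)
  fix s t assume "s \<in> carrier S" "t \<in> carrier S"
  then show "ip S (lact S r s) t = ip S s (lact S (star R r) t)"
    using ab by (elim S_E) (simp add: lact_S carrier_S f.S.lact.map_star g.S.lact.map_star f.S.star_L_ip g.S.star_L_ip)
qed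

lemma lact_S_hom: "star_hom R S.L (lact S)"
proof -
  interpret L: cstar_algebra S.L by (rule S.cstar_L)
  have cl: "lact S r \<in> carrier S.L" if "r \<in> carrier R" for r using lact_S_adjp[OF that] unfolding S.carrier_L by blast
  show ?thesis
    unfolding star_hom_def linear_map_def
  proof (intro conjI ballI allI)
    show "lact S \<in> carrier R \<rightarrow> carrier S.L" using cl by blast
    fix r r' c assume r: "r \<in> carrier R"
    show "lact S (star R r) = star S.L (lact S r)" using S.star_L[OF lact_S_adjp[OF r]] by simp
    show "lact S (c \<odot>\<^bsub>R\<^esub> r) = c \<odot>\<^bsub>S.L\<^esub> lact S r"
    proof (rule S.L_ext)
      show "lact S (c \<odot>\<^bsub>R\<^esub> r) \<in> carrier S.L" "c \<odot>\<^bsub>S.L\<^esub> lact S r \<in> carrier S.L" using r by (simp_all add: cl)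
      show "lact S (c \<odot>\<^bsub>R\<^esub> r) s = (c \<odot>\<^bsub>S.L\<^esub> lact S r) s" if "s \<in> carrier S" for s
        using r that by (elim S_E R_E) (simp add: lact_S carrier_S S.L_simps f.S.lact.map_smult g.S.lact.map_smult f.S.L_simps g.S.L_simps)
    qed
    assume r': "r' \<in> carrier R"
    show "lact S (r \<oplus>\<^bsub>R\<^esub> r') = lact S r \<oplus>\<^bsub>S.L\<^esub> lact S r'"
    proof (rule S.L_ext)
      show "lact S (r \<oplus>\<^bsub>R\<^esub> r') \<in> carrier S.L" "lact S r \<oplus>\<^bsub>S.L\<^esub> lact S r' \<in> carrier S.L" using r r' by (simp_all add: cl)
      show "lact S (r \<oplus>\<^bsub>R\<^esub> r') s = (lact S r \<oplus>\<^bsub>S.L\<^esub> lact S r') s" if "s \<in> carrier S" for s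
        using r r' that by (elim S_E R_E) (simp add: lact_S carrier_S S.L_simps f.S.lact.map_add g.S.lact.map_add f.S.L_simps g.S.L_simps)
    qed
    show "lact S (r \<otimes>\<^bsub>R\<^esub> r') = lact S r \<otimes>\<^bsub>S.L\<^esub> lact S r'"
    proof (rule S.L_ext)
      show "lact S (r \<otimes>\<^bsub>R\<^esub> r') \<in> carrier S.L" "lact S r \<otimes>\<^bsub>S.L\<^esub> lact S r' \<in> carrier S.L"
        using r r' S.A.mult_closed L.mult_closed by (simp_all add: cl)
      show "lact S (r \<otimes>\<^bsub>R\<^esub> r') s = (lact S r \<otimes>\<^bsub>S.L\<^esub> lact S r') s" if "s \<in> carrier S" for s
        using r r' that
        by (elim S_E R_E) (simp add: lact_S carrier_S S.L_simps f.S.lact.map_mult g.S.lact.map_mult f.S.L_simps g.S.L_simps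
            compose_def f.p_lact g.p_lact)
    qed
  qed
qed

sublocale S: hcorr R S
  by (intro hcorr.intro S.hilb_axioms hcorr_axioms.intro lact_S_hom)

text \<open>A given coordinate is completed to a pair by the surjectivity of the other morphism onto
  Z or C.\<close>

lemma proj_onto: "fst ` carrier S = carrier X" "snd ` carrier S = carrier Y"
  "fst ` carrier R = carrier A" "snd ` carrier R = carrier B"
proof -
  have "\<xi> \<in> fst ` carrier S" if "\<xi> \<in> carrier X" for \<xi>
  proof -
    have "\<psi>X \<xi> \<in> \<omega>Y ` carrier Y" unfolding g.p_onto by (rule f.h.psi_closed[OF that])
    then obtain \<eta> where "\<psi>X \<xi> = \<omega>Y \<eta>" "\<eta> \<in> carrier Y" by (elim imageE)
    then have "(\<xi>, \<eta>) \<in> carrier S" using that by (simp add: carrier_S)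
    from imageI[OF this, of fst] show ?thesis by simp
  qed
  moreover have "fst s \<in> carrier X" if "s \<in> carrier S" for s using that by (rule S_E) simp
  ultimately show "fst ` carrier S = carrier X" by (intro equalityI subsetI) (auto elim: imageE)
  have "\<eta> \<in> snd ` carrier S" if "\<eta> \<in> carrier Y" for \<eta>
  proof -
    have "\<omega>Y \<eta> \<in> \<psi>X ` carrier X" unfolding f.p_onto by (rule g.h.psi_closed[OF that])
    then obtain \<xi> where "\<omega>Y \<eta> = \<psi>X \<xi>" "\<xi> \<in> carrier X" by (elim imageE)
    then have "(\<xi>, \<eta>) \<in> carrier S" using that by (simp add: carrier_S)
    from imageI[OF this, of snd] show ?thesis by simp
  qed
  moreover have "snd s \<in> carrier Y" if "s \<in> carrier S" for s using that by (rule S_E) simp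
  ultimately show "snd ` carrier S = carrier Y" by (intro equalityI subsetI) (auto elim: imageE)
  have "a \<in> fst ` carrier R" if "a \<in> carrier A" for a
  proof -
    have "\<psi>A a \<in> \<omega>B ` carrier B" unfolding g.pA_onto by (rule f.h.H.map_closed[OF that])
    then obtain b where "\<psi>A a = \<omega>B b" "b \<in> carrier B" by (elim imageE)
    then have "(a, b) \<in> carrier R" using that by (simp add: P.carrier_P)
    from imageI[OF this, of fst] show ?thesis by simp
  qed
  moreover have "fst r \<in> carrier A" if "r \<in> carrier R" for r using that by (rule R_E) simp
  ultimately show "fst ` carrier R = carrier A" by (intro equalityI subsetI) (auto elim: imageE)
  have "b \<in> snd ` carrier R" if "b \<in> carrier B" for b
  proof -
    have "\<omega>B b \<in> \<psi>A ` carrier A" unfolding f.pA_onto by (rule g.h.H.map_closed[OF that])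
    then obtain a where "\<omega>B b = \<psi>A a" "a \<in> carrier A" by (elim imageE)
    then have "(a, b) \<in> carrier R" using that by (simp add: P.carrier_P)
    from imageI[OF this, of snd] show ?thesis by simp
  qed
  moreover have "snd r \<in> carrier B" if "r \<in> carrier R" for r using that by (rule R_E) simp
  ultimately show "snd ` carrier R = carrier B" by (intro equalityI subsetI) (auto elim: imageE)
qed

sublocale p: corr_quotient R S A X fst fst
proof (intro corr_quotient.intro hilbert_map.intro hilbert_map_axioms.intro corr_quotient_axioms.intro
    S.hcorr_axioms f.S.hcorr_axioms S.hilb_axioms f.S.hilb_axioms P.star_hom_fst proj_onto)
  show "linear_map S X fst" by (auto simp: linear_map_def carrier_S)
  show "ip X (fst s) (fst t) = fst (ip S s t)" if "s \<in> carrier S" "t \<in> carrier S" for s t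
    using that by (elim S_E) simp
  show "fst (lact S r s) = lact X (fst r) (fst s)" if "r \<in> carrier R" "s \<in> carrier S" for r s
    using that by (elim S_E R_E) (simp add: lact_S carrier_S)
qed

sublocale q: corr_quotient R S B Y snd snd
proof (intro corr_quotient.intro hilbert_map.intro hilbert_map_axioms.intro corr_quotient_axioms.intro
    S.hcorr_axioms g.S.hcorr_axioms S.hilb_axioms g.S.hilb_axioms P.star_hom_snd proj_onto)
  show "linear_map S Y snd" by (auto simp: linear_map_def carrier_S)
  show "ip Y (snd s) (snd t) = snd (ip S s t)" if "s \<in> carrier S" "t \<in> carrier S" for s t
    using that by (elim S_E) simp
  show "snd (lact S r s) = lact Y (snd r) (snd s)" if "r \<in> carrier R" "s \<in> carrier S" for r s
    using that by (elim S_E R_E) (simp add: lact_S carrier_S)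
qed

end

section \<open>Compact operators on the restricted sum\<close>

context restricted
begin

lemma cm_square:
  assumes "T \<in> S.K" shows "f.h.cm (p.h.cm T) = g.h.cm (q.h.cm T)"
proof (rule S.KA_hom_eqI[OF f.X.cstar_KA star_hom_comp[OF p.h.compact_map_hom f.h.compact_map_hom]
      star_hom_comp[OF q.h.compact_map_hom g.h.compact_map_hom] _ assms])
  fix s t assume "s \<in> carrier S" "t \<in> carrier S"
  then show "f.h.cm (p.h.cm (rank_one S s t)) = g.h.cm (q.h.cm (rank_one S s t))"
    by (simp add: p.h.compact_map_rank_one q.h.compact_map_rank_one f.h.compact_map_rank_one g.h.compact_map_rank_one)
      (elim S_E, simp)
qed

text \<open>Let I be the kernel of the map that \<omega> induces on compact operators, and V the
  image in I of the operators with zero first coordinate. V is closed by \<open>closed_range\<close>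
  and contains T W U for T and U in I and W of rank one; density of products enlarges this to all of
  I.\<close>

lemma compact_kernel_lift:
  assumes T': "T' \<in> g.S.K" "g.h.cm T' = \<zero>\<^bsub>f.X.L\<^esub>"
  shows "\<exists>T\<in>S.K. p.h.cm T = \<zero>\<^bsub>f.S.L\<^esub> \<and> q.h.cm T = T'"
proof -
  interpret KS: cstar_algebra S.KA by (rule S.cstar_KA)
  interpret KX: cstar_algebra f.S.KA by (rule f.S.cstar_KA)
  interpret KY: cstar_algebra g.S.KA by (rule g.S.cstar_KA)
  interpret KZ: cstar_algebra f.X.KA by (rule f.X.cstar_KA)
  interpret p: cstar_hom S.KA f.S.KA p.h.cm by (rule p.h.cstar_hom_cm)
  interpret q: cstar_hom S.KA g.S.KA q.h.cm by (rule q.h.cstar_hom_cm)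
  interpret g: cstar_hom g.S.KA f.X.KA g.h.cm by (rule g.h.cstar_hom_cm)
  interpret LY: cstar_algebra g.S.L by (rule g.S.cstar_L)
  interpret LX: cstar_algebra f.S.L by (rule f.S.cstar_L)
  let ?N = "{T \<in> carrier S.KA. p.h.cm T = \<zero>\<^bsub>f.S.KA\<^esub>}"
  let ?I = "{T \<in> carrier g.S.KA. g.h.cm T = \<zero>\<^bsub>f.X.KA\<^esub>}"
  let ?V = "q.h.cm ` ?N"
  have N: "cstar_subalgebra S.KA ?N" and I: "cstar_subalgebra g.S.KA ?I"
    by (rule p.kernel_subalgebra g.kernel_subalgebra)+
  interpret N: cstar_algebra "S.KA\<lparr>carrier := ?N\<rparr>" by (rule KS.cstar_algebra_carrier_update[OF N])
  interpret I: cstar_algebra "g.S.KA\<lparr>carrier := ?I\<rparr>" by (rule KY.cstar_algebra_carrier_update[OF I])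
  have Nsub: "?N \<subseteq> carrier S.KA" and Isub: "?I \<subseteq> carrier g.S.KA" by auto
  have qN: "q.h.cm T \<in> ?I" if "T \<in> ?N" for T
  proof -
    have T: "T \<in> S.K" "p.h.cm T = \<zero>\<^bsub>f.S.L\<^esub>" using that by simp_all
    have "f.h.cm \<zero>\<^bsub>f.S.KA\<^esub> = \<zero>\<^bsub>f.X.KA\<^esub>" by (rule cstar_hom.map_zero[OF f.h.cstar_hom_cm])
    then show ?thesis using T cm_square[OF T(1)] q.h.compact_map_K by simp
  qed
  have h1: "star_hom (S.KA\<lparr>carrier := ?N\<rparr>) g.S.KA q.h.cm"
    by (rule star_hom_carrier_restrict[OF q.hom Nsub])
  have h2: "star_hom (S.KA\<lparr>carrier := ?N\<rparr>) (g.S.KA\<lparr>carrier := ?I\<rparr>) q.h.cm"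
    by (rule star_hom_carrier_update[OF h1 Isub]) (use qN in simp)
  interpret h1: cstar_hom "S.KA\<lparr>carrier := ?N\<rparr>" g.S.KA q.h.cm
    by (rule cstar_homI[OF N.cstar_algebra_axioms KY.cstar_algebra_axioms h1])
  interpret h2: cstar_hom "S.KA\<lparr>carrier := ?N\<rparr>" "g.S.KA\<lparr>carrier := ?I\<rparr>" q.h.cm
    by (rule cstar_homI[OF N.cstar_algebra_axioms I.cstar_algebra_axioms h2])
  have V1: "submodule ?V complex_ring g.S.KA" "ncl g.S.KA (cnorm g.S.KA) ?V \<subseteq> ?V"
    using h1.image_submodule h1.closed_range by simp_all
  have V2: "submodule ?V complex_ring (g.S.KA\<lparr>carrier := ?I\<rparr>)"
    "ncl (g.S.KA\<lparr>carrier := ?I\<rparr>) (cnorm (g.S.KA\<lparr>carrier := ?I\<rparr>)) ?V \<subseteq> ?V"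
    using h2.image_submodule h2.closed_range by simp_all
  \<comment> \<open>T and the adjoint of U take values in the kernel of \<omega>, so (0, T \<eta>)
    and (0, U* \<eta>') lie in the restricted sum. Their rank-one operator has first coordinate
    zero, and its second is the product in question.\<close>
  have 1: "T \<otimes>\<^bsub>g.S.L\<^esub> (rank_one Y \<eta> \<eta>' \<otimes>\<^bsub>g.S.L\<^esub> U) \<in> ?V"
    if T: "T \<in> ?I" and U: "U \<in> ?I" and y: "\<eta> \<in> carrier Y" "\<eta>' \<in> carrier Y" for T U \<eta> \<eta>'
  proof -
    have TK: "T \<in> g.S.K" "g.h.cm T = \<zero>\<^bsub>f.X.L\<^esub>" and UK: "U \<in> g.S.K" using T U by simp_all
    have U': "star g.S.KA U \<in> ?I" using I U unfolding KY.cstar_subalgebra_iff by blast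
    let ?U = "star g.S.L U"
    have U'K: "?U \<in> g.S.K" "g.h.cm ?U = \<zero>\<^bsub>f.X.L\<^esub>" using U' by simp_all
    have L: "T \<in> carrier g.S.L" "U \<in> carrier g.S.L" "?U \<in> carrier g.S.L" using TK UK U'K g.S.K_L by auto
    have k: "(\<zero>\<^bsub>X\<^esub>, W \<zeta>) \<in> carrier S" if "W \<in> g.S.K" "g.h.cm W = \<zero>\<^bsub>f.X.L\<^esub>" "\<zeta> \<in> carrier Y" for W \<zeta>
      using that g.h.compact_map_intertw[OF that(1,3)] g.S.K_L by (auto simp: carrier_S f.X.L_simps)
    let ?s = "(\<zero>\<^bsub>X\<^esub>, T \<eta>)" and ?t = "(\<zero>\<^bsub>X\<^esub>, ?U \<eta>')"
    have st: "?s \<in> carrier S" "?t \<in> carrier S" using k TK U'K y by blast+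
    have "rank_one X \<zero>\<^bsub>X\<^esub> \<zero>\<^bsub>X\<^esub> = \<zero>\<^bsub>f.S.L\<^esub>"
      using f.S.smult_rank_one[of "\<zero>\<^bsub>X\<^esub>" "\<zero>\<^bsub>X\<^esub>" 0] f.S.rank_one_L[of "\<zero>\<^bsub>X\<^esub>" "\<zero>\<^bsub>X\<^esub>"] by simp
    then have r: "rank_one S ?s ?t \<in> ?N"
      using S.rank_one_K[OF st] p.h.compact_map_rank_one[OF st] by simp
    have e: "q.h.cm (rank_one S ?s ?t) = T \<otimes>\<^bsub>g.S.L\<^esub> (rank_one Y \<eta> \<eta>' \<otimes>\<^bsub>g.S.L\<^esub> U)"
      using q.h.compact_map_rank_one[OF st] L y
      by (simp add: g.S.rank_one_mult g.S.mult_rank_one)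
    from imageI[OF r, of q.h.cm] show ?thesis unfolding e .
  qed
  \<comment> \<open>For fixed T and U the W with this property form a closed subspace of the
    compacts, and it contains the rank-one operators.\<close>
  have 2: "T \<otimes>\<^bsub>g.S.L\<^esub> (W \<otimes>\<^bsub>g.S.L\<^esub> U) \<in> ?V" if T: "T \<in> ?I" and U: "U \<in> ?I" and W: "W \<in> g.S.K" for T U W
  proof -
    have c: "T \<in> carrier g.S.KA" "U \<in> carrier g.S.KA" using T U by auto
    note l = KY.closed_submodule_mult_left[OF V1 c(1)]
    have "{W \<in> carrier g.S.KA. W \<otimes>\<^bsub>g.S.KA\<^esub> U \<in> {W \<in> carrier g.S.KA. T \<otimes>\<^bsub>g.S.KA\<^esub> W \<in> ?V}} = g.S.K"
    proof (rule g.S.KA_least)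
      show "ncl g.S.KA g.S.opn {W \<in> carrier g.S.KA. W \<otimes>\<^bsub>g.S.KA\<^esub> U \<in> {W \<in> carrier g.S.KA. T \<otimes>\<^bsub>g.S.KA\<^esub> W \<in> ?V}}
        \<subseteq> {W \<in> carrier g.S.KA. W \<otimes>\<^bsub>g.S.KA\<^esub> U \<in> {W \<in> carrier g.S.KA. T \<otimes>\<^bsub>g.S.KA\<^esub> W \<in> ?V}}"
        using KY.closed_submodule_mult_right(2)[OF l c(2)] by simp
      fix \<eta> \<eta>' assume y: "\<eta> \<in> carrier Y" "\<eta>' \<in> carrier Y"
      have "rank_one Y \<eta> \<eta>' \<otimes>\<^bsub>g.S.KA\<^esub> U \<in> carrier g.S.KA" using g.S.rank_one_K[OF y] c by (intro KY.mult_closed) simp_all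
      then show "rank_one Y \<eta> \<eta>' \<in> {W \<in> carrier g.S.KA. W \<otimes>\<^bsub>g.S.KA\<^esub> U \<in> {W \<in> carrier g.S.KA. T \<otimes>\<^bsub>g.S.KA\<^esub> W \<in> ?V}}"
        using g.S.rank_one_K[OF y] 1[OF T U y] by simp
    qed (rule KY.closed_submodule_mult_right(1)[OF l c(2)])
    then have "W \<in> {W \<in> carrier g.S.KA. W \<otimes>\<^bsub>g.S.KA\<^esub> U \<in> {W \<in> carrier g.S.KA. T \<otimes>\<^bsub>g.S.KA\<^esub> W \<in> ?V}}" using W by simp
    then show ?thesis by simp
  qed
  \<comment> \<open>For fixed W the T with T W in V form a closed subspace of I. By the previous
    step, with U as the middle factor, it contains all products T U from I, hence it is I.\<close>
  have 3: "T \<otimes>\<^bsub>g.S.L\<^esub> W \<in> ?V" if "T \<in> ?I" "W \<in> ?I" for T W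
  proof -
    let ?M = "{T \<in> carrier (g.S.KA\<lparr>carrier := ?I\<rparr>). T \<otimes>\<^bsub>g.S.KA\<lparr>carrier := ?I\<rparr>\<^esub> W \<in> ?V}"
    have Wc: "W \<in> carrier (g.S.KA\<lparr>carrier := ?I\<rparr>)" using that by simp
    have "?M = carrier (g.S.KA\<lparr>carrier := ?I\<rparr>)"
    proof (rule I.closed_submodule_products[OF I.closed_submodule_mult_right[OF V2 Wc]])
      fix T U assume TU: "T \<in> carrier (g.S.KA\<lparr>carrier := ?I\<rparr>)" "U \<in> carrier (g.S.KA\<lparr>carrier := ?I\<rparr>)"
      have "T \<otimes>\<^bsub>g.S.KA\<lparr>carrier := ?I\<rparr>\<^esub> U \<in> carrier (g.S.KA\<lparr>carrier := ?I\<rparr>)" using TU by (rule I.mult_closed)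
      moreover have "T \<otimes>\<^bsub>g.S.L\<^esub> U \<otimes>\<^bsub>g.S.L\<^esub> W = T \<otimes>\<^bsub>g.S.L\<^esub> (U \<otimes>\<^bsub>g.S.L\<^esub> W)"
        using I.mult_assoc[OF TU Wc] by simp
      ultimately show "T \<otimes>\<^bsub>g.S.KA\<lparr>carrier := ?I\<rparr>\<^esub> U \<in> ?M" using 2[of T W U] TU that(2) by simp
    qed
    then have "T \<in> ?M" using that(1) by simp
    then show ?thesis by simp
  qed
  have "?V = carrier (g.S.KA\<lparr>carrier := ?I\<rparr>)"
    by (rule I.closed_submodule_products[OF V2]) (use 3 in simp)
  moreover have "T' \<in> carrier (g.S.KA\<lparr>carrier := ?I\<rparr>)" using T' by simp
  ultimately have "T' \<in> ?V" by simp
  then show ?thesis by auto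
qed

text \<open>Rank-one operators lift because the projection is onto, and the range on compacts is
  closed.\<close>

lemma compact_lift: assumes "T \<in> f.S.K" shows "\<exists>U\<in>S.K. p.h.cm U = T"
proof -
  interpret p: cstar_hom S.KA f.S.KA p.h.cm by (rule p.h.cstar_hom_cm)
  have "p.h.cm ` carrier S.KA = f.S.K"
  proof (rule f.S.KA_least[OF p.image_submodule])
    show "ncl f.S.KA f.S.opn (p.h.cm ` carrier S.KA) \<subseteq> p.h.cm ` carrier S.KA" using p.closed_range by simp
    fix \<xi> \<eta> assume "\<xi> \<in> carrier X" "\<eta> \<in> carrier X"
    then obtain s t where s: "s \<in> carrier S" "\<xi> = fst s" "t \<in> carrier S" "\<eta> = fst t"
      unfolding proj_onto(1)[symmetric] by (elim imageE)
    have e: "p.h.cm (rank_one S s t) = rank_one X \<xi> \<eta>" using s by (simp add: p.h.compact_map_rank_one)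
    show "rank_one X \<xi> \<eta> \<in> p.h.cm ` carrier S.KA" unfolding e[symmetric] using S.rank_one_K[OF s(1,3)] by (intro imageI) simp
  qed
  then have "T \<in> p.h.cm ` carrier S.KA" using assms by simp
  then show ?thesis by auto
qed

text \<open>A compact lift T of the action of a has a second coordinate that differs from the action
  of b by an operator killed on Z, as both induce the action of the common image of a and b. A lift
  U of this difference with zero first coordinate corrects T.\<close>

lemma lact_S_compact:
  assumes ab: "a \<in> carrier A" "b \<in> carrier B" "\<psi>A a = \<omega>B b"
    and c: "lact X a \<in> f.S.K" "lact Y b \<in> g.S.K"
  shows "lact S (a, b) \<in> S.K"
proof -
  interpret KS: cstar_algebra S.KA by (rule S.cstar_KA)
  interpret KX: cstar_algebra f.S.KA by (rule f.S.cstar_KA)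
  interpret KY: cstar_algebra g.S.KA by (rule g.S.cstar_KA)
  interpret KZ: cstar_algebra f.X.KA by (rule f.X.cstar_KA)
  interpret p: cstar_hom S.KA f.S.KA p.h.cm by (rule p.h.cstar_hom_cm)
  interpret q: cstar_hom S.KA g.S.KA q.h.cm by (rule q.h.cstar_hom_cm)
  interpret g: cstar_hom g.S.KA f.X.KA g.h.cm by (rule g.h.cstar_hom_cm)
  obtain T where T: "T \<in> S.K" "p.h.cm T = lact X a" using compact_lift[OF c(1)] by blast
  have qT: "q.h.cm T \<in> g.S.K" using q.h.compact_map_K[OF T(1)] .
  have 1: "g.h.cm (lact Y b) = f.h.cm (lact X a)" using f.cm_lact[OF ab(1) c(1)] g.cm_lact[OF ab(2) c(2)] ab by simp
  have "g.h.cm (lact Y b \<ominus>\<^bsub>g.S.KA\<^esub> q.h.cm T) = \<zero>\<^bsub>f.X.KA\<^esub>"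
    using g.map_diff[of "lact Y b" "q.h.cm T"] c qT 1 cm_square[OF T(1)] T(2) KZ.diff_zero_iff[of "g.h.cm (lact Y b)" "g.h.cm (lact Y b)"]
      g.h.compact_map_K[OF c(2)] by simp
  moreover have "lact Y b \<ominus>\<^bsub>g.S.KA\<^esub> q.h.cm T \<in> carrier g.S.KA" using c qT by (intro KY.M.minus_closed) simp_all
  ultimately obtain U where U: "U \<in> S.K" "p.h.cm U = \<zero>\<^bsub>f.S.L\<^esub>" "q.h.cm U = lact Y b \<ominus>\<^bsub>g.S.KA\<^esub> q.h.cm T"
    using compact_kernel_lift[of "lact Y b \<ominus>\<^bsub>g.S.KA\<^esub> q.h.cm T"] by auto
  have TU: "T \<oplus>\<^bsub>S.L\<^esub> U \<in> S.K" using KS.M.a_closed[of T U] T U by simp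
  have pTU: "p.h.cm (T \<oplus>\<^bsub>S.L\<^esub> U) = lact X a" using p.map_add[of T U] T U c KX.M.r_zero[of "lact X a"] by simp
  have "q.h.cm (T \<oplus>\<^bsub>S.L\<^esub> U) = q.h.cm T \<oplus>\<^bsub>g.S.KA\<^esub> (lact Y b \<ominus>\<^bsub>g.S.KA\<^esub> q.h.cm T)" using q.map_add[of T U] T U by simp
  also have "\<dots> = lact Y b"
    using c qT by (intro KY.add_diff) simp_all
  finally have qTU: "q.h.cm (T \<oplus>\<^bsub>S.L\<^esub> U) = lact Y b" .
  have "T \<oplus>\<^bsub>S.L\<^esub> U = lact S (a, b)"
  proof (rule S.L_ext)
    show "T \<oplus>\<^bsub>S.L\<^esub> U \<in> carrier S.L" using TU S.K_L by blast
    show "lact S (a, b) \<in> carrier S.L" using ab by (intro S.lact.map_closed) (simp add: P.carrier_P)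
    fix s assume s: "s \<in> carrier S"
    then obtain \<xi> \<eta> where e: "s = (\<xi>, \<eta>)" by (rule S_E)
    show "(T \<oplus>\<^bsub>S.L\<^esub> U) s = lact S (a, b) s"
      using p.h.compact_map_intertw[OF TU s] q.h.compact_map_intertw[OF TU s] pTU qTU s
      unfolding e by (simp add: lact_S prod_eq_iff)
  qed
  then show ?thesis using TU by simp
qed

end

section \<open>The Katsura ideal of the restricted sum\<close>

locale restricted_compact = restricted A X B Y C Z \<psi>X \<psi>A \<omega>Y \<omega>B
  for A :: "'a cstar_algebra" and X :: "('a, 'x) correspondence"
    and B :: "'b cstar_algebra" and Y :: "('b, 'y) correspondence"
    and C :: "'c cstar_algebra" and Z :: "('c, 'z) correspondence"
    and \<psi>X \<psi>A \<omega>Y \<omega>B +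
  assumes J_f: "\<psi>A ` f.S.J \<subseteq> f.X.J" and J_g: "\<omega>B ` g.S.J \<subseteq> f.X.J"
    and ker_eq: "\<psi>A ` lker A X = \<omega>B ` lker B Y"
    and compact_X: "lact X ` carrier A \<subseteq> f.S.K" and compact_Y: "lact Y ` carrier B \<subseteq> g.S.K"
    and compl_X: "complemented A (lker A X)" and compl_Y: "complemented B (lker B Y)"
begin

lemma lker_S_iff: "(a, b) \<in> lker R S \<longleftrightarrow> (a, b) \<in> carrier R \<and> a \<in> lker A X \<and> b \<in> lker B Y"
proof
  assume ab: "(a, b) \<in> lker R S"
  then have c: "(a, b) \<in> carrier R" "a \<in> carrier A" "b \<in> carrier B" and z: "lact S (a, b) = \<zero>\<^bsub>S.L\<^esub>"
    by (auto simp: S.lker_iff P.carrier_P)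
  have s: "lact X a (fst s) = \<zero>\<^bsub>X\<^esub>" "lact Y b (snd s) = \<zero>\<^bsub>Y\<^esub>" if "s \<in> carrier S" for s
    using p.p_lact[OF c(1) that] q.p_lact[OF c(1) that] that by (simp_all add: z S.L_simps)
  have "lact X a = \<zero>\<^bsub>f.S.L\<^esub>"
  proof (rule f.S.L_ext[OF f.S.lact.map_closed[OF c(2)] f.S.lact.B.M.zero_closed])
    fix \<xi> assume "\<xi> \<in> carrier X"
    then obtain s where "s \<in> carrier S" "\<xi> = fst s" unfolding proj_onto(1)[symmetric] by (elim imageE)
    then show "lact X a \<xi> = \<zero>\<^bsub>f.S.L\<^esub> \<xi>" using s by (simp add: f.S.L_simps)
  qed
  moreover have "lact Y b = \<zero>\<^bsub>g.S.L\<^esub>"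
  proof (rule g.S.L_ext[OF g.S.lact.map_closed[OF c(3)] g.S.lact.B.M.zero_closed])
    fix \<eta> assume "\<eta> \<in> carrier Y"
    then obtain s where "s \<in> carrier S" "\<eta> = snd s" unfolding proj_onto(2)[symmetric] by (elim imageE)
    then show "lact Y b \<eta> = \<zero>\<^bsub>g.S.L\<^esub> \<eta>" using s by (simp add: g.S.L_simps)
  qed
  ultimately show "(a, b) \<in> carrier R \<and> a \<in> lker A X \<and> b \<in> lker B Y"
    using c by (simp add: f.S.lker_iff g.S.lker_iff)
next
  assume ab: "(a, b) \<in> carrier R \<and> a \<in> lker A X \<and> b \<in> lker B Y"
  have "lact S (a, b) = \<zero>\<^bsub>S.L\<^esub>"
  proof (rule S.L_ext[OF S.lact.map_closed S.lact.B.M.zero_closed])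
    fix s assume "s \<in> carrier S"
    then show "lact S (a, b) s = \<zero>\<^bsub>S.L\<^esub> s"
      using ab by (elim S_E) (simp add: lact_S carrier_S S.L_simps f.S.lker_iff g.S.lker_iff f.S.L_simps g.S.L_simps)
  qed (use ab in simp)
  then show "(a, b) \<in> lker R S" using ab by (simp add: S.lker_iff)
qed

text \<open>By \<open>ker_eq\<close> each element of one kernel is a coordinate of a pair of kernel
  elements, so annihilating the kernel for the restricted sum means annihilating both kernels.
  Compactness of the pair is \<open>lact_S_compact\<close>.\<close>

lemma katsura_S_iff: "(a, b) \<in> S.J \<longleftrightarrow> (a, b) \<in> carrier R \<and> a \<in> f.S.J \<and> b \<in> g.S.J"
proof
  assume ab: "(a, b) \<in> S.J"
  then have c: "(a, b) \<in> carrier R" "a \<in> carrier A" "b \<in> carrier B" using S.J_K(1) by (auto simp: P.carrier_P)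
  have z: "a \<otimes>\<^bsub>A\<^esub> a' = \<zero>\<^bsub>A\<^esub>" "b \<otimes>\<^bsub>B\<^esub> b' = \<zero>\<^bsub>B\<^esub>" if "a' \<in> lker A X" "b' \<in> lker B Y" "\<psi>A a' = \<omega>B b'" for a' b'
  proof -
    have "(a', b') \<in> lker R S" using that by (simp add: lker_S_iff P.carrier_P f.S.lker_iff g.S.lker_iff)
    then have "(a, b) \<otimes>\<^bsub>R\<^esub> (a', b') = \<zero>\<^bsub>R\<^esub>" using ab unfolding katsura_ideal_def by blast
    then show "a \<otimes>\<^bsub>A\<^esub> a' = \<zero>\<^bsub>A\<^esub>" "b \<otimes>\<^bsub>B\<^esub> b' = \<zero>\<^bsub>B\<^esub>" by simp_all
  qed
  have "a \<in> f.S.J"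
  proof (rule f.S.JI[OF c(2)])
    show "lact X a \<in> f.S.K" using compact_X c by blast
    fix a' assume a': "a' \<in> lker A X"
    then have "\<psi>A a' \<in> \<omega>B ` lker B Y" unfolding ker_eq[symmetric] by (rule imageI)
    then obtain b' where b': "b' \<in> lker B Y" "\<psi>A a' = \<omega>B b'" by (elim imageE)
    show "a \<otimes>\<^bsub>A\<^esub> a' = \<zero>\<^bsub>A\<^esub>" by (rule z(1)[OF a' b'])
  qed
  moreover have "b \<in> g.S.J"
  proof (rule g.S.JI[OF c(3)])
    show "lact Y b \<in> g.S.K" using compact_Y c by blast
    fix b' assume b': "b' \<in> lker B Y"
    then have "\<omega>B b' \<in> \<psi>A ` lker A X" unfolding ker_eq by (rule imageI)
    then obtain a' where a': "a' \<in> lker A X" "\<psi>A a' = \<omega>B b'" by (elim imageE) simp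
    show "b \<otimes>\<^bsub>B\<^esub> b' = \<zero>\<^bsub>B\<^esub>" by (rule z(2)[OF a'(1) b' a'(2)])
  qed
  ultimately show "(a, b) \<in> carrier R \<and> a \<in> f.S.J \<and> b \<in> g.S.J" using c by blast
next
  assume ab: "(a, b) \<in> carrier R \<and> a \<in> f.S.J \<and> b \<in> g.S.J"
  then have c: "a \<in> carrier A" "b \<in> carrier B" "\<psi>A a = \<omega>B b" by (auto simp: P.carrier_P)
  show "(a, b) \<in> S.J"
  proof (rule S.JI)
    show "(a, b) \<in> carrier R" using ab by blast
    show "lact S (a, b) \<in> S.K" using ab f.S.J_K(2) g.S.J_K(2) by (intro lact_S_compact c) blast+
    fix r assume "r \<in> lker R S"
    then obtain a' b' where r: "r = (a', b')" "a' \<in> lker A X" "b' \<in> lker B Y" using lker_S_iff by (cases r) auto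
    then have "a \<otimes>\<^bsub>A\<^esub> a' = \<zero>\<^bsub>A\<^esub>" "b \<otimes>\<^bsub>B\<^esub> b' = \<zero>\<^bsub>B\<^esub>" using ab unfolding katsura_ideal_def by blast+
    then show "(a, b) \<otimes>\<^bsub>R\<^esub> r = \<zero>\<^bsub>R\<^esub>" using r by simp
  qed
qed

lemma katsura_S_subset: "fst ` S.J \<subseteq> f.S.J" "snd ` S.J \<subseteq> g.S.J"
  using katsura_S_iff by auto

text \<open>The image in C of an element of one Katsura ideal lies in that of Z, and
  \<open>katsura_onto\<close> lifts it into the other Katsura ideal; the two together form a pair in
  \<open>S.J\<close>.\<close>

lemma katsura_S_onto: "f.S.J \<subseteq> fst ` S.J" "g.S.J \<subseteq> snd ` S.J"
proof -
  show "f.S.J \<subseteq> fst ` S.J"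
  proof
    fix a assume a: "a \<in> f.S.J"
    then have "\<psi>A a \<in> \<omega>B ` g.S.J" using J_f g.katsura_onto[OF compact_Y compl_Y J_g] by blast
    then obtain b where b: "\<psi>A a = \<omega>B b" "b \<in> g.S.J" by (elim imageE)
    have "(a, b) \<in> S.J" using a b f.S.J_K(1) g.S.J_K(1) by (simp add: katsura_S_iff P.carrier_P)
    from imageI[OF this, of fst] show "a \<in> fst ` S.J" by simp
  qed
  show "g.S.J \<subseteq> snd ` S.J"
  proof
    fix b assume b: "b \<in> g.S.J"
    then have "\<omega>B b \<in> \<psi>A ` f.S.J" using J_g f.katsura_onto[OF compact_X compl_X J_f] by blast
    then obtain a where a: "\<omega>B b = \<psi>A a" "a \<in> f.S.J" by (elim imageE)
    have "(a, b) \<in> S.J" using a b f.S.J_K(1) g.S.J_K(1) by (simp add: katsura_S_iff P.carrier_P)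
    from imageI[OF this, of snd] show "b \<in> snd ` S.J" by simp
  qed
qed

end

section \<open>The isomorphism\<close>

context restricted_compact
begin

context
  fixes OX :: "'ox cstar_algebra" and \<pi>X :: "'x \<Rightarrow> 'ox" and \<pi>A :: "'a \<Rightarrow> 'ox"
    and OY :: "'oy cstar_algebra" and \<pi>Y :: "'y \<Rightarrow> 'oy" and \<pi>B :: "'b \<Rightarrow> 'oy"
    and OZ :: "'oz cstar_algebra" and \<pi>Z :: "'z \<Rightarrow> 'oz" and \<pi>C :: "'c \<Rightarrow> 'oz"
    and OS :: "'os cstar_algebra" and \<pi>S :: "'x \<times> 'y \<Rightarrow> 'os" and \<pi>R :: "'a \<times> 'b \<Rightarrow> 'os"
    and \<Psi> :: "'ox \<Rightarrow> 'oz" and \<Omega> :: "'oy \<Rightarrow> 'oz"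
  assumes univX: "universal_covariant_rep A X OX \<pi>X \<pi>A"
    and univY: "universal_covariant_rep B Y OY \<pi>Y \<pi>B"
    and univZ: "universal_covariant_rep C Z OZ \<pi>Z \<pi>C"
    and univS: "universal_covariant_rep R S OS \<pi>S \<pi>R"
    and indX: "induced_hom A X OX \<pi>X \<pi>A OZ \<pi>Z \<pi>C \<psi>X \<psi>A \<Psi>"
    and indY: "induced_hom B Y OY \<pi>Y \<pi>B OZ \<pi>Z \<pi>C \<omega>Y \<omega>B \<Omega>"
begin

lemma OX: "cstar_algebra OX" "covariant_rep A X OX \<pi>X \<pi>A" "generated_by OX (\<pi>X ` carrier X \<union> \<pi>A ` carrier A)"
  and OY: "cstar_algebra OY" "covariant_rep B Y OY \<pi>Y \<pi>B" "generated_by OY (\<pi>Y ` carrier Y \<union> \<pi>B ` carrier B)"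
  and OS: "cstar_algebra OS" "covariant_rep R S OS \<pi>S \<pi>R" "generated_by OS (\<pi>S ` carrier S \<union> \<pi>R ` carrier R)"
  and OZ: "cstar_algebra OZ"
  using univX univY univZ univS by (simp_all add: universal_covariant_rep_def)

lemma \<Psi>: "star_hom OX OZ \<Psi>" "\<xi> \<in> carrier X \<Longrightarrow> \<Psi> (\<pi>X \<xi>) = \<pi>Z (\<psi>X \<xi>)" "a \<in> carrier A \<Longrightarrow> \<Psi> (\<pi>A a) = \<pi>C (\<psi>A a)"
  and \<Omega>: "star_hom OY OZ \<Omega>" "\<eta> \<in> carrier Y \<Longrightarrow> \<Omega> (\<pi>Y \<eta>) = \<pi>Z (\<omega>Y \<eta>)" "b \<in> carrier B \<Longrightarrow> \<Omega> (\<pi>B b) = \<pi>C (\<omega>B b)"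
  using indX indY by (simp_all add: induced_hom_def)

interpretation rX: toeplitz_rep A X OX \<pi>X \<pi>A by (rule toeplitz_repI[OF f.S.hcorr_axioms OX(1,2)])
interpretation rY: toeplitz_rep B Y OY \<pi>Y \<pi>B by (rule toeplitz_repI[OF g.S.hcorr_axioms OY(1,2)])
interpretation rS: toeplitz_rep R S OS \<pi>S \<pi>R by (rule toeplitz_repI[OF S.hcorr_axioms OS(1,2)])

interpretation PO: cstar_pullback OX OY OZ \<Psi> \<Omega>
  by (intro cstar_pullback.intro cstar_homI OX(1) OY(1) OZ \<Psi>(1) \<Omega>(1))

lemma projections:
  obtains \<Phi>1 \<Phi>2 where "star_hom OS OX \<Phi>1" "star_hom OS OY \<Phi>2"
    "\<And>s. s \<in> carrier S \<Longrightarrow> \<Phi>1 (\<pi>S s) = \<pi>X (fst s)" "\<And>r. r \<in> carrier R \<Longrightarrow> \<Phi>1 (\<pi>R r) = \<pi>A (fst r)"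
    "\<And>s. s \<in> carrier S \<Longrightarrow> \<Phi>2 (\<pi>S s) = \<pi>Y (snd s)" "\<And>r. r \<in> carrier R \<Longrightarrow> \<Phi>2 (\<pi>R r) = \<pi>B (snd r)"
proof -
  note 1 = p.pull[OF rX.toeplitz_rep_axioms OX(2) katsura_S_subset(1)]
  note 2 = q.pull[OF rY.toeplitz_rep_axioms OY(2) katsura_S_subset(2)]
  interpret c1: toeplitz_rep R S OX "\<lambda>s. \<pi>X (fst s)" "\<lambda>r. \<pi>A (fst r)" by (rule toeplitz_repI[OF S.hcorr_axioms OX(1) 1])
  interpret c2: toeplitz_rep R S OY "\<lambda>s. \<pi>Y (snd s)" "\<lambda>r. \<pi>B (snd r)" by (rule toeplitz_repI[OF S.hcorr_axioms OY(1) 2])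
  show thesis
    by (rule c1.universal_hom[OF univS 1], rule c2.universal_hom[OF univS 2], rule that)
qed

lemma pullback_isomorphic: "star_isomorphic OS (pullback OX OY \<Psi> \<Omega>)"
proof -
  obtain \<Phi>1 \<Phi>2 where \<Phi>1: "star_hom OS OX \<Phi>1" and \<Phi>2: "star_hom OS OY \<Phi>2"
    and \<Phi>1': "\<And>s. s \<in> carrier S \<Longrightarrow> \<Phi>1 (\<pi>S s) = \<pi>X (fst s)" "\<And>r. r \<in> carrier R \<Longrightarrow> \<Phi>1 (\<pi>R r) = \<pi>A (fst r)"
    and \<Phi>2': "\<And>s. s \<in> carrier S \<Longrightarrow> \<Phi>2 (\<pi>S s) = \<pi>Y (snd s)" "\<And>r. r \<in> carrier R \<Longrightarrow> \<Phi>2 (\<pi>R r) = \<pi>B (snd r)"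
    by (rule projections) blast
  interpret F1: cstar_hom OS OX \<Phi>1 by (rule cstar_homI[OF OS(1) OX(1) \<Phi>1])
  interpret F2: cstar_hom OS OY \<Phi>2 by (rule cstar_homI[OF OS(1) OY(1) \<Phi>2])
  have G: "\<pi>S ` carrier S \<union> \<pi>R ` carrier R \<subseteq> carrier OS" by auto
  have sq: "\<Psi> (\<Phi>1 x) = \<Omega> (\<Phi>2 x)" if "x \<in> carrier OS" for x
  proof (rule cstar_hom_eqI[OF _ _ OS(3) G _ that])
    show "cstar_hom OS OZ (\<lambda>x. \<Psi> (\<Phi>1 x))" "cstar_hom OS OZ (\<lambda>x. \<Omega> (\<Phi>2 x))"
      by (intro cstar_homI OS(1) OZ star_hom_comp[OF \<Phi>1 \<Psi>(1)] star_hom_comp[OF \<Phi>2 \<Omega>(1)])+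
    have "\<Psi> (\<Phi>1 (\<pi>S s)) = \<Omega> (\<Phi>2 (\<pi>S s))" if "s \<in> carrier S" for s
      using that by (elim S_E) (simp add: \<Phi>1' \<Phi>2' \<Psi> \<Omega> carrier_S)
    moreover have "\<Psi> (\<Phi>1 (\<pi>R r)) = \<Omega> (\<Phi>2 (\<pi>R r))" if "r \<in> carrier R" for r
      using that by (elim R_E) (simp add: \<Phi>1' \<Phi>2' \<Psi> \<Omega> P.carrier_P)
    ultimately show "\<Psi> (\<Phi>1 x) = \<Omega> (\<Phi>2 x)" if "x \<in> \<pi>S ` carrier S \<union> \<pi>R ` carrier R" for x
      using that by blast
  qed
  let ?\<Phi> = "\<lambda>x. (\<Phi>1 x, \<Phi>2 x)"
  have hom: "star_hom OS PO.P ?\<Phi>" by (rule PO.star_hom_pair[OF \<Phi>1 \<Phi>2 sq])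
  have ker1: "x \<in> K" if "closed_ideal OS K" "\<And>r. \<lbrakk>r \<in> carrier R; fst r = \<zero>\<^bsub>A\<^esub>\<rbrakk> \<Longrightarrow> \<pi>R r \<in> K"
    "x \<in> carrier OS" "\<Phi>1 x = \<zero>\<^bsub>OX\<^esub>" for K x
    by (rule p.kernel_le[OF rS.toeplitz_rep_axioms OS(2,3) univX \<Phi>1 \<Phi>1' that(1,2) katsura_S_onto(1) that(3,4)])
  have ker2: "x \<in> K" if "closed_ideal OS K" "\<And>r. \<lbrakk>r \<in> carrier R; snd r = \<zero>\<^bsub>B\<^esub>\<rbrakk> \<Longrightarrow> \<pi>R r \<in> K"
    "x \<in> carrier OS" "\<Phi>2 x = \<zero>\<^bsub>OY\<^esub>" for K x
    by (rule q.kernel_le[OF rS.toeplitz_rep_axioms OS(2,3) univY \<Phi>2 \<Phi>2' that(1,2) katsura_S_onto(2) that(3,4)])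
  have orth: "\<pi>R r \<otimes>\<^bsub>OS\<^esub> (z \<otimes>\<^bsub>OS\<^esub> \<pi>R r') = \<zero>\<^bsub>OS\<^esub>"
    if r: "r \<in> carrier R" "fst r = \<zero>\<^bsub>A\<^esub>" and r': "r' \<in> carrier R" "snd r' = \<zero>\<^bsub>B\<^esub>" and z: "z \<in> carrier OS" for r r' z
  proof (rule rS.orthogonal_ideals[OF OS(3), where I = "{r \<in> carrier R. snd r = \<zero>\<^bsub>B\<^esub>}" and I' = "{r \<in> carrier R. fst r = \<zero>\<^bsub>A\<^esub>}"])
    show "r' \<in> {r \<in> carrier R. snd r = \<zero>\<^bsub>B\<^esub>}" "r \<in> {r \<in> carrier R. fst r = \<zero>\<^bsub>A\<^esub>}" using r r' by auto
    fix b c assume b: "b \<in> {r \<in> carrier R. snd r = \<zero>\<^bsub>B\<^esub>}"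
    then show "star R b \<in> {r \<in> carrier R. snd r = \<zero>\<^bsub>B\<^esub>}"
      using S.A.star_closed[of b] q.h.H.map_star[of b] by simp
    show "ip S (lact S b s) (lact S b s) \<in> {r \<in> carrier R. snd r = \<zero>\<^bsub>B\<^esub>}" if "s \<in> carrier S" for s
      using b q.ip_lact_kernel[of b s] that by simp
    show "c \<otimes>\<^bsub>R\<^esub> b = \<zero>\<^bsub>R\<^esub>" if "c \<in> {r \<in> carrier R. fst r = \<zero>\<^bsub>A\<^esub>}"
      using b that by (cases b, cases c) (auto simp: P.carrier_P)
    assume "c \<in> carrier R"
    then show "b \<otimes>\<^bsub>R\<^esub> c \<in> {r \<in> carrier R. snd r = \<zero>\<^bsub>B\<^esub>}"
      using b S.A.mult_closed[of b c] q.h.H.map_mult[of b c] by simp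
  next
    fix b c assume b: "b \<in> {r \<in> carrier R. fst r = \<zero>\<^bsub>A\<^esub>}"
    then show "star R b \<in> {r \<in> carrier R. fst r = \<zero>\<^bsub>A\<^esub>}"
      using S.A.star_closed[of b] p.h.H.map_star[of b] by simp
    show "ip S (lact S b s) (lact S b s) \<in> {r \<in> carrier R. fst r = \<zero>\<^bsub>A\<^esub>}" if "s \<in> carrier S" for s
      using b p.ip_lact_kernel[of b s] that by simp
    assume "c \<in> carrier R"
    then show "b \<otimes>\<^bsub>R\<^esub> c \<in> {r \<in> carrier R. fst r = \<zero>\<^bsub>A\<^esub>}"
      using b S.A.mult_closed[of b c] p.h.H.map_mult[of b c] by simp
  qed (use z in auto)
  \<comment> \<open>The kernel description is used twice. First, elements of the kernel of \<Phi>1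
    annihilate the coefficients with zero second coordinate; by adjoints these coefficients
    annihilate x. Second, the kernel of \<Phi>2 is generated by such coefficients, so it annihilates
    x, and x itself belongs to it.\<close>
  have zero: "x = \<zero>\<^bsub>OS\<^esub>" if x: "x \<in> carrier OS" "\<Phi>1 x = \<zero>\<^bsub>OX\<^esub>" "\<Phi>2 x = \<zero>\<^bsub>OY\<^esub>" for x
  proof -
    let ?T = "\<pi>R ` {r \<in> carrier R. snd r = \<zero>\<^bsub>B\<^esub>}"
    have T: "?T \<subseteq> carrier OS" by auto
    have 1: "y \<otimes>\<^bsub>OS\<^esub> (z \<otimes>\<^bsub>OS\<^esub> \<pi>R r) = \<zero>\<^bsub>OS\<^esub>"
      if y: "y \<in> carrier OS" "\<Phi>1 y = \<zero>\<^bsub>OX\<^esub>" and z: "z \<in> carrier OS" and r: "r \<in> carrier R" "snd r = \<zero>\<^bsub>B\<^esub>" for y z r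
    proof -
      have "y \<in> {y \<in> carrier OS. \<forall>z\<in>carrier OS. \<forall>t\<in>?T. y \<otimes>\<^bsub>OS\<^esub> (z \<otimes>\<^bsub>OS\<^esub> t) = \<zero>\<^bsub>OS\<^esub>}"
        by (rule ker1[OF rS.D.closed_ideal_annihilator[OF T] _ y]) (use orth in auto)
      moreover have "\<pi>R r \<in> ?T" using r by blast
      ultimately show ?thesis using z by blast
    qed
    have 2: "\<pi>R r \<otimes>\<^bsub>OS\<^esub> (z \<otimes>\<^bsub>OS\<^esub> x) = \<zero>\<^bsub>OS\<^esub>" if z: "z \<in> carrier OS" and r: "r \<in> carrier R" "snd r = \<zero>\<^bsub>B\<^esub>" for z r
    proof -
      have "\<Phi>1 (star OS x) = \<zero>\<^bsub>OX\<^esub>" using x by (simp add: F1.map_star)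
      moreover have "snd (star R r) = \<zero>\<^bsub>B\<^esub>" using r q.h.H.map_star[of r] by simp
      ultimately have "star OS x \<otimes>\<^bsub>OS\<^esub> (star OS z \<otimes>\<^bsub>OS\<^esub> \<pi>R (star R r)) = \<zero>\<^bsub>OS\<^esub>"
        using x z r S.A.star_closed by (intro 1) simp_all
      then have "star OS (star OS x \<otimes>\<^bsub>OS\<^esub> (star OS z \<otimes>\<^bsub>OS\<^esub> star OS (\<pi>R r))) = \<zero>\<^bsub>OS\<^esub>"
        using r by (simp add: rS.hp.H.map_star)
      then show ?thesis using x z r by (simp add: rS.D.star_mult rS.D.mult_assoc)
    qed
    have X: "{x} \<subseteq> carrier OS" using x by simp
    have "x \<in> {y \<in> carrier OS. \<forall>z\<in>carrier OS. \<forall>t\<in>{x}. y \<otimes>\<^bsub>OS\<^esub> (z \<otimes>\<^bsub>OS\<^esub> t) = \<zero>\<^bsub>OS\<^esub>}"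
      by (rule ker2[OF rS.D.closed_ideal_annihilator[OF X] _ x(1,3)]) (use 2 in auto)
    \<comment> \<open>The middle factor is taken to be x*, so that x x* x = 0 and the square of x*x
      vanishes.\<close>
    then have "x \<otimes>\<^bsub>OS\<^esub> (star OS x \<otimes>\<^bsub>OS\<^esub> x) = \<zero>\<^bsub>OS\<^esub>" using x by simp
    then have "star OS (star OS x \<otimes>\<^bsub>OS\<^esub> x) \<otimes>\<^bsub>OS\<^esub> (star OS x \<otimes>\<^bsub>OS\<^esub> x) = \<zero>\<^bsub>OS\<^esub>"
      using x by (simp add: rS.D.star_mult rS.D.mult_assoc)
    then have "star OS x \<otimes>\<^bsub>OS\<^esub> x = \<zero>\<^bsub>OS\<^esub>" using x by (intro rS.D.star_mult_eq_zero[of "star OS x \<otimes>\<^bsub>OS\<^esub> x"] rS.D.mult_closed) simp_all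
    then show ?thesis by (rule rS.D.star_mult_eq_zero[OF x(1)])
  qed
  have inj: "inj_on ?\<Phi> (carrier OS)"
  proof (rule inj_onI)
    fix x y assume xy: "x \<in> carrier OS" "y \<in> carrier OS" "?\<Phi> x = ?\<Phi> y"
    have "x \<ominus>\<^bsub>OS\<^esub> y = \<zero>\<^bsub>OS\<^esub>"
      using xy rX.D.diff_zero_iff rY.D.diff_zero_iff by (intro zero) (simp_all add: F1.map_diff F2.map_diff)
    then show "x = y" using xy rS.D.diff_zero_iff by simp
  qed
  have onto1: "\<Phi>1 ` carrier OS = carrier OX"
  proof (rule F1.range_generated[OF OX(3)])
    have "\<pi>X \<xi> \<in> \<Phi>1 ` carrier OS" if c: "\<xi> \<in> carrier X" for \<xi>
    proof -
      obtain s where s: "s \<in> carrier S" "\<xi> = fst s" using c unfolding proj_onto(1)[symmetric] by (elim imageE)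
      show ?thesis unfolding s(2) \<Phi>1'(1)[OF s(1), symmetric] using s by (intro imageI rS.rep_closed)
    qed
    moreover have "\<pi>A a \<in> \<Phi>1 ` carrier OS" if c: "a \<in> carrier A" for a
    proof -
      obtain r where r: "r \<in> carrier R" "a = fst r" using c unfolding proj_onto(3)[symmetric] by (elim imageE)
      show ?thesis unfolding r(2) \<Phi>1'(2)[OF r(1), symmetric] using r by (intro imageI rS.hp.H.map_closed)
    qed
    ultimately show "\<pi>X ` carrier X \<union> \<pi>A ` carrier A \<subseteq> \<Phi>1 ` carrier OS" by blast
  qed
  have onto2: "\<Phi>2 ` carrier OS = carrier OY"
  proof (rule F2.range_generated[OF OY(3)])
    have "\<pi>Y \<eta> \<in> \<Phi>2 ` carrier OS" if c: "\<eta> \<in> carrier Y" for \<eta>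
    proof -
      obtain s where s: "s \<in> carrier S" "\<eta> = snd s" using c unfolding proj_onto(2)[symmetric] by (elim imageE)
      show ?thesis unfolding s(2) \<Phi>2'(1)[OF s(1), symmetric] using s by (intro imageI rS.rep_closed)
    qed
    moreover have "\<pi>B b \<in> \<Phi>2 ` carrier OS" if c: "b \<in> carrier B" for b
    proof -
      obtain r where r: "r \<in> carrier R" "b = snd r" using c unfolding proj_onto(4)[symmetric] by (elim imageE)
      show ?thesis unfolding r(2) \<Phi>2'(2)[OF r(1), symmetric] using r by (intro imageI rS.hp.H.map_closed)
    qed
    ultimately show "\<pi>Y ` carrier Y \<union> \<pi>B ` carrier B \<subseteq> \<Phi>2 ` carrier OS" by blast
  qed
  let ?N = "{s \<in> carrier OS. \<Phi>1 s = \<zero>\<^bsub>OX\<^esub>}"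
  \<comment> \<open>The ideal property comes from surjectivity of \<Phi>2; closedness comes from the
    closed range theorem for \<Phi>2 restricted to the kernel of \<Phi>1.\<close>
  have K: "closed_ideal OY (\<Phi>2 ` ?N)"
  proof -
    have N: "cstar_subalgebra OS ?N" by (rule F1.kernel_subalgebra)
    interpret N: cstar_hom "OS\<lparr>carrier := ?N\<rparr>" OY \<Phi>2
      by (rule cstar_homI[OF rS.D.cstar_algebra_carrier_update[OF N] OY(1) star_hom_carrier_restrict[OF \<Phi>2]]) auto
    show ?thesis
      unfolding rY.D.closed_ideal_iff
    proof (intro conjI ballI)
      show "submodule (\<Phi>2 ` ?N) complex_ring OY" using N.image_submodule by simp
      show "ncl OY (cnorm OY) (\<Phi>2 ` ?N) \<subseteq> \<Phi>2 ` ?N" using N.closed_range by simp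
      fix y x assume "y \<in> carrier OY" "x \<in> \<Phi>2 ` ?N"
      then obtain s t where s: "s \<in> carrier OS" "y = \<Phi>2 s" "t \<in> ?N" "x = \<Phi>2 t"
        unfolding onto2[symmetric] by (elim imageE)
      then have t: "t \<in> carrier OS" "\<Phi>1 t = \<zero>\<^bsub>OX\<^esub>" by simp_all
      have st: "s \<otimes>\<^bsub>OS\<^esub> t \<in> ?N" "t \<otimes>\<^bsub>OS\<^esub> s \<in> ?N" using s(1) t rS.D.mult_closed by (simp_all add: F1.map_mult)
      show "y \<otimes>\<^bsub>OY\<^esub> x \<in> \<Phi>2 ` ?N"
        using imageI[OF st(1), of \<Phi>2] F2.map_mult[OF s(1) t(1)] unfolding s(2,4) by simp
      show "x \<otimes>\<^bsub>OY\<^esub> y \<in> \<Phi>2 ` ?N"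
        using imageI[OF st(2), of \<Phi>2] F2.map_mult[OF t(1) s(1)] unfolding s(2,4) by simp
    qed
  qed
  \<comment> \<open>For b with \<omega> b = 0 the pair (0, b) is in the pullback, and its image in
    \<open>OS\<close> is killed by \<Phi>1 and sent to \<open>\<pi>B b\<close> by \<Phi>2.\<close>
  have ker\<Omega>: "d \<in> \<Phi>2 ` ?N" if d: "d \<in> carrier OY" "\<Omega> d = \<zero>\<^bsub>OZ\<^esub>" for d
  proof (rule g.kernel_le[OF rY.toeplitz_rep_axioms OY(2,3) univZ \<Omega> K _ g.katsura_onto[OF compact_Y compl_Y J_g] d])
    fix b assume b: "b \<in> carrier B" "\<omega>B b = \<zero>\<^bsub>C\<^esub>"
    then have r: "(\<zero>\<^bsub>A\<^esub>, b) \<in> carrier R" by (simp add: P.carrier_P)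
    then have "\<pi>R (\<zero>\<^bsub>A\<^esub>, b) \<in> ?N" using \<Phi>1'(2)[OF r] by simp
    from imageI[OF this, of \<Phi>2] show "\<pi>B b \<in> \<Phi>2 ` ?N" using \<Phi>2'(2)[OF r] by simp
  qed
  \<comment> \<open>A lift s of x leaves the error y - \<Phi>2 s, which lies in the kernel of
    \<Omega>; it is therefore \<Phi>2 t with \<Phi>1 t = 0, and s + t hits both coordinates.\<close>
  have "(x, y) \<in> ?\<Phi> ` carrier OS" if xy: "x \<in> carrier OX" "y \<in> carrier OY" "\<Psi> x = \<Omega> y" for x y
  proof -
    obtain s where s: "s \<in> carrier OS" "x = \<Phi>1 s" using xy(1) unfolding onto1[symmetric] by (elim imageE)
    have "\<Omega> (y \<ominus>\<^bsub>OY\<^esub> \<Phi>2 s) = \<zero>\<^bsub>OZ\<^esub>"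
      using xy s sq[OF s(1)] PO.F.B.diff_zero_iff by (simp add: PO.G.map_diff)
    then have "y \<ominus>\<^bsub>OY\<^esub> \<Phi>2 s \<in> \<Phi>2 ` ?N" using xy s by (intro ker\<Omega>) simp_all
    then obtain t where t: "t \<in> carrier OS" "\<Phi>1 t = \<zero>\<^bsub>OX\<^esub>" "y \<ominus>\<^bsub>OY\<^esub> \<Phi>2 s = \<Phi>2 t" by auto
    have "\<Phi>2 s \<oplus>\<^bsub>OY\<^esub> \<Phi>2 t = y" unfolding t(3)[symmetric] using s xy by (intro rY.D.add_diff) simp_all
    then have e: "?\<Phi> (s \<oplus>\<^bsub>OS\<^esub> t) = (x, y)" using s t xy by (simp add: F1.map_add F2.map_add)
    have "s \<oplus>\<^bsub>OS\<^esub> t \<in> carrier OS" using s t by simp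
    then show ?thesis unfolding e[symmetric] by (rule imageI)
  qed
  then have "carrier PO.P \<subseteq> ?\<Phi> ` carrier OS" by (auto simp: PO.carrier_P)
  moreover have "?\<Phi> ` carrier OS \<subseteq> carrier PO.P" using hom by (auto simp: star_hom_def linear_map_def)
  ultimately have "bij_betw ?\<Phi> (carrier OS) (carrier PO.P)" using inj by (simp add: bij_betw_def)
  then show ?thesis unfolding star_isomorphic_def using OS(1) PO.cstar_P hom by blast
qed

end

end

lemma corr_quotientI:
  assumes "correspondence A X" and "correspondence C Z" and m: "corr_morphism A X C Z \<psi>X \<psi>A"
    and "\<psi>X ` carrier X = carrier Z" and "\<psi>A ` carrier A = carrier C"
  shows "corr_quotient A X C Z \<psi>X \<psi>A"
proof -
  interpret X: hcorr A X by (rule correspondence.hcorr[OF assms(1)])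
  interpret Z: hcorr C Z by (rule correspondence.hcorr[OF assms(2)])
  show ?thesis
    by unfold_locales (use assms(4,5) m in \<open>simp_all add: corr_morphism_def\<close>)
qed

theorem theorem3p3:
  fixes A :: "'a cstar_algebra" and X :: "('a, 'x) correspondence"
    and B :: "'b cstar_algebra" and Y :: "('b, 'y) correspondence"
    and C :: "'c cstar_algebra" and Z :: "('c, 'z) correspondence"
    and \<psi>X :: "'x \<Rightarrow> 'z" and \<psi>A :: "'a \<Rightarrow> 'c"
    and \<omega>Y :: "'y \<Rightarrow> 'z" and \<omega>B :: "'b \<Rightarrow> 'c"
    and OX :: "'ox cstar_algebra" and \<pi>X :: "'x \<Rightarrow> 'ox" and \<pi>A :: "'a \<Rightarrow> 'ox"
    and OY :: "'oy cstar_algebra" and \<pi>Y :: "'y \<Rightarrow> 'oy" and \<pi>B :: "'b \<Rightarrow> 'oy"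
    and OZ :: "'oz cstar_algebra" and \<pi>Z :: "'z \<Rightarrow> 'oz" and \<pi>C :: "'c \<Rightarrow> 'oz"
    and OS :: "'os cstar_algebra"
    and \<pi>S :: "'x \<times> 'y \<Rightarrow> 'os" and \<pi>AB :: "'a \<times> 'b \<Rightarrow> 'os"
    and \<Psi> :: "'ox \<Rightarrow> 'oz" and \<Omega> :: "'oy \<Rightarrow> 'oz"
  assumes "correspondence A X" and "correspondence B Y" and "correspondence C Z"
    and "corr_morphism A X C Z \<psi>X \<psi>A" and "corr_morphism B Y C Z \<omega>Y \<omega>B"
    and "\<psi>X ` carrier X = carrier Z" and "\<psi>A ` carrier A = carrier C"
    and "\<omega>Y ` carrier Y = carrier Z" and "\<omega>B ` carrier B = carrier C"
    and "\<psi>A ` lker A X = \<omega>B ` lker B Y"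
    and "lact X ` carrier A \<subseteq> compacts A X" and "lact Y ` carrier B \<subseteq> compacts B Y"
    and "complemented A (lker A X)" and "complemented B (lker B Y)"
    and "universal_covariant_rep A X OX \<pi>X \<pi>A"
    and "universal_covariant_rep B Y OY \<pi>Y \<pi>B"
    and "universal_covariant_rep C Z OZ \<pi>Z \<pi>C"
    and "universal_covariant_rep (pullback A B \<psi>A \<omega>B) (restricted_sum X Y \<psi>X \<omega>Y) OS \<pi>S \<pi>AB"
    and "induced_hom A X OX \<pi>X \<pi>A OZ \<pi>Z \<pi>C \<psi>X \<psi>A \<Psi>"
    and "induced_hom B Y OY \<pi>Y \<pi>B OZ \<pi>Z \<pi>C \<omega>Y \<omega>B \<Omega>"
  shows "star_isomorphic OS (pullback OX OY \<Psi> \<Omega>)"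
proof -
  have "restricted A X B Y C Z \<psi>X \<psi>A \<omega>Y \<omega>B"
    by (intro restricted.intro corr_quotientI assms(1-9))
  moreover have "\<psi>A ` katsura_ideal A X \<subseteq> katsura_ideal C Z" "\<omega>B ` katsura_ideal B Y \<subseteq> katsura_ideal C Z"
    using assms(4,5) by (simp_all add: corr_morphism_def)
  ultimately have "restricted_compact A X B Y C Z \<psi>X \<psi>A \<omega>Y \<omega>B"
    by (intro restricted_compact.intro restricted_compact_axioms.intro assms(10-14))
  then show ?thesis using assms(15-20) by (rule restricted_compact.pullback_isomorphic)
qed

end
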